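(* Let $\mathcal{M}$ be a $\sigma$-finite infinite factor, let $A\in\mathcal{M}^+$ and let $\{B_j\}_{j=1}^\infty\subseteq\mathcal{M}^+$ with $\alpha:=\sup_{j\ge1}\|B_j\|<\infty$. Each of the following two conditions is sufficient for the existence of operators $C_j\in\mathcal{M}^+$ with $C_j\sim B_j$ and $N_{C_j}$ infinite for every $j$, such that $A=\sum_{j=1}^\infty C_j$: (i) $\tau((A-\alpha I)_+)=\infty$ when $\mathcal{M}$ is semifinite (resp., $\|A\|>\alpha$ when $\mathcal{M}$ is of type III), and there are a $\beta>0$ and a non-zero projection $P\in\mathcal{M}$ for which $P\prec\chi_{(\beta,\infty)}(B_j)$ for infinitely many indices $j$. (ii) $\|A\|_e\ge\alpha$ when $\mathcal{M}$ is semifinite (resp., $\|A\|\ge\alpha$ when $\mathcal{M}$ is of type III), $\chi_{\{\alpha\}}(B_j)=0$ for all $j$, and there are $0<\beta<\gamma<\alpha$ and a non-zero projection $P\in\mathcal{M}$ such that $P\prec\chi_{(\beta,\gamma]}(B_j)$ for infinitely many indices $j$.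
   Context: $\mathcal{M}$ acts on a Hilbert space; $\mathcal{M}^+$ is its set of positive elements. A $\sigma$-finite infinite factor is either semifinite (type I$_\infty$ or II$_\infty$) or of type III. When $\mathcal{M}$ is semifinite, $\tau$ is its faithful normal semifinite trace (on type I$_\infty$ normalized to be $1$ on rank-one projections), $\mathcal{J}$ is the norm-closed two-sided ideal generated by the finite projections of $\mathcal{M}$, $\pi:\mathcal{M}\to\mathcal{M}/\mathcal{J}$ is the quotient map and $\|A\|_e=\|\pi(A)\|$. For $B,C\in\mathcal{M}^+$, $B\sim C$ means $B=XX^*$ and $C=X^*X$ for some $X\in\mathcal{M}$; for projections this is Murray-von Neumann equivalence, and $P\prec Q$ means $P$ is equivalent to a subprojection of $Q$. $N_C$ is the projection on the null space of $C$. $\chi_S(B)$ is the spectral projection of $B$ for the Borel set $S$, and $X_+$ is the positive part of a selfadjoint $X$. "Infinite" for a projection is meant relative to $\mathcal{M}$ (Murray-von Neumann). Infinite sums of operators converge in the strong operator topology. *)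

theory Defs
  imports "HOL-Analysis.Analysis"
begin

section \<open>Complex Hilbert spaces and bounded operators\<close>

text \<open>
  The real Hilbert space structure (norm, metric, completeness, \<^const>\<open>inner\<close>) comes from the
  library; the axioms below add the complex one.  The inner product is linear in its first
  argument.  Positive definiteness of \<open>cinner\<close> and \<open>norm x = sqrt (cinner x x)\<close> are inherited
  from \<^class>\<open>real_inner\<close> through \<open>inner_eq_Re_cinner\<close>.
\<close>

class chilbert_space = real_inner + banach +
  fixes scaleC :: "complex \<Rightarrow> 'a \<Rightarrow> 'a"  (infixr "*\<^sub>C" 75)
    and cinner :: "'a \<Rightarrow> 'a \<Rightarrow> complex"
  assumes scaleR_eq_scaleC: "r *\<^sub>R x = complex_of_real r *\<^sub>C x"
    and scaleC_add_right: "a *\<^sub>C (x + y) = a *\<^sub>C x + a *\<^sub>C y"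
    and scaleC_add_left: "(a + b) *\<^sub>C x = a *\<^sub>C x + b *\<^sub>C x"
    and scaleC_scaleC: "a *\<^sub>C b *\<^sub>C x = (a * b) *\<^sub>C x"
    and cinner_commute: "cinner x y = cnj (cinner y x)"
    and cinner_add_left: "cinner (x + y) z = cinner x z + cinner y z"
    and cinner_scaleC_left: "cinner (a *\<^sub>C x) y = a * cinner x y"
    and inner_eq_Re_cinner: "inner x y = Re (cinner x y)"

text \<open>
  The type \<open>'h \<Rightarrow>\<^sub>L 'h\<close> consists of the bounded \<^emph>\<open>real\<close>-linear operators, with the operator norm;
  \<open>clin_ops\<close> is \<open>B(H)\<close> inside it.  The definite descriptions below denote as intended on
  \<open>clin_ops\<close> (\<open>adj\<close>, \<open>null_proj\<close>) and on selfadjoint operators (\<open>pos_part\<close>, \<open>spec_proj\<close>).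
\<close>

type_synonym 'h oper = "'h \<Rightarrow>\<^sub>L 'h"

definition clin_ops :: "'h::chilbert_space oper set" where
  "clin_ops = {T. \<forall>c x. blinfun_apply T (c *\<^sub>C x) = c *\<^sub>C blinfun_apply T x}"

definition adj :: "'h::chilbert_space oper \<Rightarrow> 'h oper" where
  "adj T = (THE S. \<forall>x y. cinner (blinfun_apply T x) y = cinner x (blinfun_apply S y))"

definition positive_op :: "'h::chilbert_space oper \<Rightarrow> bool" where
  "positive_op T \<longleftrightarrow>
     T \<in> clin_ops \<and> (\<forall>x. cinner (blinfun_apply T x) x \<in> \<real>\<^sub>\<ge>\<^sub>0)"

definition op_le :: "'h::chilbert_space oper \<Rightarrow> 'h oper \<Rightarrow> bool"  (infix "\<preceq>" 50) where
  "S \<preceq> T \<longleftrightarrow> positive_op (T - S)"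

definition is_proj :: "'h::chilbert_space oper \<Rightarrow> bool" where
  "is_proj P \<longleftrightarrow> P \<in> clin_ops \<and> P o\<^sub>L P = P \<and> adj P = P"

definition null_proj :: "'h::chilbert_space oper \<Rightarrow> 'h oper" where
  "null_proj T =
     (THE P. is_proj P \<and> range (blinfun_apply P) = {x. blinfun_apply T x = 0})"

text \<open>For selfadjoint \<open>X\<close>: \<open>X = R - (R - X)\<close> with \<open>R\<close> and \<open>R - X\<close> positive and
  \<open>R (R - X) = 0\<close>, i.e. \<open>R = X\<^sub>+\<close> and \<open>R - X = X\<^sub>-\<close>.\<close>

definition pos_part :: "'h::chilbert_space oper \<Rightarrow> 'h oper" where
  "pos_part X = (THE R. positive_op R \<and> positive_op (R - X) \<and> R o\<^sub>L (R - X) = 0)"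

subsection \<open>Spectral projections\<close>

definition spectral_measure :: "(real set \<Rightarrow> 'h::chilbert_space oper) \<Rightarrow> bool" where
  "spectral_measure E \<longleftrightarrow>
     (\<forall>S\<in>sets borel. is_proj (E S)) \<and>
     E UNIV = id_blinfun \<and>
     (\<forall>S\<in>sets borel. \<forall>T\<in>sets borel. E (S \<inter> T) = E S o\<^sub>L E T) \<and>
     (\<forall>F. range F \<subseteq> sets borel \<and> disjoint_family F \<longrightarrow>
        (\<forall>x. (\<lambda>n::nat. blinfun_apply (E (F n)) x) sums blinfun_apply (E (\<Union>n. F n)) x))"

definition scalar_measure ::
  "(real set \<Rightarrow> 'h::chilbert_space oper) \<Rightarrow> 'h \<Rightarrow> real measure" where
  "scalar_measure E x =
     measure_of UNIV (sets borel) (\<lambda>S. ennreal (Re (cinner (blinfun_apply (E S) x) x)))"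

text \<open>\<open>T = \<integral> t dE(t)\<close> in the weak sense.\<close>

definition spectral_measure_of ::
  "(real set \<Rightarrow> 'h::chilbert_space oper) \<Rightarrow> 'h oper \<Rightarrow> bool" where
  "spectral_measure_of E T \<longleftrightarrow>
     spectral_measure E \<and>
     (\<forall>x. integrable (scalar_measure E x) (\<lambda>t. t) \<and>
          cinner (blinfun_apply T x) x = complex_of_real (LINT t|scalar_measure E x. t))"

text \<open>\<open>\<chi>\<^sub>S(T)\<close> for selfadjoint \<open>T\<close> and Borel \<open>S\<close>.  The description ranges over the value \<open>E S\<close> and
  not over \<open>E\<close>, because \<open>E\<close> is determined by \<open>T\<close> on Borel sets only.\<close>

definition spec_proj :: "real set \<Rightarrow> 'h::chilbert_space oper \<Rightarrow> 'h oper" where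
  "spec_proj S T = (THE P. \<exists>E. spectral_measure_of E T \<and> P = E S)"

section \<open>Von Neumann algebras\<close>

definition commutant :: "'h::chilbert_space oper set \<Rightarrow> 'h oper set" where
  "commutant S = {T \<in> clin_ops. \<forall>X\<in>S. T o\<^sub>L X = X o\<^sub>L T}"

definition von_neumann_algebra :: "'h::chilbert_space oper set \<Rightarrow> bool" where
  "von_neumann_algebra M \<longleftrightarrow>
     M \<subseteq> clin_ops \<and> (\<forall>T\<in>M. adj T \<in> M) \<and> commutant (commutant M) = M"

definition vn_factor :: "'h::chilbert_space oper set \<Rightarrow> bool" where
  "vn_factor M \<longleftrightarrow>
     von_neumann_algebra M \<and>
     M \<inter> commutant M = {T. \<exists>c. \<forall>x. blinfun_apply T x = c *\<^sub>C x}"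

definition pos_elems :: "'h::chilbert_space oper set \<Rightarrow> 'h oper set" where
  "pos_elems M = {T \<in> M. positive_op T}"

definition projs :: "'h::chilbert_space oper set \<Rightarrow> 'h oper set" where
  "projs M = {P \<in> M. is_proj P}"

subsection \<open>Comparison theory\<close>

definition equiv_in :: "'h::chilbert_space oper set \<Rightarrow> 'h oper \<Rightarrow> 'h oper \<Rightarrow> bool" where
  "equiv_in M B C \<longleftrightarrow> (\<exists>X\<in>M. B = X o\<^sub>L adj X \<and> C = adj X o\<^sub>L X)"

definition subequiv_in :: "'h::chilbert_space oper set \<Rightarrow> 'h oper \<Rightarrow> 'h oper \<Rightarrow> bool" where
  "subequiv_in M P Q \<longleftrightarrow> (\<exists>Q'\<in>projs M. Q' \<preceq> Q \<and> equiv_in M P Q')"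

definition finite_proj :: "'h::chilbert_space oper set \<Rightarrow> 'h oper \<Rightarrow> bool" where
  "finite_proj M P \<longleftrightarrow>
     P \<in> projs M \<and> (\<forall>Q\<in>projs M. Q \<preceq> P \<and> equiv_in M P Q \<longrightarrow> Q = P)"

definition infinite_proj :: "'h::chilbert_space oper set \<Rightarrow> 'h oper \<Rightarrow> bool" where
  "infinite_proj M P \<longleftrightarrow> P \<in> projs M \<and> \<not> finite_proj M P"

definition minimal_proj :: "'h::chilbert_space oper set \<Rightarrow> 'h oper \<Rightarrow> bool" where
  "minimal_proj M P \<longleftrightarrow>
     P \<in> projs M \<and> P \<noteq> 0 \<and> (\<forall>Q\<in>projs M. Q \<preceq> P \<longrightarrow> Q = 0 \<or> Q = P)"

definition infinite_factor :: "'h::chilbert_space oper set \<Rightarrow> bool" where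
  "infinite_factor M \<longleftrightarrow> vn_factor M \<and> infinite_proj M id_blinfun"

definition sigma_finite_vna :: "'h::chilbert_space oper set \<Rightarrow> bool" where
  "sigma_finite_vna M \<longleftrightarrow>
     (\<forall>F. F \<subseteq> projs M - {0} \<and> pairwise (\<lambda>P Q. P o\<^sub>L Q = 0) F \<longrightarrow> countable F)"

definition semifinite_vna :: "'h::chilbert_space oper set \<Rightarrow> bool" where
  "semifinite_vna M \<longleftrightarrow>
     (\<forall>Z \<in> projs M \<inter> commutant M. Z \<noteq> 0 \<longrightarrow> (\<exists>P. finite_proj M P \<and> P \<noteq> 0 \<and> P \<preceq> Z))"

definition type_III_vna :: "'h::chilbert_space oper set \<Rightarrow> bool" where
  "type_III_vna M \<longleftrightarrow> (\<forall>P. finite_proj M P \<longrightarrow> P = 0)"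

subsection \<open>Traces\<close>

definition trace_on :: "'h::chilbert_space oper set \<Rightarrow> ('h oper \<Rightarrow> ennreal) \<Rightarrow> bool" where
  "trace_on M \<tau> \<longleftrightarrow>
     (\<forall>S\<in>pos_elems M. \<forall>T\<in>pos_elems M. \<tau> (S + T) = \<tau> S + \<tau> T) \<and>
     (\<forall>T\<in>pos_elems M. \<forall>c\<ge>0. \<tau> (c *\<^sub>R T) = ennreal c * \<tau> T) \<and>
     (\<forall>X\<in>M. \<tau> (adj X o\<^sub>L X) = \<tau> (X o\<^sub>L adj X))"

definition faithful_on :: "'h::chilbert_space oper set \<Rightarrow> ('h oper \<Rightarrow> ennreal) \<Rightarrow> bool" where
  "faithful_on M \<tau> \<longleftrightarrow> (\<forall>T\<in>pos_elems M. \<tau> T = 0 \<longrightarrow> T = 0)"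

text \<open>Normality: \<open>\<tau>\<close> preserves suprema of bounded upward directed sets (equivalently, of bounded
  increasing nets) in the positive cone.\<close>

definition normal_on :: "'h::chilbert_space oper set \<Rightarrow> ('h oper \<Rightarrow> ennreal) \<Rightarrow> bool" where
  "normal_on M \<tau> \<longleftrightarrow>
     (\<forall>D A. D \<subseteq> pos_elems M \<and> D \<noteq> {} \<and>
        (\<forall>S\<in>D. \<forall>T\<in>D. \<exists>U\<in>D. S \<preceq> U \<and> T \<preceq> U) \<and>
        A \<in> pos_elems M \<and> (\<forall>T\<in>D. T \<preceq> A) \<and>
        (\<forall>A'\<in>pos_elems M. (\<forall>T\<in>D. T \<preceq> A') \<longrightarrow> A \<preceq> A')
        \<longrightarrow> \<tau> A = (SUP T\<in>D. \<tau> T))"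

definition semifinite_on :: "'h::chilbert_space oper set \<Rightarrow> ('h oper \<Rightarrow> ennreal) \<Rightarrow> bool" where
  "semifinite_on M \<tau> \<longleftrightarrow>
     (\<forall>T\<in>pos_elems M. T \<noteq> 0 \<longrightarrow>
        (\<exists>S\<in>pos_elems M. S \<noteq> 0 \<and> S \<preceq> T \<and> \<tau> S < \<infinity>))"

text \<open>Minimal projections are the rank-one projections of a factor of type I and do not exist in
  the other types, so that the last conjunct is the normalisation on type I only.\<close>

definition factor_trace :: "'h::chilbert_space oper set \<Rightarrow> ('h oper \<Rightarrow> ennreal) \<Rightarrow> bool" where
  "factor_trace M \<tau> \<longleftrightarrow>
     trace_on M \<tau> \<and> faithful_on M \<tau> \<and> normal_on M \<tau> \<and> semifinite_on M \<tau> \<and>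
     (\<forall>P. minimal_proj M P \<longrightarrow> \<tau> P = 1)"

subsection \<open>The ideal generated by the finite projections\<close>

definition two_sided_ideal :: "'h::chilbert_space oper set \<Rightarrow> 'h oper set \<Rightarrow> bool" where
  "two_sided_ideal M J \<longleftrightarrow>
     J \<subseteq> M \<and> 0 \<in> J \<and> (\<forall>S\<in>J. \<forall>T\<in>J. S + T \<in> J) \<and>
     (\<forall>S\<in>J. \<forall>T\<in>M. T o\<^sub>L S \<in> J \<and> S o\<^sub>L T \<in> J)"

definition finite_proj_ideal :: "'h::chilbert_space oper set \<Rightarrow> 'h oper set" where
  "finite_proj_ideal M =
     \<Inter>{J. two_sided_ideal M J \<and> closed J \<and> {P. finite_proj M P} \<subseteq> J}"

text \<open>The norm of the coset of \<open>T\<close> in the quotient of \<open>M\<close> by \<^const>\<open>finite_proj_ideal\<close>, that is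
  the infimum of \<open>norm (T - K)\<close> over \<open>K\<close> in the ideal.\<close>

definition ess_norm :: "'h::chilbert_space oper set \<Rightarrow> 'h oper \<Rightarrow> real" where
  "ess_norm M T = infdist T (finite_proj_ideal M)"

end

theory Submission
  imports Defs "HOL-Computational_Algebra.Factorial_Ring"
begin

text \<open>
  Choose pairwise orthogonal infinite projections \<open>P\<^sub>n\<close> of \<open>M\<close> that commute with \<open>A\<close> and on which \<open>A\<close>
  is large.  Put \<open>T\<^sub>0 = 1\<close> and construct \<open>Z\<^sub>n\<close> in \<open>M\<close> with \<open>Z\<^sub>n\<^sup>* A Z\<^sub>n = B\<^sub>n\<close> such that
  \<open>T\<^sub>n\<^sub>+\<^sub>1 = T\<^sub>n - Z\<^sub>n Z\<^sub>n\<^sup>*\<close> stays positive and is still the identity on the unused pieces \<open>P\<^sub>m\<close>.  The main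
  part of \<open>Z\<^sub>n\<close> spends a spectral projection of \<open>B\<^sub>n\<close> on a prescribed part of \<open>T\<^sub>n\<close>, and the rest has its
  range in \<open>P\<^sub>n\<close>, where \<open>A\<close> has room for what is left of \<open>B\<^sub>n\<close>.  Each target is visited so often that
  \<open>T\<^sub>n\<close> tends to \<open>0\<close> strongly.  Then \<open>C\<^sub>n = A\<^sup>1\<^sup>/\<^sup>2 Z\<^sub>n Z\<^sub>n\<^sup>* A\<^sup>1\<^sup>/\<^sup>2\<close> is equivalent to \<open>B\<^sub>n\<close>, is annihilated by
  \<open>P\<^sub>n\<^sub>+\<^sub>1\<close>, and the \<open>C\<^sub>n\<close> add up to \<open>A\<close>.

  If every spectral projection of \<open>A\<close> for \<open>(l,\<infinity>)\<close> with \<open>l < \<alpha>\<close> is infinite and \<open>\<alpha>\<close> is not an eigenvalue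
  of \<open>B\<^sub>n\<close>, the pieces come in infinite families on which the lower bounds of \<open>A\<close> increase to \<open>\<alpha>\<close>.  This
  covers (ii), and also (i) with \<open>\<alpha>\<close> replaced by some \<open>l > \<alpha>\<close>, unless all the spectral projections for
  \<open>(s,\<infinity>)\<close> with \<open>s > \<alpha>\<close> are finite.  In that case \<open>\<tau>((A - \<alpha>)\<^sub>+) = \<infinity>\<close> yields slices of comparable finite
  trace on which \<open>A \<ge> s\<^sub>k > \<alpha>\<close> with \<open>\<Sum> (s\<^sub>k - \<alpha>) = \<infinity>\<close>, and this divergence is what drives \<open>T\<^sub>n\<close> to \<open>0\<close>.

  The complex structure enters only through the operator \<open>\<i>1\<close> of \<open>M\<close>, so that the argument takes place in
  a real Hilbert space, with symmetric operators and real adjoints.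
\<close>

text \<open>Everything is governed by a norm budget. If \<open>Z = T Y\<close> and the form of
  \<open>T\<close> at \<open>Y u\<close> is at most the squared norm of \<open>u\<close>, then
  \<open>Z\<close> times its adjoint is at most \<open>T\<close>. Compressing a positive
  \<open>K\<close> onto a piece where A >= l costs the form of \<open>K\<close> divided by l; what
  the correction leaves of the budget is a multiple \<open>\<delta>\<close> of a projection below a
  spectral projection of \<open>B n\<close>, and only this can be spent on a target. The obstacle is
  that the lower bounds of A may tend to \<alpha>, so a gap has to be made. In (ii) the part of
  \<open>B n\<close> below \<open>t i\<close> goes to a piece where A >= \<open>t (Suc i)\<close>,
  with \<open>t 0 = \<gamma>\<close>, and the first block yields a constant saving. With slices, a
  part of \<open>B n\<close> of size \<beta>/2 is moved from level \<alpha> to level s, which saves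
  \<beta>/2 times 1/\<alpha> - 1/s. These savings may tend to 0, but the energy \<open>a n\<close>
  of a vector of the target satisfies
  \<open>\<delta> n * (a n)\<^sup>2 \<le> C * (a n - a (Suc n))\<close>, so it suffices that the
  proportions given to each target have a divergent sum.\<close>

notation blinfun_apply (infixl "\<cdot>" 100)

section \<open>Bounded operators on a real Hilbert space\<close>

lemmas op_simps = blinfun.add_left blinfun.add_right blinfun.diff_left blinfun.diff_right
  blinfun.minus_left blinfun.minus_right blinfun.scaleR_left blinfun.scaleR_right
  inner_add_left inner_add_right inner_diff_left inner_diff_right inner_scaleR_left
  inner_scaleR_right inner_minus_left inner_minus_right

subsection \<open>Orthogonal projection and adjoints\<close>

lemma norm_diff_square: "(norm (x - y))\<^sup>2 = (norm x)\<^sup>2 - 2 * inner x y + (norm y)\<^sup>2"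
  and norm_add_square: "(norm (x + y))\<^sup>2 = (norm x)\<^sup>2 + 2 * inner x y + (norm y)\<^sup>2"
  for x y :: "'a::real_inner"
  by (simp_all add: power2_norm_eq_inner op_simps inner_commute)

text \<open>A minimising sequence for the distance to \<open>S\<close> is Cauchy by the
  parallelogram law, since midpoints stay in \<open>S\<close>; a first variation shows that the
  minimiser is the foot of the perpendicular.\<close>

lemma closed_subspace_decomp:
  fixes S :: "'a::{real_inner,banach} set"
  assumes S: "subspace S" "closed S"
  shows "\<exists>y\<in>S. \<forall>z\<in>S. inner (x - y) z = 0"
proof -
  define d where "d = infdist x S"
  have ne: "S \<noteq> {}" using S(1) subspace_0 by auto
  have lo: "d \<le> norm (x - z)" if "z \<in> S" for z
    using infdist_le[OF that, of x] by (simp add: d_def dist_norm)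
  have d0: "0 \<le> d" by (simp add: d_def infdist_nonneg)
  have "\<exists>y\<in>S. norm (x - y) < d + inverse (real (Suc n))" for n
  proof (rule ccontr)
    assume "\<not> ?thesis"
    hence "\<And>y. y \<in> S \<Longrightarrow> d + inverse (real (Suc n)) \<le> dist x y" by (force simp: dist_norm)
    hence "d + inverse (real (Suc n)) \<le> infdist x S"
      unfolding infdist_notempty[OF ne] using ne by (intro cINF_greatest) auto
    thus False by (simp add: d_def)
  qed
  then obtain y where y: "\<And>n. y n \<in> S" "\<And>n. norm (x - y n) < d + inverse (real (Suc n))" by metis
  have par: "(norm (y m - y n))\<^sup>2 \<le> 2 * (norm (x - y m))\<^sup>2 + 2 * (norm (x - y n))\<^sup>2 - 4 * d\<^sup>2" for m n
  proof -
    have "(1/2) *\<^sub>R (y m + y n) \<in> S" using S(1) y(1) by (simp add: subspace_add subspace_scale)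
    hence "d\<^sup>2 \<le> (norm (x - (1/2) *\<^sub>R (y m + y n)))\<^sup>2" using lo d0 by (simp add: power_mono)
    also have "4 * (norm (x - (1/2) *\<^sub>R (y m + y n)))\<^sup>2
        = 2 * (norm (x - y m))\<^sup>2 + 2 * (norm (x - y n))\<^sup>2 - (norm (y m - y n))\<^sup>2"
      by (simp add: power2_norm_eq_inner op_simps inner_commute algebra_simps)
    finally show ?thesis by simp
  qed
  have lim: "(\<lambda>n. norm (x - y n)) \<longlonglongrightarrow> d"
  proof (rule tendsto_sandwich)
    show "\<forall>\<^sub>F n in sequentially. d \<le> norm (x - y n)" using lo y(1) by simp
    show "\<forall>\<^sub>F n in sequentially. norm (x - y n) \<le> d + inverse (real (Suc n))"
      using y(2) by (simp add: less_imp_le)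
    show "(\<lambda>n. d + inverse (real (Suc n))) \<longlonglongrightarrow> d"
      using tendsto_add[OF tendsto_const LIMSEQ_inverse_real_of_nat] by fastforce
  qed simp
  have "Cauchy y"
  proof (rule metric_CauchyI)
    fix e :: real assume e: "0 < e"
    have "(\<lambda>n. (norm (x - y n))\<^sup>2) \<longlonglongrightarrow> d\<^sup>2" using lim by (intro tendsto_intros)
    moreover have "d\<^sup>2 < d\<^sup>2 + e\<^sup>2 / 4" using e by simp
    ultimately have "\<forall>\<^sub>F n in sequentially. (norm (x - y n))\<^sup>2 < d\<^sup>2 + e\<^sup>2 / 4"
      by (rule order_tendstoD)
    then obtain N where N: "\<And>n. n \<ge> N \<Longrightarrow> (norm (x - y n))\<^sup>2 < d\<^sup>2 + e\<^sup>2 / 4"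
      by (auto simp: eventually_sequentially)
    have "dist (y m) (y n) < e" if "m \<ge> N" "n \<ge> N" for m n
    proof -
      have "(norm (y m - y n))\<^sup>2 < e\<^sup>2" using par[of m n] N[OF that(1)] N[OF that(2)] by linarith
      thus ?thesis using e by (simp add: dist_norm power_less_imp_less_base)
    qed
    thus "\<exists>N. \<forall>m\<ge>N. \<forall>n\<ge>N. dist (y m) (y n) < e" by blast
  qed
  then obtain l where l: "y \<longlonglongrightarrow> l" using Cauchy_convergent convergent_def by blast
  have lS: "l \<in> S" using closed_sequentially[OF S(2) _ l] y(1) by simp
  have nl: "norm (x - l) = d"
    by (rule LIMSEQ_unique[OF _ lim]) (intro tendsto_intros l)
  have "inner (x - l) z = 0" if z: "z \<in> S" for z
  proof (cases "z = 0")
    case False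
    \<comment> \<open>The coefficient of \<open>x - l\<close> along \<open>z\<close>: moving the
      minimiser by \<open>c *\<^sub>R z\<close> would lower the squared distance by
      \<open>(inner (x - l) z)\<^sup>2 / inner z z\<close>.\<close>
    define c where "c = inner (x - l) z / inner z z"
    have zz: "inner z z > 0" using False by simp
    have "l + c *\<^sub>R z \<in> S" using S(1) lS z by (simp add: subspace_add subspace_scale)
    hence "d\<^sup>2 \<le> (norm (x - (l + c *\<^sub>R z)))\<^sup>2" using lo d0 by (simp add: power_mono)
    also have "x - (l + c *\<^sub>R z) = (x - l) - c *\<^sub>R z" by simp
    also have "(norm \<dots>)\<^sup>2 = (norm (x - l))\<^sup>2 - 2 * c * inner (x - l) z + c\<^sup>2 * inner z z"
      unfolding norm_diff_square by (simp add: power_mult_distrib flip: power2_norm_eq_inner)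
    also have "\<dots> = d\<^sup>2 - (inner (x - l) z)\<^sup>2 / inner z z"
      using zz nl by (simp add: c_def field_simps power2_eq_square)
    finally have "(inner (x - l) z)\<^sup>2 / inner z z \<le> 0" by simp
    thus ?thesis using zz by (simp add: divide_le_0_iff)
  qed simp
  with lS show ?thesis by blast
qed

text \<open>The kernel of \<open>f\<close> is a closed hyperplane, and the representing vector is a
  multiple of its normal \<open>v\<close>; the multiple is found by splitting \<open>x\<close> along
  \<open>v\<close> and the kernel.\<close>

lemma riesz_representation:
  fixes f :: "'a::{real_inner,banach} \<Rightarrow> real"
  assumes f: "bounded_linear f"
  shows "\<exists>y. \<forall>x. f x = inner x y"
proof (cases "\<forall>x. f x = 0")
  case True thus ?thesis by (intro exI[of _ 0]) simp
next
  case False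
  then obtain u where u: "f u \<noteq> 0" by blast
  interpret bounded_linear f by fact
  have sub: "subspace {x. f x = 0}" by (auto simp: subspace_def add scaleR zero)
  have cl: "closed {x. f x = 0}" by (intro closed_Collect_eq continuous_intros continuous_on)
  obtain y where y: "f y = 0" "\<And>z. f z = 0 \<Longrightarrow> inner (u - y) z = 0"
    using closed_subspace_decomp[OF sub cl, of u] by auto
  define v where "v = u - y"
  have fv: "f v = f u" by (simp add: v_def diff y)
  have vv: "inner v v \<noteq> 0" using fv u zero by auto
  have "f x = inner x ((f v / inner v v) *\<^sub>R v)" for x
  proof -
    have "f (x - (f x / f v) *\<^sub>R v) = 0" using u fv by (simp add: diff scaleR)
    hence "inner v (x - (f x / f v) *\<^sub>R v) = 0" using y(2) v_def by blast
    hence "inner v x = f x / f v * inner v v" by (simp add: op_simps)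
    thus ?thesis using vv u fv by (simp add: inner_commute field_simps)
  qed
  thus ?thesis by blast
qed

lemma inner_eq_all_imp_eq: "(\<And>z. inner x z = inner y z) \<Longrightarrow> x = (y::'a::real_inner)"
  using inner_diff_left[of x y "x - y"] by simp

lemma inner_eq_all_imp_eq': "(\<And>z. inner z x = inner z y) \<Longrightarrow> x = (y::'a::real_inner)"
  by (rule inner_eq_all_imp_eq) (simp add: inner_commute)

lemma adjoint_exists:
  fixes T :: "'a::{real_inner,banach} \<Rightarrow>\<^sub>L 'a"
  shows "\<exists>S::'a \<Rightarrow>\<^sub>L 'a. \<forall>x y. inner (T \<cdot> x) y = inner x (S \<cdot> y)"
proof -
  have "\<exists>z. \<forall>x. inner (T \<cdot> x) y = inner x z" for y
    by (rule riesz_representation) (intro bounded_linear_intros)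
  then obtain g where g: "\<And>x y. inner (T \<cdot> x) y = inner x (g y)" by metis
  have "bounded_linear g"
  proof (rule bounded_linear_intro)
    show "g (x + y) = g x + g y" for x y
      by (rule inner_eq_all_imp_eq') (simp add: op_simps flip: g)
    show "g (r *\<^sub>R x) = r *\<^sub>R g x" for r x
      by (rule inner_eq_all_imp_eq') (simp add: op_simps flip: g)
    show "norm (g x) \<le> norm x * norm T" for x
    proof (cases "g x = 0")
      case False
      have "(norm (g x))\<^sup>2 = inner (T \<cdot> (g x)) x" by (simp add: power2_norm_eq_inner g)
      also have "\<dots> \<le> norm (T \<cdot> (g x)) * norm x" by (rule norm_cauchy_schwarz)
      also have "\<dots> \<le> norm T * norm (g x) * norm x" by (intro mult_right_mono norm_blinfun) simp
      finally show ?thesis using False by (simp add: power2_eq_square mult.assoc mult.commute)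
    qed simp
  qed
  then show ?thesis using g by (intro exI[of _ "Blinfun g"]) (simp add: bounded_linear_Blinfun_apply)
qed

text \<open>The adjoint for the real inner product, which exists for every bounded real linear
  operator. On complex linear operators it is the adjoint \<open>adj\<close> of the theorem, see
  \<open>adj_eq_radj\<close>.\<close>

definition radj :: "('a::{real_inner,banach} \<Rightarrow>\<^sub>L 'a) \<Rightarrow> ('a \<Rightarrow>\<^sub>L 'a)" where
  "radj T = (SOME S :: 'a \<Rightarrow>\<^sub>L 'a. \<forall>x y. inner (T \<cdot> x) y = inner x (S \<cdot> y))"

lemma radj: "inner (T \<cdot> x) y = inner x (radj T \<cdot> y)"
  using someI_ex[OF adjoint_exists[of T]] unfolding radj_def by blast

lemma radj': "inner x (T \<cdot> y) = inner (radj T \<cdot> x) y"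
  using radj[of T y x] by (simp add: inner_commute)

lemma radj_eqI: "(\<And>x y. inner (T \<cdot> x) y = inner x (S \<cdot> y)) \<Longrightarrow> radj T = S"
  by (rule blinfun_eqI, rule inner_eq_all_imp_eq') (simp flip: radj)

lemma radj_radj [simp]: "radj (radj T) = T"
  by (rule radj_eqI) (simp add: radj')

lemma radj_compose [simp]: "radj (S o\<^sub>L T) = radj T o\<^sub>L radj S"
  by (rule radj_eqI) (simp add: radj)

lemma radj_add [simp]: "radj (S + T) = radj S + radj T"
  and radj_diff [simp]: "radj (S - T) = radj S - radj T"
  and radj_scaleR [simp]: "radj (r *\<^sub>R T) = r *\<^sub>R radj T"
  and radj_id [simp]: "radj id_blinfun = id_blinfun"
  and radj_zero [simp]: "radj 0 = 0"
  by (rule radj_eqI, simp add: op_simps radj)+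

lemma norm_radj_apply: "(norm (radj T \<cdot> x))\<^sup>2 = inner (T \<cdot> (radj T \<cdot> x)) x"
  by (simp add: power2_norm_eq_inner radj)

lemma contraction_radj:
  assumes "\<And>x. norm (T \<cdot> x) \<le> c * norm x" "0 \<le> c"
  shows "norm (radj T \<cdot> x) \<le> c * norm x"
proof (cases "radj T \<cdot> x = 0")
  case False
  have "(norm (radj T \<cdot> x))\<^sup>2 \<le> norm (T \<cdot> (radj T \<cdot> x)) * norm x"
    unfolding norm_radj_apply by (rule norm_cauchy_schwarz)
  also have "\<dots> \<le> c * norm (radj T \<cdot> x) * norm x" by (intro mult_right_mono assms) simp
  finally show ?thesis using False by (simp add: power2_eq_square)
qed (use assms in simp)

subsection \<open>Symmetric and positive semidefinite operators\<close>

definition sym_op :: "('a::real_inner \<Rightarrow>\<^sub>L 'a) \<Rightarrow> bool" where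
  "sym_op T \<longleftrightarrow> (\<forall>x y. inner (T \<cdot> x) y = inner x (T \<cdot> y))"

text \<open>Over the reals a nonnegative quadratic form does not force symmetry, unlike over the
  complex numbers, so symmetry is a separate conjunct.\<close>

definition psd :: "('a::real_inner \<Rightarrow>\<^sub>L 'a) \<Rightarrow> bool" where
  "psd T \<longleftrightarrow> sym_op T \<and> (\<forall>x. 0 \<le> inner (T \<cdot> x) x)"

definition rproj :: "('a::real_inner \<Rightarrow>\<^sub>L 'a) \<Rightarrow> bool" where
  "rproj P \<longleftrightarrow> sym_op P \<and> (\<forall>x. P \<cdot> (P \<cdot> x) = P \<cdot> x)"

lemma sym_opD: "sym_op T \<Longrightarrow> inner (T \<cdot> x) y = inner x (T \<cdot> y)"
  by (simp add: sym_op_def)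

lemma sym_op_swap: "sym_op T \<Longrightarrow> inner (T \<cdot> x) y = inner (T \<cdot> y) x"
  using inner_commute[of x "T \<cdot> y"] sym_opD[of T x y] by simp

lemma psd_sym: "psd T \<Longrightarrow> sym_op T" and psd_ge0: "psd T \<Longrightarrow> 0 \<le> inner (T \<cdot> x) x"
  by (simp_all add: psd_def)

lemma rproj_sym: "rproj P \<Longrightarrow> sym_op P" and rproj_idem [simp]: "rproj P \<Longrightarrow> P \<cdot> (P \<cdot> x) = P \<cdot> x"
  by (simp_all add: rproj_def)

lemma sym_op_radj: "sym_op T \<longleftrightarrow> radj T = T"
proof
  show "sym_op T \<Longrightarrow> radj T = T" by (rule radj_eqI) (simp add: sym_op_def)
  show "radj T = T \<Longrightarrow> sym_op T" unfolding sym_op_def by (metis radj)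
qed

lemma sym_op_simps [simp]:
  "sym_op id_blinfun" "sym_op 0"
  "sym_op S \<Longrightarrow> sym_op T \<Longrightarrow> sym_op (S + T)"
  "sym_op S \<Longrightarrow> sym_op T \<Longrightarrow> sym_op (S - T)"
  "sym_op T \<Longrightarrow> sym_op (r *\<^sub>R T)"
  by (simp_all add: sym_op_def op_simps)

lemma psd_simps [simp]:
  "psd id_blinfun" "psd 0"
  "psd S \<Longrightarrow> psd T \<Longrightarrow> psd (S + T)"
  "psd T \<Longrightarrow> 0 \<le> r \<Longrightarrow> psd (r *\<^sub>R T)"
  by (simp_all add: psd_def op_simps)

lemma rproj_simps [simp]: "rproj id_blinfun" "rproj 0"
  by (simp_all add: rproj_def)

lemma psd_radj_compose: "psd (radj T o\<^sub>L T)" "psd (T o\<^sub>L radj T)"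
proof -
  have "0 \<le> inner (radj T \<cdot> (T \<cdot> x)) x" "0 \<le> inner (T \<cdot> (radj T \<cdot> x)) x" for x
    using radj'[of "T \<cdot> x" T x] norm_radj_apply[of T x] by (metis inner_ge_zero zero_le_power2)+
  thus "psd (radj T o\<^sub>L T)" "psd (T o\<^sub>L radj T)" by (simp_all add: psd_def sym_op_radj)
qed

text \<open>Polarisation: the form at \<open>x + z\<close> together with symmetry recovers the
  bilinear form.\<close>

lemma sym_op_eqI:
  assumes "sym_op S" "sym_op T" "\<And>x. inner (S \<cdot> x) x = inner (T \<cdot> x) x"
  shows "S = T"
proof (rule blinfun_eqI, rule inner_eq_all_imp_eq)
  fix x z
  have "inner (S \<cdot> (x + z)) (x + z) = inner (T \<cdot> (x + z)) (x + z)" by (rule assms)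
  moreover have "inner (S \<cdot> z) x = inner (S \<cdot> x) z" "inner (T \<cdot> z) x = inner (T \<cdot> x) z"
    using assms(1,2) by (simp_all add: sym_op_swap)
  ultimately show "inner (S \<cdot> x) z = inner (T \<cdot> x) z"
    using assms(3)[of x] assms(3)[of z] by (simp add: op_simps)
qed

lemma rproj_inner: "rproj P \<Longrightarrow> inner (P \<cdot> x) x = (norm (P \<cdot> x))\<^sup>2"
  by (simp add: power2_norm_eq_inner sym_opD[OF rproj_sym, of P] inner_commute)

lemma rproj_psd: "rproj P \<Longrightarrow> psd P"
  by (simp add: psd_def rproj_inner rproj_sym)

lemma rproj_compl: "rproj P \<Longrightarrow> rproj (id_blinfun - P)"
  by (simp add: rproj_def op_simps)

lemma rproj_pythagoras: "rproj P \<Longrightarrow> (norm x)\<^sup>2 = (norm (P \<cdot> x))\<^sup>2 + (norm (x - P \<cdot> x))\<^sup>2"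
  using rproj_inner[of P x]
  by (simp add: power2_norm_eq_inner op_simps inner_commute)

lemma rproj_norm_le: "rproj P \<Longrightarrow> norm (P \<cdot> x) \<le> norm x"
  by (rule power2_le_imp_le) (simp_all add: rproj_pythagoras[of P x])

lemma rproj_radj: "rproj P \<Longrightarrow> radj P = P"
  using rproj_sym sym_op_radj by blast

lemma rproj_orth_sym: "rproj P \<Longrightarrow> rproj Q \<Longrightarrow> (\<And>x. P \<cdot> (Q \<cdot> x) = 0) \<Longrightarrow> Q \<cdot> (P \<cdot> x) = 0"
  by (rule inner_eq_all_imp_eq) (simp add: sym_opD[OF rproj_sym])

text \<open>At vectors \<open>P x\<close> the form inequality says that \<open>Q\<close> does not
  shorten the range of \<open>P\<close>; by Pythagoras it then fixes that range.\<close>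

lemma rproj_le_iff:
  assumes "rproj P" "rproj Q"
  shows "(\<forall>x. inner (P \<cdot> x) x \<le> inner (Q \<cdot> x) x) \<longleftrightarrow> (\<forall>x. Q \<cdot> (P \<cdot> x) = P \<cdot> x)"
proof (intro iffI allI)
  fix x assume "\<forall>x. inner (P \<cdot> x) x \<le> inner (Q \<cdot> x) x"
  hence "(norm (P \<cdot> x))\<^sup>2 \<le> (norm (Q \<cdot> (P \<cdot> x)))\<^sup>2" using assms by (metis rproj_inner rproj_idem)
  hence "norm (P \<cdot> x - Q \<cdot> (P \<cdot> x)) = 0"
    using rproj_pythagoras[OF assms(2), of "P \<cdot> x"] by (smt (verit) zero_le_power2 power2_eq_iff_nonneg norm_ge_zero zero_power2)
  thus "Q \<cdot> (P \<cdot> x) = P \<cdot> x" by simp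
next
  fix x assume a: "\<forall>x. Q \<cdot> (P \<cdot> x) = P \<cdot> x"
  have "P \<cdot> (Q \<cdot> x) = P \<cdot> x"
    by (rule inner_eq_all_imp_eq) (simp add: sym_opD[OF rproj_sym] a assms)
  hence "norm (P \<cdot> x) \<le> norm (Q \<cdot> x)" by (metis assms(1) rproj_norm_le)
  thus "inner (P \<cdot> x) x \<le> inner (Q \<cdot> x) x" using assms by (simp add: rproj_inner power_mono)
qed

lemma rproj_le_sym:
  assumes "rproj P" "rproj Q" "\<And>x. Q \<cdot> (P \<cdot> x) = P \<cdot> x"
  shows "P \<cdot> (Q \<cdot> x) = P \<cdot> x"
  by (rule inner_eq_all_imp_eq) (simp add: sym_opD[OF rproj_sym] assms)

lemma psd_cauchy_schwarz:
  assumes T: "psd T"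
  shows "(inner (T \<cdot> x) y)\<^sup>2 \<le> inner (T \<cdot> x) x * inner (T \<cdot> y) y"
proof -
  let ?a = "inner (T \<cdot> y) y" and ?b = "inner (T \<cdot> x) y" and ?c = "inner (T \<cdot> x) x"
  have b: "inner (T \<cdot> y) x = ?b" using psd_sym[OF T] by (rule sym_op_swap)
  have q: "0 \<le> ?c + 2 * t * ?b + t\<^sup>2 * ?a" for t
  proof -
    have "0 \<le> inner (T \<cdot> (x + t *\<^sub>R y)) (x + t *\<^sub>R y)" using T by (rule psd_ge0)
    thus ?thesis using b by (simp add: op_simps algebra_simps power2_eq_square)
  qed
  show ?thesis
  proof (cases "?a = 0")
    case True
    have "?b = 0"
    proof (rule ccontr)
      assume "?b \<noteq> 0"
      \<comment> \<open>This value of \<open>t\<close> makes \<open>?c + 2 * t * ?b\<close> equal to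
        -1, while the quadratic term vanishes.\<close>
      thus False using q[of "- (?c + 1) / (2 * ?b)"] True by (simp add: field_simps)
    qed
    thus ?thesis using True by simp
  next
    case False
    hence "0 < ?a" using psd_ge0[OF T, of y] by simp
    thus ?thesis using q[of "- ?b / ?a"] by (simp add: field_simps power2_eq_square)
  qed
qed

text \<open>Cauchy-Schwarz for the form of \<open>T\<close> with \<open>T x\<close> as second
  vector, after which a factor is cancelled. This is the passage from bounds on forms to bounds on
  norms, and from convergence of forms to strong convergence.\<close>

lemma psd_norm_sq_le:
  assumes T: "psd T" and c: "\<And>x. inner (T \<cdot> x) x \<le> c * (norm x)\<^sup>2"
  shows "(norm (T \<cdot> x))\<^sup>2 \<le> c * inner (T \<cdot> x) x"
proof (cases "T \<cdot> x = 0")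
  case True thus ?thesis using c[of x] by simp
next
  case False
  have "((norm (T \<cdot> x))\<^sup>2)\<^sup>2 = (inner (T \<cdot> x) (T \<cdot> x))\<^sup>2" by (simp add: power2_norm_eq_inner)
  also have "\<dots> \<le> inner (T \<cdot> x) x * inner (T \<cdot> (T \<cdot> x)) (T \<cdot> x)" by (rule psd_cauchy_schwarz[OF T])
  also have "\<dots> \<le> inner (T \<cdot> x) x * (c * (norm (T \<cdot> x))\<^sup>2)"
    by (intro mult_left_mono c psd_ge0 T)
  finally show ?thesis using False by (simp add: power2_eq_square algebra_simps)
qed

lemma inner_le_norm: "inner (T \<cdot> x) x \<le> norm T * (norm x)\<^sup>2" for T :: "'a::real_inner \<Rightarrow>\<^sub>L 'a"
proof -
  have "inner (T \<cdot> x) x \<le> norm (T \<cdot> x) * norm x" by (rule norm_cauchy_schwarz)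
  also have "\<dots> \<le> norm T * norm x * norm x" by (intro mult_right_mono norm_blinfun) simp
  finally show ?thesis by (simp add: power2_eq_square mult.assoc)
qed

lemma psd_norm_sq_le': "psd T \<Longrightarrow> (norm (T \<cdot> x))\<^sup>2 \<le> norm T * inner (T \<cdot> x) x"
  by (rule psd_norm_sq_le[OF _ inner_le_norm])

lemma psd_kernel: "psd T \<Longrightarrow> inner (T \<cdot> x) x = 0 \<Longrightarrow> T \<cdot> x = 0"
  using psd_norm_sq_le'[of T x] by simp

lemma norm_le_if_form_le:
  assumes T: "psd T" and c: "0 \<le> c" "\<And>x. inner (T \<cdot> x) x \<le> c * (norm x)\<^sup>2"
  shows "norm T \<le> c"
proof (rule norm_blinfun_bound[OF c(1)])
  fix x
  have "(norm (T \<cdot> x))\<^sup>2 \<le> c * inner (T \<cdot> x) x" by (rule psd_norm_sq_le[OF T c(2)])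
  also have "\<dots> \<le> c * (c * (norm x)\<^sup>2)" by (intro mult_left_mono c)
  finally have "(norm (T \<cdot> x))\<^sup>2 \<le> (c * norm x)\<^sup>2" by (simp add: power2_eq_square algebra_simps)
  thus "norm (T \<cdot> x) \<le> c * norm x" by (rule power2_le_imp_le) (use c(1) in simp)
qed

definition proj_on :: "'a::{real_inner,banach} set \<Rightarrow> ('a \<Rightarrow>\<^sub>L 'a)" where
  "proj_on S = (SOME P :: 'a \<Rightarrow>\<^sub>L 'a. rproj P \<and> range P = S)"

lemma proj_on:
  fixes S :: "'a::{real_inner,banach} set"
  assumes S: "subspace S" "closed S"
  shows "rproj (proj_on S)" "range (proj_on S) = S"
proof -
  obtain p where p: "\<And>x. p x \<in> S" "\<And>x z. z \<in> S \<Longrightarrow> inner (x - p x) z = 0"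
    using closed_subspace_decomp[OF S] by metis
  have uniq: "p x = y" if "y \<in> S" "\<And>z. z \<in> S \<Longrightarrow> inner (x - y) z = 0" for x y
  proof -
    have d: "p x - y \<in> S" using S(1) p(1) that(1) by (simp add: subspace_diff)
    have "inner (p x - y) (p x - y) = 0"
      using p(2)[OF d, of x] that(2)[OF d] by (simp add: inner_diff_left)
    thus ?thesis by simp
  qed
  have bl: "bounded_linear p"
  proof (rule bounded_linear_intro[where K = 1])
    show "p (x + y) = p x + p y" for x y
    proof (rule uniq)
      show "p x + p y \<in> S" by (intro subspace_add S p)
      show "inner (x + y - (p x + p y)) z = 0" if "z \<in> S" for z
        using p(2)[OF that, of x] p(2)[OF that, of y] by (simp only: op_simps)
    qed
    show "p (r *\<^sub>R x) = r *\<^sub>R p x" for r x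
    proof (rule uniq)
      show "r *\<^sub>R p x \<in> S" by (intro subspace_scale S p)
      show "inner (r *\<^sub>R x - r *\<^sub>R p x) z = 0" if "z \<in> S" for z
        using p(2)[OF that, of x] by (simp add: op_simps)
    qed
    show "norm (p x) \<le> norm x * 1" for x
    proof -
      have "(norm x)\<^sup>2 = (norm (p x))\<^sup>2 + (norm (x - p x))\<^sup>2"
        using p(2)[OF p(1), of x x] by (simp add: power2_norm_eq_inner op_simps inner_commute)
      hence "(norm (p x))\<^sup>2 \<le> (norm x)\<^sup>2" by simp
      thus ?thesis by simp
    qed
  qed
  have idem: "p x = x" if "x \<in> S" for x by (rule uniq) (use that in simp_all)
  have "inner (p x) y = inner x (p y)" for x y
    using p(2)[OF p(1), of x y] p(2)[OF p(1), of y x] inner_commute[of "p x" "p y"] inner_commute[of "p x" y]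
    by (simp add: inner_diff_left)
  hence "rproj (Blinfun p) \<and> range (Blinfun p) = S"
    using idem p(1) by (auto simp: rproj_def sym_op_def bounded_linear_Blinfun_apply[OF bl]) (metis rangeI)
  from someI[of "\<lambda>P. rproj P \<and> range P = S", OF this]
  show "rproj (proj_on S)" "range (proj_on S) = S" unfolding proj_on_def by auto
qed

lemma proj_on_eq_iff:
  assumes "subspace S" "closed S"
  shows "proj_on S \<cdot> x = x \<longleftrightarrow> x \<in> S"
proof
  assume "proj_on S \<cdot> x = x"
  hence "x \<in> range (blinfun_apply (proj_on S))" by (rule range_eqI[OF sym])
  thus "x \<in> S" by (simp add: proj_on(2)[OF assms])
next
  assume "x \<in> S"
  hence "x \<in> range (blinfun_apply (proj_on S))" by (simp add: proj_on(2)[OF assms])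
  thus "proj_on S \<cdot> x = x" using proj_on(1)[OF assms] by auto
qed

lemma rproj_commute_if_invariant:
  assumes "rproj P" "\<And>x. P \<cdot> (Z \<cdot> (P \<cdot> x)) = Z \<cdot> (P \<cdot> x)" "\<And>x. P \<cdot> (radj Z \<cdot> (P \<cdot> x)) = radj Z \<cdot> (P \<cdot> x)"
  shows "P \<cdot> (Z \<cdot> x) = Z \<cdot> (P \<cdot> x)"
proof -
  have "P \<cdot> (Z \<cdot> x) = P \<cdot> (Z \<cdot> (P \<cdot> x))"
  proof (rule inner_eq_all_imp_eq)
    fix z
    have "inner (P \<cdot> (Z \<cdot> x)) z = inner x (radj Z \<cdot> (P \<cdot> z))"
      by (simp add: sym_opD[OF rproj_sym[OF assms(1)]] radj[of Z])
    also have "\<dots> = inner x (P \<cdot> (radj Z \<cdot> (P \<cdot> z)))" by (simp add: assms(3))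
    also have "\<dots> = inner (P \<cdot> (Z \<cdot> (P \<cdot> x))) z"
      by (simp add: sym_opD[OF rproj_sym[OF assms(1)]] radj[of Z])
    finally show "inner (P \<cdot> (Z \<cdot> x)) z = inner (P \<cdot> (Z \<cdot> (P \<cdot> x))) z" .
  qed
  thus ?thesis by (simp add: assms(2))
qed

subsection \<open>Pointwise limits of operators\<close>

lemma pointwise_limit_op:
  fixes T :: "nat \<Rightarrow> 'a::real_normed_vector \<Rightarrow>\<^sub>L 'b::real_normed_vector"
  assumes conv: "\<And>x. convergent (\<lambda>n. T n \<cdot> x)" and bd: "\<And>n x. norm (T n \<cdot> x) \<le> C * norm x"
  obtains S where "\<And>x. (\<lambda>n. T n \<cdot> x) \<longlonglongrightarrow> S \<cdot> x" "\<And>x. norm (S \<cdot> x) \<le> C * norm x"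
proof -
  obtain s where s: "\<And>x. (\<lambda>n. T n \<cdot> x) \<longlonglongrightarrow> s x" using conv unfolding convergent_def by metis
  have bound: "norm (s x) \<le> C * norm x" for x
    by (rule LIMSEQ_le_const2[OF tendsto_norm[OF s]]) (use bd in blast)
  have "bounded_linear s"
  proof (rule bounded_linear_intro)
    show "s (x + y) = s x + s y" for x y
      by (rule LIMSEQ_unique[OF s]) (simp add: op_simps tendsto_add s)
    show "s (r *\<^sub>R x) = r *\<^sub>R s x" for r x
      by (rule LIMSEQ_unique[OF s]) (simp add: op_simps tendsto_scaleR s)
    show "norm (s x) \<le> norm x * C" for x using bound by (simp add: mult.commute)
  qed
  with s bound that[of "Blinfun s"] show ?thesis by (simp add: bounded_linear_Blinfun_apply)
qed

lemma blinfun_tendsto: "f \<longlonglongrightarrow> l \<Longrightarrow> (\<lambda>n. T \<cdot> f n) \<longlonglongrightarrow> T \<cdot> l"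
  by (intro tendsto_intros)

lemma pointwise_limit_compose:
  fixes S :: "nat \<Rightarrow> 'a::real_normed_vector \<Rightarrow>\<^sub>L 'a"
  assumes S: "\<And>x. (\<lambda>n. S n \<cdot> x) \<longlonglongrightarrow> S' \<cdot> x" and bd: "\<And>n x. norm (S n \<cdot> x) \<le> C * norm x"
    and f: "f \<longlonglongrightarrow> y"
  shows "(\<lambda>n. S n \<cdot> (f n)) \<longlonglongrightarrow> S' \<cdot> y"
proof -
  have "(\<lambda>n. S n \<cdot> (f n - y)) \<longlonglongrightarrow> 0"
  proof (rule Lim_null_comparison)
    show "\<forall>\<^sub>F n in sequentially. norm (S n \<cdot> (f n - y)) \<le> C * norm (f n - y)" using bd by simp
    have "(\<lambda>n. C * norm (f n - y)) \<longlonglongrightarrow> C * norm (y - y)" by (intro tendsto_intros f)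
    thus "(\<lambda>n. C * norm (f n - y)) \<longlonglongrightarrow> 0" by simp
  qed
  from tendsto_add[OF this S[of y]] show ?thesis by (simp add: op_simps)
qed

lemma sym_op_limit:
  assumes "\<And>n. sym_op (T n)" "\<And>x. (\<lambda>n. T n \<cdot> x) \<longlonglongrightarrow> S \<cdot> x"
  shows "sym_op S"
  unfolding sym_op_def
proof (intro allI)
  fix x y
  have "(\<lambda>n. inner (T n \<cdot> x) y) \<longlonglongrightarrow> inner (S \<cdot> x) y" by (intro tendsto_intros assms)
  moreover have "(\<lambda>n. inner x (T n \<cdot> y)) \<longlonglongrightarrow> inner x (S \<cdot> y)" by (intro tendsto_intros assms)
  ultimately show "inner (S \<cdot> x) y = inner x (S \<cdot> y)"
    using assms(1) by (simp add: sym_opD LIMSEQ_unique)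
qed

text \<open>For \<open>m \<le> n\<close> the operator \<open>T n - T m\<close> is positive with form
  at most \<open>2 * C\<close>, so \<open>psd_norm_sq_le\<close> controls the increments of
  \<open>T n x\<close> by those of the bounded monotone sequence of forms.\<close>

lemma monotone_convergence_op:
  fixes T :: "nat \<Rightarrow> 'a::{real_inner,banach} \<Rightarrow>\<^sub>L 'a"
  assumes sym: "\<And>n. sym_op (T n)"
    and mono: "\<And>n x. inner (T n \<cdot> x) x \<le> inner (T (Suc n) \<cdot> x) x"
    and lo: "\<And>n x. norm (T n \<cdot> x) \<le> C * norm x"
  obtains S where "\<And>x. (\<lambda>n. T n \<cdot> x) \<longlonglongrightarrow> S \<cdot> x" "sym_op S" "\<And>x. norm (S \<cdot> x) \<le> C * norm x"
    "\<And>n x. inner (T n \<cdot> x) x \<le> inner (S \<cdot> x) x"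
proof -
  have mono': "inner (T m \<cdot> x) x \<le> inner (T n \<cdot> x) x" if "m \<le> n" for m n x
    using lift_Suc_mono_le[of "\<lambda>n. inner (T n \<cdot> x) x", OF mono that] .
  have ub: "\<bar>inner (T n \<cdot> x) x\<bar> \<le> C * (norm x)\<^sup>2" for n x
  proof -
    have "\<bar>inner (T n \<cdot> x) x\<bar> \<le> norm (T n \<cdot> x) * norm x" by (rule Cauchy_Schwarz_ineq2)
    also have "\<dots> \<le> C * norm x * norm x" by (intro mult_right_mono lo) simp
    finally show ?thesis by (simp add: power2_eq_square mult.assoc)
  qed
  have key: "(norm (T n \<cdot> x - T m \<cdot> x))\<^sup>2 \<le> 2 * C * (inner (T n \<cdot> x) x - inner (T m \<cdot> x) x)"
    if "m \<le> n" for m n x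
  proof -
    have "psd (T n - T m)" using sym mono'[OF that] by (simp add: psd_def op_simps)
    moreover have "inner ((T n - T m) y) y \<le> 2 * C * (norm y)\<^sup>2" for y
      using ub[of n y] ub[of m y] by (simp add: op_simps abs_le_iff)
    ultimately show ?thesis using psd_norm_sq_le[of "T n - T m" "2 * C" x] by (simp add: op_simps)
  qed
  have conv: "convergent (\<lambda>n. T n \<cdot> x)" for x
  proof -
    let ?a = "\<lambda>n. inner (T n \<cdot> x) x"
    have "Bseq ?a" using ub by (intro BseqI'[of _ "C * (norm x)\<^sup>2"]) simp
    moreover have "monoseq ?a" using mono by (intro incseq_imp_monoseq incseq_SucI)
    ultimately have "Cauchy ?a" by (simp add: Bseq_monoseq_convergent convergent_Cauchy)
    have "Cauchy (\<lambda>n. T n \<cdot> x)"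
    proof (rule metric_CauchyI)
      fix e :: real assume e: "0 < e"
      define e' where "e' = e\<^sup>2 / (2 * \<bar>C\<bar> + 1)"
      have e': "0 < e'" using e by (simp add: e'_def)
      obtain N where N: "\<And>m n. m \<ge> N \<Longrightarrow> n \<ge> N \<Longrightarrow> \<bar>?a m - ?a n\<bar> < e'"
        using metric_CauchyD[OF \<open>Cauchy ?a\<close> e'] by (auto simp: dist_real_def)
      have *: "norm (T n \<cdot> x - T m \<cdot> x) < e" if "m \<ge> N" "n \<ge> m" for m n
      proof -
        have d: "0 \<le> ?a n - ?a m" using mono'[OF that(2)] by simp
        have "(norm (T n \<cdot> x - T m \<cdot> x))\<^sup>2 \<le> 2 * C * (?a n - ?a m)" by (rule key[OF that(2)])
        also have "\<dots> \<le> 2 * \<bar>C\<bar> * (?a n - ?a m)" by (intro mult_right_mono) (use d in auto)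
        also have "\<dots> \<le> 2 * \<bar>C\<bar> * e'"
          using N[of n m] that by (intro mult_left_mono) auto
        also have "\<dots> < e\<^sup>2" using e by (simp add: e'_def field_simps)
        finally show ?thesis using e by (simp add: power_less_imp_less_base)
      qed
      have "dist (T m \<cdot> x) (T n \<cdot> x) < e" if "m \<ge> N" "n \<ge> N" for m n
        using *[of m n] *[of n m] that by (cases "m \<le> n") (auto simp: dist_norm norm_minus_commute)
      thus "\<exists>N. \<forall>m\<ge>N. \<forall>n\<ge>N. dist (T m \<cdot> x) (T n \<cdot> x) < e" by blast
    qed
    thus ?thesis by (rule Cauchy_convergent)
  qed
  obtain S where S: "\<And>x. (\<lambda>n. T n \<cdot> x) \<longlonglongrightarrow> S \<cdot> x" "\<And>x. norm (S \<cdot> x) \<le> C * norm x"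
    using pointwise_limit_op[OF conv lo] by blast
  moreover have "sym_op S" using sym S(1) by (rule sym_op_limit)
  moreover have "inner (T n \<cdot> x) x \<le> inner (S \<cdot> x) x" for n x
  proof (rule LIMSEQ_le_const)
    show "(\<lambda>n. inner (T n \<cdot> x) x) \<longlonglongrightarrow> inner (S \<cdot> x) x" by (intro tendsto_intros S)
  qed (use mono' in blast)
  ultimately show ?thesis using that by blast
qed

subsection \<open>Commuting positive operators and square roots\<close>

definition ocomm :: "('a::real_normed_vector \<Rightarrow>\<^sub>L 'a) \<Rightarrow> ('a \<Rightarrow>\<^sub>L 'a) \<Rightarrow> bool" where
  "ocomm S T \<longleftrightarrow> (\<forall>x. S \<cdot> (T \<cdot> x) = T \<cdot> (S \<cdot> x))"

lemma ocommD: "ocomm S T \<Longrightarrow> S \<cdot> (T \<cdot> x) = T \<cdot> (S \<cdot> x)"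
  by (simp add: ocomm_def)

lemma ocomm_sym: "ocomm S T \<Longrightarrow> ocomm T S"
  by (simp add: ocomm_def)

lemma ocomm_simps [simp]:
  "ocomm T T" "ocomm id_blinfun T" "ocomm T id_blinfun" "ocomm 0 T" "ocomm T 0"
  "ocomm Z S \<Longrightarrow> ocomm Z T \<Longrightarrow> ocomm Z (S + T)"
  "ocomm Z S \<Longrightarrow> ocomm Z T \<Longrightarrow> ocomm Z (S - T)"
  "ocomm Z S \<Longrightarrow> ocomm Z T \<Longrightarrow> ocomm Z (S o\<^sub>L T)"
  "ocomm Z T \<Longrightarrow> ocomm Z (r *\<^sub>R T)"
  by (simp_all add: ocomm_def op_simps)

lemma ocomm_simps' [simp]:
  "ocomm S Z \<Longrightarrow> ocomm T Z \<Longrightarrow> ocomm (S + T) Z"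
  "ocomm S Z \<Longrightarrow> ocomm T Z \<Longrightarrow> ocomm (S - T) Z"
  "ocomm S Z \<Longrightarrow> ocomm T Z \<Longrightarrow> ocomm (S o\<^sub>L T) Z"
  "ocomm T Z \<Longrightarrow> ocomm (r *\<^sub>R T) Z"
  by (simp_all add: ocomm_def op_simps)

lemma ocomm_limit:
  assumes "\<And>x. (\<lambda>n. T n \<cdot> x) \<longlonglongrightarrow> S \<cdot> x" "\<And>n. ocomm Z (T n)"
  shows "ocomm Z S"
  unfolding ocomm_def
proof
  fix x
  have "(\<lambda>n. Z \<cdot> (T n \<cdot> x)) \<longlonglongrightarrow> Z \<cdot> (S \<cdot> x)" by (intro blinfun_tendsto assms)
  hence "(\<lambda>n. T n \<cdot> (Z \<cdot> x)) \<longlonglongrightarrow> Z \<cdot> (S \<cdot> x)" by (simp only: ocommD[OF assms(2)])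
  thus "Z \<cdot> (S \<cdot> x) = S \<cdot> (Z \<cdot> x)" using assms(1) by (rule LIMSEQ_unique)
qed

lemma sym_op_compose: "sym_op S \<Longrightarrow> sym_op T \<Longrightarrow> ocomm S T \<Longrightarrow> sym_op (S o\<^sub>L T)"
  by (simp add: sym_op_def ocomm_def)

lemma psd_sandwich:
  assumes "psd S" "sym_op T"
  shows "psd (T o\<^sub>L S o\<^sub>L T)"
  unfolding psd_def sym_op_def
proof (intro conjI allI)
  note s = sym_opD[OF assms(2)] sym_opD[OF psd_sym[OF assms(1)]]
  show "inner ((T o\<^sub>L S o\<^sub>L T) \<cdot> x) y = inner x ((T o\<^sub>L S o\<^sub>L T) \<cdot> y)" for x y by (simp add: s)
  show "0 \<le> inner ((T o\<^sub>L S o\<^sub>L T) \<cdot> x) x" for x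
    using psd_ge0[OF assms(1), of "T \<cdot> x"] by (simp add: s)
qed

lemma psd_diff_iff: "psd (S - T) \<longleftrightarrow> sym_op (S - T) \<and> (\<forall>x. inner (T \<cdot> x) x \<le> inner (S \<cdot> x) x)"
  by (simp add: psd_def op_simps)

lemma psd_contraction:
  assumes "psd T" "psd (id_blinfun - T)"
  shows "norm (T \<cdot> x) \<le> norm x"
proof -
  have b: "inner (T \<cdot> y) y \<le> 1 * (norm y)\<^sup>2" for y
    using psd_ge0[OF assms(2), of y] by (simp add: op_simps power2_norm_eq_inner)
  have "norm T \<le> 1" using norm_le_if_form_le[OF assms(1) _ b] by simp
  moreover have "norm (T \<cdot> x) \<le> norm T * norm x" by (rule norm_blinfun)
  ultimately show ?thesis by (metis mult_left_le_one_le mult.commute mult_right_mono norm_ge_zero order_trans mult_1)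
qed

text \<open>F. Riesz: with \<open>A\<^sub>0 = A\<close> and \<open>A\<^sub>n\<^sub>+\<^sub>1 = A\<^sub>n - A\<^sub>n\<^sup>2\<close> one has \<open>A = \<Sum> A\<^sub>n\<^sup>2\<close> for \<open>0 \<le> A \<le> 1\<close>.\<close>

lemma psd_compose_contraction:
  fixes A B :: "'a::real_inner \<Rightarrow>\<^sub>L 'a"
  assumes A: "psd A" "psd (id_blinfun - A)" and B: "psd B" and c: "ocomm A B"
  shows "0 \<le> inner (A \<cdot> (B \<cdot> x)) x"
proof -
  define X where "X = rec_nat A (\<lambda>_ T. T - (T o\<^sub>L T))"
  have X0: "X 0 = A" and XS: "\<And>n. X (Suc n) = X n - (X n o\<^sub>L X n)" by (simp_all add: X_def)
  have X: "psd (X n) \<and> psd (id_blinfun - X n) \<and> ocomm (X n) B" for n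
  proof (induction n)
    case 0 thus ?case using A c by (simp add: X0)
  next
    case (Suc n)
    let ?T = "X n" and ?U = "id_blinfun - X n"
    have p: "psd ?T" "psd ?U" "ocomm ?T B" using Suc by auto
    have s: "sym_op ?T" "sym_op ?U" using p psd_sym by auto
    \<comment> \<open>The identity T - T^2 = T (1 - T) T + (1 - T) T (1 - T) gives positivity by
      sandwiching alone, before products of commuting positive operators are known to be
      positive.\<close>
    have e1: "?T - (?T o\<^sub>L ?T) = (?T o\<^sub>L ?U o\<^sub>L ?T) + (?U o\<^sub>L ?T o\<^sub>L ?U)"
      by (rule blinfun_eqI) (simp add: op_simps)
    have e2: "id_blinfun - (?T - (?T o\<^sub>L ?T)) = ?U + (?T o\<^sub>L id_blinfun o\<^sub>L ?T)"
      by (rule blinfun_eqI) (simp add: op_simps)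
    have "psd (?T - (?T o\<^sub>L ?T))" unfolding e1 by (intro psd_simps psd_sandwich p s)
    moreover have "psd (id_blinfun - (?T - (?T o\<^sub>L ?T)))" unfolding e2 by (intro psd_simps psd_sandwich p s)
    ultimately show ?case using p(3) by (simp add: XS)
  qed
  have part: "A \<cdot> y - X n \<cdot> y = (\<Sum>k<n. X k \<cdot> (X k \<cdot> y))" for n y
    by (induction n) (simp_all add: X0 XS op_simps)
  have bound: "(\<Sum>k<n. (norm (X k \<cdot> y))\<^sup>2) \<le> inner (A \<cdot> y) y" for n y
  proof -
    have "(\<Sum>k<n. (norm (X k \<cdot> y))\<^sup>2) = (\<Sum>k<n. inner (X k \<cdot> (X k \<cdot> y)) y)"
      using X by (intro sum.cong refl) (simp add: power2_norm_eq_inner sym_opD psd_sym)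
    also have "\<dots> = inner (A \<cdot> y - X n \<cdot> y) y" by (simp add: part inner_sum_left)
    also have "\<dots> \<le> inner (A \<cdot> y) y" using X[of n] psd_ge0[of "X n" y] by (simp add: inner_diff_left)
    finally show ?thesis .
  qed
  have "summable (\<lambda>k. (norm (X k \<cdot> y))\<^sup>2)" for y
    using bound[where y = y] by (intro summableI_nonneg_bounded[where x = "inner (A \<cdot> y) y"]) simp_all
  hence "(\<lambda>k. (norm (X k \<cdot> y))\<^sup>2) \<longlonglongrightarrow> 0" for y by (rule summable_LIMSEQ_zero)
  hence "(\<lambda>k. norm (X k \<cdot> y)) \<longlonglongrightarrow> 0" for y by (simp add: power_tendsto_0_iff)
  hence lim0: "(\<lambda>k. X k \<cdot> y) \<longlonglongrightarrow> 0" for y by (rule tendsto_norm_zero_cancel)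
  have "(\<lambda>n. inner (A \<cdot> (B \<cdot> x) - X n \<cdot> (B \<cdot> x)) x) \<longlonglongrightarrow> inner (A \<cdot> (B \<cdot> x) - 0) x"
    by (intro tendsto_intros lim0)
  \<comment> \<open>The difference is the sum over \<open>k < n\<close> of \<open>X k\<close>
    applied twice to \<open>B x\<close>. As \<open>B\<close> commutes with \<open>X k\<close>, each
    summand is the form of \<open>B\<close> at \<open>X k x\<close>.\<close>
  moreover have "0 \<le> inner (A \<cdot> (B \<cdot> x) - X n \<cdot> (B \<cdot> x)) x" for n
  proof -
    have "inner (X k \<cdot> (X k \<cdot> (B \<cdot> x))) x = inner (B \<cdot> (X k \<cdot> x)) (X k \<cdot> x)" for k
    proof -
      have "inner (X k \<cdot> (X k \<cdot> (B \<cdot> x))) x = inner (X k \<cdot> (B \<cdot> x)) (X k \<cdot> x)"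
        using X[of k] by (simp add: sym_opD psd_sym)
      thus ?thesis using X[of k] by (simp add: ocommD)
    qed
    thus ?thesis by (simp add: part inner_sum_left sum_nonneg psd_ge0[OF B])
  qed
  ultimately have "0 \<le> inner (A \<cdot> (B \<cdot> x) - 0) x" by (intro LIMSEQ_le_const) auto
  thus ?thesis by simp
qed

lemma psd_scaled_contraction:
  assumes "psd A" "norm A \<le> c" "0 < c"
  shows "psd (id_blinfun - inverse c *\<^sub>R A)"
proof -
  have "inner (A \<cdot> x) x \<le> c * inner x x" for x
  proof -
    have "inner (A \<cdot> x) x \<le> norm A * (norm x)\<^sup>2" by (rule inner_le_norm)
    also have "\<dots> \<le> c * (norm x)\<^sup>2" by (intro mult_right_mono assms) simp
    finally show ?thesis by (simp add: power2_norm_eq_inner)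
  qed
  hence "inverse c * inner (A \<cdot> x) x \<le> inner x x" for x using assms(3) by (simp add: field_simps)
  thus ?thesis using assms by (simp add: psd_diff_iff op_simps psd_sym)
qed

lemma psd_compose:
  assumes A: "psd A" and B: "psd B" and c: "ocomm A B"
  shows "psd (A o\<^sub>L B)"
proof -
  define c where "c = norm A + 1"
  have cp: "0 < c" by (simp add: c_def add_nonneg_pos)
  have "0 \<le> inner ((inverse c *\<^sub>R A) \<cdot> (B \<cdot> x)) x" for x
  proof (rule psd_compose_contraction)
    show "psd (id_blinfun - inverse c *\<^sub>R A)"
      by (rule psd_scaled_contraction[OF A _ cp]) (simp add: c_def)
  qed (use A B assms(3) cp in simp_all)
  hence "0 \<le> inner (A \<cdot> (B \<cdot> x)) x" for x
    using cp by (simp add: op_simps zero_le_mult_iff)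
  moreover have "sym_op (A o\<^sub>L B)" using assms by (simp add: sym_op_compose psd_sym)
  ultimately show ?thesis by (simp add: psd_def)
qed

text \<open>With X = 1 - T the iteration Y' = (X + Y^2) / 2 started at 0 increases to some L with 2
  L = X + L^2, that is (1 - L)^2 = T. All iterates commute, so the increments are products of
  commuting positive operators.\<close>

lemma psd_sqrt_contraction:
  fixes T :: "'a::{real_inner,banach} \<Rightarrow>\<^sub>L 'a"
  assumes T: "psd T" "psd (id_blinfun - T)"
  shows "\<exists>R. psd R \<and> R o\<^sub>L R = T \<and> (\<forall>Z. ocomm Z T \<longrightarrow> ocomm Z R)"
proof -
  define X where "X = id_blinfun - T"
  define Y where "Y = rec_nat 0 (\<lambda>_ Z. (1/2) *\<^sub>R (X + (Z o\<^sub>L Z)))"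
  have Y0: "Y 0 = 0" and YS: "\<And>n. Y (Suc n) = (1/2) *\<^sub>R (X + (Y n o\<^sub>L Y n))" by (simp_all add: Y_def)
  have X: "psd X" "psd (id_blinfun - X)" using T by (simp_all add: X_def)
  have YZ: "ocomm Z (Y n)" if "ocomm Z T" for Z n
    by (induction n) (use that in \<open>simp_all add: Y0 YS X_def\<close>)
  have "ocomm T (Y n)" for n by (rule YZ) simp
  hence YY: "ocomm (Y m) (Y n)" for m n by (rule YZ[OF ocomm_sym])
  have Yp: "psd (Y n) \<and> psd (id_blinfun - Y n)" for n
  proof (induction n)
    case (Suc n)
    have "psd (Y n o\<^sub>L Y n)" using Suc by (intro psd_compose) auto
    moreover have "psd (Y n o\<^sub>L (id_blinfun - Y n))" using Suc by (intro psd_compose) auto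
    moreover have "id_blinfun - (1/2) *\<^sub>R (X + (Y n o\<^sub>L Y n))
      = (1/2) *\<^sub>R ((id_blinfun - X) + ((id_blinfun - Y n) + (Y n o\<^sub>L (id_blinfun - Y n))))"
      (is "?l = ?r")
    proof (rule blinfun_eqI)
      fix x
      have "2 *\<^sub>R (?l \<cdot> x) = 2 *\<^sub>R (?r \<cdot> x)"
        by (simp add: op_simps scaleR_right_diff_distrib scaleR_right_distrib) (simp add: scaleR_2)
      thus "?l \<cdot> x = ?r \<cdot> x" by simp
    qed
    ultimately show ?case using Suc X by (simp add: YS)
  qed (simp add: Y0)
  have inc: "psd (Y (Suc n) - Y n)" for n
  proof (induction n)
    case 0 thus ?case using X by (simp add: Y0 YS)
  next
    case (Suc n)
    define V where "V = Y (Suc n)"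
    have "V \<cdot> (Y n \<cdot> x) = Y n \<cdot> (V \<cdot> x)" for x unfolding V_def using YY by (rule ocommD)
    hence "(1/2) *\<^sub>R (X + (V o\<^sub>L V)) - (1/2) *\<^sub>R (X + (Y n o\<^sub>L Y n)) = (1/2) *\<^sub>R ((V - Y n) o\<^sub>L (V + Y n))"
      by (intro blinfun_eqI) (simp add: op_simps scaleR_right_diff_distrib scaleR_right_distrib)
    hence "Y (Suc (Suc n)) - Y (Suc n) = (1/2) *\<^sub>R ((Y (Suc n) - Y n) o\<^sub>L (Y (Suc n) + Y n))"
      by (simp only: YS[of "Suc n"] V_def) (simp only: YS[of n])
    moreover have "psd ((Y (Suc n) - Y n) o\<^sub>L (Y (Suc n) + Y n))"
      using Suc Yp YY by (intro psd_compose) auto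
    ultimately show ?case by simp
  qed
  have "inner (Y n \<cdot> x) x \<le> inner (Y (Suc n) \<cdot> x) x" for n x
    using inc by (simp add: psd_diff_iff)
  moreover have Yc: "norm (Y n \<cdot> x) \<le> 1 * norm x" for n x using Yp[of n] psd_contraction[of "Y n" x] by simp
  ultimately obtain L where L: "\<And>x. (\<lambda>n. Y n \<cdot> x) \<longlonglongrightarrow> L \<cdot> x" "sym_op L" "\<And>x. norm (L \<cdot> x) \<le> 1 * norm x"
    using monotone_convergence_op[of Y 1] Yp psd_sym by metis
  have eq: "L \<cdot> x = (1/2) *\<^sub>R (X \<cdot> x + L \<cdot> (L \<cdot> x))" for x
  proof (rule LIMSEQ_unique[OF LIMSEQ_Suc[OF L(1)]])
    show "(\<lambda>n. Y (Suc n) \<cdot> x) \<longlonglongrightarrow> (1/2) *\<^sub>R (X \<cdot> x + L \<cdot> (L \<cdot> x))"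
      unfolding YS blinfun.scaleR_left blinfun.add_left blinfun_apply_blinfun_compose
      by (intro tendsto_intros pointwise_limit_compose[OF L(1) Yc] L(1))
  qed
  have "psd (id_blinfun - L)"
  proof -
    have "inner (L \<cdot> x) x \<le> inner x x" for x
    proof -
      have "inner (L \<cdot> x) x \<le> norm (L \<cdot> x) * norm x" by (rule norm_cauchy_schwarz)
      also have "\<dots> \<le> norm x * norm x" using L(3) by (intro mult_right_mono) simp_all
      finally show ?thesis by (metis power2_eq_square power2_norm_eq_inner)
    qed
    thus ?thesis using L(2) by (simp add: psd_diff_iff)
  qed
  moreover have "(id_blinfun - L) o\<^sub>L (id_blinfun - L) = T"
  proof (rule blinfun_eqI)
    fix x
    have "2 *\<^sub>R L \<cdot> x = X \<cdot> x + L \<cdot> (L \<cdot> x)" by (subst eq) simp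
    thus "((id_blinfun - L) o\<^sub>L (id_blinfun - L)) \<cdot> x = T \<cdot> x"
      by (simp add: op_simps X_def scaleR_2 algebra_simps)
  qed
  moreover have "ocomm Z (id_blinfun - L)" if "ocomm Z T" for Z
    using ocomm_limit[OF L(1) YZ[OF that]] by simp
  ultimately show ?thesis by blast
qed

lemma psd_sqrt_exists:
  fixes T :: "'a::{real_inner,banach} \<Rightarrow>\<^sub>L 'a"
  assumes T: "psd T"
  shows "\<exists>R. psd R \<and> R o\<^sub>L R = T \<and> (\<forall>Z. ocomm Z T \<longrightarrow> ocomm Z R)"
proof -
  define c where "c = norm T + 1"
  have cp: "0 < c" by (simp add: c_def add_nonneg_pos)
  have "psd (id_blinfun - inverse c *\<^sub>R T)"
    by (rule psd_scaled_contraction[OF T _ cp]) (simp add: c_def)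
  moreover have "psd (inverse c *\<^sub>R T)" using T cp by simp
  ultimately obtain R where R: "psd R" "R o\<^sub>L R = inverse c *\<^sub>R T"
    "\<And>Z. ocomm Z (inverse c *\<^sub>R T) \<Longrightarrow> ocomm Z R" using psd_sqrt_contraction by blast
  have "(sqrt c *\<^sub>R R) o\<^sub>L (sqrt c *\<^sub>R R) = c *\<^sub>R (R o\<^sub>L R)"
    using cp by (intro blinfun_eqI) (simp add: op_simps)
  hence "(sqrt c *\<^sub>R R) o\<^sub>L (sqrt c *\<^sub>R R) = T" using R(2) cp by simp
  thus ?thesis using R cp by (intro exI[of _ "sqrt c *\<^sub>R R"]) simp
qed

text \<open>The commutation property is part of the choice because it places the root in every
  bicommutant that contains \<open>T\<close>, see \<open>osqrt_closed\<close>.\<close>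

definition osqrt :: "('a::{real_inner,banach} \<Rightarrow>\<^sub>L 'a) \<Rightarrow> ('a \<Rightarrow>\<^sub>L 'a)" where
  "osqrt T = (SOME R :: 'a \<Rightarrow>\<^sub>L 'a. psd R \<and> R o\<^sub>L R = T \<and> (\<forall>Z. ocomm Z T \<longrightarrow> ocomm Z R))"

lemma osqrt:
  assumes "psd T"
  shows "psd (osqrt T)" "osqrt T o\<^sub>L osqrt T = T" "osqrt T \<cdot> (osqrt T \<cdot> x) = T \<cdot> x"
    "ocomm Z T \<Longrightarrow> ocomm Z (osqrt T)" "sym_op (osqrt T)"
    "(norm (osqrt T \<cdot> x))\<^sup>2 = inner (T \<cdot> x) x"
proof -
  have *: "psd (osqrt T) \<and> osqrt T o\<^sub>L osqrt T = T \<and> (\<forall>Z. ocomm Z T \<longrightarrow> ocomm Z (osqrt T))"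
    unfolding osqrt_def by (rule someI_ex[OF psd_sqrt_exists[OF assms]])
  thus 1: "psd (osqrt T)" "osqrt T o\<^sub>L osqrt T = T" "ocomm Z T \<Longrightarrow> ocomm Z (osqrt T)" by auto
  show 2: "osqrt T \<cdot> (osqrt T \<cdot> x) = T \<cdot> x" using 1(2) by (metis blinfun_apply_blinfun_compose)
  show 3: "sym_op (osqrt T)" using 1(1) by (rule psd_sym)
  show "(norm (osqrt T \<cdot> x))\<^sup>2 = inner (T \<cdot> x) x"
    by (simp add: power2_norm_eq_inner 2 flip: sym_opD[OF 3])
qed

subsection \<open>The spectral projections of a symmetric operator for half-lines\<close>

text \<open>The projection onto the closure of the range of the positive part of \<open>X\<close>, as the complement
  of the kernel of \<open>\<bar>X\<bar> + X\<close>.\<close>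

definition pos_supp :: "('a::{real_inner,banach} \<Rightarrow>\<^sub>L 'a) \<Rightarrow> ('a \<Rightarrow>\<^sub>L 'a)" where
  "pos_supp X = id_blinfun - proj_on {x. osqrt (X o\<^sub>L X) \<cdot> x + X \<cdot> x = 0}"

lemma kernel_subspace: "subspace {x. T \<cdot> x = 0}" "closed {x. T \<cdot> x = 0}"
  by (auto simp: subspace_def op_simps intro!: closed_Collect_eq continuous_intros)

lemma proj_on_kernel_ocomm:
  assumes "ocomm Z T" "ocomm (radj Z) T"
  shows "ocomm Z (proj_on {x. T \<cdot> x = 0})"
proof -
  let ?K = "{x. T \<cdot> x = 0}"
  have iff: "proj_on ?K \<cdot> x = x \<longleftrightarrow> T \<cdot> x = 0" for x
    using proj_on_eq_iff[OF kernel_subspace(1,2)[of T], of x] by simp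
  have pr: "rproj (proj_on ?K)" by (rule proj_on(1)[OF kernel_subspace])
  have "T \<cdot> (proj_on ?K \<cdot> x) = 0" for x by (subst iff[symmetric]) (simp add: pr)
  hence "proj_on ?K \<cdot> (Z \<cdot> x) = Z \<cdot> (proj_on ?K \<cdot> x)" for x
    using assms by (intro rproj_commute_if_invariant[OF pr]) (simp_all add: iff flip: ocommD, simp_all add: iff flip: ocommD[of _ T])
  thus ?thesis by (simp add: ocomm_def)
qed

text \<open>With R the modulus of X, the product (R + X)(R - X) vanishes; so X = -R on the kernel of
  R + X, and X = R on its orthogonal complement. The last claim, strict positivity on the support,
  is what ties the support to an open half-line.\<close>

lemma pos_supp:
  fixes X :: "'a::{real_inner,banach} \<Rightarrow>\<^sub>L 'a"
  assumes X: "sym_op X"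
  shows "rproj (pos_supp X)"
    and "ocomm Z X \<Longrightarrow> ocomm (radj Z) X \<Longrightarrow> ocomm Z (pos_supp X)"
    and "ocomm X (pos_supp X)"
    and "0 \<le> inner (X \<cdot> (pos_supp X \<cdot> x)) (pos_supp X \<cdot> x)"
    and "inner (X \<cdot> (x - pos_supp X \<cdot> x)) (x - pos_supp X \<cdot> x) \<le> 0"
    and "inner (X \<cdot> (pos_supp X \<cdot> x)) (pos_supp X \<cdot> x) = 0 \<Longrightarrow> pos_supp X \<cdot> x = 0"
proof -
  have X2: "psd (X o\<^sub>L X)" using psd_radj_compose(1)[of X] X by (simp add: sym_op_radj)
  define R where "R = osqrt (X o\<^sub>L X)"
  have Rs: "psd R" "\<And>x. R \<cdot> (R \<cdot> x) = X \<cdot> (X \<cdot> x)"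
    using osqrt(1,3)[OF X2] by (simp_all add: R_def)
  have RZ: "ocomm Z R" if "ocomm Z X" for Z
    unfolding R_def by (rule osqrt(4)[OF X2]) (use that in simp)
  have XR: "X \<cdot> (R \<cdot> x) = R \<cdot> (X \<cdot> x)" for x using RZ[of X] by (simp add: ocomm_def)
  define K where "K = proj_on {x. (R + X) \<cdot> x = 0}"
  have F: "pos_supp X = id_blinfun - K" by (simp add: pos_supp_def K_def R_def op_simps)
  have K: "rproj K" unfolding K_def by (rule proj_on(1)[OF kernel_subspace])
  have Kx: "K \<cdot> x = x \<longleftrightarrow> R \<cdot> x + X \<cdot> x = 0" for x
    unfolding K_def using proj_on_eq_iff[OF kernel_subspace(1,2)[of "R + X"], of x] by (simp add: op_simps)
  show rp: "rproj (pos_supp X)" unfolding F by (rule rproj_compl[OF K])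
  have KZ: "ocomm Z K" if "ocomm Z X" "ocomm (radj Z) X" for Z
    unfolding K_def by (rule proj_on_kernel_ocomm) (use that RZ in simp_all)
  thus FZ: "ocomm Z (pos_supp X)" if "ocomm Z X" "ocomm (radj Z) X" for Z
    unfolding F using that by simp
  thus XF: "ocomm X (pos_supp X)" using X by (simp add: sym_op_radj)
  have KX: "K \<cdot> (X \<cdot> x) = X \<cdot> (K \<cdot> x)" for x using KZ[of X] X by (simp add: sym_op_radj ocomm_def)
  have KR: "K \<cdot> (R \<cdot> x) = R \<cdot> (K \<cdot> x)" for x
  proof -
    have "ocomm R X" using XR by (simp add: ocomm_def)
    thus ?thesis using KZ[of R] psd_sym[OF Rs(1)] by (simp add: sym_op_radj ocomm_def)
  qed
  have neg: "R \<cdot> (K \<cdot> x) = - (X \<cdot> (K \<cdot> x))" for x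
    using Kx[of "K \<cdot> x"] K by (simp add: eq_neg_iff_add_eq_0)
  have "K \<cdot> (R \<cdot> x - X \<cdot> x) = R \<cdot> x - X \<cdot> x" for x
    unfolding Kx by (simp add: op_simps Rs(2) XR)
  hence d: "R \<cdot> (K \<cdot> x) - X \<cdot> (K \<cdot> x) = R \<cdot> x - X \<cdot> x" for x by (simp only: op_simps KX KR)
  have "R \<cdot> (x - K \<cdot> x) - X \<cdot> (x - K \<cdot> x) = (R \<cdot> x - X \<cdot> x) - (R \<cdot> (K \<cdot> x) - X \<cdot> (K \<cdot> x))" for x
    by (simp add: op_simps)
  hence pos: "R \<cdot> (x - K \<cdot> x) = X \<cdot> (x - K \<cdot> x)" for x by (simp add: d)
  have Fx: "pos_supp X \<cdot> x = x - K \<cdot> x" for x by (simp add: F blinfun.diff_left)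
  show "0 \<le> inner (X \<cdot> (pos_supp X \<cdot> x)) (pos_supp X \<cdot> x)" for x
    unfolding Fx pos[symmetric] by (rule psd_ge0[OF Rs(1)])
  show "inner (X \<cdot> (x - pos_supp X \<cdot> x)) (x - pos_supp X \<cdot> x) \<le> 0"
    using psd_ge0[OF Rs(1), of "K \<cdot> x"] by (simp add: Fx neg inner_minus_left)
  show "pos_supp X \<cdot> x = 0" if "inner (X \<cdot> (pos_supp X \<cdot> x)) (pos_supp X \<cdot> x) = 0"
  proof -
    define y where "y = x - K \<cdot> x"
    have "inner (R \<cdot> y) y = 0" using that unfolding Fx y_def pos .
    hence "R \<cdot> y = 0" by (rule psd_kernel[OF Rs(1)])
    moreover from this have "X \<cdot> y = 0" using pos[of x] by (simp add: y_def)
    ultimately have "K \<cdot> y = y" by (simp add: Kx)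
    moreover have "K \<cdot> y = 0" using K by (simp add: y_def op_simps)
    ultimately show ?thesis by (simp add: Fx y_def)
  qed
qed

subsection \<open>Inverses and normalising operators\<close>

text \<open>The lower bound gives injectivity and a closed range. A vector orthogonal to the range
  has form 0 and hence vanishes, so the range is everything.\<close>

lemma sym_op_inverse:
  fixes Y :: "'a::{real_inner,banach} \<Rightarrow>\<^sub>L 'a"
  assumes Y: "sym_op Y" and c: "0 < c" "\<And>x. c * (norm x)\<^sup>2 \<le> inner (Y \<cdot> x) x"
  obtains N where "psd N" "\<And>x. N \<cdot> (Y \<cdot> x) = x" "\<And>x. Y \<cdot> (N \<cdot> x) = x" "\<And>Z. ocomm Z Y \<Longrightarrow> ocomm Z N"
proof -
  have low: "c * norm x \<le> norm (Y \<cdot> x)" for x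
  proof (cases "x = 0")
    case False
    have "c * norm x * norm x \<le> norm (Y \<cdot> x) * norm x"
      using c(2)[of x] norm_cauchy_schwarz[of "Y \<cdot> x" x] by (simp add: power2_eq_square)
    thus ?thesis using False by simp
  qed simp
  have bl: "bounded_linear (blinfun_apply Y)" by (rule blinfun.bounded_linear_right)
  have sub: "subspace (range (blinfun_apply Y))"
    by (rule linear_subspace_image[OF bounded_linear.linear[OF bl] subspace_UNIV])
  have "complete (range (blinfun_apply Y))"
    by (rule complete_isometric_image[OF c(1) subspace_UNIV bl]) (use low complete_UNIV in simp_all)
  hence cl: "closed (range (blinfun_apply Y))" by (rule complete_imp_closed)
  have "surj (blinfun_apply Y)"
  proof -
    have "y \<in> range (blinfun_apply Y)" for y
    proof -
      obtain v where v: "v \<in> range (blinfun_apply Y)"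
        "\<And>z. z \<in> range (blinfun_apply Y) \<Longrightarrow> inner (y - v) z = 0"
        using closed_subspace_decomp[OF sub cl, of y] by blast
      have "inner (Y \<cdot> (y - v)) (y - v) = 0" using v(2)[of "Y \<cdot> (y - v)"] by (simp add: inner_commute)
      hence "norm (y - v) = 0" using c by (metis mult_le_0_iff norm_ge_zero power2_less_eq_zero_iff norm_zero not_less order_antisym_conv)
      thus ?thesis using v(1) by simp
    qed
    thus ?thesis by blast
  qed
  then obtain g where g: "\<And>y. Y \<cdot> g y = y" by (metis surj_f_inv_f)
  have inj: "x = y" if "Y \<cdot> x = Y \<cdot> y" for x y
  proof -
    have "c * norm (x - y) \<le> 0" using low[of "x - y"] that by (simp add: op_simps)
    thus ?thesis using c(1) by (simp add: mult_le_0_iff)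
  qed
  have "bounded_linear g"
  proof (rule bounded_linear_intro[where K = "inverse c"])
    show "g (x + y) = g x + g y" for x y by (rule inj) (simp add: op_simps g)
    show "g (r *\<^sub>R x) = r *\<^sub>R g x" for r x by (rule inj) (simp add: op_simps g)
    show "norm (g x) \<le> norm x * inverse c" for x using low[of "g x"] c(1) by (simp add: g field_simps)
  qed
  hence N: "\<And>x. Blinfun g \<cdot> x = g x" by (simp add: bounded_linear_Blinfun_apply)
  have "psd (Blinfun g)"
    unfolding psd_def sym_op_def N
  proof (intro conjI allI)
    show "inner (g x) y = inner x (g y)" for x y using sym_opD[OF Y, of "g x" "g y"] by (simp add: g)
    show "0 \<le> inner (g x) x" for x
    proof -
      have "0 \<le> c * (norm (g x))\<^sup>2" using c(1) by simp
      also have "\<dots> \<le> inner x (g x)" using c(2)[of "g x"] by (simp add: g)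
      finally show ?thesis by (simp add: inner_commute)
    qed
  qed
  moreover have "ocomm Z (Blinfun g)" if "ocomm Z Y" for Z
    unfolding ocomm_def N
  proof
    fix x
    have "Y \<cdot> (Z \<cdot> g x) = Y \<cdot> g (Z \<cdot> x)" using ocommD[OF that, of "g x"] by (simp add: g)
    thus "Z \<cdot> g x = g (Z \<cdot> x)" by (rule inj)
  qed
  moreover have "g (Y \<cdot> x) = x" for x by (rule inj) (rule g)
  ultimately show ?thesis using that[of "Blinfun g"] g by (simp add: N)
qed

text \<open>\<open>h\<close> is the inverse square root of the part of \<open>T\<close> on the range
  of \<open>f\<close>, extended by 0. It turns a compression of \<open>T\<close> into the projection
  \<open>f\<close>, at the cost of a factor \<open>1 / e\<close> in squared norms, and it takes the
  place of a polar decomposition.\<close>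

lemma normalizer_exists:
  fixes T f :: "'a::{real_inner,banach} \<Rightarrow>\<^sub>L 'a"
  assumes T: "psd T" and f: "rproj f" "ocomm T f"
    and e: "0 < e" "\<And>x. e * (norm (f \<cdot> x))\<^sup>2 \<le> inner (T \<cdot> (f \<cdot> x)) (f \<cdot> x)"
  obtains h where "psd h" "\<And>x. h \<cdot> (f \<cdot> x) = h \<cdot> x" "\<And>x. f \<cdot> (h \<cdot> x) = h \<cdot> x"
    "\<And>x. h \<cdot> (T \<cdot> (h \<cdot> x)) = f \<cdot> x" "\<And>Z. ocomm Z T \<Longrightarrow> ocomm Z f \<Longrightarrow> ocomm Z h"
    "\<And>x. e * (norm (h \<cdot> x))\<^sup>2 \<le> (norm (f \<cdot> x))\<^sup>2"
proof -
  \<comment> \<open>The identity on the complement of \<open>f\<close> makes the operator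
    invertible, with lower bound \<open>min e 1\<close>, and leaves it unchanged on the range of
    \<open>f\<close>.\<close>
  define Y where "Y = (T o\<^sub>L f) + (id_blinfun - f)"
  have fT: "f \<cdot> (T \<cdot> x) = T \<cdot> (f \<cdot> x)" for x using f(2) by (simp add: ocomm_def)
  have YZ: "ocomm Z Y" if "ocomm Z T" "ocomm Z f" for Z using that by (simp add: Y_def)
  have "sym_op (T o\<^sub>L f)" using T f by (simp add: sym_op_compose psd_sym rproj_sym)
  hence Ys: "sym_op Y" using rproj_sym[OF f(1)] by (simp add: Y_def)
  have "min e 1 * (norm x)\<^sup>2 \<le> inner (Y \<cdot> x) x" for x
  proof -
    have a: "inner (T \<cdot> (f \<cdot> x)) x = inner (T \<cdot> (f \<cdot> x)) (f \<cdot> x)"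
      using sym_opD[OF rproj_sym[OF f(1)], of "T \<cdot> (f \<cdot> x)" x] f(1) by (simp add: fT)
    have b: "inner (x - f \<cdot> x) x = (norm (x - f \<cdot> x))\<^sup>2"
      using rproj_inner[OF rproj_compl[OF f(1)], of x] by (simp add: op_simps)
    have "min e 1 * (norm x)\<^sup>2 = min e 1 * (norm (f \<cdot> x))\<^sup>2 + min e 1 * (norm (x - f \<cdot> x))\<^sup>2"
      by (subst rproj_pythagoras[OF f(1)]) (simp add: distrib_left)
    also have "\<dots> \<le> e * (norm (f \<cdot> x))\<^sup>2 + 1 * (norm (x - f \<cdot> x))\<^sup>2"
      by (intro add_mono mult_right_mono) simp_all
    also have "\<dots> \<le> inner (Y \<cdot> x) x" using e(2)[of x] a b by (simp add: Y_def blinfun.add_left blinfun.diff_left inner_add_left)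
    finally show ?thesis .
  qed
  then obtain N where N: "psd N" "\<And>x. N \<cdot> (Y \<cdot> x) = x" "\<And>x. Y \<cdot> (N \<cdot> x) = x"
    "\<And>Z. ocomm Z Y \<Longrightarrow> ocomm Z N"
    using sym_op_inverse[OF Ys, of "min e 1"] e(1) by auto
  define r where "r = osqrt N"
  define h where "h = r o\<^sub>L f"
  have r: "psd r" "\<And>x. r \<cdot> (r \<cdot> x) = N \<cdot> x" using osqrt[OF N(1)] by (auto simp: r_def)
  have rZ: "ocomm Z r" if "ocomm Z T" "ocomm Z f" for Z
    unfolding r_def by (intro osqrt(4)[OF N(1)] N(4) YZ that)
  have "ocomm f T" using f(2) by (rule ocomm_sym)
  hence fr: "f \<cdot> (r \<cdot> x) = r \<cdot> (f \<cdot> x)" for x using rZ[of f] by (simp add: ocomm_def)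
  have Tr: "T \<cdot> (r \<cdot> x) = r \<cdot> (T \<cdot> x)" for x using rZ[of T] f(2) by (simp add: ocomm_def)
  have ff: "f \<cdot> (f \<cdot> x) = f \<cdot> x" for x using f(1) by simp
  have h1: "h \<cdot> (f \<cdot> x) = h \<cdot> x" "f \<cdot> (h \<cdot> x) = h \<cdot> x" for x by (simp_all add: h_def fr ff)
  have h2: "h \<cdot> (T \<cdot> (h \<cdot> x)) = f \<cdot> x" for x
  proof -
    have "h \<cdot> (T \<cdot> (h \<cdot> x)) = N \<cdot> (T \<cdot> (f \<cdot> x))" by (simp add: h_def fr Tr fT ff r)
    also have "T \<cdot> (f \<cdot> x) = Y \<cdot> (f \<cdot> x)" by (simp add: Y_def op_simps ff)
    finally show ?thesis by (simp add: N(2))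
  qed
  have hp: "psd h" unfolding h_def
    by (rule psd_compose) (use r f fr in \<open>auto simp: rproj_psd ocomm_def\<close>)
  have hs: "sym_op h" by (rule psd_sym[OF hp])
  have "e * (norm (h \<cdot> x))\<^sup>2 \<le> (norm (f \<cdot> x))\<^sup>2" for x
  proof -
    have "e * (norm (h \<cdot> x))\<^sup>2 \<le> inner (T \<cdot> (h \<cdot> x)) (h \<cdot> x)" using e(2)[of "h \<cdot> x"] by (simp add: h1)
    also have "\<dots> = inner (f \<cdot> x) x" by (simp add: h2 flip: sym_opD[OF hs])
    finally show ?thesis by (simp add: rproj_inner[OF f(1)])
  qed
  moreover have "ocomm Z h" if "ocomm Z T" "ocomm Z f" for Z using rZ[OF that] that by (simp add: h_def)
  ultimately show ?thesis using that hp h1 h2 by blast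
qed

subsection \<open>Orthogonal series\<close>

lemma norm_sq_sum_orth:
  fixes v :: "nat \<Rightarrow> 'a::real_inner"
  assumes "\<And>i j. i \<noteq> j \<Longrightarrow> inner (v i) (v j) = 0" "finite A"
  shows "(norm (sum v A))\<^sup>2 = (\<Sum>i\<in>A. (norm (v i))\<^sup>2)"
  using assms(2)
proof (induction A rule: finite_induct)
  case (insert i A)
  have "inner (v i) (sum v A) = 0"
    unfolding inner_sum_right using insert(2) by (intro sum.neutral) (auto intro!: assms(1))
  thus ?case using insert by (simp add: norm_add_square)
qed simp

lemma summable_orth:
  fixes v :: "nat \<Rightarrow> 'a::{real_inner,banach}"
  assumes orth: "\<And>i j. i \<noteq> j \<Longrightarrow> inner (v i) (v j) = 0" and s: "summable (\<lambda>i. (norm (v i))\<^sup>2)"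
  shows "summable v" "(\<lambda>i. (norm (v i))\<^sup>2) sums (norm (suminf v))\<^sup>2"
proof -
  show sv: "summable v"
    unfolding summable_Cauchy
  proof (intro allI impI)
    fix e :: real assume e: "0 < e"
    then obtain N where N: "\<And>m n. m \<ge> N \<Longrightarrow> norm (\<Sum>i=m..<n. (norm (v i))\<^sup>2) < e\<^sup>2"
      using s unfolding summable_Cauchy by (metis zero_less_power)
    have "norm (sum v {m..<n}) < e" if "m \<ge> N" for m n
    proof (rule power_less_imp_less_base)
      have "(norm (sum v {m..<n}))\<^sup>2 \<le> norm (\<Sum>i=m..<n. (norm (v i))\<^sup>2)"
        by (subst norm_sq_sum_orth[OF orth]) auto
      also have "\<dots> < e\<^sup>2" by (rule N[OF that])
      finally show "(norm (sum v {m..<n}))\<^sup>2 < e\<^sup>2" .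
    qed (use e in simp)
    thus "\<exists>N. \<forall>m\<ge>N. \<forall>n. norm (sum v {m..<n}) < e" by blast
  qed
  have "(\<lambda>n. (norm (sum v {..<n}))\<^sup>2) \<longlonglongrightarrow> (norm (suminf v))\<^sup>2"
    by (intro tendsto_intros summable_LIMSEQ sv)
  moreover have "(norm (sum v {..<n}))\<^sup>2 = (\<Sum>i<n. (norm (v i))\<^sup>2)" for n
    by (rule norm_sq_sum_orth[OF orth]) auto
  ultimately show "(\<lambda>i. (norm (v i))\<^sup>2) sums (norm (suminf v))\<^sup>2" by (simp add: sums_def)
qed

lemma bessel_projections:
  assumes F: "\<And>i. rproj (F i)" "\<And>i j x. i \<noteq> j \<Longrightarrow> F i \<cdot> (F j \<cdot> x) = 0"
  shows "(\<Sum>i<n::nat. (norm (F i \<cdot> x))\<^sup>2) \<le> (norm x)\<^sup>2"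
proof -
  let ?y = "\<Sum>i<n. F i \<cdot> x"
  have o: "inner (F i \<cdot> x) (F j \<cdot> x) = 0" if "i \<noteq> j" for i j
    using F(2)[OF that] by (simp add: sym_opD[OF rproj_sym[OF F(1)]])
  have "(norm ?y)\<^sup>2 = (\<Sum>i<n. (norm (F i \<cdot> x))\<^sup>2)" by (rule norm_sq_sum_orth[OF o]) auto
  moreover have "inner ?y x = (\<Sum>i<n. (norm (F i \<cdot> x))\<^sup>2)"
    by (simp add: inner_sum_left rproj_inner[OF F(1)])
  ultimately have "(norm ?y)\<^sup>2 \<le> norm ?y * norm x" using norm_cauchy_schwarz[of ?y x] by simp
  hence "norm ?y \<le> norm x" by (cases "?y = 0") (simp_all add: power2_eq_square)
  hence "(norm ?y)\<^sup>2 \<le> (norm x)\<^sup>2" by (intro power_mono) simp_all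
  thus ?thesis using \<open>(norm ?y)\<^sup>2 = _\<close> by simp
qed

text \<open>Orthogonal ranges make the squared norms of the \<open>T i x\<close> add up, and the
  orthogonal initial projections \<open>F i\<close> bound the total by Bessel's inequality.\<close>

lemma orth_sum_op:
  fixes T F :: "nat \<Rightarrow> 'a::{real_inner,banach} \<Rightarrow>\<^sub>L 'a"
  assumes F: "\<And>i. rproj (F i)" "\<And>i j x. i \<noteq> j \<Longrightarrow> F i \<cdot> (F j \<cdot> x) = 0"
    and T: "\<And>i x. T i \<cdot> (F i \<cdot> x) = T i \<cdot> x" "\<And>i j x y. i \<noteq> j \<Longrightarrow> inner (T i \<cdot> x) (T j \<cdot> y) = 0"
      "\<And>i x. norm (T i \<cdot> x) \<le> norm x"
  obtains S where "\<And>x. (\<lambda>i. T i \<cdot> x) sums (S \<cdot> x)" "\<And>x. norm (S \<cdot> x) \<le> norm x"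
    "\<And>x. (\<lambda>i. (norm (T i \<cdot> x))\<^sup>2) sums (norm (S \<cdot> x))\<^sup>2"
proof -
  have b: "(\<Sum>i<n. (norm (T i \<cdot> x))\<^sup>2) \<le> (norm x)\<^sup>2" for n x
  proof -
    have "norm (T i \<cdot> x) \<le> norm (F i \<cdot> x)" for i using T(3)[of i "F i \<cdot> x"] by (simp add: T(1))
    hence "(\<Sum>i<n. (norm (T i \<cdot> x))\<^sup>2) \<le> (\<Sum>i<n. (norm (F i \<cdot> x))\<^sup>2)" by (intro sum_mono power_mono) simp_all
    also have "\<dots> \<le> (norm x)\<^sup>2" by (rule bessel_projections[OF F])
    finally show ?thesis .
  qed
  hence s: "summable (\<lambda>i. (norm (T i \<cdot> x))\<^sup>2)" for x
    by (intro summableI_nonneg_bounded[where x = "(norm x)\<^sup>2"]) simp_all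
  have sv: "summable (\<lambda>i. T i \<cdot> x)" for x by (rule summable_orth(1)[OF _ s]) (rule T(2))
  define P where "P n = (\<Sum>i<n. T i)" for n
  have P: "P n \<cdot> x = (\<Sum>i<n. T i \<cdot> x)" for n x by (simp add: P_def blinfun.sum_left)
  have "norm (P n \<cdot> x) \<le> 1 * norm x" for n x
  proof -
    have "(norm (P n \<cdot> x))\<^sup>2 = (\<Sum>i<n. (norm (T i \<cdot> x))\<^sup>2)"
      unfolding P by (rule norm_sq_sum_orth) (auto intro: T(2))
    also have "\<dots> \<le> (norm x)\<^sup>2" by (rule b)
    finally show ?thesis by simp
  qed
  moreover have "convergent (\<lambda>n. P n \<cdot> x)" for x
    unfolding P using sv by (simp add: summable_iff_convergent)
  ultimately obtain S where S: "\<And>x. (\<lambda>n. P n \<cdot> x) \<longlonglongrightarrow> S \<cdot> x" "\<And>x. norm (S \<cdot> x) \<le> 1 * norm x"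
    using pointwise_limit_op[of P 1] by blast
  have sm: "(\<lambda>i. T i \<cdot> x) sums (S \<cdot> x)" for x using S(1)[of x] by (simp add: P sums_def)
  have sq: "(\<lambda>i. (norm (T i \<cdot> x))\<^sup>2) sums (norm (S \<cdot> x))\<^sup>2" for x
  proof -
    have "(\<lambda>i. (norm (T i \<cdot> x))\<^sup>2) sums (norm (\<Sum>i. T i \<cdot> x))\<^sup>2"
      by (rule summable_orth(2)[OF _ s]) (rule T(2))
    thus ?thesis using sums_unique[OF sm] by simp
  qed
  have "norm (S \<cdot> x) \<le> norm x" for x using S(2)[of x] by simp
  from that[OF sm this sq] show ?thesis .
qed

lemma orth_sum_proj:
  fixes F :: "nat \<Rightarrow> 'a::{real_inner,banach} \<Rightarrow>\<^sub>L 'a"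
  assumes F: "\<And>i. rproj (F i)" "\<And>i j x. i \<noteq> j \<Longrightarrow> F i \<cdot> (F j \<cdot> x) = 0"
  obtains P where "rproj P" "\<And>x. (\<lambda>i. F i \<cdot> x) sums (P \<cdot> x)" "\<And>i x. P \<cdot> (F i \<cdot> x) = F i \<cdot> x"
    "\<And>i x. F i \<cdot> (P \<cdot> x) = F i \<cdot> x"
proof -
  have o: "inner (F i \<cdot> x) (F j \<cdot> y) = 0" if "i \<noteq> j" for i j x y
    using F(2)[OF that] by (simp add: sym_opD[OF rproj_sym[OF F(1)]])
  obtain P where P: "\<And>x. (\<lambda>i. F i \<cdot> x) sums (P \<cdot> x)"
  proof (rule orth_sum_op[where F = F and T = F])
    show "F i \<cdot> (F i \<cdot> x) = F i \<cdot> x" "norm (F i \<cdot> x) \<le> norm x" for i x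
      by (rule rproj_idem[OF F(1)], rule rproj_norm_le[OF F(1)])
  qed (use F o in blast)+
  have PF: "P \<cdot> (F i \<cdot> x) = F i \<cdot> x" for i x
  proof (rule sums_unique2[OF P])
    have "(\<lambda>j. F j \<cdot> (F i \<cdot> x)) = (\<lambda>j. if j = i then F i \<cdot> x else 0)"
      using F by (auto simp: fun_eq_iff)
    thus "(\<lambda>j. F j \<cdot> (F i \<cdot> x)) sums (F i \<cdot> x)"
      using sums_single[of i "\<lambda>_. F i \<cdot> x"] by simp
  qed
  have "sym_op P"
    unfolding sym_op_def
  proof (intro allI)
    fix x y
    have "(\<lambda>i. inner (F i \<cdot> x) y) sums inner (P \<cdot> x) y"
      by (rule bounded_linear.sums[OF bounded_linear_inner_left P])
    moreover have "(\<lambda>i. inner x (F i \<cdot> y)) sums inner x (P \<cdot> y)"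
      by (rule bounded_linear.sums[OF bounded_linear_inner_right P])
    ultimately show "inner (P \<cdot> x) y = inner x (P \<cdot> y)"
      using sums_unique2 by (simp add: sym_opD[OF rproj_sym[OF F(1)]]) blast
  qed
  moreover have "P \<cdot> (P \<cdot> x) = P \<cdot> x" for x
  proof (rule sums_unique2)
    show "(\<lambda>i. F i \<cdot> x) sums (P \<cdot> x)" by (rule P)
    have "(\<lambda>i. P \<cdot> (F i \<cdot> x)) sums (P \<cdot> (P \<cdot> x))"
      by (rule bounded_linear.sums[OF blinfun.bounded_linear_right P])
    thus "(\<lambda>i. F i \<cdot> x) sums (P \<cdot> (P \<cdot> x))" by (simp add: PF)
  qed
  ultimately have rp: "rproj P" by (simp add: rproj_def)
  show ?thesis by (rule that[OF rp P PF rproj_le_sym[OF F(1) rp PF]])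
qed

lemma sums_ocomm:
  assumes "\<And>x. (\<lambda>i. T i \<cdot> x) sums (S \<cdot> x)" "\<And>i. ocomm Z (T i)"
  shows "ocomm Z S"
  unfolding ocomm_def
proof
  fix x
  have "(\<lambda>i. Z \<cdot> (T i \<cdot> x)) sums (Z \<cdot> (S \<cdot> x))"
    by (rule bounded_linear.sums[OF blinfun.bounded_linear_right assms(1)])
  hence "(\<lambda>i. T i \<cdot> (Z \<cdot> x)) sums (Z \<cdot> (S \<cdot> x))" by (simp only: ocommD[OF assms(2)])
  thus "Z \<cdot> (S \<cdot> x) = S \<cdot> (Z \<cdot> x)" using assms(1) by (rule sums_unique2)
qed

subsection \<open>The spectral measure of a symmetric operator\<close>

lemma rproj_diff:
  assumes P: "rproj P" and Q: "rproj Q" and PQ: "\<And>x. P \<cdot> (Q \<cdot> x) = Q \<cdot> x"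
  shows "rproj (P - Q)"
proof -
  have "Q \<cdot> (P \<cdot> x) = Q \<cdot> x" for x by (rule rproj_le_sym[OF Q P PQ])
  thus ?thesis using P Q PQ by (simp add: rproj_def op_simps)
qed

lemma ocomm_radj: "sym_op T \<Longrightarrow> ocomm Z T \<Longrightarrow> ocomm (radj Z) T"
  unfolding ocomm_def
proof (intro allI, rule inner_eq_all_imp_eq)
  fix x z assume T: "sym_op T" and Z: "\<forall>x. Z \<cdot> (T \<cdot> x) = T \<cdot> (Z \<cdot> x)"
  show "inner (radj Z \<cdot> (T \<cdot> x)) z = inner (T \<cdot> (radj Z \<cdot> x)) z"
    unfolding radj'[symmetric] sym_opD[OF T] using Z by simp
qed

lemma Pow_UNIV_sub: "G \<subseteq> Pow UNIV" by simp

lemma Int_stable_Ioc: "Int_stable (range (\<lambda>(a, b). {a<..b::real}))"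
  unfolding Int_stable_def
proof safe
  fix a b c d :: real
  have "{a<..b} \<inter> {c<..d} = (\<lambda>(a, b). {a<..b}) (max a c, min b d)" by auto
  thus "{a<..b} \<inter> {c<..d} \<in> range (\<lambda>(a, b). {a<..b})" by blast
qed

definition spec_gt :: "('a::{real_inner,banach} \<Rightarrow>\<^sub>L 'a) \<Rightarrow> real \<Rightarrow> ('a \<Rightarrow>\<^sub>L 'a)" where
  "spec_gt T a = pos_supp (T - a *\<^sub>R id_blinfun)"

context
  fixes T :: "'a::{real_inner,banach} \<Rightarrow>\<^sub>L 'a"
  assumes T: "sym_op T"
begin

lemma spec_gt:
  shows "rproj (spec_gt T a)"
    and "ocomm Z T \<Longrightarrow> ocomm Z (spec_gt T a)"
    and "a * (norm (spec_gt T a \<cdot> x))\<^sup>2 \<le> inner (T \<cdot> (spec_gt T a \<cdot> x)) (spec_gt T a \<cdot> x)"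
    and "inner (T \<cdot> (x - spec_gt T a \<cdot> x)) (x - spec_gt T a \<cdot> x) \<le> a * (norm (x - spec_gt T a \<cdot> x))\<^sup>2"
    and "inner (T \<cdot> (spec_gt T a \<cdot> x)) (spec_gt T a \<cdot> x) = a * (norm (spec_gt T a \<cdot> x))\<^sup>2 \<Longrightarrow> spec_gt T a \<cdot> x = 0"
proof -
  have s: "sym_op (T - a *\<^sub>R id_blinfun)" using T by simp
  have i: "inner ((T - a *\<^sub>R id_blinfun) \<cdot> y) y = inner (T \<cdot> y) y - a * (norm y)\<^sup>2" for y
    by (simp add: blinfun.diff_left blinfun.scaleR_left inner_diff_left power2_norm_eq_inner)
  note ps = pos_supp[OF s]
  show "rproj (spec_gt T a)" unfolding spec_gt_def by (rule ps)
  show "ocomm Z (spec_gt T a)" if "ocomm Z T"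
    unfolding spec_gt_def by (rule ps(2)) (use that ocomm_radj[OF T that] in simp_all)
  show "a * (norm (spec_gt T a \<cdot> x))\<^sup>2 \<le> inner (T \<cdot> (spec_gt T a \<cdot> x)) (spec_gt T a \<cdot> x)"
    using ps(4)[of x] unfolding i spec_gt_def by simp
  show "inner (T \<cdot> (x - spec_gt T a \<cdot> x)) (x - spec_gt T a \<cdot> x) \<le> a * (norm (x - spec_gt T a \<cdot> x))\<^sup>2"
    using ps(5)[of x] unfolding i spec_gt_def by simp
  show "spec_gt T a \<cdot> x = 0" if "inner (T \<cdot> (spec_gt T a \<cdot> x)) (spec_gt T a \<cdot> x) = a * (norm (spec_gt T a \<cdot> x))\<^sup>2"
    using ps(6)[of x] that unfolding i spec_gt_def by simp
qed

text \<open>Among the projections that commute with \<open>T\<close> and on which \<open>T\<close>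
  is strictly above \<open>a\<close>, \<open>spec_gt T a\<close> is the largest: on the part of
  \<open>P\<close> outside it the form is both at least and at most \<open>a\<close>, and strictness
  removes that part. Monotonicity in \<open>a\<close> and uniqueness of the spectral measure rest on
  this.\<close>

lemma spec_gt_absorb:
  assumes P: "rproj P" "ocomm P T" and ge: "\<And>x. a * (norm (P \<cdot> x))\<^sup>2 \<le> inner (T \<cdot> (P \<cdot> x)) (P \<cdot> x)"
    and eq: "\<And>x. inner (T \<cdot> (P \<cdot> x)) (P \<cdot> x) = a * (norm (P \<cdot> x))\<^sup>2 \<Longrightarrow> P \<cdot> x = 0"
  shows "spec_gt T a \<cdot> (P \<cdot> x) = P \<cdot> x"
proof -
  let ?G = "spec_gt T a"
  have c: "P \<cdot> (?G \<cdot> x) = ?G \<cdot> (P \<cdot> x)" for x using spec_gt(2)[OF P(2)] by (rule ocommD)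
  define y where "y = P \<cdot> x - ?G \<cdot> (P \<cdot> x)"
  have y1: "P \<cdot> y = y" using P(1) by (simp add: y_def op_simps c)
  have "inner (T \<cdot> y) y \<le> a * (norm y)\<^sup>2" using spec_gt(4)[of "P \<cdot> x" a] by (simp add: y_def)
  with ge[of y] have "inner (T \<cdot> (P \<cdot> y)) (P \<cdot> y) = a * (norm (P \<cdot> y))\<^sup>2" by (simp add: y1)
  hence "P \<cdot> y = 0" by (rule eq)
  thus ?thesis by (simp add: y1) (simp add: y_def)
qed

lemma spec_gt_mono:
  assumes "a \<le> b"
  shows "spec_gt T a \<cdot> (spec_gt T b \<cdot> x) = spec_gt T b \<cdot> x"
proof (cases "a = b")
  case True thus ?thesis using spec_gt(1) by simp
next
  case False
  with assms have ab: "a < b" by simp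
  show ?thesis
  proof (rule spec_gt_absorb[OF spec_gt(1)])
    show "ocomm (spec_gt T b) T" by (rule ocomm_sym, rule spec_gt(2)) simp
    fix x let ?y = "spec_gt T b \<cdot> x"
    have 1: "b * (norm ?y)\<^sup>2 \<le> inner (T \<cdot> ?y) ?y" by (rule spec_gt(3))
    have 2: "a * (norm ?y)\<^sup>2 \<le> b * (norm ?y)\<^sup>2" using assms by (intro mult_right_mono) simp_all
    show "a * (norm ?y)\<^sup>2 \<le> inner (T \<cdot> ?y) ?y" using 1 2 by simp
    assume "inner (T \<cdot> ?y) ?y = a * (norm ?y)\<^sup>2"
    with 1 have "(b - a) * (norm ?y)\<^sup>2 \<le> 0" by (simp add: left_diff_distrib)
    thus "?y = 0" using ab by (simp add: mult_le_0_iff)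
  qed
qed

lemma spec_gt_low: "a < - norm T \<Longrightarrow> spec_gt T a \<cdot> x = x"
proof -
  assume a: "a < - norm T"
  define y where "y = x - spec_gt T a \<cdot> x"
  have "inner (T \<cdot> y) y \<le> a * (norm y)\<^sup>2" unfolding y_def by (rule spec_gt(4))
  moreover have "- norm T * (norm y)\<^sup>2 \<le> inner (T \<cdot> y) y"
    using inner_le_norm[of "- T" y] by (simp add: blinfun.minus_left)
  ultimately have "(- norm T - a) * (norm y)\<^sup>2 \<le> 0" by (simp add: left_diff_distrib)
  hence "y = 0" using a by (simp add: mult_le_0_iff)
  thus ?thesis by (simp add: y_def)
qed

lemma spec_gt_high: "a \<ge> norm T \<Longrightarrow> spec_gt T a \<cdot> x = 0"
proof (rule spec_gt(5), rule antisym)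
  assume a: "a \<ge> norm T"
  let ?y = "spec_gt T a \<cdot> x"
  have "inner (T \<cdot> ?y) ?y \<le> norm T * (norm ?y)\<^sup>2" by (rule inner_le_norm)
  also have "\<dots> \<le> a * (norm ?y)\<^sup>2" using a by (intro mult_right_mono) simp_all
  finally show "inner (T \<cdot> ?y) ?y \<le> a * (norm ?y)\<^sup>2" .
qed (rule spec_gt(3))

text \<open>The projections increase to some \<open>S\<close> below \<open>spec_gt T a\<close>. In
  the limit the form of \<open>T\<close> off \<open>S\<close> is at most \<open>a\<close>, whereas
  it is strictly above \<open>a\<close> on \<open>spec_gt T a\<close>; so nothing remains between
  the two.\<close>

lemma spec_gt_right_cont: "(\<lambda>n. spec_gt T (a + inverse (real (Suc n))) \<cdot> x) \<longlonglongrightarrow> spec_gt T a \<cdot> x"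
proof -
  let ?e = "\<lambda>n. inverse (real (Suc n))"
  let ?G = "\<lambda>n. spec_gt T (a + ?e n)"
  have m1: "inner (?G n \<cdot> x) x \<le> inner (?G (Suc n) \<cdot> x) x" for n x
    using rproj_le_iff[OF spec_gt(1) spec_gt(1), of "a + ?e n" "a + ?e (Suc n)"]
      spec_gt_mono[of "a + ?e (Suc n)" "a + ?e n"] by (simp add: le_imp_inverse_le)
  have m2: "norm (?G n \<cdot> x) \<le> 1 * norm x" for n x using rproj_norm_le[OF spec_gt(1)] by simp
  obtain S where S: "\<And>x. (\<lambda>n. ?G n \<cdot> x) \<longlonglongrightarrow> S \<cdot> x" "sym_op S"
    by (rule monotone_convergence_op[of ?G 1, OF rproj_sym[OF spec_gt(1)] m1 m2]) (rule that)
  have GG: "spec_gt T a \<cdot> (?G n \<cdot> x) = ?G n \<cdot> x" for n x by (rule spec_gt_mono) simp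
  have GS: "spec_gt T a \<cdot> (S \<cdot> x) = S \<cdot> x" for x
  proof (rule LIMSEQ_unique)
    show "(\<lambda>n. ?G n \<cdot> x) \<longlonglongrightarrow> S \<cdot> x" by (rule S)
    have "(\<lambda>n. spec_gt T a \<cdot> (?G n \<cdot> x)) \<longlonglongrightarrow> spec_gt T a \<cdot> (S \<cdot> x)" by (intro blinfun_tendsto S)
    thus "(\<lambda>n. ?G n \<cdot> x) \<longlonglongrightarrow> spec_gt T a \<cdot> (S \<cdot> x)" by (simp only: GG)
  qed
  have SG: "S \<cdot> (spec_gt T a \<cdot> x) = S \<cdot> x" for x
    by (rule inner_eq_all_imp_eq) (simp add: sym_opD[OF S(2)] sym_opD[OF rproj_sym[OF spec_gt(1)]] GS)
  define y where "y = spec_gt T a \<cdot> x - S \<cdot> x"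
  have yG: "spec_gt T a \<cdot> y = y" using spec_gt(1) by (simp add: y_def op_simps GS)
  have "(\<lambda>n. inner (T \<cdot> (z - ?G n \<cdot> z)) (z - ?G n \<cdot> z)) \<longlonglongrightarrow> inner (T \<cdot> (z - S \<cdot> z)) (z - S \<cdot> z)" for z
    by (intro tendsto_intros blinfun_tendsto S)
  moreover have "(\<lambda>n. (a + ?e n) * (norm (z - ?G n \<cdot> z))\<^sup>2) \<longlonglongrightarrow> (a + 0) * (norm (z - S \<cdot> z))\<^sup>2" for z
    by (intro tendsto_intros S LIMSEQ_inverse_real_of_nat)
  ultimately have le: "inner (T \<cdot> (z - S \<cdot> z)) (z - S \<cdot> z) \<le> a * (norm (z - S \<cdot> z))\<^sup>2" for z
    using spec_gt(4) by (metis (no_types, lifting) LIMSEQ_le add.right_neutral)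
  have "y = spec_gt T a \<cdot> x - S \<cdot> (spec_gt T a \<cdot> x)" by (simp add: y_def SG)
  hence "inner (T \<cdot> y) y \<le> a * (norm y)\<^sup>2" using le[of "spec_gt T a \<cdot> x"] by simp
  moreover have "a * (norm y)\<^sup>2 \<le> inner (T \<cdot> y) y" using spec_gt(3)[of a y] by (simp add: yG)
  ultimately have "y = 0" using spec_gt(5)[of a y] by (simp add: yG)
  thus ?thesis using S(1)[of x] by (simp add: y_def)
qed

text \<open>The sign makes the distribution function increasing, and
  \<open>spec_gt_right_cont\<close> makes it right continuous, as a Stieltjes measure
  requires.\<close>

definition spec_meas :: "'a \<Rightarrow> real measure" where
  "spec_meas x = interval_measure (\<lambda>a. - inner (spec_gt T a \<cdot> x) x)"

lemma spec_meas_Ioc: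
  assumes "a \<le> b"
  shows "emeasure (spec_meas x) {a<..b} = ennreal (inner (spec_gt T a \<cdot> x) x - inner (spec_gt T b \<cdot> x) x)"
proof -
  let ?f = "\<lambda>a. - inner (spec_gt T a \<cdot> x) x"
  have mono: "?f a \<le> ?f b" if "a \<le> b" for a b
    using rproj_le_iff[OF spec_gt(1) spec_gt(1), of b a] spec_gt_mono[OF that] by simp
  have rc: "continuous (at_right a) ?f" for a
    unfolding continuous_within
  proof (rule tendstoI)
    fix e :: real assume e: "0 < e"
    have "(\<lambda>n. ?f (a + inverse (real (Suc n)))) \<longlonglongrightarrow> ?f a"
      by (intro tendsto_intros spec_gt_right_cont)
    then obtain n where n: "dist (?f (a + inverse (real (Suc n)))) (?f a) < e"
      using e by (metis (no_types, lifting) LIMSEQ_def order_refl)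
    have "dist (?f z) (?f a) < e" if z: "a < z" "z < a + inverse (real (Suc n))" for z
      using mono[of a z] mono[of z "a + inverse (real (Suc n))"] n z by (simp add: dist_real_def)
    moreover have "\<forall>\<^sub>F z in at_right a. a < z \<and> z < a + inverse (real (Suc n))"
      by (intro eventually_conj eventually_at_right_less) (simp add: eventually_at_right_field, intro exI[of _ "a + inverse (real (Suc n))"], simp)
    ultimately show "\<forall>\<^sub>F z in at_right a. dist (?f z) (?f a) < e" by (auto elim: eventually_mono)
  qed
  show ?thesis
    unfolding spec_meas_def using emeasure_interval_measure_Ioc[OF assms mono rc] by simp
qed

lemma sets_spec_meas [simp]: "sets (spec_meas x) = sets borel"
  and space_spec_meas [simp]: "space (spec_meas x) = UNIV"
  by (simp_all add: spec_meas_def)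

lemma spec_meas_UNIV: "emeasure (spec_meas x) UNIV = ennreal ((norm x)\<^sup>2)"
proof -
  let ?A = "\<lambda>n. {- real n<..real n}"
  have "range ?A \<subseteq> sets (spec_meas x)" by auto
  moreover have "incseq ?A" by (auto simp: incseq_def)
  ultimately have lim: "(\<lambda>n. emeasure (spec_meas x) (?A n)) \<longlonglongrightarrow> emeasure (spec_meas x) (\<Union>n. ?A n)"
    by (rule Lim_emeasure_incseq)
  have un: "(\<Union>n. ?A n) = UNIV"
  proof -
    have "\<exists>n. y \<in> ?A n" for y
    proof -
      obtain n where "\<bar>y\<bar> < real n" using reals_Archimedean2 by blast
      thus ?thesis by (intro exI[of _ n]) auto
    qed
    thus ?thesis by blast
  qed
  have "\<forall>\<^sub>F n in sequentially. emeasure (spec_meas x) (?A n) = ennreal ((norm x)\<^sup>2)"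
  proof -
    obtain N where N: "norm T < real N" using reals_Archimedean2 by blast
    have "emeasure (spec_meas x) (?A n) = ennreal ((norm x)\<^sup>2)" if "n \<ge> N" for n
    proof -
      have n: "norm T < real n" using N that by simp
      have "emeasure (spec_meas x) (?A n) = ennreal (inner (spec_gt T (- real n) \<cdot> x) x - inner (spec_gt T (real n) \<cdot> x) x)"
        by (rule spec_meas_Ioc) simp
      thus ?thesis using n by (simp add: spec_gt_low spec_gt_high power2_norm_eq_inner)
    qed
    thus ?thesis by (auto simp: eventually_sequentially)
  qed
  hence "(\<lambda>n. emeasure (spec_meas x) (?A n)) \<longlonglongrightarrow> ennreal ((norm x)\<^sup>2)" by (rule tendsto_eventually)
  from LIMSEQ_unique[OF lim this] show ?thesis by (simp add: un)
qed

lemma finite_spec_meas: "finite_measure (spec_meas x)"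
  by (rule finite_measureI) (simp add: spec_meas_UNIV)

text \<open>The sets whose measure is represented by a projection include the intervals (a,b] and
  are closed under complements and countable disjoint unions, hence include all Borel sets.\<close>

lemma spec_proj_exists:
  assumes S: "S \<in> sets borel"
  shows "\<exists>P. rproj P \<and> (\<forall>x. measure (spec_meas x) S = inner (P \<cdot> x) x) \<and> (\<forall>Z. ocomm Z T \<longrightarrow> ocomm Z P)"
proof -
  interpret fm: finite_measure "spec_meas x" for x by (rule finite_spec_meas)
  have tot: "measure (spec_meas x) UNIV = (norm x)\<^sup>2" for x
    using spec_meas_UNIV[of x] by (simp add: measure_def)
  have sb: "sets borel = sigma_sets UNIV (range (\<lambda>(a, b). {a<..b::real}))"
    by (subst borel_sigma_sets_Ioc) (rule sets_measure_of, simp)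
  have "S \<in> sigma_sets UNIV (range (\<lambda>(a, b). {a<..b::real}))" using S sb by simp
  with Int_stable_Ioc Pow_UNIV_sub show ?thesis
  proof (induction rule: sigma_sets_induct_disjoint)
    case (basic A)
    then obtain a b where A: "A = {a<..b}" by auto
    show ?case
    proof (cases "a \<le> b")
      case True
      let ?P = "spec_gt T a - spec_gt T b"
      have P: "rproj ?P" by (rule rproj_diff[OF spec_gt(1) spec_gt(1) spec_gt_mono[OF True]])
      have "0 \<le> inner (?P \<cdot> x) x" for x using rproj_psd[OF P] by (rule psd_ge0)
      hence "measure (spec_meas x) A = inner (?P \<cdot> x) x" for x
        unfolding A measure_def spec_meas_Ioc[OF True] by (simp add: op_simps)
      moreover have "ocomm Z ?P" if "ocomm Z T" for Z using spec_gt(2)[OF that] by simp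
      ultimately show ?thesis using P by blast
    next
      case False
      thus ?thesis by (intro exI[of _ 0]) (simp add: A)
    qed
  next
    case empty
    show ?case by (intro exI[of _ 0]) simp
  next
    case (compl A)
    then obtain P where P: "rproj P" "\<And>x. measure (spec_meas x) A = inner (P \<cdot> x) x"
      "\<And>Z. ocomm Z T \<Longrightarrow> ocomm Z P" by blast
    have "measure (spec_meas x) (UNIV - A) = inner ((id_blinfun - P) \<cdot> x) x" for x
      using fm.finite_measure_compl[of A x] compl(1) sb
      by (simp add: tot P(2) op_simps power2_norm_eq_inner)
    thus ?case using P rproj_compl by (intro exI[of _ "id_blinfun - P"]) simp
  next
    case (union A)
    then obtain P where P: "\<And>i. rproj (P i)" "\<And>i x. measure (spec_meas x) (A i) = inner (P i \<cdot> x) x"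
      "\<And>i Z. ocomm Z T \<Longrightarrow> ocomm Z (P i)" by metis
    have Ab: "A i \<in> sets borel" for i using union(2) sb by auto
    \<comment> \<open>At a vector of the range of \<open>P j\<close> the set \<open>A j\<close>
      already carries the whole mass, so the disjoint set \<open>A i\<close> carries none.\<close>
    have orth: "P i \<cdot> (P j \<cdot> x) = 0" if "i \<noteq> j" for i j x
    proof -
      let ?y = "P j \<cdot> x"
      have "measure (spec_meas ?y) (A i) + measure (spec_meas ?y) (A j) = measure (spec_meas ?y) (A i \<union> A j)"
        using union(1) that Ab by (intro fm.finite_measure_Union[symmetric]) (auto simp: disjoint_family_on_def)
      also have "\<dots> \<le> measure (spec_meas ?y) UNIV" using Ab by (intro fm.finite_measure_mono) auto
      also have "\<dots> = (norm ?y)\<^sup>2" by (rule tot)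
      finally have "(norm (P i \<cdot> ?y))\<^sup>2 \<le> 0" by (simp add: P(2) rproj_inner[OF P(1)] P(1) flip: power2_norm_eq_inner)
      thus ?thesis by simp
    qed
    obtain Q where Q: "rproj Q" "\<And>x. (\<lambda>i. P i \<cdot> x) sums (Q \<cdot> x)"
      by (rule orth_sum_proj[of P]) (use P(1) orth that in blast)+
    have "measure (spec_meas x) (\<Union>i. A i) = inner (Q \<cdot> x) x" for x
    proof (rule sums_unique2)
      show "(\<lambda>i. measure (spec_meas x) (A i)) sums measure (spec_meas x) (\<Union>i. A i)"
        using Ab union(1) by (intro fm.finite_measure_UNION) auto
      show "(\<lambda>i. measure (spec_meas x) (A i)) sums inner (Q \<cdot> x) x"
        unfolding P(2) by (rule bounded_linear.sums[OF bounded_linear_inner_left Q(2)])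
    qed
    moreover have "ocomm Z Q" if "ocomm Z T" for Z by (rule sums_ocomm[OF Q(2) P(3)[OF that]])
    ultimately show ?case using Q(1) by blast
  qed
qed

definition spec :: "real set \<Rightarrow> ('a \<Rightarrow>\<^sub>L 'a)" where
  "spec S = (SOME P. rproj P \<and> (\<forall>x. measure (spec_meas x) S = inner (P \<cdot> x) x) \<and> (\<forall>Z. ocomm Z T \<longrightarrow> ocomm Z P))"

lemma spec:
  assumes "S \<in> sets borel"
  shows "rproj (spec S)" "measure (spec_meas x) S = inner (spec S \<cdot> x) x" "ocomm Z T \<Longrightarrow> ocomm Z (spec S)"
  using someI_ex[OF spec_proj_exists[OF assms]] unfolding spec_def by blast+

lemma spec_eqI:
  assumes "S \<in> sets borel" "sym_op P" "\<And>x. measure (spec_meas x) S = inner (P \<cdot> x) x"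
  shows "spec S = P"
  by (rule sym_op_eqI[OF rproj_sym[OF spec(1)[OF assms(1)]] assms(2)])
    (simp add: assms(3) flip: spec(2)[OF assms(1)])

lemma spec_ocomm: "S \<in> sets borel \<Longrightarrow> T \<cdot> (spec S \<cdot> x) = spec S \<cdot> (T \<cdot> x)"
  by (rule ocommD[OF spec(3)]) simp_all

lemma measure_spec_meas_UNIV: "measure (spec_meas x) UNIV = (norm x)\<^sup>2"
  using spec_meas_UNIV[of x] by (simp add: measure_def)

lemma spec_UNIV: "spec UNIV = id_blinfun"
  by (rule spec_eqI) (simp_all add: measure_spec_meas_UNIV power2_norm_eq_inner)

lemma spec_Un:
  assumes "S \<in> sets borel" "U \<in> sets borel" "S \<inter> U = {}"
  shows "spec (S \<union> U) = spec S + spec U"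
proof (rule spec_eqI)
  interpret fm: finite_measure "spec_meas x" for x by (rule finite_spec_meas)
  fix x
  have "measure (spec_meas x) (S \<union> U) = measure (spec_meas x) S + measure (spec_meas x) U"
    using assms by (intro fm.finite_measure_Union) auto
  thus "measure (spec_meas x) (S \<union> U) = inner ((spec S + spec U) \<cdot> x) x"
    by (simp add: spec(2) assms op_simps)
qed (use assms in \<open>simp_all add: spec(1) rproj_sym\<close>)

text \<open>On the range of \<open>spec U\<close> the form of \<open>spec (S \<union> U)\<close> is
  the form of \<open>spec S\<close> plus the full squared norm, and it cannot exceed the
  latter.\<close>

lemma spec_disjoint:
  assumes "S \<in> sets borel" "U \<in> sets borel" "S \<inter> U = {}"
  shows "spec S \<cdot> (spec U \<cdot> x) = 0"
proof -
  have SU: "S \<union> U \<in> sets borel" using assms by simp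
  let ?y = "spec U \<cdot> x"
  have "spec (S \<union> U) \<cdot> ?y = spec S \<cdot> ?y + ?y"
    using spec(1)[OF assms(2)] by (simp add: spec_Un[OF assms] blinfun.add_left)
  hence "inner (spec (S \<union> U) \<cdot> ?y) ?y = (norm (spec S \<cdot> ?y))\<^sup>2 + (norm ?y)\<^sup>2"
    by (simp add: inner_add_left rproj_inner[OF spec(1)[OF assms(1)]] power2_norm_eq_inner)
  moreover have "inner (spec (S \<union> U) \<cdot> ?y) ?y \<le> (norm ?y)\<^sup>2"
    using rproj_norm_le[OF spec(1)[OF SU], of ?y] by (simp add: rproj_inner[OF spec(1)[OF SU]] power_mono)
  ultimately show ?thesis by simp
qed

lemma spec_empty: "spec {} = 0"
  by (rule spec_eqI) simp_all

lemma spec_Int: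
  assumes "S \<in> sets borel" "U \<in> sets borel"
  shows "spec (S \<inter> U) \<cdot> x = spec S \<cdot> (spec U \<cdot> x)"
proof -
  have m: "S \<inter> U \<in> sets borel" "S - U \<in> sets borel" "U - S \<in> sets borel" using assms by auto
  have "S = (S \<inter> U) \<union> (S - U)" "U = (S \<inter> U) \<union> (U - S)" by auto
  hence "spec S = spec (S \<inter> U) + spec (S - U)" "spec U = spec (S \<inter> U) + spec (U - S)"
    using m by (metis spec_Un Diff_disjoint Diff_Int2 Int_Diff_disjoint Int_commute)+
  moreover have "spec (S \<inter> U) \<cdot> (spec (U - S) \<cdot> x) = 0" "spec (S - U) \<cdot> (spec (S \<inter> U) \<cdot> x) = 0"
    "spec (S - U) \<cdot> (spec (U - S) \<cdot> x) = 0"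
    using m by (auto intro!: spec_disjoint)
  ultimately show ?thesis using spec(1)[OF m(1)] by (simp add: op_simps)
qed

lemma spec_mono:
  assumes "S \<in> sets borel" "U \<in> sets borel" "S \<subseteq> U"
  shows "spec U \<cdot> (spec S \<cdot> x) = spec S \<cdot> x" "spec S \<cdot> (spec U \<cdot> x) = spec S \<cdot> x"
  using spec_Int[OF assms(2,1)] spec_Int[OF assms(1,2)] assms(3) by (simp_all add: Int_absorb1 Int_absorb2)

lemma spec_sums:
  assumes "range F \<subseteq> sets borel" "disjoint_family F"
  shows "(\<lambda>n::nat. spec (F n) \<cdot> x) sums (spec (\<Union>n. F n) \<cdot> x)"
proof -
  interpret fm: finite_measure "spec_meas x" for x by (rule finite_spec_meas)
  have m: "F n \<in> sets borel" for n using assms(1) by auto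
  have orth: "spec (F i) \<cdot> (spec (F j) \<cdot> y) = 0" if "i \<noteq> j" for i j y
    using m assms(2) that by (intro spec_disjoint) (auto simp: disjoint_family_on_def)
  obtain P where P: "rproj P" "\<And>y. (\<lambda>n. spec (F n) \<cdot> y) sums (P \<cdot> y)"
    by (rule orth_sum_proj[of "\<lambda>n. spec (F n)"]) (use spec(1)[OF m] orth that in blast)+
  have "spec (\<Union>n. F n) = P"
  proof (rule spec_eqI)
    fix y
    have "(\<lambda>n. measure (spec_meas y) (F n)) sums measure (spec_meas y) (\<Union>n. F n)"
      using m assms by (intro fm.finite_measure_UNION) auto
    moreover have "(\<lambda>n. measure (spec_meas y) (F n)) sums inner (P \<cdot> y) y"
      unfolding spec(2)[OF m] by (rule bounded_linear.sums[OF bounded_linear_inner_left P(2)])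
    ultimately show "measure (spec_meas y) (\<Union>n. F n) = inner (P \<cdot> y) y" by (rule sums_unique2)
  qed (use m P(1) in \<open>auto simp: rproj_sym\<close>)
  thus ?thesis using P(2) by simp
qed

lemma spec_greaterThan: "spec {a<..} = spec_gt T a"
proof (rule spec_eqI)
  interpret fm: finite_measure "spec_meas x" for x by (rule finite_spec_meas)
  fix x
  define c where "c = max a (norm T)"
  define d where "d = - norm T - 1"
  have dc: "d \<le> c" "d < - norm T" "norm T \<le> c" "a \<le> c"
    using norm_ge_zero[of T] unfolding d_def c_def by linarith+
  have Ioc: "measure (spec_meas x) {a<..b} = inner (spec_gt T a \<cdot> x) x - inner (spec_gt T b \<cdot> x) x" if "a \<le> b" for a b
  proof -
    have "inner (spec_gt T b \<cdot> x) x \<le> inner (spec_gt T a \<cdot> x) x"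
      using rproj_le_iff[OF spec_gt(1) spec_gt(1), of b a] spec_gt_mono[OF that] by simp
    thus ?thesis by (simp add: measure_def spec_meas_Ioc[OF that])
  qed
  have "measure (spec_meas x) ({d<..c} \<union> {c<..}) = measure (spec_meas x) {d<..c} + measure (spec_meas x) {c<..}"
    by (intro fm.finite_measure_Union) auto
  moreover have "measure (spec_meas x) ({d<..c} \<union> {c<..}) \<le> (norm x)\<^sup>2"
    using fm.finite_measure_mono[of "{d<..c} \<union> {c<..}" UNIV x] by (simp add: measure_spec_meas_UNIV)
  moreover have "measure (spec_meas x) {d<..c} = (norm x)\<^sup>2"
    using dc by (simp add: Ioc spec_gt_low spec_gt_high power2_norm_eq_inner)
  ultimately have "measure (spec_meas x) {c<..} = 0"
    using measure_nonneg[of "spec_meas x" "{c<..}"] by linarith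
  moreover have "measure (spec_meas x) ({a<..c} \<union> {c<..}) = measure (spec_meas x) {a<..c} + measure (spec_meas x) {c<..}"
    by (intro fm.finite_measure_Union) auto
  moreover have "{a<..c} \<union> {c<..} = {a<..}" using dc by auto
  ultimately show "measure (spec_meas x) {a<..} = inner (spec_gt T a \<cdot> x) x"
    using dc by (simp add: Ioc spec_gt_high)
qed (simp_all add: spec_gt(1) rproj_sym)

text \<open>The closed half-line is reached through the open half-lines of slightly lower
  level.\<close>

lemma spec_ge:
  assumes S: "S \<in> sets borel" "S \<subseteq> {a..}"
  shows "a * (norm (spec S \<cdot> x))\<^sup>2 \<le> inner (T \<cdot> (spec S \<cdot> x)) (spec S \<cdot> x)"
proof (rule LIMSEQ_le_const2)
  let ?y = "spec S \<cdot> x"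
  have "(\<lambda>n. (a - inverse (real (Suc n))) * (norm ?y)\<^sup>2) \<longlonglongrightarrow> (a - 0) * (norm ?y)\<^sup>2"
    by (intro tendsto_intros LIMSEQ_inverse_real_of_nat)
  thus "(\<lambda>n. (a - inverse (real (Suc n))) * (norm ?y)\<^sup>2) \<longlonglongrightarrow> a * (norm ?y)\<^sup>2" by simp
  have "(a - inverse (real (Suc n))) * (norm ?y)\<^sup>2 \<le> inner (T \<cdot> ?y) ?y" for n
  proof -
    let ?b = "a - inverse (real (Suc n))"
    have "S \<subseteq> {?b<..}" using S(2) by (force intro: less_le_trans[of _ a])
    hence "spec {?b<..} \<cdot> ?y = ?y" using S by (intro spec_mono) auto
    thus ?thesis using spec_gt(3)[of ?b ?y] by (simp add: spec_greaterThan)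
  qed
  thus "\<exists>N. \<forall>n\<ge>N. (a - inverse (real (Suc n))) * (norm ?y)\<^sup>2 \<le> inner (T \<cdot> ?y) ?y" by blast
qed

lemma spec_le:
  assumes S: "S \<in> sets borel" "S \<subseteq> {..a}"
  shows "inner (T \<cdot> (spec S \<cdot> x)) (spec S \<cdot> x) \<le> a * (norm (spec S \<cdot> x))\<^sup>2"
proof -
  let ?y = "spec S \<cdot> x"
  have "spec {a<..} \<cdot> ?y = 0" using S by (intro spec_disjoint) auto
  thus ?thesis using spec_gt(4)[of ?y a] by (simp add: spec_greaterThan)
qed

text \<open>The defect \<open>D\<close> between the form of \<open>T\<close> and the integral is
  additive over disjoint sets, and on (a,b] it is at most b - a times the measure. Cutting a bounded
  interval of full measure into \<open>n + 1\<close> equal parts leaves a total defect of order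
  \<open>1 / (n + 1)\<close>.\<close>

lemma spec_integral:
  shows "integrable (spec_meas x) (\<lambda>t. t)" and "inner (T \<cdot> x) x = (LINT t|spec_meas x. t)"
proof -
  interpret fm: finite_measure "spec_meas x" by (rule finite_spec_meas)
  \<comment> \<open>The left end lies strictly below \<open>- norm T\<close> because the intervals
    are open on the left and \<open>spec_gt_low\<close> asks for a strict inequality.\<close>
  have full: "spec {- norm T - 1<..norm T} = id_blinfun"
  proof -
    let ?a = "- norm T - 1" and ?b = "norm T"
    have "spec {?a<..} = spec ({?a<..?b} \<union> {?b<..})"
      by (rule arg_cong[where f = spec], auto) (use norm_ge_zero[of T] in linarith)
    also have "\<dots> = spec {?a<..?b} + spec {?b<..}" by (rule spec_Un) auto
    finally have "spec {?a<..} \<cdot> y = spec {?a<..?b} \<cdot> y + spec {?b<..} \<cdot> y" for y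
      by (simp add: blinfun.add_left)
    thus ?thesis by (intro blinfun_eqI) (simp add: spec_greaterThan spec_gt_low spec_gt_high)
  qed
  hence measure_full: "measure (spec_meas x) {- norm T - 1<..norm T} = (norm x)\<^sup>2"
    by (simp add: spec(2) power2_norm_eq_inner)
  from measure_full have "measure (spec_meas x) (UNIV - {- norm T - 1<..norm T}) = 0"
    using fm.finite_measure_compl[of "{- norm T - 1<..norm T}"] by (simp add: measure_spec_meas_UNIV)
  hence AE: "AE t in spec_meas x. t \<in> {- norm T - 1<..norm T}"
    by (intro AE_I[where N = "UNIV - {- norm T - 1<..norm T}"]) (auto simp: fm.emeasure_eq_measure)
  show int: "integrable (spec_meas x) (\<lambda>t. t)"
  proof (rule fm.integrable_const_bound[where B = "norm T + 1"])
    show "AE t in spec_meas x. norm t \<le> norm T + 1" using AE by (rule eventually_mono) auto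
    show "(\<lambda>t. t) \<in> borel_measurable (spec_meas x)" by (rule measurable_ident_sets) simp
  qed
  define D where "D S = inner (T \<cdot> (spec S \<cdot> x)) (spec S \<cdot> x) - (LINT t:S|spec_meas x. t)" for S
  have sint: "set_integrable (spec_meas x) S (\<lambda>t. t)" if "S \<in> sets borel" for S
    unfolding set_integrable_def using int that by (intro integrable_mult_indicator) auto
  have D_add: "D (S \<union> U) = D S + D U" if m: "S \<in> sets borel" "U \<in> sets borel" "S \<inter> U = {}" for S U
  proof -
    have "inner (T \<cdot> (spec S \<cdot> x)) (spec U \<cdot> x) = 0" if "S \<in> sets borel" "U \<in> sets borel" "S \<inter> U = {}" for S U
      by (simp add: spec_ocomm that sym_opD[OF rproj_sym[OF spec(1)]] spec_disjoint)
    from this[OF m] this[of U S] m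
    have "inner (T \<cdot> (spec S \<cdot> x)) (spec U \<cdot> x) = 0" "inner (T \<cdot> (spec U \<cdot> x)) (spec S \<cdot> x) = 0" by auto
    moreover have "(LINT t:S \<union> U|spec_meas x. t) = (LINT t:S|spec_meas x. t) + (LINT t:U|spec_meas x. t)"
      using m by (intro set_integral_Un sint) auto
    ultimately show ?thesis by (simp add: D_def spec_Un[OF m] op_simps)
  qed
  have D_le: "\<bar>D {a<..b}\<bar> \<le> (b - a) * measure (spec_meas x) {a<..b}" for a b
  proof -
    let ?S = "{a<..b}"
    have m: "measure (spec_meas x) ?S = (norm (spec ?S \<cdot> x))\<^sup>2" by (simp add: spec(2) rproj_inner spec(1))
    have c: "(LINT t:?S|spec_meas x. c) = c * measure (spec_meas x) ?S" for c :: real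
      unfolding set_lebesgue_integral_def by simp
    have ci: "set_integrable (spec_meas x) ?S (\<lambda>t. c)" for c :: real
      unfolding set_integrable_def by (intro integrable_mult_indicator) auto
    have "(LINT t:?S|spec_meas x. a) \<le> (LINT t:?S|spec_meas x. t)"
      by (intro set_integral_mono sint ci) auto
    moreover have "(LINT t:?S|spec_meas x. t) \<le> (LINT t:?S|spec_meas x. b)"
      by (intro set_integral_mono sint ci) auto
    moreover have "a * (norm (spec ?S \<cdot> x))\<^sup>2 \<le> inner (T \<cdot> (spec ?S \<cdot> x)) (spec ?S \<cdot> x)"
      by (rule spec_ge) auto
    moreover have "inner (T \<cdot> (spec ?S \<cdot> x)) (spec ?S \<cdot> x) \<le> b * (norm (spec ?S \<cdot> x))\<^sup>2"
      by (rule spec_le) auto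
    ultimately show ?thesis unfolding c D_def m left_diff_distrib by linarith
  qed
  let ?c = "- norm T - 1"
  have D_ind: "\<bar>D {?c<..?c + real k * h}\<bar> \<le> h * measure (spec_meas x) {?c<..?c + real k * h}" if h: "0 < h" for h k
  proof (induction k)
    case 0 show ?case by (simp add: D_def spec_empty set_lebesgue_integral_def)
  next
    case (Suc k)
    let ?S = "{?c<..?c + real k * h}" and ?U = "{?c + real k * h<..?c + real (Suc k) * h}"
    have "?c + real k * h \<le> ?c + real (Suc k) * h" using h by (simp add: algebra_simps)
    moreover have "?c \<le> ?c + real k * h" using h by simp
    ultimately have e: "{?c<..?c + real (Suc k) * h} = ?S \<union> ?U" by (auto simp del: of_nat_Suc)
    have d: "?S \<inter> ?U = {}" by auto
    have "measure (spec_meas x) (?S \<union> ?U) = measure (spec_meas x) ?S + measure (spec_meas x) ?U"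
      using d by (intro fm.finite_measure_Union) auto
    moreover have "\<bar>D ?U\<bar> \<le> h * measure (spec_meas x) ?U"
      using D_le[of "?c + real k * h" "?c + real (Suc k) * h"] by (simp add: algebra_simps)
    moreover have "D (?S \<union> ?U) = D ?S + D ?U" by (rule D_add) (use d in auto)
    ultimately show ?case unfolding e using Suc by (simp add: distrib_left del: of_nat_Suc)
  qed
  define C where "C = (2 * norm T + 1) * (norm x)\<^sup>2"
  have le: "\<bar>D {?c<..norm T}\<bar> \<le> C / real (Suc n)" for n
  proof -
    define h where "h = (2 * norm T + 1) / real (Suc n)"
    have h: "0 < h" using norm_ge_zero[of T] unfolding h_def by (intro divide_pos_pos) linarith+
    have e: "?c + real (Suc n) * h = norm T" by (simp add: h_def del: of_nat_Suc)
    have "\<bar>D {?c<..norm T}\<bar> \<le> h * measure (spec_meas x) {?c<..norm T}"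
      using D_ind[OF h, of "Suc n"] unfolding e .
    thus ?thesis by (simp add: measure_full C_def h_def)
  qed
  have lim0: "(\<lambda>n. C / real (Suc n)) \<longlonglongrightarrow> 0"
    using tendsto_mult[OF tendsto_const[of C] LIMSEQ_inverse_real_of_nat] by (simp add: divide_inverse)
  have "\<bar>D {?c<..norm T}\<bar> \<le> 0" by (rule LIMSEQ_le_const[OF lim0]) (use le in blast)
  hence "D {?c<..norm T} = 0" by simp
  moreover have "(LINT t:{?c<..norm T}|spec_meas x. t) = (LINT t|spec_meas x. t)"
    unfolding set_lebesgue_integral_def
  proof (rule integral_cong_AE)
    have id: "(\<lambda>t. t) \<in> borel_measurable (spec_meas x)" by (rule measurable_ident_sets) simp
    show "(\<lambda>t. t) \<in> borel_measurable (spec_meas x)" by (rule id)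
    show "(\<lambda>t. indicat_real {?c<..norm T} t *\<^sub>R t) \<in> borel_measurable (spec_meas x)"
      by (intro borel_measurable_scaleR borel_measurable_indicator id) simp
    show "AE t in spec_meas x. indicat_real {?c<..norm T} t *\<^sub>R t = t"
      using AE by (rule eventually_mono) simp
  qed
  ultimately show "inner (T \<cdot> x) x = (LINT t|spec_meas x. t)" by (simp add: D_def full)
qed

end

section \<open>Comparison of projections in a factor\<close>

subsection \<open>Partial isometries\<close>

lemma partial_isometry:
  fixes V :: "'a::{real_inner,banach} \<Rightarrow>\<^sub>L 'a"
  assumes e: "rproj e" "\<And>x. radj V \<cdot> (V \<cdot> x) = e \<cdot> x"
  shows "V \<cdot> (e \<cdot> x) = V \<cdot> x" "e \<cdot> (radj V \<cdot> x) = radj V \<cdot> x" "rproj (V o\<^sub>L radj V)"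
    "(norm (V \<cdot> x))\<^sup>2 = (norm (e \<cdot> x))\<^sup>2" "norm (V \<cdot> x) \<le> norm x"
proof -
  have n: "(norm (V \<cdot> x))\<^sup>2 = (norm (e \<cdot> x))\<^sup>2" for x
  proof -
    have "(norm (V \<cdot> x))\<^sup>2 = inner (radj V \<cdot> (V \<cdot> x)) x" by (simp add: power2_norm_eq_inner flip: radj')
    thus ?thesis by (simp only: e(2) rproj_inner[OF e(1)])
  qed
  thus "(norm (V \<cdot> x))\<^sup>2 = (norm (e \<cdot> x))\<^sup>2" .
  hence "norm (V \<cdot> x) = norm (e \<cdot> x)" by simp
  thus "norm (V \<cdot> x) \<le> norm x" using rproj_norm_le[OF e(1)] by simp
  have Ve: "V \<cdot> (e \<cdot> x) = V \<cdot> x" for x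
  proof -
    have "(norm (V \<cdot> (x - e \<cdot> x)))\<^sup>2 = 0" unfolding n using e(1) by (simp add: blinfun.diff_right)
    thus ?thesis by (simp add: blinfun.diff_right)
  qed
  thus "V \<cdot> (e \<cdot> x) = V \<cdot> x" .
  show eV: "e \<cdot> (radj V \<cdot> x) = radj V \<cdot> x" for x
    by (rule inner_eq_all_imp_eq) (simp add: sym_opD[OF rproj_sym[OF e(1)]] Ve flip: radj')
  have "sym_op (V o\<^sub>L radj V)" by (simp add: sym_op_radj)
  thus "rproj (V o\<^sub>L radj V)" by (simp add: rproj_def e(2) eV)
qed

lemma partial_isometry_radj:
  fixes V :: "'a::{real_inner,banach} \<Rightarrow>\<^sub>L 'a"
  assumes "rproj (radj V o\<^sub>L V)"
  shows "V \<cdot> (radj V \<cdot> (V \<cdot> x)) = V \<cdot> x" "radj V \<cdot> (V \<cdot> (radj V \<cdot> x)) = radj V \<cdot> x" "rproj (V o\<^sub>L radj V)"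
    "norm (V \<cdot> x) \<le> norm x" "norm (radj V \<cdot> x) \<le> norm x"
proof -
  note p = partial_isometry[where e = "radj V o\<^sub>L V" and V = V, OF assms blinfun_apply_blinfun_compose[symmetric]]
  show 1: "V \<cdot> (radj V \<cdot> (V \<cdot> x)) = V \<cdot> x" "radj V \<cdot> (V \<cdot> (radj V \<cdot> x)) = radj V \<cdot> x" "rproj (V o\<^sub>L radj V)"
    "norm (V \<cdot> x) \<le> norm x" for x
    using p(1)[of x] p(2)[of x] p(3) p(5)[of x] by simp_all
  show "norm (radj V \<cdot> x) \<le> norm x"
    using contraction_radj[of V 1 x] 1(4) by simp
qed

lemma orth_of_ranges:
  assumes "\<And>x. radj V \<cdot> (W \<cdot> x) = 0"
  shows "radj W \<cdot> (V \<cdot> x) = 0"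
  by (rule inner_eq_all_imp_eq) (simp add: assms radj flip: radj')

lemma partial_isometry_sum:
  fixes V :: "nat \<Rightarrow> 'a::{real_inner,banach} \<Rightarrow>\<^sub>L 'a"
  assumes p: "\<And>k. rproj (radj (V k) o\<^sub>L V k)"
    and o: "\<And>i j x. i \<noteq> j \<Longrightarrow> radj (V i) \<cdot> (V j \<cdot> x) = 0"
    and o': "\<And>i j x. i \<noteq> j \<Longrightarrow> V i \<cdot> (radj (V j) \<cdot> x) = 0"
  obtains S where "\<And>x. (\<lambda>k. V k \<cdot> x) sums (S \<cdot> x)" "\<And>x. (\<lambda>k. radj (V k) \<cdot> x) sums (radj S \<cdot> x)"
    "\<And>x. (\<lambda>k. radj (V k) \<cdot> (V k \<cdot> x)) sums (radj S \<cdot> (S \<cdot> x))"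
    "\<And>x. (\<lambda>k. V k \<cdot> (radj (V k) \<cdot> x)) sums (S \<cdot> (radj S \<cdot> x))"
proof -
  note pi = partial_isometry_radj[OF p]
  obtain S where S: "\<And>x. (\<lambda>k. V k \<cdot> x) sums (S \<cdot> x)"
  proof (rule orth_sum_op[of "\<lambda>k. radj (V k) o\<^sub>L V k" V])
    show "inner (V i \<cdot> x) (V j \<cdot> y) = 0" if "i \<noteq> j" for i j x y by (simp add: radj[of "V i"] o[OF that])
  qed (use p o' pi that in \<open>auto simp: blinfun.zero_right\<close>)
  obtain R where R: "\<And>x. (\<lambda>k. radj (V k) \<cdot> x) sums (R \<cdot> x)"
  proof (rule orth_sum_op[of "\<lambda>k. V k o\<^sub>L radj (V k)" "\<lambda>k. radj (V k)"])
    show "inner (radj (V i) \<cdot> x) (radj (V j) \<cdot> y) = 0" if "i \<noteq> j" for i j x y by (simp add: o'[OF that[symmetric]] flip: radj)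
  qed (use p o pi that in \<open>auto simp: blinfun.zero_right\<close>)
  have RS: "radj S = R"
  proof (rule radj_eqI)
    fix x y
    have "(\<lambda>k. inner (V k \<cdot> x) y) sums inner (S \<cdot> x) y"
      by (rule bounded_linear.sums[OF bounded_linear_inner_left S])
    moreover have "(\<lambda>k. inner x (radj (V k) \<cdot> y)) sums inner x (R \<cdot> y)"
      by (rule bounded_linear.sums[OF bounded_linear_inner_right R])
    ultimately show "inner (S \<cdot> x) y = inner x (R \<cdot> y)" unfolding radj by (rule sums_unique2)
  qed
  have single: "(\<lambda>k. if k = i then z else 0) sums z" for i :: nat and z :: 'a
    using sums_single[of i "\<lambda>_. z"] by simp
  have VS: "radj (V i) \<cdot> (S \<cdot> x) = radj (V i) \<cdot> (V i \<cdot> x)" for i x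
  proof (rule sums_unique2)
    show "(\<lambda>k. radj (V i) \<cdot> (V k \<cdot> x)) sums (radj (V i) \<cdot> (S \<cdot> x))"
      by (rule bounded_linear.sums[OF blinfun.bounded_linear_right S])
    have "(\<lambda>k. radj (V i) \<cdot> (V k \<cdot> x)) = (\<lambda>k. if k = i then radj (V i) \<cdot> (V i \<cdot> x) else 0)"
      by (auto simp: o)
    thus "(\<lambda>k. radj (V i) \<cdot> (V k \<cdot> x)) sums (radj (V i) \<cdot> (V i \<cdot> x))" by (simp add: single)
  qed
  have VR: "V i \<cdot> (R \<cdot> x) = V i \<cdot> (radj (V i) \<cdot> x)" for i x
  proof (rule sums_unique2)
    show "(\<lambda>k. V i \<cdot> (radj (V k) \<cdot> x)) sums (V i \<cdot> (R \<cdot> x))"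
      by (rule bounded_linear.sums[OF blinfun.bounded_linear_right R])
    have "(\<lambda>k. V i \<cdot> (radj (V k) \<cdot> x)) = (\<lambda>k. if k = i then V i \<cdot> (radj (V i) \<cdot> x) else 0)"
      by (auto simp: o')
    thus "(\<lambda>k. V i \<cdot> (radj (V k) \<cdot> x)) sums (V i \<cdot> (radj (V i) \<cdot> x))" by (simp add: single)
  qed
  show ?thesis
  proof (rule that[of S])
    show "(\<lambda>k. V k \<cdot> x) sums (S \<cdot> x)" "(\<lambda>k. radj (V k) \<cdot> x) sums (radj S \<cdot> x)" for x
      using S R RS by simp_all
    show "(\<lambda>k. radj (V k) \<cdot> (V k \<cdot> x)) sums (radj S \<cdot> (S \<cdot> x))" for x
      using R[of "S \<cdot> x"] by (simp add: RS VS)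
    show "(\<lambda>k. V k \<cdot> (radj (V k) \<cdot> x)) sums (S \<cdot> (radj S \<cdot> x))" for x
      using S[of "R \<cdot> x"] by (simp add: RS VR)
  qed
qed

subsection \<open>Bicommutants\<close>

definition rcomm :: "('a::real_normed_vector \<Rightarrow>\<^sub>L 'a) set \<Rightarrow> ('a \<Rightarrow>\<^sub>L 'a) set" where
  "rcomm N = {Z. \<forall>T\<in>N. ocomm Z T}"

text \<open>Membership is tested by commutation with the commutant. The square roots, inverses and
  spectral projections above were built together with their commutation properties for this
  purpose.\<close>

locale real_vna =
  fixes M :: "('a::{real_inner,banach} \<Rightarrow>\<^sub>L 'a) set"
  assumes bicommutant: "rcomm (rcomm M) = M"
    and radj_closed: "T \<in> M \<Longrightarrow> radj T \<in> M"
begin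

lemma mem_iff: "T \<in> M \<longleftrightarrow> (\<forall>Z\<in>rcomm M. ocomm Z T)"
proof -
  have "T \<in> M \<longleftrightarrow> T \<in> rcomm (rcomm M)" by (simp add: bicommutant)
  thus ?thesis by (auto simp: rcomm_def[of "rcomm M"] intro: ocomm_sym)
qed

lemma mem_ocomm: "T \<in> M \<Longrightarrow> Z \<in> rcomm M \<Longrightarrow> ocomm Z T"
  by (simp add: mem_iff)

lemma memI: "(\<And>Z. Z \<in> rcomm M \<Longrightarrow> ocomm Z T) \<Longrightarrow> T \<in> M"
  by (simp add: mem_iff)

lemma closure_simps [simp, intro]:
  "id_blinfun \<in> M" "0 \<in> M" "S \<in> M \<Longrightarrow> T \<in> M \<Longrightarrow> S + T \<in> M" "S \<in> M \<Longrightarrow> T \<in> M \<Longrightarrow> S - T \<in> M"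
  "S \<in> M \<Longrightarrow> T \<in> M \<Longrightarrow> S o\<^sub>L T \<in> M" "T \<in> M \<Longrightarrow> r *\<^sub>R T \<in> M" "T \<in> M \<Longrightarrow> radj T \<in> M"
  by (simp_all add: mem_iff) (use radj_closed in \<open>simp add: mem_iff\<close>)

lemma limit_closed: "(\<And>n. T n \<in> M) \<Longrightarrow> (\<And>x. (\<lambda>n. T n \<cdot> x) \<longlonglongrightarrow> S \<cdot> x) \<Longrightarrow> S \<in> M"
  by (rule memI, rule ocomm_limit[of T]) (auto simp: mem_ocomm)

lemma sums_closed: "(\<And>n. T n \<in> M) \<Longrightarrow> (\<And>x. (\<lambda>n. T n \<cdot> x) sums (S \<cdot> x)) \<Longrightarrow> S \<in> M"
  by (rule memI, rule sums_ocomm[of T]) (auto simp: mem_ocomm)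

lemma spec_closed: "T \<in> M \<Longrightarrow> sym_op T \<Longrightarrow> S \<in> sets borel \<Longrightarrow> spec T S \<in> M"
  by (rule memI) (simp add: spec(3) mem_ocomm)

lemma spec_gt_closed: "T \<in> M \<Longrightarrow> sym_op T \<Longrightarrow> spec_gt T a \<in> M"
  by (rule memI) (simp add: spec_gt(2) mem_ocomm)

lemma osqrt_closed: "T \<in> M \<Longrightarrow> psd T \<Longrightarrow> osqrt T \<in> M"
  by (rule memI) (simp add: osqrt(4) mem_ocomm)

lemma rcomm_radj: "Z \<in> rcomm M \<Longrightarrow> radj Z \<in> rcomm M"
proof -
  assume Z: "Z \<in> rcomm M"
  have "radj Z \<cdot> (T \<cdot> x) = T \<cdot> (radj Z \<cdot> x)" if T: "T \<in> M" for T x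
  proof (rule inner_eq_all_imp_eq)
    fix z
    have "Z \<cdot> (radj T \<cdot> z) = radj T \<cdot> (Z \<cdot> z)" by (rule ocommD[OF mem_ocomm[OF radj_closed[OF T] Z]])
    thus "inner (radj Z \<cdot> (T \<cdot> x)) z = inner (T \<cdot> (radj Z \<cdot> x)) z"
      unfolding radj'[symmetric] radj by simp
  qed
  thus ?thesis by (simp add: rcomm_def ocomm_def)
qed

definition mproj :: "('a \<Rightarrow>\<^sub>L 'a) \<Rightarrow> bool" where
  "mproj e \<longleftrightarrow> e \<in> M \<and> rproj e"

text \<open>For a projection \<open>e\<close> this makes \<open>V\<close> a partial isometry in
  \<open>M\<close> with initial projection \<open>e\<close> and final projection
  \<open>V o\<^sub>L radj V\<close> below \<open>f\<close>, see \<open>emb_final\<close>. Hence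
  \<open>subeq\<close> is Murray-von Neumann subequivalence.\<close>

definition emb :: "('a \<Rightarrow>\<^sub>L 'a) \<Rightarrow> ('a \<Rightarrow>\<^sub>L 'a) \<Rightarrow> ('a \<Rightarrow>\<^sub>L 'a) \<Rightarrow> bool" where
  "emb V e f \<longleftrightarrow> V \<in> M \<and> (\<forall>x. radj V \<cdot> (V \<cdot> x) = e \<cdot> x) \<and> (\<forall>x. f \<cdot> (V \<cdot> x) = V \<cdot> x)"

definition subeq :: "('a \<Rightarrow>\<^sub>L 'a) \<Rightarrow> ('a \<Rightarrow>\<^sub>L 'a) \<Rightarrow> bool" where
  "subeq e f \<longleftrightarrow> (\<exists>V. emb V e f)"

lemma mprojD [dest]: "mproj e \<Longrightarrow> e \<in> M" "mproj e \<Longrightarrow> rproj e"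
  by (simp_all add: mproj_def)

lemma mproj_simps [simp]: "mproj id_blinfun" "mproj 0" "mproj e \<Longrightarrow> mproj (id_blinfun - e)"
  by (simp_all add: mproj_def rproj_compl)

lemma mproj_diff: "mproj e \<Longrightarrow> mproj f \<Longrightarrow> (\<And>x. e \<cdot> (f \<cdot> x) = f \<cdot> x) \<Longrightarrow> mproj (e - f)"
  by (auto simp: mproj_def intro: rproj_diff)

lemma mproj_spec: "T \<in> M \<Longrightarrow> sym_op T \<Longrightarrow> S \<in> sets borel \<Longrightarrow> mproj (spec T S)"
  by (simp add: mproj_def spec_closed spec(1))

lemma mproj_sums:
  assumes "\<And>i. mproj (F i)" "\<And>i j x. i \<noteq> j \<Longrightarrow> F i \<cdot> (F j \<cdot> x) = 0"
  obtains P where "mproj P" "\<And>x. (\<lambda>i. F i \<cdot> x) sums (P \<cdot> x)" "\<And>i x. P \<cdot> (F i \<cdot> x) = F i \<cdot> x"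
    "\<And>i x. F i \<cdot> (P \<cdot> x) = F i \<cdot> x"
proof (rule orth_sum_proj[of F])
  fix P assume P: "rproj P" "\<And>x. (\<lambda>i. F i \<cdot> x) sums (P \<cdot> x)" "\<And>i x. P \<cdot> (F i \<cdot> x) = F i \<cdot> x"
    "\<And>i x. F i \<cdot> (P \<cdot> x) = F i \<cdot> x"
  have "P \<in> M" by (rule sums_closed[of F P]) (use assms P(2) in auto)
  with P(1) have "mproj P" by (simp add: mproj_def)
  from that[OF this P(2-4)] show thesis .
qed (use assms in auto)

lemma embD: "emb V e f \<Longrightarrow> V \<in> M" "emb V e f \<Longrightarrow> radj V \<cdot> (V \<cdot> x) = e \<cdot> x" "emb V e f \<Longrightarrow> f \<cdot> (V \<cdot> x) = V \<cdot> x"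
  by (simp_all add: emb_def)

lemma emb_range: "emb V e f \<Longrightarrow> rproj f \<Longrightarrow> radj V \<cdot> (f \<cdot> x) = radj V \<cdot> x"
  by (rule inner_eq_all_imp_eq) (simp add: embD(3) sym_opD[OF rproj_sym] flip: radj')

lemma emb_final:
  assumes "emb V e f" "mproj e"
  shows "mproj (V o\<^sub>L radj V)" "f \<cdot> (V \<cdot> (radj V \<cdot> x)) = V \<cdot> (radj V \<cdot> x)"
proof -
  have "rproj (V o\<^sub>L radj V)" by (rule partial_isometry(3)[of e]) (use assms embD in auto)
  thus "mproj (V o\<^sub>L radj V)" using embD(1)[OF assms(1)] by (simp add: mproj_def)
qed (rule embD(3)[OF assms(1)])

lemma emb_trans: "emb V e f \<Longrightarrow> emb W f g \<Longrightarrow> emb (W o\<^sub>L V) e g"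
  by (auto simp: emb_def)

lemma subeq_trans: "subeq e f \<Longrightarrow> subeq f g \<Longrightarrow> subeq e g"
  unfolding subeq_def using emb_trans by blast

lemma emb_self: "mproj e \<Longrightarrow> (\<And>x. f \<cdot> (e \<cdot> x) = e \<cdot> x) \<Longrightarrow> emb e e f"
  by (auto simp: emb_def rproj_radj)

lemma subeq_sub: "mproj e \<Longrightarrow> (\<And>x. f \<cdot> (e \<cdot> x) = e \<cdot> x) \<Longrightarrow> subeq e f"
  unfolding subeq_def using emb_self by blast

end

lemma maximal_pairwise_subset:
  obtains F where "F \<subseteq> X" "pairwise R F" "\<And>x. x \<in> X \<Longrightarrow> (\<And>y. y \<in> F \<Longrightarrow> R x y \<and> R y x) \<Longrightarrow> x \<in> F"
proof -
  define \<A> where "\<A> = {F. F \<subseteq> X \<and> pairwise R F}"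
  have "\<exists>F\<in>\<A>. \<forall>G\<in>\<A>. F \<subseteq> G \<longrightarrow> G = F"
  proof (rule subset_Zorn')
    fix C assume C: "subset.chain \<A> C"
    hence "F \<subseteq> X" "pairwise R F" if "F \<in> C" for F using that by (auto simp: \<A>_def subset.chain_def)
    moreover have "chain\<^sub>\<subseteq> C" using C by (auto simp: subset.chain_def chain_subset_def)
    ultimately show "\<Union>C \<in> \<A>" unfolding \<A>_def using pairwise_chain_Union[of C R] by blast
  qed
  then obtain F where FA: "F \<in> \<A>" and m: "\<forall>G\<in>\<A>. F \<subseteq> G \<longrightarrow> G = F" by (rule bexE)
  have F: "F \<subseteq> X" "pairwise R F" using FA by (simp_all add: \<A>_def)
  have max: "G = F" if "G \<subseteq> X" "pairwise R G" "F \<subseteq> G" for G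
    using m that by (simp add: \<A>_def)
  have "x \<in> F" if "x \<in> X" "\<And>y. y \<in> F \<Longrightarrow> R x y \<and> R y x" for x
  proof -
    have "pairwise R (insert x F)" using F(2) that(2) by (simp add: pairwise_insert)
    hence "insert x F = F" using F(1) that(1) by (intro max) auto
    thus ?thesis by blast
  qed
  with F show ?thesis by (rule that)
qed

text \<open>Padding with 0 lets a finite or empty family be indexed by all natural numbers; 0 counts
  as a partial isometry and adds nothing to an orthogonal sum.\<close>

lemma countable_sequence:
  fixes F :: "'b::zero set"
  assumes "countable F"
  obtains v :: "nat \<Rightarrow> 'b" where "\<And>k. v k \<in> F \<or> v k = 0" "F \<subseteq> range v"
    "\<And>i j. i \<noteq> j \<Longrightarrow> v i \<in> F \<Longrightarrow> v j \<in> F \<Longrightarrow> 0 \<notin> F \<Longrightarrow> v i \<noteq> v j"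
proof -
  define v where "v k = (if k \<in> to_nat_on F ` F then from_nat_into F k else 0)" for k
  have v: "v (to_nat_on F x) = x" if "x \<in> F" for x using that assms by (simp add: v_def)
  show ?thesis
  proof (rule that[of v])
    show "v k \<in> F \<or> v k = 0" for k using assms by (auto simp: v_def)
    show "F \<subseteq> range v" using v by (metis rangeI subsetI)
    show "v i \<noteq> v j" if "i \<noteq> j" "v i \<in> F" "v j \<in> F" "0 \<notin> F" for i j
    proof -
      have "i \<in> to_nat_on F ` F" "j \<in> to_nat_on F ` F" using that by (metis v_def)+
      thus ?thesis using v that(1) by auto
    qed
  qed
qed

section \<open>Linking, comparison and absorption of projections in a sigma-finite infinite
  factor\<close>

locale real_factor = real_vna M for M :: "('a::{real_inner,banach} \<Rightarrow>\<^sub>L 'a) set" +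
  assumes center: "rproj Z \<Longrightarrow> Z \<in> M \<Longrightarrow> Z \<in> rcomm M \<Longrightarrow> Z = 0 \<or> Z = id_blinfun"
    and sigma_finite: "F \<subseteq> {P\<in>M. rproj P \<and> P \<noteq> 0} \<Longrightarrow> pairwise (\<lambda>P Q. \<forall>x. P \<cdot> (Q \<cdot> x) = 0) F \<Longrightarrow> countable F"
    and nonunitary_isometry: "\<exists>S\<in>M. (\<forall>x. radj S \<cdot> (S \<cdot> x) = x) \<and> S o\<^sub>L radj S \<noteq> id_blinfun"
begin

text \<open>The vectors annihilated by all \<open>f T\<close> with \<open>T\<close> in
  \<open>M\<close> form a closed subspace invariant under \<open>M\<close> and its commutant, so its
  projection is central. If nothing links \<open>e\<close> to \<open>f\<close>, it contains the
  range of \<open>e\<close>, hence is the identity, and then \<open>f = 0\<close>.\<close>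

lemma factor_link:
  assumes e: "mproj e" "e \<noteq> 0" and f: "mproj f" "f \<noteq> 0"
  shows "\<exists>T\<in>M. \<exists>x. f \<cdot> (T \<cdot> (e \<cdot> x)) \<noteq> 0"
proof (rule ccontr)
  assume "\<not> ?thesis"
  hence no: "\<And>T x. T \<in> M \<Longrightarrow> f \<cdot> (T \<cdot> (e \<cdot> x)) = 0" by blast
  define K where "K = {x. \<forall>T\<in>M. f \<cdot> (T \<cdot> x) = 0}"
  have sub: "subspace K" by (auto simp: K_def subspace_def op_simps)
  have K_Int: "K = (\<Inter>T\<in>M. {x. (f o\<^sub>L T) \<cdot> x = 0})" by (auto simp: K_def)
  have cl: "closed K" unfolding K_Int by (intro closed_INT ballI kernel_subspace(2))
  define P where "P = proj_on K"
  have P: "rproj P" and Pfix: "\<And>x. P \<cdot> x = x \<longleftrightarrow> x \<in> K"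
    using proj_on(1)[OF sub cl] proj_on_eq_iff[OF sub cl] by (simp_all add: P_def)
  have PK: "P \<cdot> x \<in> K" for x using Pfix[of "P \<cdot> x"] P by simp
  have inv: "S \<cdot> x \<in> K" if "S \<in> M \<or> S \<in> rcomm M" "x \<in> K" for S x
  proof -
    have "f \<cdot> (T \<cdot> (S \<cdot> x)) = 0" if T: "T \<in> M" for T
    proof (cases "S \<in> M")
      case True
      hence "T o\<^sub>L S \<in> M" using T by blast
      thus ?thesis using \<open>x \<in> K\<close> by (force simp: K_def)
    next
      case False
      hence S: "S \<in> rcomm M" using that(1) \<open>S \<in> M \<or> S \<in> rcomm M\<close> by simp
      have "f \<cdot> (T \<cdot> (S \<cdot> x)) = S \<cdot> (f \<cdot> (T \<cdot> x))"
        using ocommD[OF mem_ocomm[OF T S]] ocommD[OF mem_ocomm[OF mprojD(1)[OF f(1)] S]] by simp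
      thus ?thesis using \<open>x \<in> K\<close> T by (simp add: K_def)
    qed
    thus ?thesis by (simp add: K_def)
  qed
  have comm: "ocomm P S" if "S \<in> M \<or> S \<in> rcomm M" for S
  proof -
    have "radj S \<in> M \<or> radj S \<in> rcomm M" using that radj_closed rcomm_radj by blast
    hence "P \<cdot> (S \<cdot> x) = S \<cdot> (P \<cdot> x)" for x
      by (intro rproj_commute_if_invariant[OF P]) (simp_all add: Pfix inv PK that)
    thus ?thesis by (simp add: ocomm_def)
  qed
  have "P \<in> M" by (rule memI, rule ocomm_sym) (simp add: comm)
  moreover have "P \<in> rcomm M" using comm by (simp add: rcomm_def)
  ultimately have "P = 0 \<or> P = id_blinfun" using center P by blast
  moreover have "P \<cdot> (e \<cdot> x) = e \<cdot> x" for x unfolding Pfix using no by (simp add: K_def)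
  moreover obtain x where "e \<cdot> x \<noteq> 0" using e(2) by (metis blinfun_eqI blinfun.zero_left)
  ultimately have "P = id_blinfun" by (metis blinfun.zero_left)
  hence "f \<cdot> x = 0" for x using Pfix[of x] by (auto simp: K_def) (metis blinfun_apply_id_blinfun closure_simps(1))
  hence "f = 0" by (intro blinfun_eqI) simp
  thus False using f(2) by simp
qed

text \<open>A nonzero \<open>X = f T e\<close> becomes a partial isometry once it is cut to a
  spectral projection of \<open>radj X o\<^sub>L X\<close> away from 0 and normalised there; right
  continuity at 0 provides an \<open>\<epsilon>\<close> for which the cut is nonzero.\<close>

lemma partial_isometry_between:
  assumes e: "mproj e" "e \<noteq> 0" and f: "mproj f" "f \<noteq> 0"
  obtains V where "V \<in> M" "V \<noteq> 0" "rproj (radj V o\<^sub>L V)" "\<And>x. f \<cdot> (V \<cdot> x) = V \<cdot> x" "\<And>x. V \<cdot> (e \<cdot> x) = V \<cdot> x"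
proof -
  obtain T x0 where T: "T \<in> M" "f \<cdot> (T \<cdot> (e \<cdot> x0)) \<noteq> 0" using factor_link[OF assms] by blast
  define X where "X = f o\<^sub>L T o\<^sub>L e"
  have XM: "X \<in> M" using T(1) e f by (auto simp: X_def)
  have Xe: "X \<cdot> (e \<cdot> x) = X \<cdot> x" and fX: "f \<cdot> (X \<cdot> x) = X \<cdot> x" for x
    using mprojD(2)[OF e(1)] mprojD(2)[OF f(1)] by (simp_all add: X_def)
  define Q where "Q = radj X o\<^sub>L X"
  have Q: "psd Q" "Q \<in> M" using XM by (auto simp: Q_def psd_radj_compose)
  have Qs: "sym_op Q" by (rule psd_sym[OF Q(1)])
  have iQ: "inner (Q \<cdot> x) x = (norm (X \<cdot> x))\<^sup>2" for x
    by (simp add: Q_def power2_norm_eq_inner flip: radj')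
  have "\<exists>n. spec_gt Q (0 + inverse (real (Suc n))) \<cdot> x0 \<noteq> 0"
  proof (rule ccontr)
    assume "\<not> ?thesis"
    hence "(\<lambda>n. 0) \<longlonglongrightarrow> spec_gt Q 0 \<cdot> x0" using spec_gt_right_cont[OF Qs, of 0 x0] by simp
    hence "spec_gt Q 0 \<cdot> x0 = 0" by (simp add: LIMSEQ_const_iff)
    hence "inner (Q \<cdot> x0) x0 \<le> 0" using spec_gt(4)[OF Qs, of x0 0] by simp
    hence "X \<cdot> x0 = 0" by (simp add: iQ)
    thus False using T(2) by (simp add: X_def)
  qed
  then obtain n where n: "spec_gt Q (0 + inverse (real (Suc n))) \<cdot> x0 \<noteq> 0" by blast
  define \<epsilon> where "\<epsilon> = inverse (real (Suc n))"
  have \<epsilon>: "0 < \<epsilon>" "spec_gt Q \<epsilon> \<cdot> x0 \<noteq> 0" using n by (simp_all add: \<epsilon>_def)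
  define g where "g = spec_gt Q \<epsilon>"
  have g: "rproj g" "ocomm Q g" unfolding g_def using spec_gt[OF Qs] by auto
  have gT: "\<epsilon> * (norm (g \<cdot> x))\<^sup>2 \<le> inner (Q \<cdot> (g \<cdot> x)) (g \<cdot> x)" for x
    unfolding g_def by (rule spec_gt(3)[OF Qs])
  obtain h where h: "psd h" "\<And>x. h \<cdot> (Q \<cdot> (h \<cdot> x)) = g \<cdot> x" "\<And>Z. ocomm Z Q \<Longrightarrow> ocomm Z g \<Longrightarrow> ocomm Z h"
    by (rule normalizer_exists[OF Q(1) g \<epsilon>(1) gT]) (rule that)
  have "ocomm Z Q" if "Z \<in> rcomm M" for Z by (rule mem_ocomm[OF Q(2) that])
  hence hM: "h \<in> M" by (intro memI h(3)) (auto simp: g_def intro: spec_gt(2)[OF Qs])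
  have "radj X \<cdot> x = e \<cdot> (radj X \<cdot> x)" for x
    by (rule inner_eq_all_imp_eq) (simp add: sym_opD[OF rproj_sym[OF mprojD(2)[OF e(1)]]] Xe flip: radj')
  hence "ocomm e Q" by (simp add: ocomm_def Q_def Xe)
  hence "ocomm e h" by (intro h(3)) (auto simp: g_def intro: spec_gt(2)[OF Qs])
  hence eh: "e \<cdot> (h \<cdot> x) = h \<cdot> (e \<cdot> x)" for x by (rule ocommD)
  define V where "V = X o\<^sub>L h"
  have hs: "radj h = h" using psd_sym[OF h(1)] by (simp add: sym_op_radj)
  have VV: "radj V o\<^sub>L V = g" by (rule blinfun_eqI) (use h(2) in \<open>simp add: V_def hs Q_def\<close>)
  show ?thesis
  proof (rule that[of V])
    show "V \<in> M" using XM hM by (auto simp: V_def)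
    show "V \<noteq> 0"
    proof
      assume "V = 0"
      hence "g = 0" using VV by simp
      thus False using \<epsilon>(2) by (simp add: g_def)
    qed
    show "rproj (radj V o\<^sub>L V)" by (simp add: VV g)
    show "f \<cdot> (V \<cdot> x) = V \<cdot> x" "V \<cdot> (e \<cdot> x) = V \<cdot> x" for x
      by (simp_all add: V_def fX flip: eh) (simp add: Xe)
  qed
qed

lemma partial_isometry_nonzero: "V \<noteq> 0 \<Longrightarrow> rproj (radj V o\<^sub>L V) \<Longrightarrow> V o\<^sub>L radj V \<noteq> 0"
proof
  assume V: "V \<noteq> 0" "rproj (radj V o\<^sub>L V)" "V o\<^sub>L radj V = 0"
  have "V \<cdot> x = (V o\<^sub>L radj V) \<cdot> (V \<cdot> x)" for x using partial_isometry_radj(1)[OF V(2)] by simp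
  hence "V = 0" unfolding V(3) by (intro blinfun_eqI) simp
  thus False using V(1) by simp
qed

text \<open>Sigma-finiteness speaks of projections: the final projections of the family are nonzero,
  pairwise orthogonal and determine their members.\<close>

lemma countable_orthogonal_family:
  assumes F: "\<And>V. V \<in> F \<Longrightarrow> V \<in> M \<and> V \<noteq> 0 \<and> rproj (radj V o\<^sub>L V)"
    and o: "\<And>V W x. V \<in> F \<Longrightarrow> W \<in> F \<Longrightarrow> V \<noteq> W \<Longrightarrow> radj V \<cdot> (W \<cdot> x) = 0"
  shows "countable F"
proof -
  let ?g = "\<lambda>V. V o\<^sub>L radj V"
  have gg: "?g V \<cdot> (?g W \<cdot> x) = 0" if "V \<in> F" "W \<in> F" "V \<noteq> W" for V W x
    using o[OF that] by simp
  have p: "?g V \<in> M" "rproj (?g V)" "?g V \<noteq> 0" if "V \<in> F" for V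
    using F[OF that] partial_isometry_radj(3) partial_isometry_nonzero by auto
  have inj: "inj_on ?g F"
  proof (rule inj_onI, rule ccontr)
    fix V W assume *: "V \<in> F" "W \<in> F" "?g V = ?g W" "V \<noteq> W"
    have "?g V \<cdot> x = 0" for x using gg[OF *(1,2,4), of x] p(2)[OF *(1)] unfolding *(3)[symmetric] by (metis rproj_idem)
    hence "?g V = 0" by (intro blinfun_eqI) simp
    thus False using p(3)[OF *(1)] by simp
  qed
  have "countable (?g ` F)"
  proof (rule sigma_finite)
    show "pairwise (\<lambda>P Q. \<forall>x. P \<cdot> (Q \<cdot> x) = 0) (?g ` F)"
    proof (rule pairwiseI)
      fix P Q assume PQ: "P \<in> ?g ` F" "Q \<in> ?g ` F" "P \<noteq> Q"
      then obtain V W where VW: "V \<in> F" "P = ?g V" "W \<in> F" "Q = ?g W" by (elim imageE)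
      hence "V \<noteq> W" using PQ(3) by blast
      thus "\<forall>x. P \<cdot> (Q \<cdot> x) = 0" unfolding VW(2,4) using gg[OF VW(1,3)] by blast
    qed
    show "?g ` F \<subseteq> {P \<in> M. rproj P \<and> P \<noteq> 0}" using p by (intro image_subsetI) simp
  qed
  thus ?thesis using inj by (rule countable_image_inj_on)
qed

text \<open>A maximal family of nonzero partial isometries with initial projections below
  \<open>e\<close> and orthogonal ranges below \<open>G\<close> is countable and fills
  \<open>G\<close>, since \<open>partial_isometry_between\<close> would add a member inside any
  remainder.\<close>

lemma projection_partition:
  assumes e: "mproj e" "e \<noteq> 0" and G: "mproj G"
  obtains V where "\<And>k::nat. V k \<in> M" "\<And>k. rproj (radj (V k) o\<^sub>L V k)" "\<And>k x. V k \<cdot> (e \<cdot> x) = V k \<cdot> x"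
    "\<And>k x. G \<cdot> (V k \<cdot> x) = V k \<cdot> x" "\<And>i j x. i \<noteq> j \<Longrightarrow> radj (V i) \<cdot> (V j \<cdot> x) = 0"
    "\<And>x. (\<lambda>k. V k \<cdot> (radj (V k) \<cdot> x)) sums (G \<cdot> x)"
proof -
  define X where "X = {V\<in>M. V \<noteq> 0 \<and> rproj (radj V o\<^sub>L V) \<and> (\<forall>x. V \<cdot> (e \<cdot> x) = V \<cdot> x) \<and> (\<forall>x. G \<cdot> (V \<cdot> x) = V \<cdot> x)}"
  define R where "R V W \<longleftrightarrow> (\<forall>x. radj V \<cdot> (W \<cdot> x) = 0)" for V W :: "'a \<Rightarrow>\<^sub>L 'a"
  obtain F where F: "F \<subseteq> X" "pairwise R F" and max: "\<And>V. V \<in> X \<Longrightarrow> (\<And>W. W \<in> F \<Longrightarrow> R V W \<and> R W V) \<Longrightarrow> V \<in> F"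
    by (rule maximal_pairwise_subset[of X R], rule that, assumption, assumption) meson
  have "countable F"
    by (rule countable_orthogonal_family) (use F in \<open>auto simp: X_def pairwise_def R_def\<close>)
  then obtain v :: "nat \<Rightarrow> 'a \<Rightarrow>\<^sub>L 'a" where v: "\<And>k. v k \<in> F \<or> v k = 0" "F \<subseteq> range v"
    "\<And>i j. i \<noteq> j \<Longrightarrow> v i \<in> F \<Longrightarrow> v j \<in> F \<Longrightarrow> 0 \<notin> F \<Longrightarrow> v i \<noteq> v j"
    by (rule countable_sequence) (rule that)
  have F0: "0 \<notin> F" using F(1) by (auto simp: X_def)
  have vX: "v k \<in> X \<or> v k = 0" for k using v(1) F(1) by blast
  have vM: "v k \<in> M" and vp: "rproj (radj (v k) o\<^sub>L v k)" and ve: "v k \<cdot> (e \<cdot> x) = v k \<cdot> x"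
    and vG: "G \<cdot> (v k \<cdot> x) = v k \<cdot> x" for k x
    using vX[of k] by (auto simp: X_def)
  have vo: "radj (v i) \<cdot> (v j \<cdot> x) = 0" if "i \<noteq> j" for i j x
  proof (cases "v i \<in> F \<and> v j \<in> F")
    case True
    hence "v i \<noteq> v j" using v(3)[OF that] F0 by blast
    thus ?thesis using F(2) True by (auto simp: pairwise_def R_def)
  next
    case False
    hence "v i = 0 \<or> v j = 0" using v(1) by blast
    thus ?thesis by auto
  qed
  note pi = partial_isometry_radj[OF vp]
  obtain P where P: "mproj P" "\<And>x. (\<lambda>i. (v i o\<^sub>L radj (v i)) \<cdot> x) sums (P \<cdot> x)"
    "\<And>i x. (v i o\<^sub>L radj (v i)) \<cdot> (P \<cdot> x) = (v i o\<^sub>L radj (v i)) \<cdot> x"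
    by (rule mproj_sums[of "\<lambda>i. v i o\<^sub>L radj (v i)"]) (use vo vM pi(3) that in \<open>auto simp: mproj_def\<close>)
  have GP: "G \<cdot> (P \<cdot> x) = P \<cdot> x" for x
  proof (rule sums_unique2)
    show "(\<lambda>i. G \<cdot> ((v i o\<^sub>L radj (v i)) \<cdot> x)) sums (G \<cdot> (P \<cdot> x))"
      by (rule bounded_linear.sums[OF blinfun.bounded_linear_right P(2)])
    show "(\<lambda>i. G \<cdot> ((v i o\<^sub>L radj (v i)) \<cdot> x)) sums (P \<cdot> x)" using P(2)[of x] by (simp add: vG)
  qed
  have "G - P = 0"
  proof (rule ccontr)
    assume "G - P \<noteq> 0"
    moreover have GPm: "mproj (G - P)" by (rule mproj_diff[OF G P(1) GP])
    ultimately obtain W where W: "W \<in> M" "W \<noteq> 0" "rproj (radj W o\<^sub>L W)"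
      "\<And>x. (G - P) \<cdot> (W \<cdot> x) = W \<cdot> x" "\<And>x. W \<cdot> (e \<cdot> x) = W \<cdot> x"
      using partial_isometry_between[OF e, of "G - P"] by blast
    have PW: "P \<cdot> (W \<cdot> x) = 0" for x
    proof -
      have "P \<cdot> (G \<cdot> (W \<cdot> x)) = P \<cdot> (W \<cdot> x)" by (rule rproj_le_sym) (use P(1) G GP in auto)
      thus ?thesis using arg_cong[OF W(4)[of x], of "blinfun_apply P"] mprojD(2)[OF P(1)] by (simp add: op_simps)
    qed
    have GW: "G \<cdot> (W \<cdot> x) = W \<cdot> x" for x using W(4)[of x] by (simp add: op_simps PW)
    have vW: "radj (v k) \<cdot> (W \<cdot> x) = 0" for k x
    proof -
      have "radj (v k) \<cdot> (W \<cdot> x) = radj (v k) \<cdot> ((v k o\<^sub>L radj (v k)) \<cdot> (W \<cdot> x))" using pi(2) by simp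
      also have "\<dots> = radj (v k) \<cdot> ((v k o\<^sub>L radj (v k)) \<cdot> (P \<cdot> (W \<cdot> x)))" by (simp only: P(3))
      finally show ?thesis by (simp add: PW)
    qed
    have "W \<in> X" using W GW by (simp add: X_def)
    moreover have "R W U \<and> R U W" if "U \<in> F" for U
    proof -
      obtain k where "U = v k" using \<open>U \<in> F\<close> v(2) by blast
      thus ?thesis using vW orth_of_ranges[OF vW] by (simp add: R_def)
    qed
    ultimately have "W \<in> F" by (rule max)
    then obtain k where "W = v k" using v(2) by blast
    hence "radj W o\<^sub>L W = 0" using vW by (intro blinfun_eqI) simp
    moreover have "W \<cdot> x = W \<cdot> ((radj W o\<^sub>L W) \<cdot> x)" for x using partial_isometry_radj(1)[OF W(3)] by simp
    ultimately have "W = 0" by (intro blinfun_eqI) simp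
    thus False using W(2) by simp
  qed
  hence "(\<lambda>k. v k \<cdot> (radj (v k) \<cdot> x)) sums (G \<cdot> x)" for x using P(2)[of x] by simp
  from that[OF vM vp ve vG vo this] show ?thesis .
qed

text \<open>As in \<open>projection_partition\<close>, but with orthogonal initial projections as
  well. By maximality one of the remainders \<open>e - E\<close> and \<open>f - G\<close> vanishes,
  and the sum of the family or its adjoint is the embedding.\<close>

lemma comparison:
  assumes e: "mproj e" and f: "mproj f"
  shows "subeq e f \<or> subeq f e"
proof -
  define X where "X = {V\<in>M. V \<noteq> 0 \<and> rproj (radj V o\<^sub>L V) \<and> (\<forall>x. V \<cdot> (e \<cdot> x) = V \<cdot> x) \<and> (\<forall>x. f \<cdot> (V \<cdot> x) = V \<cdot> x)}"
  define R where "R V W \<longleftrightarrow> (\<forall>x. radj V \<cdot> (W \<cdot> x) = 0) \<and> (\<forall>x. V \<cdot> (radj W \<cdot> x) = 0)" for V W :: "'a \<Rightarrow>\<^sub>L 'a"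
  obtain F where F: "F \<subseteq> X" "pairwise R F" and max: "\<And>V. V \<in> X \<Longrightarrow> (\<And>W. W \<in> F \<Longrightarrow> R V W \<and> R W V) \<Longrightarrow> V \<in> F"
    by (rule maximal_pairwise_subset[of X R], rule that, assumption, assumption) meson
  have "countable F"
    by (rule countable_orthogonal_family) (use F in \<open>auto simp: X_def pairwise_def R_def\<close>)
  then obtain v :: "nat \<Rightarrow> 'a \<Rightarrow>\<^sub>L 'a" where v: "\<And>k. v k \<in> F \<or> v k = 0" "F \<subseteq> range v"
    "\<And>i j. i \<noteq> j \<Longrightarrow> v i \<in> F \<Longrightarrow> v j \<in> F \<Longrightarrow> 0 \<notin> F \<Longrightarrow> v i \<noteq> v j"
    by (rule countable_sequence) (rule that)
  have F0: "0 \<notin> F" using F(1) by (auto simp: X_def)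
  have vX: "v k \<in> X \<or> v k = 0" for k using v(1) F(1) by blast
  have vM: "v k \<in> M" and vp: "rproj (radj (v k) o\<^sub>L v k)" and ve: "v k \<cdot> (e \<cdot> x) = v k \<cdot> x"
    and vf: "f \<cdot> (v k \<cdot> x) = v k \<cdot> x" for k x
    using vX[of k] by (auto simp: X_def)
  have vR: "R (v i) (v j)" if "i \<noteq> j" for i j
  proof (cases "v i \<in> F \<and> v j \<in> F")
    case True
    hence "v i \<noteq> v j" using v(3)[OF that] F0 by blast
    thus ?thesis using F(2) True by (auto simp: pairwise_def)
  next
    case False
    hence "v i = 0 \<or> v j = 0" using v(1) by blast
    thus ?thesis by (auto simp: R_def)
  qed
  note pi = partial_isometry_radj[OF vp]
  obtain U where U: "\<And>x. (\<lambda>k. v k \<cdot> x) sums (U \<cdot> x)" "\<And>x. (\<lambda>k. radj (v k) \<cdot> x) sums (radj U \<cdot> x)"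
    "\<And>x. (\<lambda>k. radj (v k) \<cdot> (v k \<cdot> x)) sums (radj U \<cdot> (U \<cdot> x))"
    "\<And>x. (\<lambda>k. v k \<cdot> (radj (v k) \<cdot> x)) sums (U \<cdot> (radj U \<cdot> x))"
    by (rule partial_isometry_sum[of v]) (use vp vR that in \<open>auto simp: R_def\<close>)
  have UM: "U \<in> M" by (rule sums_closed[OF vM U(1)])
  obtain E where E: "mproj E" "\<And>x. (\<lambda>k. (radj (v k) o\<^sub>L v k) \<cdot> x) sums (E \<cdot> x)"
    "\<And>k x. (radj (v k) o\<^sub>L v k) \<cdot> (E \<cdot> x) = (radj (v k) o\<^sub>L v k) \<cdot> x"
    by (rule mproj_sums[of "\<lambda>k. radj (v k) o\<^sub>L v k"]) (use vR vM vp that in \<open>auto simp: mproj_def R_def\<close>)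
  obtain G where G: "mproj G" "\<And>x. (\<lambda>k. (v k o\<^sub>L radj (v k)) \<cdot> x) sums (G \<cdot> x)"
    "\<And>k x. (v k o\<^sub>L radj (v k)) \<cdot> (G \<cdot> x) = (v k o\<^sub>L radj (v k)) \<cdot> x"
    by (rule mproj_sums[of "\<lambda>k. v k o\<^sub>L radj (v k)"]) (use vR vM pi(3) that in \<open>auto simp: mproj_def R_def\<close>)
  have UE: "radj U \<cdot> (U \<cdot> x) = E \<cdot> x" for x using sums_unique2[OF U(3)] E(2)[of x] by simp
  have UG: "U \<cdot> (radj U \<cdot> x) = G \<cdot> x" for x using sums_unique2[OF U(4)] G(2)[of x] by simp
  have evr: "e \<cdot> (radj (v k) \<cdot> x) = radj (v k) \<cdot> x" for k x
    by (rule inner_eq_all_imp_eq) (use e in \<open>simp add: sym_opD[OF rproj_sym] mprojD ve flip: radj'\<close>)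
  have eU: "e \<cdot> (radj U \<cdot> x) = radj U \<cdot> x" and fU: "f \<cdot> (U \<cdot> x) = U \<cdot> x" for x
    using bounded_linear.sums[OF blinfun.bounded_linear_right U(2), of e x] U(2)[of x]
      bounded_linear.sums[OF blinfun.bounded_linear_right U(1), of f x] U(1)[of x]
    by (auto simp: evr vf intro: sums_unique2)
  have eE: "e \<cdot> (E \<cdot> x) = E \<cdot> x" and fG: "f \<cdot> (G \<cdot> x) = G \<cdot> x" for x
    by (simp_all add: eU fU flip: UE UG)
  have eEm: "mproj (e - E)" and fGm: "mproj (f - G)"
    by (rule mproj_diff[OF e E(1) eE], rule mproj_diff[OF f G(1) fG])
  have "e - E = 0 \<or> f - G = 0"
  proof (rule ccontr)
    assume "\<not> ?thesis"
    then obtain W where W: "W \<in> M" "W \<noteq> 0" "rproj (radj W o\<^sub>L W)"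
      "\<And>x. (f - G) \<cdot> (W \<cdot> x) = W \<cdot> x" "\<And>x. W \<cdot> ((e - E) \<cdot> x) = W \<cdot> x"
      using partial_isometry_between[OF eEm _ fGm] by blast
    have GW: "G \<cdot> (W \<cdot> x) = 0" for x
    proof -
      have "G \<cdot> (f \<cdot> (W \<cdot> x)) = G \<cdot> (W \<cdot> x)" by (rule rproj_le_sym) (use G(1) f fG in auto)
      thus ?thesis using arg_cong[OF W(4)[of x], of "blinfun_apply G"] mprojD(2)[OF G(1)] by (simp add: op_simps)
    qed
    have WE: "W \<cdot> (E \<cdot> x) = 0" for x
      using W(5)[of "E \<cdot> x"] mprojD(2)[OF E(1)] by (simp add: op_simps eE)
    have We: "W \<cdot> (e \<cdot> x) = W \<cdot> x" and fW: "f \<cdot> (W \<cdot> x) = W \<cdot> x" for x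
      using W(5)[of x] W(4)[of x] by (simp_all add: op_simps WE GW)
    have vW: "radj (v k) \<cdot> (W \<cdot> x) = 0" for k x
    proof -
      have "radj (v k) \<cdot> (W \<cdot> x) = radj (v k) \<cdot> ((v k o\<^sub>L radj (v k)) \<cdot> (W \<cdot> x))" using pi(2) by simp
      also have "\<dots> = radj (v k) \<cdot> ((v k o\<^sub>L radj (v k)) \<cdot> (G \<cdot> (W \<cdot> x)))" by (simp only: G(3))
      finally show ?thesis by (simp add: GW)
    qed
    have EW: "E \<cdot> (radj W \<cdot> x) = 0" for x
      by (rule inner_eq_all_imp_eq) (use E(1) in \<open>simp add: sym_opD[OF rproj_sym] mprojD WE flip: radj'\<close>)
    have vW': "v k \<cdot> (radj W \<cdot> x) = 0" for k x
    proof -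
      have "v k \<cdot> (radj W \<cdot> x) = v k \<cdot> ((radj (v k) o\<^sub>L v k) \<cdot> (radj W \<cdot> x))" using pi(1) by simp
      also have "\<dots> = v k \<cdot> ((radj (v k) o\<^sub>L v k) \<cdot> (E \<cdot> (radj W \<cdot> x)))" by (simp only: E(3))
      finally show ?thesis by (simp add: EW)
    qed
    have Wv': "W \<cdot> (radj (v k) \<cdot> x) = 0" for k x
      using orth_of_ranges[of "radj (v k)" "radj W"] vW' by simp
    have "W \<in> X" using W We fW by (simp add: X_def)
    moreover have "R W Y \<and> R Y W" if "Y \<in> F" for Y
    proof -
      obtain k where "Y = v k" using \<open>Y \<in> F\<close> v(2) by blast
      thus ?thesis using vW orth_of_ranges[OF vW] vW' Wv' by (simp add: R_def)
    qed
    ultimately have "W \<in> F" by (rule max)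
    then obtain k where "W = v k" using v(2) by blast
    hence "radj W o\<^sub>L W = 0" using vW by (intro blinfun_eqI) simp
    moreover have "W \<cdot> x = W \<cdot> ((radj W o\<^sub>L W) \<cdot> x)" for x using partial_isometry_radj(1)[OF W(3)] by simp
    ultimately have "W = 0" by (intro blinfun_eqI) simp
    thus False using W(2) by simp
  qed
  thus ?thesis
  proof
    assume "e - E = 0"
    hence "emb U e f" using UM UE fU by (simp add: emb_def)
    thus ?thesis by (auto simp: subeq_def)
  next
    assume "f - G = 0"
    hence "emb (radj U) f e" using UM UG eU by (simp add: emb_def)
    thus ?thesis by (auto simp: subeq_def)
  qed
qed

text \<open>\<open>G\<close> is an orthogonal sum of projections equivalent to subprojections of
  \<open>e\<close>, and each summand is moved into its own copy of \<open>e\<close> inside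
  \<open>P\<close>. So infinitely many orthogonal copies of one nonzero projection absorb every
  projection of \<open>M\<close>.\<close>

lemma sum_absorbs:
  assumes e: "mproj e" "e \<noteq> 0" and G: "mproj G"
    and w: "\<And>k::nat. emb (w k) e (Q k)" and Q: "\<And>k. rproj (Q k)" "\<And>i j x. i \<noteq> j \<Longrightarrow> Q i \<cdot> (Q j \<cdot> x) = 0"
    and P: "\<And>k x. P \<cdot> (Q k \<cdot> x) = Q k \<cdot> x"
  shows "subeq G P"
proof -
  obtain V where V: "\<And>k::nat. V k \<in> M" "\<And>k. rproj (radj (V k) o\<^sub>L V k)" "\<And>k x. V k \<cdot> (e \<cdot> x) = V k \<cdot> x"
    "\<And>i j x. i \<noteq> j \<Longrightarrow> radj (V i) \<cdot> (V j \<cdot> x) = 0" "\<And>x. (\<lambda>k. V k \<cdot> (radj (V k) \<cdot> x)) sums (G \<cdot> x)"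
    by (rule projection_partition[OF e G]) (rule that)
  note pi = partial_isometry_radj[OF V(2)]
  define T where "T k = w k o\<^sub>L radj (V k)" for k
  have TT: "radj (T k) \<cdot> (T k \<cdot> x) = V k \<cdot> (radj (V k) \<cdot> x)" for k x
    by (simp add: T_def embD(2)[OF w] V(3))
  have wQ: "radj (w i) \<cdot> (w j \<cdot> x) = 0" if "i \<noteq> j" for i j x
  proof -
    have "radj (w i) \<cdot> (w j \<cdot> x) = radj (w i) \<cdot> (Q i \<cdot> (Q j \<cdot> (w j \<cdot> x)))"
      by (simp add: embD(3)[OF w] emb_range[OF w Q(1)])
    thus ?thesis by (simp add: Q(2)[OF that])
  qed
  obtain S where S: "\<And>x. (\<lambda>k. T k \<cdot> x) sums (S \<cdot> x)" "\<And>x. (\<lambda>k. radj (T k) \<cdot> (T k \<cdot> x)) sums (radj S \<cdot> (S \<cdot> x))"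
  proof (rule partial_isometry_sum[of T])
    show "rproj (radj (T k) o\<^sub>L T k)" for k
    proof -
      have "radj (T k) o\<^sub>L T k = V k o\<^sub>L radj (V k)" by (rule blinfun_eqI) (use TT in simp)
      thus ?thesis using pi(3) by simp
    qed
    show "radj (T i) \<cdot> (T j \<cdot> x) = 0" "T i \<cdot> (radj (T j) \<cdot> x) = 0" if "i \<noteq> j" for i j x
      by (simp_all add: T_def wQ[OF that] V(4)[OF that])
  qed (rule that)
  have "S \<in> M" by (rule sums_closed[OF _ S(1)]) (use V(1) embD(1)[OF w] in \<open>auto simp: T_def\<close>)
  moreover have "radj S \<cdot> (S \<cdot> x) = G \<cdot> x" for x using sums_unique2[OF S(2)] V(5)[of x] by (simp add: TT)
  moreover have "P \<cdot> (S \<cdot> x) = S \<cdot> x" for x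
  proof (rule sums_unique2[OF _ S(1)])
    have "P \<cdot> (T k \<cdot> x) = T k \<cdot> x" for k
    proof -
      have "P \<cdot> (w k \<cdot> y) = w k \<cdot> y" for y using P[of k "w k \<cdot> y"] by (simp add: embD(3)[OF w])
      thus ?thesis by (simp add: T_def)
    qed
    thus "(\<lambda>k. T k \<cdot> x) sums (P \<cdot> (S \<cdot> x))"
      using bounded_linear.sums[OF blinfun.bounded_linear_right S(1), of P x] by simp
  qed
  ultimately have "emb S G P" by (simp add: emb_def)
  thus ?thesis by (auto simp: subeq_def)
qed

text \<open>\<open>big P\<close> says that \<open>P\<close> is infinite; in a \<open>\<sigma>\<close>-finite factor an infinite projection is equivalent to
  the identity.\<close>

definition big :: "('a \<Rightarrow>\<^sub>L 'a) \<Rightarrow> bool" where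
  "big P \<longleftrightarrow> mproj P \<and> subeq id_blinfun P"

lemma big_mono: "big P \<Longrightarrow> mproj Q \<Longrightarrow> (\<And>x. Q \<cdot> (P \<cdot> x) = P \<cdot> x) \<Longrightarrow> big Q"
  unfolding big_def using subeq_trans subeq_sub by blast

lemma big_subeq: "big P \<Longrightarrow> mproj e \<Longrightarrow> subeq e P"
  unfolding big_def using subeq_trans[of e id_blinfun P] subeq_sub[of e id_blinfun] by auto

text \<open>\<open>d\<close> is the wandering projection of the shift \<open>V\<close> inside
  \<open>P\<close>; its images under the powers of \<open>V\<close> are pairwise orthogonal
  copies.\<close>

lemma shift_copies:
  assumes P: "mproj P" and V: "emb V P P" and ne: "V o\<^sub>L radj V \<noteq> P"
  obtains d w where "mproj d" "d \<noteq> 0" "\<And>k::nat. emb (w k) d P"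
    "\<And>i j x. i \<noteq> j \<Longrightarrow> radj (w i) \<cdot> (w j \<cdot> x) = 0"
proof -
  note Vd = embD[OF V]
  have Vm: "mproj (V o\<^sub>L radj V)" by (rule emb_final(1)[OF V P])
  define d where "d = P - (V o\<^sub>L radj V)"
  have dm: "mproj d" unfolding d_def by (rule mproj_diff[OF P Vm]) (simp add: Vd)
  have d0: "d \<noteq> 0" using ne by (auto simp: d_def)
  have VP: "V \<cdot> (P \<cdot> x) = V \<cdot> x" for x by (rule partial_isometry(1)[of P]) (use P Vd in auto)
  have Pd: "P \<cdot> (d \<cdot> x) = d \<cdot> x" for x using mprojD(2)[OF P] by (simp add: d_def op_simps Vd)
  have dV: "d \<cdot> (V \<cdot> x) = 0" for x by (simp add: d_def op_simps Vd VP)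
  define w where "w = rec_nat d (\<lambda>_ W. V o\<^sub>L W)"
  have w0: "w 0 = d" and wS: "\<And>k. w (Suc k) = V o\<^sub>L w k" by (simp_all add: w_def)
  have w: "emb (w k) d P" for k
  proof (induction k)
    case 0 show ?case unfolding w0 by (rule emb_self[OF dm Pd])
  next
    case (Suc k) show ?case unfolding wS by (rule emb_trans[OF Suc V])
  qed
  have o: "radj (w i) \<cdot> (w (Suc (i + j)) \<cdot> x) = 0" for i j x
  proof (induction i)
    case 0 show ?case by (simp add: w0 wS rproj_radj[OF mprojD(2)[OF dm]] dV)
  next
    case (Suc i) thus ?case using embD(3)[OF w] by (simp add: wS Vd)
  qed
  have "radj (w i) \<cdot> (w j \<cdot> x) = 0" if "i \<noteq> j" for i j x
  proof (cases "i < j")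
    case True
    then obtain k where "j = Suc (i + k)" using less_iff_Suc_add by blast
    thus ?thesis using o by simp
  next
    case False
    hence "j < i" using that by simp
    then obtain k where "i = Suc (j + k)" using less_iff_Suc_add by blast
    thus ?thesis using orth_of_ranges[of "w j" "w i"] o by simp
  qed
  from that[OF dm d0 w this] show ?thesis .
qed

lemma infinite_imp_big:
  assumes P: "mproj P" and V: "emb V P P" "V o\<^sub>L radj V \<noteq> P"
  shows "big P"
proof -
  obtain d w where d: "mproj d" "d \<noteq> 0" and w: "\<And>k::nat. emb (w k) d P"
    "\<And>i j x. i \<noteq> j \<Longrightarrow> radj (w i) \<cdot> (w j \<cdot> x) = 0"
    by (rule shift_copies[OF P V]) (rule that)
  let ?Q = "\<lambda>k. w k o\<^sub>L radj (w k)"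
  have wd: "w k \<cdot> (d \<cdot> x) = w k \<cdot> x" for k x
    using partial_isometry(1)[of d "w k"] d embD(2)[OF w(1)] by (simp add: mprojD)
  have "subeq id_blinfun P"
  proof (rule sum_absorbs[OF d, of _ w ?Q])
    show "emb (w k) d (?Q k)" for k using w(1)[of k] wd by (simp add: emb_def)
    show "rproj (?Q k)" for k using emb_final(1)[OF w(1) d(1)] by (rule mprojD(2))
    show "?Q i \<cdot> (?Q j \<cdot> x) = 0" if "i \<noteq> j" for i j x by (simp add: w(2)[OF that])
    show "P \<cdot> (?Q k \<cdot> x) = ?Q k \<cdot> x" for k x by (simp add: embD(3)[OF w(1)])
  qed simp
  thus ?thesis using P by (simp add: big_def)
qed

lemma big_imp_infinite:
  assumes "big P"
  obtains V where "emb V P P" "V o\<^sub>L radj V \<noteq> P"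
proof -
  have P: "mproj P" using assms by (simp add: big_def)
  obtain U where U: "emb U id_blinfun P" using assms by (auto simp: big_def subeq_def)
  note Ud = embD[OF U]
  have UP: "radj U \<cdot> (P \<cdot> x) = radj U \<cdot> x" for x by (rule emb_range[OF U]) (use P in auto)
  obtain S where S: "S \<in> M" "\<And>x. radj S \<cdot> (S \<cdot> x) = x" "S o\<^sub>L radj S \<noteq> id_blinfun"
    using nonunitary_isometry by blast
  have Pi: "P \<cdot> (P \<cdot> x) = P \<cdot> x" "radj P = P" for x using P by (auto simp: rproj_radj)
  \<comment> \<open>The nonunitary isometry \<open>S\<close> transported into \<open>P\<close> by
    \<open>U\<close>, completed by the identity on the part of \<open>P\<close> outside the range of
    \<open>U\<close>.\<close>
  define V where "V = (U o\<^sub>L S o\<^sub>L radj U) + (P - (U o\<^sub>L radj U))"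
  have rV: "radj V = (U o\<^sub>L radj S o\<^sub>L radj U) + (P - (U o\<^sub>L radj U))"
    by (rule blinfun_eqI) (simp add: V_def Pi op_simps)
  have "V \<in> M" using Ud(1) S(1) P by (auto simp: V_def)
  moreover have "radj V \<cdot> (V \<cdot> x) = P \<cdot> x" "P \<cdot> (V \<cdot> x) = V \<cdot> x" for x
    unfolding rV by (simp_all add: V_def op_simps Ud S UP Pi)
  ultimately have "emb V P P" by (simp add: emb_def)
  moreover have "V o\<^sub>L radj V \<noteq> P"
  proof
    assume "V o\<^sub>L radj V = P"
    hence "radj U \<cdot> ((V o\<^sub>L radj V) \<cdot> (U \<cdot> x)) = radj U \<cdot> (P \<cdot> (U \<cdot> x))" for x by simp
    hence "S \<cdot> (radj S \<cdot> x) = x" for x unfolding rV by (simp add: V_def op_simps Ud UP)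
    hence "S o\<^sub>L radj S = id_blinfun" by (intro blinfun_eqI) simp
    thus False using S(3) by simp
  qed
  ultimately show ?thesis by (rule that)
qed

lemma big_of_copies:
  assumes e: "mproj e" "e \<noteq> 0" and Q: "\<And>k::nat. mproj (Q k)" "\<And>k. subeq e (Q k)"
    "\<And>i j x. i \<noteq> j \<Longrightarrow> Q i \<cdot> (Q j \<cdot> x) = 0" and P: "mproj P" "\<And>k x. P \<cdot> (Q k \<cdot> x) = Q k \<cdot> x"
  shows "big P"
proof -
  obtain w where w: "\<And>k. emb (w k) e (Q k)" using Q(2) unfolding subeq_def by metis
  have "subeq id_blinfun P"
    by (rule sum_absorbs[OF e _ w]) (use Q P in auto)
  thus ?thesis using P(1) by (simp add: big_def)
qed

text \<open>The copies of the wandering projection are separated by parity: \<open>Q\<close>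
  collects the even ones, and the odd ones stay below \<open>P - Q\<close>.\<close>

lemma big_split:
  assumes "big P"
  obtains Q where "big Q" "\<And>x. P \<cdot> (Q \<cdot> x) = Q \<cdot> x" "big (P - Q)"
proof -
  have P: "mproj P" using assms by (simp add: big_def)
  obtain V where V: "emb V P P" "V o\<^sub>L radj V \<noteq> P" by (rule big_imp_infinite[OF assms])
  obtain d w where d: "mproj d" "d \<noteq> 0" and w: "\<And>k::nat. emb (w k) d P"
    "\<And>i j x. i \<noteq> j \<Longrightarrow> radj (w i) \<cdot> (w j \<cdot> x) = 0"
    by (rule shift_copies[OF P V]) (rule that)
  let ?Q = "\<lambda>k. w k o\<^sub>L radj (w k)"
  have wd: "w k \<cdot> (d \<cdot> x) = w k \<cdot> x" for k x
    using partial_isometry(1)[of d "w k"] d embD(2)[OF w(1)] by (simp add: mprojD)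
  have Qm: "mproj (?Q k)" for k by (rule emb_final(1)[OF w(1) d(1)])
  have Qd: "subeq d (?Q k)" for k
    unfolding subeq_def using w(1)[of k] wd by (intro exI[of _ "w k"]) (simp add: emb_def)
  have Qo: "?Q i \<cdot> (?Q j \<cdot> x) = 0" if "i \<noteq> j" for i j x by (simp add: w(2)[OF that])
  obtain R where R: "mproj R" "\<And>x. (\<lambda>k. ?Q (2 * k) \<cdot> x) sums (R \<cdot> x)" "\<And>i x. R \<cdot> (?Q (2 * i) \<cdot> x) = ?Q (2 * i) \<cdot> x"
    by (rule mproj_sums[of "\<lambda>k. ?Q (2 * k)"]) (use Qm Qo that in auto)
  have PQ: "P \<cdot> (?Q k \<cdot> x) = ?Q k \<cdot> x" for k x by (simp add: embD(3)[OF w(1)])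
  have PR: "P \<cdot> (R \<cdot> x) = R \<cdot> x" for x
  proof (rule sums_unique2[OF _ R(2)])
    show "(\<lambda>k. ?Q (2 * k) \<cdot> x) sums (P \<cdot> (R \<cdot> x))"
      using bounded_linear.sums[OF blinfun.bounded_linear_right R(2), of P x] unfolding PQ .
  qed
  have RQ: "R \<cdot> (?Q (2 * k + 1) \<cdot> x) = 0" for k x
  proof (rule sums_unique2[OF R(2)])
    have "?Q (2 * i) \<cdot> (?Q (2 * k + 1) \<cdot> x) = 0" for i by (rule Qo) presburger
    thus "(\<lambda>i. ?Q (2 * i) \<cdot> (?Q (2 * k + 1) \<cdot> x)) sums 0" by simp
  qed
  show ?thesis
  proof (rule that[of R])
    show "big R" by (rule big_of_copies[OF d, of "\<lambda>k. ?Q (2 * k)"]) (use Qm Qd Qo R in auto)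
    show "P \<cdot> (R \<cdot> x) = R \<cdot> x" for x by (rule PR)
    show "big (P - R)"
    proof (rule big_of_copies[OF d, of "\<lambda>k. ?Q (2 * k + 1)"])
      show "mproj (P - R)" by (rule mproj_diff[OF P R(1) PR])
      show "(P - R) \<cdot> (?Q (2 * k + 1) \<cdot> x) = ?Q (2 * k + 1) \<cdot> x" for k x
        by (simp only: blinfun.diff_left PQ RQ diff_zero)
    qed (use Qm Qd Qo in auto)
  qed
qed

end

section \<open>Reserving pieces of an operator\<close>

lemma incseq_Ioc: "incseq (\<lambda>n. {l<..c - inverse (real (Suc n))})" for c l :: real
proof (intro incseq_SucI subsetI)
  have inv: "inverse (real (Suc (Suc n))) \<le> inverse (real (Suc n))" for n by (simp add: le_imp_inverse_le)
  fix n y assume "y \<in> {l<..c - inverse (real (Suc n))}"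
  thus "y \<in> {l<..c - inverse (real (Suc (Suc n)))}" using inv[of n] unfolding greaterThanAtMost_iff by linarith
qed

lemma UN_Ioc: "(\<Union>n. {l<..c - inverse (real (Suc n))}) = {l<..<c}" for c l :: real
proof (intro equalityI subsetI)
  fix y assume y: "y \<in> {l<..<c}"
  then obtain n where "inverse (real (Suc n)) < c - y" using reals_Archimedean[of "c - y"] by auto
  hence "y \<in> {l<..c - inverse (real (Suc n))}"
    using y unfolding greaterThanAtMost_iff greaterThanLessThan_iff by linarith
  thus "y \<in> (\<Union>n. {l<..c - inverse (real (Suc n))})" by (rule UN_I[OF UNIV_I])
next
  fix y assume "y \<in> (\<Union>n. {l<..c - inverse (real (Suc n))})"
  then obtain n where "l < y" "y \<le> c - inverse (real (Suc n))" by auto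
  moreover have "0 < inverse (real (Suc n))" by simp
  ultimately have "l < y" "y < c" by linarith+
  thus "y \<in> {l<..<c}" by simp
qed

lemma incseq_Ioi: "incseq (\<lambda>n. {c + inverse (real (Suc n))<..})" for c :: real
proof (intro incseq_SucI subsetI)
  have inv: "inverse (real (Suc (Suc n))) \<le> inverse (real (Suc n))" for n by (simp add: le_imp_inverse_le)
  fix n y assume "y \<in> {c + inverse (real (Suc n))<..}"
  thus "y \<in> {c + inverse (real (Suc (Suc n)))<..}" using inv[of n] unfolding greaterThan_iff by linarith
qed

lemma UN_Ioi: "(\<Union>n. {c + inverse (real (Suc n))<..}) = {c<..}" for c :: real
proof (intro equalityI subsetI)
  fix y assume "y \<in> {c<..}"
  then obtain n where "inverse (real (Suc n)) < y - c" using reals_Archimedean[of "y - c"] by auto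
  hence "y \<in> {c + inverse (real (Suc n))<..}" unfolding greaterThan_iff by linarith
  thus "y \<in> (\<Union>n. {c + inverse (real (Suc n))<..})" by (rule UN_I[OF UNIV_I])
next
  fix y assume "y \<in> (\<Union>n. {c + inverse (real (Suc n))<..})"
  then obtain n where "c + inverse (real (Suc n)) < y" by auto
  moreover have "0 < inverse (real (Suc n))" by simp
  ultimately have "c < y" by linarith
  thus "y \<in> {c<..}" by simp
qed

lemma spec_incseq:
  assumes T: "sym_op T" and F: "range F \<subseteq> sets borel" "incseq F"
  shows "(\<lambda>n::nat. spec T (F n) \<cdot> x) \<longlonglongrightarrow> spec T (\<Union>n. F n) \<cdot> x"
proof -
  interpret fm: finite_measure "spec_meas T x" by (rule finite_spec_meas[OF T])
  let ?U = "\<Union>n. F n"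
  have m: "F n \<in> sets borel" for n using F(1) by auto
  hence U: "?U \<in> sets borel" by auto
  have "(\<lambda>n. measure (spec_meas T x) (F n)) \<longlonglongrightarrow> measure (spec_meas T x) ?U"
    using F by (intro fm.finite_Lim_measure_incseq) (auto simp: sets_spec_meas[OF T])
  hence "(\<lambda>n. measure (spec_meas T x) ?U - measure (spec_meas T x) (F n)) \<longlonglongrightarrow> measure (spec_meas T x) ?U - measure (spec_meas T x) ?U"
    by (intro tendsto_intros)
  moreover have "measure (spec_meas T x) ?U - measure (spec_meas T x) (F n) = (norm (spec T (F n) \<cdot> x - spec T ?U \<cdot> x))\<^sup>2" for n
  proof -
    have rp: "rproj (spec T ?U - spec T (F n))"
      by (rule rproj_diff[OF spec(1)[OF T U] spec(1)[OF T m]]) (rule spec_mono(1)[OF T m U], auto)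
    have "measure (spec_meas T x) ?U - measure (spec_meas T x) (F n) = inner ((spec T ?U - spec T (F n)) \<cdot> x) x"
      by (simp add: spec(2)[OF T] m U op_simps)
    also have "\<dots> = (norm (spec T ?U \<cdot> x - spec T (F n) \<cdot> x))\<^sup>2"
      unfolding rproj_inner[OF rp] by (simp add: blinfun.diff_left)
    finally show ?thesis by (simp add: norm_minus_commute)
  qed
  ultimately have "(\<lambda>n. (norm (spec T (F n) \<cdot> x - spec T ?U \<cdot> x))\<^sup>2) \<longlonglongrightarrow> 0" by simp
  hence "(\<lambda>n. norm (spec T (F n) \<cdot> x - spec T ?U \<cdot> x)) \<longlonglongrightarrow> 0" by (simp add: power_tendsto_0_iff)
  thus ?thesis by (simp add: tendsto_norm_zero_iff LIM_zero_iff)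
qed

lemma spec_singleton:
  assumes T: "sym_op T"
  shows "T \<cdot> (spec T {c} \<cdot> x) = c *\<^sub>R (spec T {c} \<cdot> x)"
proof -
  let ?E = "spec T {c}"
  have E: "rproj ?E" by (rule spec(1)[OF T]) simp
  have TE: "T \<cdot> (?E \<cdot> x) = ?E \<cdot> (T \<cdot> x)" for x by (rule spec_ocomm[OF T]) simp
  have "T o\<^sub>L ?E = c *\<^sub>R ?E"
  proof (rule sym_op_eqI)
    show "sym_op (T o\<^sub>L ?E)" using T rproj_sym[OF E] TE by (intro sym_op_compose) (auto simp: ocomm_def)
    show "sym_op (c *\<^sub>R ?E)" using rproj_sym[OF E] by simp
    fix x
    have "inner ((T o\<^sub>L ?E) \<cdot> x) x = inner (T \<cdot> (?E \<cdot> x)) (?E \<cdot> x)"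
      using E sym_opD[OF rproj_sym[OF E], of "T \<cdot> (?E \<cdot> x)" x] by (simp flip: TE)
    also have "\<dots> = c * (norm (?E \<cdot> x))\<^sup>2"
      by (rule antisym[OF spec_le[OF T] spec_ge[OF T]]) auto
    finally show "inner ((T o\<^sub>L ?E) \<cdot> x) x = inner ((c *\<^sub>R ?E) \<cdot> x) x"
      by (simp add: blinfun.scaleR_left rproj_inner[OF E])
  qed
  from arg_cong[OF this, of "\<lambda>S. S \<cdot> x"] show ?thesis by (simp add: blinfun.scaleR_left)
qed

section \<open>Cutting the spectrum of \<open>A\<close> inside a projection that commutes with
  it\<close>

context real_factor
begin

lemma mproj_compose:
  assumes "mproj P" "mproj Q" "ocomm P Q"
  shows "mproj (P o\<^sub>L Q)"
proof -
  have "sym_op (P o\<^sub>L Q)" using assms by (intro sym_op_compose) (auto intro: rproj_sym)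
  moreover have "(P o\<^sub>L Q) \<cdot> ((P o\<^sub>L Q) \<cdot> x) = (P o\<^sub>L Q) \<cdot> x" for x
    using assms(1,2) by (simp flip: ocommD[OF assms(3)] add: mprojD)
  ultimately show ?thesis using assms(1,2) by (auto simp: mproj_def rproj_def)
qed

lemma mproj_add:
  assumes "mproj P" "mproj Q" "\<And>x. P \<cdot> (Q \<cdot> x) = 0"
  shows "mproj (P + Q)"
proof -
  have "Q \<cdot> (P \<cdot> x) = 0" for x by (rule rproj_orth_sym) (use assms in auto)
  thus ?thesis using assms by (auto simp: mproj_def rproj_def op_simps)
qed

lemma not_big_zero: "\<not> big 0"
proof
  assume "big 0"
  then obtain V where "emb V id_blinfun 0" by (auto simp: big_def subeq_def)
  hence "x = 0" for x :: 'a using embD(2,3)[of V id_blinfun 0 x] by simp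
  hence "S = T" for S T :: "'a \<Rightarrow>\<^sub>L 'a" by (intro blinfun_eqI) metis
  thus False using nonunitary_isometry by blast
qed

context
  fixes A G :: "'a \<Rightarrow>\<^sub>L 'a"
  assumes A: "A \<in> M" "psd A" and G: "mproj G" "ocomm A G"
begin

abbreviation cut :: "real set \<Rightarrow> 'a \<Rightarrow>\<^sub>L 'a" where
  "cut S \<equiv> G o\<^sub>L spec A S"

lemma As: "sym_op A" by (rule psd_sym[OF A(2)])

lemma cut_comm: "S \<in> sets borel \<Longrightarrow> G \<cdot> (spec A S \<cdot> x) = spec A S \<cdot> (G \<cdot> x)"
  by (rule ocommD[OF spec(3)[OF As]]) (use G(2) ocomm_sym in auto)

lemma cut_mproj: "S \<in> sets borel \<Longrightarrow> mproj (cut S)"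
  by (rule mproj_compose[OF G(1) mproj_spec[OF A(1) As]]) (auto simp: ocomm_def cut_comm)

lemma cut_ocomm: "S \<in> sets borel \<Longrightarrow> ocomm A (cut S)"
  using G(2) spec_ocomm[OF As] by (simp add: ocomm_def)

lemma cut_Int: "S \<in> sets borel \<Longrightarrow> U \<in> sets borel \<Longrightarrow> cut S \<cdot> (cut U \<cdot> x) = cut (S \<inter> U) \<cdot> x"
  using mprojD(2)[OF G(1)] by (simp add: spec_Int[OF As] flip: cut_comm)

lemma cut_mono: "S \<in> sets borel \<Longrightarrow> U \<in> sets borel \<Longrightarrow> S \<subseteq> U \<Longrightarrow> cut U \<cdot> (cut S \<cdot> x) = cut S \<cdot> x"
  by (subst cut_Int) (auto simp: Int_absorb1)

lemma cut_disjoint: "S \<in> sets borel \<Longrightarrow> U \<in> sets borel \<Longrightarrow> S \<inter> U = {} \<Longrightarrow> cut S \<cdot> (cut U \<cdot> x) = 0"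
  by (subst cut_Int) (auto simp: spec_empty[OF As])

lemma cut_Un: "S \<in> sets borel \<Longrightarrow> U \<in> sets borel \<Longrightarrow> S \<inter> U = {} \<Longrightarrow> cut (S \<union> U) = cut S + cut U"
  by (intro blinfun_eqI) (simp add: spec_Un[OF As] op_simps)

lemma cut_G: "S \<in> sets borel \<Longrightarrow> G \<cdot> (cut S \<cdot> x) = cut S \<cdot> x" "S \<in> sets borel \<Longrightarrow> cut S \<cdot> (G \<cdot> x) = cut S \<cdot> x"
  using mprojD(2)[OF G(1)] by (simp_all flip: cut_comm)

lemma cut_incseq: "range F \<subseteq> sets borel \<Longrightarrow> incseq F \<Longrightarrow> (\<lambda>n::nat. cut (F n) \<cdot> x) \<longlonglongrightarrow> cut (\<Union>n. F n) \<cdot> x"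
  by (simp only: blinfun_apply_blinfun_compose) (intro blinfun_tendsto spec_incseq As)

lemma cut_ge:
  assumes "S \<in> sets borel" "S \<subseteq> {a..}"
  shows "a * (norm (cut S \<cdot> x))\<^sup>2 \<le> inner (A \<cdot> (cut S \<cdot> x)) (cut S \<cdot> x)"
  using spec_ge[OF As assms, of "G \<cdot> x"] assms(1) by (simp add: cut_comm)

lemma cut_high: "norm A \<le> s \<Longrightarrow> cut {s<..} = 0"
  by (intro blinfun_eqI) (simp add: spec_greaterThan[OF As] spec_gt_high[OF As])

text \<open>Below an eigenprojection \<open>A\<close> acts as the scalar \<open>c\<close>, so every
  projection there commutes with it. Eigenspaces may therefore be divided by comparison theory,
  whereas the other pieces are cut spectrally.\<close>

lemma atom_ocomm:
  assumes J: "mproj J" "\<And>x. cut {c} \<cdot> (J \<cdot> x) = J \<cdot> x"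
  shows "A \<cdot> (J \<cdot> x) = c *\<^sub>R (J \<cdot> x)" "ocomm A J"
proof -
  have 1: "A \<cdot> (J \<cdot> x) = c *\<^sub>R (J \<cdot> x)" for x
  proof -
    have "J \<cdot> x = spec A {c} \<cdot> (G \<cdot> (J \<cdot> x))" using J(2)[of x] by (simp add: cut_comm)
    thus ?thesis by (metis spec_singleton[OF As])
  qed
  thus "A \<cdot> (J \<cdot> x) = c *\<^sub>R (J \<cdot> x)" .
  have "J \<cdot> (A \<cdot> x) = c *\<^sub>R (J \<cdot> x)" for x
    by (rule inner_eq_all_imp_eq)
      (use J(1) in \<open>simp add: sym_opD[OF rproj_sym] mprojD sym_opD[OF As] 1\<close>)
  thus "ocomm A J" by (simp add: ocomm_def 1)
qed

end

text \<open>The supremum \<open>c\<close> of the levels above which \<open>G\<close> has infinite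
  spectrum is at least \<open>\<alpha>\<close>, and the piece must not consume what keeps the
  spectrum near \<open>c\<close> infinite. An infinite eigenspace at \<open>c\<close> is divided in
  two. If (s,c) is infinite for every \<open>s < c\<close>, a set bounded away from \<open>c\<close>
  is taken. Otherwise (c,\<infinity>) is infinite, and the part above some \<open>\<mu> > c\<close>
  is taken, which leaves the infinite (c,\<mu>]. \<open>F1\<close> and \<open>F2\<close> express
  additivity and continuity of infiniteness; a trace or type III supplies them.\<close>

lemma reserve_step:
  assumes A: "A \<in> M" "psd A" and G: "mproj G" "ocomm A G"
    and F1: "\<And>P Q. mproj P \<Longrightarrow> mproj Q \<Longrightarrow> (\<And>x. P \<cdot> (Q \<cdot> x) = 0) \<Longrightarrow> big (P + Q) \<Longrightarrow> big P \<or> big Q"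
    and F2: "\<And>J P. (\<And>n. mproj (J n)) \<Longrightarrow> (\<And>n x. J (Suc n) \<cdot> (J n \<cdot> x) = J n \<cdot> x) \<Longrightarrow>
      (\<And>x. (\<lambda>n::nat. J n \<cdot> x) \<longlonglongrightarrow> P \<cdot> x) \<Longrightarrow> big P \<Longrightarrow> \<exists>n. subeq e (J n)"
    and e: "mproj e"
    and inf: "\<And>l. l < \<alpha> \<Longrightarrow> big (G o\<^sub>L spec A {l<..})" and l: "l < \<alpha>"
  shows "\<exists>J. mproj J \<and> (\<forall>x. G \<cdot> (J \<cdot> x) = J \<cdot> x) \<and> ocomm A J \<and> subeq e J \<and>
    (\<forall>x. l * (norm (J \<cdot> x))\<^sup>2 \<le> inner (A \<cdot> (J \<cdot> x)) (J \<cdot> x)) \<and>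
    (\<forall>l<\<alpha>. big ((G - J) o\<^sub>L spec A {l<..}))"
proof -
  note c = A G
  let ?g = "\<lambda>S. G o\<^sub>L spec A S"
  note Asym = psd_sym[OF A(2)]
  note gm = cut_mproj[OF c] and gmono = cut_mono[OF c] and gG = cut_G[OF c]
  have g_big_mono: "big (?g U)" if "big (?g S)" "S \<in> sets borel" "U \<in> sets borel" "S \<subseteq> U" for S U
    by (rule big_mono[OF that(1) gm[OF that(3)] gmono[OF that(2-4)]])
  define D where "D = {s. big (?g {s<..})}"
  have bdd: "bdd_above D"
  proof (rule bdd_aboveI[of _ "norm A"])
    fix s assume "s \<in> D"
    show "s \<le> norm A"
    proof (rule ccontr)
      assume "\<not> s \<le> norm A"
      hence "?g {s<..} = 0" by (intro cut_high[OF c]) simp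
      thus False using \<open>s \<in> D\<close> not_big_zero by (simp add: D_def)
    qed
  qed
  have inD: "s \<in> D" if "s < \<alpha>" for s using inf that by (simp add: D_def)
  define c where "c = Sup D"
  have below: "s \<in> D" if "s < c" for s
  proof -
    have "D \<noteq> {}" using inD[OF l] by auto
    from less_cSupD[OF this that[unfolded c_def]] obtain s' where "s' \<in> D" "s < s'" by blast
    thus ?thesis using g_big_mono[of "{s'<..}" "{s<..}"] by (auto simp: D_def)
  qed
  have above: "\<not> big (?g {s<..})" if "c < s" for s
    using that cSup_upper[OF _ bdd, of s] by (auto simp: c_def D_def)
  have \<alpha>c: "\<alpha> \<le> c"
  proof (rule dense_le)
    fix s assume "s < \<alpha>"
    thus "s \<le> c" unfolding c_def by (intro cSup_upper bdd inD)
  qed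
  have rest: "big ((G - J) o\<^sub>L spec A {l'<..})"
    if J: "mproj J" "\<And>x. G \<cdot> (J \<cdot> x) = J \<cdot> x" "ocomm A J" and B: "big B" "\<And>x. J \<cdot> (B \<cdot> x) = 0" "\<And>x. ?g {l'<..} \<cdot> (B \<cdot> x) = B \<cdot> x"
    for J B l'
  proof (rule big_mono[OF B(1)])
    have "mproj (G - J)" by (rule mproj_diff[OF G(1) J(1,2)])
    moreover have "ocomm A (G - J)" using G(2) J(3) by simp
    ultimately show "mproj ((G - J) o\<^sub>L spec A {l'<..})" by (intro cut_mproj[OF A]) auto
    fix x
    have "spec A {l'<..} \<cdot> (B \<cdot> x) = B \<cdot> x"
    proof -
      have "B \<cdot> x = spec A {l'<..} \<cdot> (G \<cdot> (B \<cdot> x))" using B(3)[of x] by (simp add: cut_comm[OF c])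
      thus ?thesis using rproj_idem[OF spec(1)[OF Asym, of "{l'<..}"]] by (metis borel_open open_greaterThan)
    qed
    moreover from this have "G \<cdot> (B \<cdot> x) = B \<cdot> x" using B(3)[of x] by simp
    ultimately show "((G - J) o\<^sub>L spec A {l'<..}) \<cdot> (B \<cdot> x) = B \<cdot> x" by (simp add: blinfun.diff_left B(2))
  qed
  have cutJ: ?thesis
    if J: "J = ?g S" "S \<in> sets borel" "S \<subseteq> {l..}" "subeq e J"
      and B: "\<And>l'. l' < \<alpha> \<Longrightarrow> \<exists>U. U \<in> sets borel \<and> S \<inter> U = {} \<and> U \<subseteq> {l'<..} \<and> big (?g U)" for J S
  proof (intro exI[of _ J] conjI allI impI)
    show 1: "mproj J" "G \<cdot> (J \<cdot> x) = J \<cdot> x" "ocomm A J" "subeq e J" for x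
      using J gm gG cut_ocomm[OF c] by auto
    show "l * (norm (J \<cdot> x))\<^sup>2 \<le> inner (A \<cdot> (J \<cdot> x)) (J \<cdot> x)" for x
      unfolding J(1) by (rule cut_ge[OF c J(2,3)])
    fix l' assume "l' < \<alpha>"
    then obtain U where U: "U \<in> sets borel" "S \<inter> U = {}" "U \<subseteq> {l'<..}" "big (?g U)" using B by blast
    show "big ((G - J) o\<^sub>L spec A {l'<..})"
    proof (rule rest[OF 1(1-3) U(4)])
      show "J \<cdot> (?g U \<cdot> x) = 0" for x unfolding J(1) by (rule cut_disjoint[OF c J(2) U(1,2)])
      show "?g {l'<..} \<cdot> (?g U \<cdot> x) = ?g U \<cdot> x" for x by (rule gmono) (use U in auto)
    qed
  qed
  consider (atom) "big (?g {c})" | (left) "\<forall>s<c. big (?g {s<..<c})"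
    | (right) "\<not> big (?g {c})" "\<exists>s<c. \<not> big (?g {s<..<c})" by blast
  thus ?thesis
  proof cases
    case atom
    obtain J where J: "big J" "\<And>x. ?g {c} \<cdot> (J \<cdot> x) = J \<cdot> x" "big (?g {c} - J)"
      by (rule big_split[OF atom]) (rule that)
    have Jm: "mproj J" using J(1) by (simp add: big_def)
    note Jc = atom_ocomm[OF A G Jm J(2)]
    have GJ: "G \<cdot> (J \<cdot> x) = J \<cdot> x" for x using gG(1)[of "{c}" "J \<cdot> x"] by (simp add: J(2) del: blinfun_apply_blinfun_compose)
    show ?thesis
    proof (intro exI[of _ J] conjI allI impI)
      show "l * (norm (J \<cdot> x))\<^sup>2 \<le> inner (A \<cdot> (J \<cdot> x)) (J \<cdot> x)" for x
        using l \<alpha>c by (simp add: Jc mult_right_mono flip: power2_norm_eq_inner)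
      show "subeq e J" by (rule big_subeq[OF J(1) e])
      fix l' assume l': "l' < \<alpha>"
      show "big ((G - J) o\<^sub>L spec A {l'<..})"
      proof (rule rest[OF Jm GJ Jc(2) J(3)])
        have Jg: "J \<cdot> (?g {c} \<cdot> x) = J \<cdot> x" for x by (rule rproj_le_sym[OF mprojD(2)[OF Jm] mprojD(2)[OF gm] J(2)]) simp
        show "J \<cdot> ((?g {c} - J) \<cdot> x) = 0" for x
          unfolding blinfun.diff_left blinfun.diff_right Jg using mprojD(2)[OF Jm] by simp
        fix x
        have 1: "?g {l'<..} \<cdot> (?g {c} \<cdot> y) = ?g {c} \<cdot> y" for y by (rule gmono) (use l' \<alpha>c in auto)
        have 2: "?g {l'<..} \<cdot> (J \<cdot> y) = J \<cdot> y" for y using 1[of "J \<cdot> y"] by (simp only: J(2))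
        show "?g {l'<..} \<cdot> ((?g {c} - J) \<cdot> x) = (?g {c} - J) \<cdot> x"
          by (simp only: blinfun.diff_left blinfun.diff_right 1 2)
      qed
    qed (use Jm GJ Jc in auto)
  next
    case left
    let ?F = "\<lambda>n. {l<..c - inverse (real (Suc n))}"
    note inc = incseq_Ioc[of l c] and un = UN_Ioc[of l c]
    have rb: "range ?F \<subseteq> sets borel" by (rule image_subsetI) simp
    have "\<exists>n. subeq e (?g (?F n))"
    proof (rule F2[of "\<lambda>n. ?g (?F n)" "?g {l<..<c}"])
      show "mproj (?g (?F n))" for n by (rule gm) simp
      show "?g (?F (Suc n)) \<cdot> (?g (?F n) \<cdot> x) = ?g (?F n) \<cdot> x" for n x
        by (rule gmono) (use incseq_SucD[OF inc] in auto)
      show "(\<lambda>n. ?g (?F n) \<cdot> x) \<longlonglongrightarrow> ?g {l<..<c} \<cdot> x" for x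
        using cut_incseq[OF c rb inc, of x] unfolding un .
      show "big (?g {l<..<c})" using left l \<alpha>c by auto
    qed
    then obtain n where n: "subeq e (?g (?F n))" ..
    show ?thesis
    proof (rule cutJ[OF refl _ _ n])
      fix l' assume l': "l' < \<alpha>"
      \<comment> \<open>Whatever lies above the piece, above \<open>l'\<close> and below
        \<open>c\<close> is still infinite and untouched.\<close>
      let ?s = "max l' (c - inverse (real (Suc n)))"
      have "?s < c" using l' \<alpha>c by auto
      hence "big (?g {?s<..<c})" using left by blast
      thus "\<exists>U. U \<in> sets borel \<and> ?F n \<inter> U = {} \<and> U \<subseteq> {l'<..} \<and> big (?g U)"
        by (intro exI[of _ "{?s<..<c}"]) auto
    qed auto
  next
    case right
    then obtain s0 where s0: "s0 < c" "\<not> big (?g {s0<..<c})" by blast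
    have s0_Un: "{s0<..} = ({s0<..<c} \<union> {c}) \<union> {c<..}" using s0(1) by auto
    have "?g {s0<..} = ?g ({s0<..<c} \<union> {c}) + ?g {c<..}" unfolding s0_Un by (rule cut_Un[OF c]) auto
    hence "big (?g ({s0<..<c} \<union> {c}) + ?g {c<..})" using below[OF s0(1)] by (simp add: D_def)
    hence "big (?g ({s0<..<c} \<union> {c})) \<or> big (?g {c<..})"
      by (intro F1 gm cut_disjoint[OF c]) auto
    moreover have "\<not> big (?g ({s0<..<c} \<union> {c}))"
    proof
      assume "big (?g ({s0<..<c} \<union> {c}))"
      moreover have "?g ({s0<..<c} \<union> {c}) = ?g {s0<..<c} + ?g {c}" by (rule cut_Un[OF c]) auto
      ultimately have "big (?g {s0<..<c}) \<or> big (?g {c})"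
        by (intro F1 gm cut_disjoint[OF c]) auto
      thus False using s0(2) right(1) by blast
    qed
    ultimately have bc: "big (?g {c<..})" by blast
    let ?F = "\<lambda>n. {c + inverse (real (Suc n))<..}"
    note inc = incseq_Ioi[of c] and un = UN_Ioi[of c]
    have rb: "range ?F \<subseteq> sets borel" by (rule image_subsetI) simp
    have "\<exists>n. subeq e (?g (?F n))"
    proof (rule F2[of "\<lambda>n. ?g (?F n)" "?g {c<..}"])
      show "mproj (?g (?F n))" for n by (rule gm) simp
      show "?g (?F (Suc n)) \<cdot> (?g (?F n) \<cdot> x) = ?g (?F n) \<cdot> x" for n x
        by (rule gmono) (use incseq_SucD[OF inc] in auto)
      show "(\<lambda>n. ?g (?F n) \<cdot> x) \<longlonglongrightarrow> ?g {c<..} \<cdot> x" for x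
        using cut_incseq[OF c rb inc, of x] unfolding un .
    qed (rule bc)
    then obtain n where n: "subeq e (?g (?F n))" ..
    \<comment> \<open>The part above \<open>\<mu>\<close> contains a copy of \<open>e\<close> but is
      not infinite, because \<open>\<mu>\<close> exceeds the supremum \<open>c\<close>; so the
      infinite part of (c,\<infinity>) sits in (c,\<mu>].\<close>
    define \<mu> where "\<mu> = c + inverse (real (Suc n))"
    have \<mu>: "c < \<mu>" by (simp add: \<mu>_def)
    have c_Un: "{c<..} = {c<..\<mu>} \<union> {\<mu><..}" using \<mu> by auto
    have "?g {c<..} = ?g {c<..\<mu>} + ?g {\<mu><..}" unfolding c_Un by (rule cut_Un[OF c]) auto
    hence "big (?g {c<..\<mu>} + ?g {\<mu><..})" using bc by simp
    hence "big (?g {c<..\<mu>}) \<or> big (?g {\<mu><..})"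
      by (intro F1 gm cut_disjoint[OF c]) auto
    hence b: "big (?g {c<..\<mu>})" using above[OF \<mu>] by blast
    show ?thesis
    proof (rule cutJ[OF refl _ _ n, folded \<mu>_def])
      show "{\<mu><..} \<subseteq> {l..}" using l \<alpha>c \<mu> by auto
      fix l' assume l': "l' < \<alpha>"
      show "\<exists>U. U \<in> sets borel \<and> {\<mu><..} \<inter> U = {} \<and> U \<subseteq> {l'<..} \<and> big (?g U)"
        using b l' \<alpha>c by (intro exI[of _ "{c<..\<mu>}"]) auto
    qed auto
  qed
qed

text \<open>Shared by the greedy constructions of reserved pieces, of copies in a projection of
  infinite trace and of slices: what is removed later lies in every earlier remainder.\<close>

lemma orthogonal_remainders:
  assumes R: "\<And>k. mproj (R k)" and J: "\<And>k. mproj (J k)" "\<And>k x. R k \<cdot> (J k \<cdot> x) = J k \<cdot> x"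
    and RS: "\<And>k::nat. R (Suc k) = R k - J k"
  shows "i \<noteq> j \<Longrightarrow> J i \<cdot> (J j \<cdot> x) = 0" "i \<le> j \<Longrightarrow> R i \<cdot> (R j \<cdot> x) = R j \<cdot> x"
proof -
  have JR: "J k \<cdot> (R k \<cdot> x) = J k \<cdot> x" for k x by (rule rproj_le_sym) (use R J in auto)
  have JRS: "J k \<cdot> (R (Suc k) \<cdot> x) = 0" for k x
    using mprojD(2)[OF J(1)] by (simp add: RS op_simps JR)
  have dec: "R i \<cdot> (R (i + d) \<cdot> x) = R (i + d) \<cdot> x" for i d x
  proof (induction d arbitrary: x)
    case 0 thus ?case using mprojD(2)[OF R] by simp
  next
    case (Suc d)
    have "R (i + d) \<cdot> (R (Suc (i + d)) \<cdot> x) = R (Suc (i + d)) \<cdot> x"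
      using mprojD(2)[OF R, of "i + d"] by (simp add: RS op_simps J(2))
    thus ?case using Suc[of "R (Suc (i + d)) \<cdot> x"] by simp
  qed
  thus "i \<le> j \<Longrightarrow> R i \<cdot> (R j \<cdot> x) = R j \<cdot> x" using le_Suc_ex by blast
  have lt: "J i \<cdot> (J j \<cdot> x) = 0" if "i < j" for i j x
  proof -
    obtain d where d: "j = Suc i + d" using less_imp_Suc_add[OF \<open>i < j\<close>] by auto
    have "R (Suc i) \<cdot> (R j \<cdot> (J j \<cdot> x)) = R j \<cdot> (J j \<cdot> x)" unfolding d by (rule dec)
    hence "R (Suc i) \<cdot> (J j \<cdot> x) = J j \<cdot> x" by (simp only: J(2))
    thus ?thesis using JRS[of i "J j \<cdot> x"] by simp
  qed
  show "J i \<cdot> (J j \<cdot> x) = 0" if "i \<noteq> j"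
  proof (cases "i < j")
    case False
    hence "j < i" using that by simp
    thus ?thesis by (intro rproj_orth_sym[of "J j"]) (use J lt in auto)
  qed (rule lt)
qed

text \<open>Dependent choice on the remainder, iterating \<open>reserve_step\<close>. The invariant
  \<open>OK\<close> keeps the remainder infinite above every level below \<open>\<alpha>\<close>, so
  each prescribed bound \<open>t k\<close> can be met afresh.\<close>

lemma reserve:
  assumes A: "A \<in> M" "psd A"
    and F1: "\<And>P Q. mproj P \<Longrightarrow> mproj Q \<Longrightarrow> (\<And>x. P \<cdot> (Q \<cdot> x) = 0) \<Longrightarrow> big (P + Q) \<Longrightarrow> big P \<or> big Q"
    and F2: "\<And>J P. (\<And>n. mproj (J n)) \<Longrightarrow> (\<And>n x. J (Suc n) \<cdot> (J n \<cdot> x) = J n \<cdot> x) \<Longrightarrow>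
      (\<And>x. (\<lambda>n::nat. J n \<cdot> x) \<longlonglongrightarrow> P \<cdot> x) \<Longrightarrow> big P \<Longrightarrow> \<exists>n. subeq e (J n)"
    and e: "mproj e"
    and inf: "\<And>l. l < \<alpha> \<Longrightarrow> big (spec A {l<..})" and t: "\<And>k::nat. t k < \<alpha>"
  obtains J where "\<And>k. mproj (J k)" "\<And>k. ocomm A (J k)" "\<And>k. subeq e (J k)"
    "\<And>k x. t k * (norm (J k \<cdot> x))\<^sup>2 \<le> inner (A \<cdot> (J k \<cdot> x)) (J k \<cdot> x)"
    "\<And>i j x. i \<noteq> j \<Longrightarrow> J i \<cdot> (J j \<cdot> x) = 0"
proof -
  define OK where "OK G \<longleftrightarrow> mproj G \<and> ocomm A G \<and> (\<forall>l<\<alpha>. big (G o\<^sub>L spec A {l<..}))" for G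
  define ST where "ST k G J \<longleftrightarrow> mproj J \<and> (\<forall>x. G \<cdot> (J \<cdot> x) = J \<cdot> x) \<and> ocomm A J \<and> subeq e J \<and>
    (\<forall>x. t k * (norm (J \<cdot> x))\<^sup>2 \<le> inner (A \<cdot> (J \<cdot> x)) (J \<cdot> x))" for k G J
  have OK0: "OK id_blinfun"
  proof -
    have "id_blinfun o\<^sub>L S = S" for S :: "'a \<Rightarrow>\<^sub>L 'a" by (rule blinfun_eqI) simp
    thus ?thesis using inf by (simp add: OK_def)
  qed
  have step: "\<exists>G'. OK G' \<and> (\<exists>J. G' = G - J \<and> ST k G J)" if "OK G" for G k
  proof -
    have G: "mproj G" "ocomm A G" "\<And>l. l < \<alpha> \<Longrightarrow> big (G o\<^sub>L spec A {l<..})" using that by (auto simp: OK_def)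
    have "\<exists>J. ST k G J \<and> (\<forall>l<\<alpha>. big ((G - J) o\<^sub>L spec A {l<..}))"
      unfolding ST_def conj_assoc by (rule reserve_step[OF A G(1,2) F1 F2 e G(3) t])
    then obtain J where J: "ST k G J" "\<forall>l<\<alpha>. big ((G - J) o\<^sub>L spec A {l<..})" by (elim exE conjE)
    have Jm: "mproj J" "\<And>x. G \<cdot> (J \<cdot> x) = J \<cdot> x" "ocomm A J" using J(1) by (simp_all add: ST_def)
    have "mproj (G - J)" by (rule mproj_diff[OF G(1) Jm(1,2)])
    hence "OK (G - J)" using J(2) G(2) Jm(3) by (simp add: OK_def)
    thus ?thesis using J(1) by (intro exI[of _ "G - J"] conjI exI[of _ J] refl)
  qed
  obtain R where R: "\<And>k. OK (R k)" "\<And>k. \<exists>J. R (Suc k) = R k - J \<and> ST k (R k) J"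
  proof -
    have "\<exists>f. \<forall>k. OK (f k) \<and> (\<exists>J. f (Suc k) = f k - J \<and> ST k (f k) J)"
      using dependent_nat_choice[of "\<lambda>_. OK" "\<lambda>k G G'. \<exists>J. G' = G - J \<and> ST k G J", OF exI[of OK, OF OK0] step] .
    thus thesis using that by (elim exE) blast
  qed
  define J where "J k = (SOME J. R (Suc k) = R k - J \<and> ST k (R k) J)" for k
  have J: "R (Suc k) = R k - J k" "ST k (R k) (J k)" for k
    using someI_ex[OF R(2)[of k]] unfolding J_def by (rule conjunct1, rule conjunct2)
  have Rm: "mproj (R k)" for k using R(1) by (simp add: OK_def)
  have Jm: "mproj (J k)" "R k \<cdot> (J k \<cdot> x) = J k \<cdot> x" for k x using J(2)[of k] by (simp_all add: ST_def)
  show ?thesis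
  proof (rule that[of J])
    show "J i \<cdot> (J j \<cdot> x) = 0" if "i \<noteq> j" for i j x
      by (rule orthogonal_remainders(1)[where R = R and J = J, OF Rm Jm J(1) that])
  qed (use J(2) in \<open>auto simp: ST_def\<close>)
qed

end

section \<open>Traces\<close>

text \<open>Normality has the form in which limits arise here, for increasing sequences with a
  strong limit; \<open>trace_factor_of_factor_trace\<close> derives it from suprema of directed
  sets.\<close>

locale trace_factor = real_factor M for M :: "('a::{real_inner,banach} \<Rightarrow>\<^sub>L 'a) set" +
  fixes \<tau> :: "('a \<Rightarrow>\<^sub>L 'a) \<Rightarrow> ennreal"
  assumes tr_add: "S \<in> M \<Longrightarrow> psd S \<Longrightarrow> T \<in> M \<Longrightarrow> psd T \<Longrightarrow> \<tau> (S + T) = \<tau> S + \<tau> T"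
    and tr_scale: "T \<in> M \<Longrightarrow> psd T \<Longrightarrow> 0 \<le> c \<Longrightarrow> \<tau> (c *\<^sub>R T) = ennreal c * \<tau> T"
    and tr_comm: "X \<in> M \<Longrightarrow> \<tau> (radj X o\<^sub>L X) = \<tau> (X o\<^sub>L radj X)"
    and tr_faithful: "T \<in> M \<Longrightarrow> psd T \<Longrightarrow> \<tau> T = 0 \<Longrightarrow> T = 0"
    and tr_normal: "(\<And>n. F n \<in> M) \<Longrightarrow> (\<And>n. psd (F n)) \<Longrightarrow> (\<And>n. psd (F (Suc n) - F n)) \<Longrightarrow>
      (\<And>x. (\<lambda>n::nat. F n \<cdot> x) \<longlonglongrightarrow> S \<cdot> x) \<Longrightarrow> \<tau> S = (SUP n. \<tau> (F n))"
    and tr_semifinite: "T \<in> M \<Longrightarrow> psd T \<Longrightarrow> T \<noteq> 0 \<Longrightarrow> \<exists>S\<in>M. psd S \<and> S \<noteq> 0 \<and> psd (T - S) \<and> \<tau> S < \<infinity>"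
begin

lemma tr_zero: "\<tau> 0 = 0"
  using tr_scale[of 0 0] by simp

lemma tr_mono: "S \<in> M \<Longrightarrow> psd S \<Longrightarrow> T \<in> M \<Longrightarrow> psd (T - S) \<Longrightarrow> \<tau> S \<le> \<tau> T"
  using tr_add[of S "T - S"] by simp

lemma tr_proj_add: "mproj P \<Longrightarrow> mproj Q \<Longrightarrow> \<tau> (P + Q) = \<tau> P + \<tau> Q"
  by (intro tr_add) (auto intro: rproj_psd)

lemma tr_emb: "emb V e f \<Longrightarrow> \<tau> (V o\<^sub>L radj V) = \<tau> e"
proof -
  assume V: "emb V e f"
  have "radj V o\<^sub>L V = e" by (rule blinfun_eqI) (simp add: embD(2)[OF V])
  thus ?thesis using tr_comm[OF embD(1)[OF V]] by simp
qed

lemma mproj_psd_diff: "mproj e \<Longrightarrow> mproj f \<Longrightarrow> (\<And>x. f \<cdot> (e \<cdot> x) = e \<cdot> x) \<Longrightarrow> psd (f - e)"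
  by (rule rproj_psd, rule rproj_diff) auto

lemma tr_proj_mono: "mproj e \<Longrightarrow> mproj f \<Longrightarrow> (\<And>x. f \<cdot> (e \<cdot> x) = e \<cdot> x) \<Longrightarrow> \<tau> e \<le> \<tau> f"
  by (rule tr_mono) (auto intro: rproj_psd mproj_psd_diff)

lemma tr_subeq: "mproj e \<Longrightarrow> mproj f \<Longrightarrow> subeq e f \<Longrightarrow> \<tau> e \<le> \<tau> f"
proof -
  assume e: "mproj e" and f: "mproj f" and "subeq e f"
  then obtain V where V: "emb V e f" by (auto simp: subeq_def)
  have "\<tau> (V o\<^sub>L radj V) \<le> \<tau> f"
    by (rule tr_proj_mono[OF emb_final(1)[OF V e] f]) (simp add: embD(3)[OF V])
  thus ?thesis by (simp add: tr_emb[OF V])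
qed

lemma tr_proj_eq:
  assumes e: "mproj e" and f: "mproj f" and le: "\<And>x. f \<cdot> (e \<cdot> x) = e \<cdot> x" and t: "\<tau> f \<le> \<tau> e" "\<tau> e < \<infinity>"
  shows "e = f"
proof -
  have d: "mproj (f - e)" by (rule mproj_diff[OF f e le])
  have "\<tau> f = \<tau> e + \<tau> (f - e)" using tr_proj_add[OF e d] by simp
  hence "\<tau> e + \<tau> (f - e) \<le> \<tau> e + 0" using t(1) by simp
  hence "\<tau> (f - e) = 0" using t(2) by (subst (asm) ennreal_add_left_cancel_le) auto
  hence "f - e = 0" using d by (intro tr_faithful) (auto intro: rproj_psd)
  thus ?thesis by simp
qed

text \<open>By comparison only a copy of \<open>f\<close> inside \<open>e\<close> has to be treated.
  That copy has the trace of \<open>f\<close>, hence at least the finite trace of \<open>e\<close>;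
  by faithfulness it is all of \<open>e\<close>, and the partial isometry can be reversed.\<close>

lemma subeq_of_trace:
  assumes e: "mproj e" "\<tau> e < \<infinity>" and f: "mproj f" and t: "\<tau> e \<le> \<tau> f"
  shows "subeq e f"
proof (rule ccontr)
  assume n: "\<not> subeq e f"
  hence "subeq f e" using comparison[OF e(1) f] by blast
  then obtain V where V: "emb V f e" by (auto simp: subeq_def)
  have m: "mproj (V o\<^sub>L radj V)" by (rule emb_final(1)[OF V f])
  have "V o\<^sub>L radj V = e"
    by (rule tr_proj_eq[OF m e(1)]) (use embD(3)[OF V] tr_emb[OF V] t e(2) tr_subeq[OF f e(1) \<open>subeq f e\<close>] in auto)
  hence "V \<cdot> (radj V \<cdot> x) = e \<cdot> x" for x by (metis blinfun_apply_blinfun_compose)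
  moreover have "f \<cdot> (radj V \<cdot> x) = radj V \<cdot> x" for x
    by (rule partial_isometry(2)[of f V]) (use f embD(2)[OF V] in auto)
  ultimately have "emb (radj V) e f" using embD(1)[OF V] by (simp add: emb_def)
  thus False using n by (auto simp: subeq_def)
qed

lemma tr_limit_proj:
  assumes J: "\<And>n. mproj (J n)" "\<And>n x. J (Suc n) \<cdot> (J n \<cdot> x) = J n \<cdot> x" "\<And>x. (\<lambda>n::nat. J n \<cdot> x) \<longlonglongrightarrow> P \<cdot> x"
  shows "\<tau> P = (SUP n. \<tau> (J n))"
  by (rule tr_normal[of J, OF _ _ _ J(3)]) (use J(1,2) in \<open>auto intro: rproj_psd mproj_psd_diff\<close>)

text \<open>Semifiniteness supplies a positive \<open>S\<close> below \<open>P\<close> of finite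
  trace. A spectral projection \<open>e\<close> of \<open>S\<close> above some
  \<open>\<epsilon> > 0\<close> has \<open>\<epsilon> *\<^sub>R e\<close> below \<open>S\<close>,
  which bounds its trace, and it lies below \<open>P\<close> because \<open>S\<close> vanishes on
  the kernel of \<open>P\<close>.\<close>

lemma finite_subprojection:
  assumes P: "mproj P" "P \<noteq> 0"
  obtains e where "mproj e" "e \<noteq> 0" "\<And>x. P \<cdot> (e \<cdot> x) = e \<cdot> x" "\<tau> e < \<infinity>"
proof -
  obtain S where S: "S \<in> M" "psd S" "S \<noteq> 0" "psd (P - S)" "\<tau> S < \<infinity>"
    using tr_semifinite[of P] P rproj_psd by auto
  have Ss: "sym_op S" by (rule psd_sym[OF S(2)])
  have SP0: "S \<cdot> (x - P \<cdot> x) = 0" for x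
  proof (rule psd_kernel[OF S(2)], rule antisym)
    let ?y = "x - P \<cdot> x"
    have "inner (P \<cdot> ?y) ?y = 0" using P(1) by (simp add: blinfun.diff_right mprojD)
    thus "inner (S \<cdot> ?y) ?y \<le> 0" using psd_ge0[OF S(4), of ?y] by (simp add: blinfun.diff_left inner_diff_left)
  qed (rule psd_ge0[OF S(2)])
  hence SP: "S \<cdot> (P \<cdot> x) = S \<cdot> x" for x by (simp add: blinfun.diff_right)
  have PS: "P \<cdot> (S \<cdot> x) = S \<cdot> x" for x
    by (rule inner_eq_all_imp_eq) (simp add: sym_opD[OF rproj_sym[OF mprojD(2)[OF P(1)]]] sym_opD[OF Ss] SP)
  obtain x0 where x0: "S \<cdot> x0 \<noteq> 0" using S(3) by (metis blinfun_eqI blinfun.zero_left)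
  have "\<exists>n. spec_gt S (0 + inverse (real (Suc n))) \<cdot> x0 \<noteq> 0"
  proof (rule ccontr)
    assume "\<not> ?thesis"
    hence "(\<lambda>n. 0) \<longlonglongrightarrow> spec_gt S 0 \<cdot> x0" using spec_gt_right_cont[OF Ss, of 0 x0] by simp
    hence "spec_gt S 0 \<cdot> x0 = 0" by (simp add: LIMSEQ_const_iff)
    hence "inner (S \<cdot> x0) x0 \<le> 0" using spec_gt(4)[OF Ss, of x0 0] by simp
    hence "S \<cdot> x0 = 0" using psd_ge0[OF S(2), of x0] by (intro psd_kernel[OF S(2)]) simp
    thus False using x0 by simp
  qed
  then obtain n where n: "spec_gt S (0 + inverse (real (Suc n))) \<cdot> x0 \<noteq> 0" by blast
  define \<epsilon> where "\<epsilon> = inverse (real (Suc n))"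
  define e where "e = spec_gt S \<epsilon>"
  have \<epsilon>: "0 < \<epsilon>" by (simp add: \<epsilon>_def)
  have em: "mproj e" using spec_gt_closed[OF S(1) Ss] spec_gt(1)[OF Ss] by (simp add: e_def mproj_def)
  have e0: "e \<noteq> 0" using n by (auto simp: e_def \<epsilon>_def)
  have ge: "\<epsilon> * (norm (e \<cdot> x))\<^sup>2 \<le> inner (S \<cdot> (e \<cdot> x)) (e \<cdot> x)" for x unfolding e_def by (rule spec_gt(3)[OF Ss])
  have "ocomm P e" unfolding e_def by (rule spec_gt(2)[OF Ss]) (simp add: ocomm_def SP PS)
  hence Pe: "P \<cdot> (e \<cdot> x) = e \<cdot> (P \<cdot> x)" for x by (rule ocommD)
  have Pe': "P \<cdot> (e \<cdot> x) = e \<cdot> x" for x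
  proof -
    have "S \<cdot> (e \<cdot> (x - P \<cdot> x)) = 0"
      using SP0[of "e \<cdot> x"] by (simp add: blinfun.diff_right Pe)
    hence "\<epsilon> * (norm (e \<cdot> (x - P \<cdot> x)))\<^sup>2 \<le> 0" using ge[of "x - P \<cdot> x"] by simp
    hence "e \<cdot> (x - P \<cdot> x) = 0" using \<epsilon> by (simp add: mult_le_0_iff)
    thus ?thesis unfolding Pe by (simp add: blinfun.diff_right)
  qed
  have "psd (S - \<epsilon> *\<^sub>R e)"
    unfolding psd_diff_iff
  proof (intro conjI allI)
    show "sym_op (S - \<epsilon> *\<^sub>R e)" using Ss rproj_sym[OF mprojD(2)[OF em]] by simp
    fix x
    have c: "e \<cdot> (S \<cdot> x) = S \<cdot> (e \<cdot> x)" for x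
      using spec_gt(2)[OF Ss, of S] by (simp add: e_def ocomm_def)
    have "inner (S \<cdot> (e \<cdot> x)) (x - e \<cdot> x) = 0"
      by (rule trans[of _ "inner (e \<cdot> (S \<cdot> x)) (x - e \<cdot> x)"])
        (use em in \<open>simp_all add: c sym_opD[OF rproj_sym[OF mprojD(2)[OF em]], of "S \<cdot> x"] blinfun.diff_right mprojD flip: c\<close>)
    hence "inner (S \<cdot> x) x = inner (S \<cdot> (e \<cdot> x)) (e \<cdot> x) + inner (S \<cdot> (x - e \<cdot> x)) (x - e \<cdot> x)"
      using sym_op_swap[OF Ss, of "e \<cdot> x" x] sym_op_swap[OF Ss, of "e \<cdot> x" "e \<cdot> x"]
      by (simp add: op_simps)
    moreover have "0 \<le> inner (S \<cdot> (x - e \<cdot> x)) (x - e \<cdot> x)" by (rule psd_ge0[OF S(2)])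
    ultimately show "inner ((\<epsilon> *\<^sub>R e) \<cdot> x) x \<le> inner (S \<cdot> x) x"
      using ge[of x] by (simp add: blinfun.scaleR_left rproj_inner mprojD[OF em])
  qed
  hence "\<tau> (\<epsilon> *\<^sub>R e) \<le> \<tau> S" using rproj_psd[OF mprojD(2)[OF em]] em \<epsilon> S(1) by (intro tr_mono) auto
  moreover have "\<tau> (\<epsilon> *\<^sub>R e) = ennreal \<epsilon> * \<tau> e"
    by (rule tr_scale[OF mprojD(1)[OF em] rproj_psd[OF mprojD(2)[OF em]]]) (use \<epsilon> in simp)
  ultimately have "ennreal \<epsilon> * \<tau> e < top" using le_less_trans[OF _ S(5)] by simp
  hence "\<tau> e < \<infinity>" using \<epsilon> by (auto simp: ennreal_mult_less_top)
  from that[OF em e0 Pe' this] show ?thesis .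
qed

lemma tr_pos: "mproj e \<Longrightarrow> e \<noteq> 0 \<Longrightarrow> 0 < \<tau> e"
  using tr_faithful[of e] rproj_psd[of e] by (auto simp: zero_less_iff_neq_zero)

lemma tr_diff_infinite:
  assumes "mproj R" "mproj G" "\<And>x. R \<cdot> (G \<cdot> x) = G \<cdot> x" "\<tau> R = \<infinity>" "\<tau> G < \<infinity>"
  shows "\<tau> (R - G) = \<infinity>"
proof -
  have "\<tau> R = \<tau> G + \<tau> (R - G)" using tr_proj_add[OF assms(2) mproj_diff[OF assms(1-3)]] by simp
  hence "\<tau> G + \<tau> (R - G) = top" using assms(4) by simp
  thus ?thesis using assms(5) by (auto simp: ennreal_add_eq_top)
qed

text \<open>Removing a copy of a fixed projection of finite trace leaves infinite trace, so
  infinitely many orthogonal copies fit into \<open>P\<close>, and these absorb the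
  identity.\<close>

lemma tr_infinite_big:
  assumes P: "mproj P" "\<tau> P = \<infinity>"
  shows "big P"
proof -
  have "P \<noteq> 0" using P(2) tr_zero by auto
  then obtain e where e: "mproj e" "e \<noteq> 0" "\<tau> e < \<infinity>" using finite_subprojection[OF P(1)] by metis
  define OK where "OK R \<longleftrightarrow> mproj R \<and> \<tau> R = \<infinity>" for R
  define ST where "ST R Q \<longleftrightarrow> mproj Q \<and> (\<forall>x. R \<cdot> (Q \<cdot> x) = Q \<cdot> x) \<and> subeq e Q" for R Q
  have step: "\<exists>R'. OK R' \<and> (\<exists>Q. R' = R - Q \<and> ST R Q)" if "OK R" for R
  proof -
    have R: "mproj R" "\<tau> R = \<infinity>" using that by (auto simp: OK_def)
    have "subeq e R" by (rule subeq_of_trace[OF e(1,3) R(1)]) (simp add: R(2))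
    then obtain w where w: "emb w e R" by (auto simp: subeq_def)
    let ?Q = "w o\<^sub>L radj w"
    have Q: "mproj ?Q" "R \<cdot> (?Q \<cdot> x) = ?Q \<cdot> x" for x using emb_final[OF w e(1)] by auto
    have "w \<cdot> (e \<cdot> x) = w \<cdot> x" for x
      by (rule partial_isometry(1)[of e w]) (use e(1) embD(2)[OF w] in auto)
    hence "emb w e ?Q" using w by (simp add: emb_def)
    hence "ST R ?Q" using Q by (auto simp: ST_def subeq_def)
    moreover have "OK (R - ?Q)"
      using mproj_diff[OF R(1) Q] tr_diff_infinite[OF R(1) Q R(2)] e(3) by (simp add: OK_def tr_emb[OF w])
    ultimately show ?thesis by (intro exI[of _ "R - ?Q"] conjI exI[of _ ?Q] refl)
  qed
  have OKP: "OK P" using P by (simp add: OK_def)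
  obtain R where R0: "R 0 = P" and R: "\<And>k. OK (R k)" "\<And>k. \<exists>Q. R (Suc k) = R k - Q \<and> ST (R k) Q"
  proof -
    have "\<exists>f. \<forall>k. (OK (f k) \<and> (k = 0 \<longrightarrow> f k = P)) \<and> (\<exists>Q. f (Suc k) = f k - Q \<and> ST (f k) Q)"
      by (rule dependent_nat_choice[of "\<lambda>k R. OK R \<and> (k = 0 \<longrightarrow> R = P)" "\<lambda>k G G'. \<exists>Q. G' = G - Q \<and> ST G Q"])
        (use OKP step in auto)
    thus thesis using that by (elim exE) blast
  qed
  define Q where "Q k = (SOME Q. R (Suc k) = R k - Q \<and> ST (R k) Q)" for k
  have Q: "R (Suc k) = R k - Q k" "ST (R k) (Q k)" for k
    using someI_ex[OF R(2)[of k]] unfolding Q_def by (rule conjunct1, rule conjunct2)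
  have Rm: "mproj (R k)" for k using R(1) by (simp add: OK_def)
  have Qm: "mproj (Q k)" "R k \<cdot> (Q k \<cdot> x) = Q k \<cdot> x" "subeq e (Q k)" for k x
    using Q(2)[of k] by (simp_all add: ST_def)
  note orth = orthogonal_remainders[where R = R and J = Q, OF Rm Qm(1,2) Q(1)]
  show ?thesis
  proof (rule big_of_copies[OF e(1,2) Qm(1,3)])
    show "Q i \<cdot> (Q j \<cdot> x) = 0" if "i \<noteq> j" for i j x by (rule orth(1)[OF that])
    show "P \<cdot> (Q k \<cdot> x) = Q k \<cdot> x" for k x
      using orth(2)[of 0 k "Q k \<cdot> x"] by (simp add: R0 Qm(2))
  qed (rule P(1))
qed

lemma big_tr_infinite:
  assumes "big P"
  shows "\<tau> P = \<infinity>"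
proof (rule ccontr)
  assume "\<tau> P \<noteq> \<infinity>"
  hence fin: "\<tau> P < \<infinity>" by (simp add: less_top)
  have P: "mproj P" using assms by (simp add: big_def)
  obtain V where V: "emb V P P" "V o\<^sub>L radj V \<noteq> P" by (rule big_imp_infinite[OF assms])
  have "V o\<^sub>L radj V = P"
    by (rule tr_proj_eq[OF emb_final(1)[OF V(1) P] P]) (use embD(3)[OF V(1)] tr_emb[OF V(1)] fin in auto)
  thus False using V(2) by simp
qed

lemma big_iff: "mproj P \<Longrightarrow> big P \<longleftrightarrow> \<tau> P = \<infinity>"
  using big_tr_infinite tr_infinite_big by blast

lemma tr_big_add:
  assumes "mproj P" "mproj Q" "\<And>x. P \<cdot> (Q \<cdot> x) = 0" "big (P + Q)"
  shows "big P \<or> big Q"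
proof -
  have "\<tau> P + \<tau> Q = top" using tr_proj_add[OF assms(1,2)] big_tr_infinite[OF assms(4)] by simp
  thus ?thesis by (simp add: big_iff assms(1,2) ennreal_add_eq_top)
qed

text \<open>Normality makes the trace of some \<open>J n\<close> exceed that of \<open>e\<close>.
  This is the semifinite source of the hypothesis \<open>F2\<close>.\<close>

lemma tr_big_limit:
  assumes e: "mproj e" "\<tau> e < \<infinity>"
    and J: "\<And>n. mproj (J n)" "\<And>n x. J (Suc n) \<cdot> (J n \<cdot> x) = J n \<cdot> x"
      "\<And>x. (\<lambda>n::nat. J n \<cdot> x) \<longlonglongrightarrow> P \<cdot> x" and P: "big P"
  shows "\<exists>n. subeq e (J n)"
proof -
  have sup: "(SUP n. \<tau> (J n)) = \<infinity>" using tr_limit_proj[OF J] big_tr_infinite[OF P] by simp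
  have "\<tau> e < (SUP n. \<tau> (J n))" unfolding sup by (rule e(2))
  then obtain n where "\<tau> e < \<tau> (J n)" by (auto simp: less_SUP_iff)
  thus ?thesis using subeq_of_trace[OF e J(1)] by (intro exI[of _ n]) simp
qed

end

context trace_factor
begin

subsection \<open>Slices of bounded trace\<close>

lemma tr_cut_limit:
  assumes A: "A \<in> M" "psd A" and R: "mproj R" "ocomm A R" and F: "range F \<subseteq> sets borel" "incseq F"
  shows "\<tau> (R o\<^sub>L spec A (\<Union>n::nat. F n)) = (SUP n. \<tau> (R o\<^sub>L spec A (F n)))"
proof (rule tr_limit_proj)
  have m: "F n \<in> sets borel" for n using F(1) by auto
  show "mproj (R o\<^sub>L spec A (F n))" for n by (rule cut_mproj[OF A R m])
  show "(R o\<^sub>L spec A (F (Suc n))) \<cdot> ((R o\<^sub>L spec A (F n)) \<cdot> x) = (R o\<^sub>L spec A (F n)) \<cdot> x" for n x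
    by (rule cut_mono[OF A R m m incseq_SucD[OF F(2)]])
  show "(\<lambda>n. (R o\<^sub>L spec A (F n)) \<cdot> x) \<longlonglongrightarrow> (R o\<^sub>L spec A (\<Union>n. F n)) \<cdot> x" for x
    by (rule cut_incseq[OF A R F])
qed

text \<open>The slice is the top part of \<open>R\<close>: all of the spectrum above a level \<open>s\<close>, together with a
  suitable part of the eigenspace at \<open>s\<close>, on which every projection commutes with \<open>A\<close>.\<close>

lemma slice_step:
  assumes A: "A \<in> M" "psd A" and R: "mproj R" "ocomm A R" "\<And>x. spec A {\<alpha><..} \<cdot> (R \<cdot> x) = R \<cdot> x" "\<tau> R = \<infinity>"
    and fin: "\<And>s. \<alpha> < s \<Longrightarrow> \<tau> (spec A {s<..}) < \<infinity>" and e: "mproj e" "e \<noteq> 0" "\<tau> e < \<infinity>"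
  shows "\<exists>s G. \<alpha> < s \<and> mproj G \<and> (\<forall>x. R \<cdot> (G \<cdot> x) = G \<cdot> x) \<and> ocomm A G \<and> subeq e G \<and> \<tau> G \<le> 2 * \<tau> e \<and>
    (\<forall>x. s * (norm (G \<cdot> x))\<^sup>2 \<le> inner (A \<cdot> (G \<cdot> x)) (G \<cdot> x)) \<and>
    (\<forall>x. inner (A \<cdot> ((R - G) \<cdot> x)) ((R - G) \<cdot> x) \<le> s * (norm ((R - G) \<cdot> x))\<^sup>2)"
proof -
  let ?g = "\<lambda>S. R o\<^sub>L spec A S" and ?p = "\<tau> e"
  note c = A R(1,2)
  note Asym = psd_sym[OF A(2)]
  note gm = cut_mproj[OF c] and gG = cut_G[OF c]
  have g_le: "\<tau> (?g S) \<le> \<tau> (?g U)" if "S \<in> sets borel" "U \<in> sets borel" "S \<subseteq> U" for S U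
    by (rule tr_proj_mono[OF gm[OF that(1)] gm[OF that(2)] cut_mono[OF c that]])
  have g_add: "\<tau> (?g (S \<union> U)) = \<tau> (?g S) + \<tau> (?g U)" if "S \<in> sets borel" "U \<in> sets borel" "S \<inter> U = {}" for S U
    using tr_proj_add[OF gm[OF that(1)] gm[OF that(2)]] by (simp only: cut_Un[OF c that])
  have g_fin: "\<tau> (?g {s<..}) < \<infinity>" if "\<alpha> < s" for s
  proof -
    have "\<tau> (?g {s<..}) \<le> \<tau> (spec A {s<..})"
      by (rule tr_proj_mono[OF gm mproj_spec[OF A(1) Asym]])
        (use rproj_idem[OF spec(1)[OF Asym, of "{s<..}"]] in \<open>simp_all add: cut_comm[OF c]\<close>)
    thus ?thesis using fin[OF that] by (rule le_less_trans)
  qed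
  have gR: "?g {\<alpha><..} = R"
  proof (rule blinfun_eqI)
    fix x
    show "?g {\<alpha><..} \<cdot> x = R \<cdot> x" using R(3)[of x] by (simp add: cut_comm[OF c])
  qed
  have p0: "0 < ?p" by (rule tr_pos[OF e(1,2)])
  \<comment> \<open>The levels above which the remaining spectrum still has at least the trace of
    \<open>e\<close>; the slice is cut at their supremum \<open>s\<close>.\<close>
  define D where "D = {s. \<alpha> < s \<and> ?p \<le> \<tau> (?g {s<..})}"
  have sup: "(SUP n. \<tau> (?g {b + inverse (real (Suc n))<..})) = \<tau> (?g {b<..})" for b
    using tr_cut_limit[OF c _ incseq_Ioi[of b]] unfolding UN_Ioi by (simp add: image_subset_iff)
  have "\<exists>s. s \<in> D"
  proof -
    have "?p < (SUP n. \<tau> (?g {\<alpha> + inverse (real (Suc n))<..}))" unfolding sup gR R(4) by (rule e(3))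
    then obtain n where "?p < \<tau> (?g {\<alpha> + inverse (real (Suc n))<..})" unfolding less_SUP_iff by blast
    hence "\<alpha> + inverse (real (Suc n)) \<in> D" by (simp add: D_def)
    thus ?thesis by blast
  qed
  then obtain d where d: "d \<in> D" ..
  hence ne: "D \<noteq> {}" by blast
  have bdd: "bdd_above D"
  proof (rule bdd_aboveI[of _ "norm A"])
    fix s assume s: "s \<in> D"
    show "s \<le> norm A"
    proof (rule ccontr)
      assume "\<not> s \<le> norm A"
      hence "?g {s<..} = 0" by (intro cut_high[OF c]) simp
      thus False using s p0 by (simp add: D_def tr_zero)
    qed
  qed
  define s where "s = Sup D"
  have \<alpha>s: "\<alpha> < s" using d cSup_upper[OF d bdd] by (simp add: D_def s_def)
  have below: "?p \<le> \<tau> (?g {r<..})" if "r < s" for r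
  proof -
    from less_cSupD[OF ne that[unfolded s_def]] obtain r' where r': "r' \<in> D" "r < r'" by blast
    have "?p \<le> \<tau> (?g {r'<..})" using r'(1) by (simp add: D_def)
    also have "\<dots> \<le> \<tau> (?g {r<..})" by (rule g_le) (use r'(2) in auto)
    finally show ?thesis .
  qed
  \<comment> \<open>(s,\<infinity>) is the increasing union of half-lines whose levels exceed the
    supremum and hence are not in \<open>D\<close>.\<close>
  have up: "\<tau> (?g {s<..}) \<le> ?p"
  proof (subst sup[symmetric], rule SUP_least)
    fix n
    have "s < s + inverse (real (Suc n))" by simp
    hence "s + inverse (real (Suc n)) \<notin> D" using cSup_upper[OF _ bdd] by (force simp: s_def)
    moreover have "\<alpha> < s + inverse (real (Suc n))" using \<alpha>s \<open>s < _\<close> by linarith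
    ultimately show "\<tau> (?g {s + inverse (real (Suc n))<..}) \<le> ?p" by (simp add: D_def)
  qed
  \<comment> \<open>Normality gives continuity along increasing sets only, so the trace of
    [s,\<infinity>) is found by subtraction inside (b,\<infinity>). The level \<open>b\<close>,
    strictly above \<open>\<alpha>\<close>, keeps the traces finite and makes the cancellation
    legitimate.\<close>
  have lo: "?p \<le> \<tau> (?g {s..})"
  proof -
    define b where "b = (\<alpha> + s) / 2"
    have b: "\<alpha> < b" "b < s" using \<alpha>s by (simp_all add: b_def)
    let ?F = "\<lambda>n. {b<..s - inverse (real (Suc n))}"
    have "\<tau> (?g (?F n)) + ?p \<le> \<tau> (?g {b<..})" for n
    proof (cases "b \<le> s - inverse (real (Suc n))")
      case True
      have "\<tau> (?g {b<..}) = \<tau> (?g (?F n \<union> {s - inverse (real (Suc n))<..}))"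
        using True by (simp add: ivl_disj_un)
      also have "\<dots> = \<tau> (?g (?F n)) + \<tau> (?g {s - inverse (real (Suc n))<..})" by (rule g_add) auto
      finally show ?thesis using below[of "s - inverse (real (Suc n))"] by (simp add: add_left_mono)
    next
      case False
      hence "?F n = {}" by auto
      hence "?g (?F n) = 0" by (simp add: spec_empty[OF Asym] del: of_nat_Suc)
      thus ?thesis using below[OF b(2)] by (simp add: tr_zero del: of_nat_Suc)
    qed
    hence "(SUP n. \<tau> (?g (?F n)) + ?p) \<le> \<tau> (?g {b<..})" by (intro SUP_least)
    moreover have "(SUP n. \<tau> (?g (?F n)) + ?p) = (SUP n. \<tau> (?g (?F n))) + ?p" by (rule ennreal_SUP_add_left) simp
    moreover have "(SUP n. \<tau> (?g (?F n))) = \<tau> (?g {b<..<s})"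
      using tr_cut_limit[OF c _ incseq_Ioc[of b s]] unfolding UN_Ioc by (simp add: image_subset_iff)
    moreover have "\<tau> (?g {b<..}) = \<tau> (?g {b<..<s}) + \<tau> (?g {s..})"
    proof -
      have u: "{b<..} = {b<..<s} \<union> {s..}" using b by auto
      show ?thesis unfolding u by (rule g_add) auto
    qed
    ultimately have "\<tau> (?g {b<..<s}) + ?p \<le> \<tau> (?g {b<..<s}) + \<tau> (?g {s..})" by simp
    moreover have "\<tau> (?g {b<..<s}) < \<infinity>"
      by (rule le_less_trans[OF g_le g_fin[OF b(1)]]) auto
    ultimately show ?thesis by (auto simp: ennreal_add_left_cancel_le)
  qed
  have split: "?g {s..} = ?g {s<..} + ?g {s}"
  proof -
    have u: "{s..} = {s<..} \<union> {s}" by auto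
    show ?thesis unfolding u by (rule cut_Un[OF c]) auto
  qed
  have finish: ?thesis
    if G: "G = ?g {s<..} + Q" "mproj Q" "\<And>x. ?g {s} \<cdot> (Q \<cdot> x) = Q \<cdot> x" "subeq e G" "\<tau> Q \<le> ?p" for G Q
  proof (intro exI[of _ s] exI[of _ G] conjI allI)
    have o: "spec A {s<..} \<cdot> (Q \<cdot> x) = 0" for x
    proof -
      have "spec A {s<..} \<cdot> (?g {s} \<cdot> (Q \<cdot> x)) = 0"
        by (simp add: cut_comm[OF c] spec_disjoint[OF Asym])
      thus ?thesis by (simp only: G(3))
    qed
    hence o': "?g {s<..} \<cdot> (Q \<cdot> x) = 0" for x by simp
    show Gm: "mproj G" unfolding G(1) by (rule mproj_add[OF gm G(2) o']) simp
    have RQ: "R \<cdot> (Q \<cdot> x) = Q \<cdot> x" for x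
      using gG(1)[of "{s}" "Q \<cdot> x"] by (simp add: G(3) del: blinfun_apply_blinfun_compose)
    show RG: "R \<cdot> (G \<cdot> x) = G \<cdot> x" for x
      using gG(1)[of "{s<..}" x] by (simp add: G(1) op_simps RQ)
    have "ocomm A Q" by (rule atom_ocomm(2)[OF c G(2,3)])
    moreover have "ocomm A (?g {s<..})" by (rule cut_ocomm[OF c]) simp
    ultimately show "ocomm A G" by (simp add: G(1))
    show "subeq e G" by (rule G(4))
    have "\<tau> G = \<tau> (?g {s<..}) + \<tau> Q" unfolding G(1) by (rule tr_proj_add[OF gm G(2)]) simp
    also have "\<dots> \<le> ?p + ?p" by (intro add_mono up G(5))
    finally show "\<tau> G \<le> 2 * ?p" by (simp add: mult_2)
    have gg: "?g {s..} \<cdot> (G \<cdot> x) = G \<cdot> x" for x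
    proof -
      have "?g {s..} \<cdot> (?g {s} \<cdot> (Q \<cdot> x)) = ?g {s} \<cdot> (Q \<cdot> x)" by (rule cut_mono[OF c]) auto
      hence "?g {s..} \<cdot> (Q \<cdot> x) = Q \<cdot> x" by (simp only: G(3))
      moreover have "?g {s..} \<cdot> (?g {s<..} \<cdot> x) = ?g {s<..} \<cdot> x" by (rule cut_mono[OF c]) auto
      ultimately show ?thesis by (simp only: G(1) blinfun.add_left blinfun.add_right)
    qed
    show "s * (norm (G \<cdot> x))\<^sup>2 \<le> inner (A \<cdot> (G \<cdot> x)) (G \<cdot> x)" for x
      using cut_ge[OF c, of "{s..}" s "G \<cdot> x"] by (simp only: gg) simp
    fix x
    let ?y = "(R - G) \<cdot> x"
    have "spec A {s<..} \<cdot> ?y = 0"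
      using rproj_idem[OF spec(1)[OF Asym, of "{s<..}"]]
      by (simp add: G(1) op_simps o cut_comm[OF c])
    thus "inner (A \<cdot> ?y) ?y \<le> s * (norm ?y)\<^sup>2"
      using spec_gt(4)[OF Asym, of ?y s] by (simp add: spec_greaterThan[OF Asym])
  qed (rule \<alpha>s)
  show ?thesis
  \<comment> \<open>Either the whole eigenspace at \<open>s\<close> is cheap enough to be included,
    or a copy of \<open>e\<close> inside it suffices; both keep the trace of \<open>G\<close> within
    twice that of \<open>e\<close>.\<close>
  proof (cases "\<tau> (?g {s}) \<le> ?p")
    case True
    show ?thesis
    proof (rule finish[OF split])
      show "?g {s} \<cdot> (?g {s} \<cdot> x) = ?g {s} \<cdot> x" for x by (rule cut_mono[OF c]) auto
      show "subeq e (?g {s..})" by (rule subeq_of_trace[OF e(1,3) gm lo]) simp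
    qed (use gm True in auto)
  next
    case False
    hence "subeq e (?g {s})" by (intro subeq_of_trace[OF e(1,3) gm]) auto
    then obtain w where w: "emb w e (?g {s})" by (auto simp: subeq_def)
    let ?Q = "w o\<^sub>L radj w"
    have Q: "mproj ?Q" "?g {s} \<cdot> (?Q \<cdot> x) = ?Q \<cdot> x" for x
      using emb_final[OF w e(1)] by auto
    have "w \<cdot> (e \<cdot> x) = w \<cdot> x" for x
      by (rule partial_isometry(1)[of e w]) (use e(1) embD(2)[OF w] in auto)
    hence "emb w e ?Q" using w by (simp add: emb_def)
    hence eQ: "subeq e ?Q" by (auto simp: subeq_def)
    have "subeq ?Q (?g {s<..} + ?Q)"
    proof (rule subeq_sub[OF Q(1)])
      fix x
      have "?g {s<..} \<cdot> (?g {s} \<cdot> (?Q \<cdot> x)) = 0" by (rule cut_disjoint[OF c]) auto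
      hence "?g {s<..} \<cdot> (?Q \<cdot> x) = 0" by (simp only: Q(2))
      thus "(?g {s<..} + ?Q) \<cdot> (?Q \<cdot> x) = ?Q \<cdot> x"
        using rproj_idem[OF mprojD(2)[OF Q(1)], of x] by (simp only: blinfun.add_left add_0_left)
    qed
    hence "subeq e (?g {s<..} + ?Q)" by (rule subeq_trans[OF eQ])
    thus ?thesis by (rule finish[OF refl Q]) (simp add: tr_emb[OF w])
  qed
qed

text \<open>The remainder after slice \<open>k\<close> has \<open>A\<close> at most
  \<open>s k\<close>, and each slice has trace at most \<open>2 * \<tau> e\<close>. If the
  \<open>s k - \<alpha>\<close> were summable, their sum would bound the trace of the positive part
  of \<open>A - \<alpha>\<close>, apart from the contribution of the first slice.\<close>

lemma slices:
  assumes A: "A \<in> M" "psd A"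
    and fin: "\<And>s. \<alpha> < s \<Longrightarrow> \<tau> (spec A {s<..}) < \<infinity>"
    and K: "\<tau> ((A - \<alpha> *\<^sub>R id_blinfun) o\<^sub>L spec A {\<alpha><..}) = \<infinity>"
    and e: "mproj e" "e \<noteq> 0" "\<tau> e < \<infinity>"
  obtains G s where "\<And>k::nat. mproj (G k)" "\<And>k. ocomm A (G k)" "\<And>k. subeq e (G k)"
    "\<And>i j x. i \<noteq> j \<Longrightarrow> G i \<cdot> (G j \<cdot> x) = 0"
    "\<And>k x. s k * (norm (G k \<cdot> x))\<^sup>2 \<le> inner (A \<cdot> (G k \<cdot> x)) (G k \<cdot> x)"
    "\<And>k. \<alpha> < s k" "\<And>k. s (Suc k) \<le> s k" "\<not> summable (\<lambda>k. s k - \<alpha>)"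
proof -
  note Asym = psd_sym[OF A(2)]
  let ?E = "spec A {\<alpha><..}" and ?B = "A - \<alpha> *\<^sub>R id_blinfun"
  have Em: "mproj ?E" by (rule mproj_spec[OF A(1) Asym]) simp
  have EA: "ocomm A ?E" using spec_ocomm[OF Asym] by (simp add: ocomm_def)
  have form: "inner ((?B o\<^sub>L P) \<cdot> x) x = inner (A \<cdot> (P \<cdot> x)) (P \<cdot> x) - \<alpha> * (norm (P \<cdot> x))\<^sup>2"
    if P: "mproj P" "ocomm A P" for P x
  proof -
    have "inner (A \<cdot> (P \<cdot> x)) x = inner (A \<cdot> (P \<cdot> x)) (P \<cdot> x)"
      using sym_opD[OF rproj_sym[OF mprojD(2)[OF P(1)]], of "A \<cdot> (P \<cdot> x)" x] mprojD(2)[OF P(1)]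
      by (simp add: ocommD[OF P(2), symmetric])
    thus ?thesis by (simp add: op_simps rproj_inner[OF mprojD(2)[OF P(1)]])
  qed
  have Bsym: "sym_op (?B o\<^sub>L P)" if P: "mproj P" "ocomm A P" for P
    using Asym rproj_sym[OF mprojD(2)[OF P(1)]] P(2) by (intro sym_op_compose) simp_all
  have Bpsd: "psd (?B o\<^sub>L P)" if P: "mproj P" "ocomm A P" and PE: "\<And>x. ?E \<cdot> (P \<cdot> x) = P \<cdot> x" for P
  proof -
    have "\<alpha> * (norm (P \<cdot> x))\<^sup>2 \<le> inner (A \<cdot> (P \<cdot> x)) (P \<cdot> x)" for x
      using spec_gt(3)[OF Asym, of \<alpha> "P \<cdot> x"] PE[of x] by (simp add: spec_greaterThan[OF Asym])
    thus ?thesis unfolding psd_def using Bsym[OF P] form[OF P] by simp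
  qed
  have Bbound: "psd (b *\<^sub>R P - (?B o\<^sub>L P))"
    if P: "mproj P" "ocomm A P" and b: "\<And>x. inner (A \<cdot> (P \<cdot> x)) (P \<cdot> x) \<le> (\<alpha> + b) * (norm (P \<cdot> x))\<^sup>2" for P b
    unfolding psd_diff_iff
  proof (intro conjI allI)
    show "sym_op (b *\<^sub>R P - (?B o\<^sub>L P))" using Bsym[OF P] rproj_sym[OF mprojD(2)[OF P(1)]] by simp
    show "inner ((?B o\<^sub>L P) \<cdot> x) x \<le> inner ((b *\<^sub>R P) \<cdot> x) x" for x
      unfolding form[OF P] using b[of x]
      by (simp add: blinfun.scaleR_left rproj_inner[OF mprojD(2)[OF P(1)]] distrib_right)
  qed
  have BM: "?B o\<^sub>L P \<in> M" if "mproj P" for P using A(1) mprojD(1)[OF that] by blast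
  have tB: "\<tau> (?B o\<^sub>L P) \<le> ennreal b * \<tau> P"
    if P: "mproj P" "ocomm A P" and PE: "\<And>x. ?E \<cdot> (P \<cdot> x) = P \<cdot> x" and b0: "0 \<le> b"
      and b: "\<And>x. inner (A \<cdot> (P \<cdot> x)) (P \<cdot> x) \<le> (\<alpha> + b) * (norm (P \<cdot> x))\<^sup>2" for P b
  proof -
    have "\<tau> (?B o\<^sub>L P) \<le> \<tau> (b *\<^sub>R P)"
      by (rule tr_mono[OF BM[OF P(1)] Bpsd[OF P PE] _ Bbound[OF P b]]) (use P in auto)
    also have "\<dots> = ennreal b * \<tau> P" by (rule tr_scale) (use P b0 rproj_psd in auto)
    finally show ?thesis .
  qed
  \<comment> \<open>Large enough that \<open>\<alpha> + c\<close> is at least \<open>norm A\<close>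
    for either sign of \<open>\<alpha>\<close>; it bounds \<open>A\<close> where no level is
    available yet.\<close>
  define c where "c = norm A + \<bar>\<alpha>\<bar>"
  have c0: "0 \<le> c" by (simp add: c_def)
  have cb: "inner (A \<cdot> y) y \<le> (\<alpha> + c) * (norm y)\<^sup>2" for y
  proof -
    have "inner (A \<cdot> y) y \<le> norm A * (norm y)\<^sup>2" by (rule inner_le_norm)
    also have "\<dots> \<le> (\<alpha> + c) * (norm y)\<^sup>2" by (intro mult_right_mono) (simp_all add: c_def)
    finally show ?thesis .
  qed
  have EE: "?E \<cdot> (?E \<cdot> x) = ?E \<cdot> x" for x using mprojD(2)[OF Em] by simp
  have Einf: "\<tau> ?E = \<infinity>"
  proof (rule ccontr)
    assume "\<tau> ?E \<noteq> \<infinity>"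
    hence "ennreal c * \<tau> ?E < top" by (simp add: ennreal_mult_less_top less_top)
    hence "\<tau> (?B o\<^sub>L ?E) < top" using tB[OF Em EA EE c0 cb] by (rule le_less_trans[rotated])
    thus False using K by simp
  qed
  define OK where "OK R \<longleftrightarrow> mproj R \<and> ocomm A R \<and> (\<forall>x. ?E \<cdot> (R \<cdot> x) = R \<cdot> x) \<and> \<tau> R = \<infinity>" for R
  define ST where "ST R s G \<longleftrightarrow> \<alpha> < s \<and> mproj G \<and> (\<forall>x. R \<cdot> (G \<cdot> x) = G \<cdot> x) \<and> ocomm A G \<and> subeq e G \<and> \<tau> G \<le> 2 * \<tau> e \<and>
    (\<forall>x. s * (norm (G \<cdot> x))\<^sup>2 \<le> inner (A \<cdot> (G \<cdot> x)) (G \<cdot> x)) \<and>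
    (\<forall>x. inner (A \<cdot> ((R - G) \<cdot> x)) ((R - G) \<cdot> x) \<le> s * (norm ((R - G) \<cdot> x))\<^sup>2)" for R s G
  have OKE: "OK ?E" using Em EA EE Einf by (simp add: OK_def)
  have step: "\<exists>R'. OK R' \<and> (\<exists>s G. R' = R - G \<and> ST R s G)" if "OK R" for R
  proof -
    have R: "mproj R" "ocomm A R" "\<And>x. ?E \<cdot> (R \<cdot> x) = R \<cdot> x" "\<tau> R = \<infinity>" using that by (auto simp: OK_def)
    have "\<exists>s G. ST R s G" unfolding ST_def by (rule slice_step[OF A R fin e])
    then obtain s G where G: "ST R s G" by (elim exE)
    have Gm: "mproj G" "\<And>x. R \<cdot> (G \<cdot> x) = G \<cdot> x" "ocomm A G" "\<tau> G \<le> 2 * \<tau> e" using G by (simp_all add: ST_def)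
    have "2 * \<tau> e < \<infinity>" using e(3) by (simp add: ennreal_mult_less_top)
    hence "\<tau> (R - G) = \<infinity>" by (intro tr_diff_infinite[OF R(1) Gm(1,2) R(4)] le_less_trans[OF Gm(4)])
    moreover have "?E \<cdot> ((R - G) \<cdot> x) = (R - G) \<cdot> x" for x
      using R(3)[of x] R(3)[of "G \<cdot> x"] by (simp add: op_simps Gm(2))
    ultimately have "OK (R - G)" using mproj_diff[OF R(1) Gm(1,2)] R(2) Gm(3) by (simp add: OK_def)
    thus ?thesis using G by (intro exI[of _ "R - G"] conjI exI[of _ s] exI[of _ G] refl)
  qed
  obtain R where R0: "R 0 = ?E" and R: "\<And>k. OK (R k)" "\<And>k. \<exists>s G. R (Suc k) = R k - G \<and> ST (R k) s G"
  proof -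
    have "\<exists>f. \<forall>k. (OK (f k) \<and> (k = 0 \<longrightarrow> f k = ?E)) \<and> (\<exists>s G. f (Suc k) = f k - G \<and> ST (f k) s G)"
      by (rule dependent_nat_choice[of "\<lambda>k R. OK R \<and> (k = 0 \<longrightarrow> R = ?E)" "\<lambda>k G G'. \<exists>s Q. G' = G - Q \<and> ST G s Q"])
        (use OKE step in auto)
    thus thesis using that by (elim exE) blast
  qed
  have "\<exists>p. R (Suc k) = R k - snd p \<and> ST (R k) (fst p) (snd p)" for k using R(2)[of k] by auto
  then obtain p where p: "\<And>k. R (Suc k) = R k - snd (p k)" "\<And>k. ST (R k) (fst (p k)) (snd (p k))" by metis
  define G where "G k = snd (p k)" for k
  define s where "s k = fst (p k)" for k
  have RS: "R (Suc k) = R k - G k" and ST: "ST (R k) (s k) (G k)" for k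
    using p by (simp_all add: G_def s_def)
  have Rm: "mproj (R k)" "ocomm A (R k)" and RE: "?E \<cdot> (R k \<cdot> x) = R k \<cdot> x" for k x
    using R(1)[of k] by (simp_all add: OK_def)
  have Gm: "mproj (G k)" "ocomm A (G k)" and RG: "R k \<cdot> (G k \<cdot> x) = G k \<cdot> x" and eG: "subeq e (G k)"
    and tG: "\<tau> (G k) \<le> 2 * \<tau> e" and low: "s k * (norm (G k \<cdot> x))\<^sup>2 \<le> inner (A \<cdot> (G k \<cdot> x)) (G k \<cdot> x)"
    and s\<alpha>: "\<alpha> < s k" for k x
    using ST[of k] by (simp_all add: ST_def)
  have up: "inner (A \<cdot> (R (Suc k) \<cdot> x)) (R (Suc k) \<cdot> x) \<le> s k * (norm (R (Suc k) \<cdot> x))\<^sup>2" for k x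
    using ST[of k] by (simp add: ST_def RS)
  have GE: "?E \<cdot> (G k \<cdot> x) = G k \<cdot> x" for k x using RE[of k "G k \<cdot> x"] by (simp add: RG)
  have upG: "inner (A \<cdot> (G (Suc k) \<cdot> x)) (G (Suc k) \<cdot> x) \<le> s k * (norm (G (Suc k) \<cdot> x))\<^sup>2" for k x
    using up[of k "G (Suc k) \<cdot> x"] by (simp add: RG)
  have dec: "s (Suc k) \<le> s k" for k
  proof -
    have "G (Suc k) \<noteq> 0"
    proof
      assume "G (Suc k) = 0"
      hence "\<tau> e \<le> 0" using tr_subeq[OF e(1) Gm(1) eG, of "Suc k"] by (simp add: tr_zero)
      thus False using tr_pos[OF e(1,2)] by simp
    qed
    then obtain x where x: "G (Suc k) \<cdot> x \<noteq> 0" by (metis blinfun_eqI blinfun.zero_left)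
    have "s (Suc k) * (norm (G (Suc k) \<cdot> x))\<^sup>2 \<le> s k * (norm (G (Suc k) \<cdot> x))\<^sup>2"
      by (rule order_trans[OF low upG])
    thus ?thesis using x by simp
  qed
  have ns: "\<not> summable (\<lambda>k. s k - \<alpha>)"
  proof
    assume sm: "summable (\<lambda>k. s k - \<alpha>)"
    define F where "F n = (?B o\<^sub>L ?E) - (?B o\<^sub>L R n)" for n
    have F0: "F 0 = 0" by (simp add: F_def R0)
    have FS: "F (Suc n) = F n + (?B o\<^sub>L G n)" for n
      by (rule blinfun_eqI) (simp add: F_def RS op_simps)
    have Fp: "F n \<in> M \<and> psd (F n)" for n
    proof (induction n)
      case (Suc n) thus ?case unfolding FS using BM[OF Gm(1)] Bpsd[OF Gm GE] by simp
    qed (simp add: F0)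
    \<comment> \<open>The shift of the index reflects that the slice \<open>G (Suc k)\<close> lies
      in the remainder \<open>R (Suc k)\<close>, where \<open>A\<close> is at most
      \<open>s k\<close>; the first slice has only the bound \<open>c\<close>.\<close>
    define b where "b k = (case k of 0 \<Rightarrow> c | Suc k \<Rightarrow> s k - \<alpha>)" for k
    have b0: "0 \<le> b k" for k using c0 s\<alpha> by (cases k) (simp_all add: b_def less_imp_le)
    have tBG: "\<tau> (?B o\<^sub>L G k) \<le> ennreal (b k) * \<tau> (G k)" for k
      by (rule tB[OF Gm GE b0]) (use cb upG in \<open>auto simp: b_def split: nat.split\<close>)
    have "summable b" using sm by (subst summable_Suc_iff[symmetric]) (simp add: b_def)
    have tF: "\<tau> (F n) \<le> ennreal (\<Sum>k<n. b k) * (2 * \<tau> e)" for n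
    proof (induction n)
      case 0 thus ?case by (simp add: F0 tr_zero)
    next
      case (Suc n)
      have "\<tau> (F (Suc n)) = \<tau> (F n) + \<tau> (?B o\<^sub>L G n)"
        unfolding FS using Fp BM[OF Gm(1)] Bpsd[OF Gm GE] by (intro tr_add) auto
      also have "\<dots> \<le> ennreal (\<Sum>k<n. b k) * (2 * \<tau> e) + ennreal (b n) * (2 * \<tau> e)"
        by (intro add_mono Suc order_trans[OF tBG] mult_left_mono tG) simp
      also have "\<dots> = ennreal (\<Sum>k<Suc n. b k) * (2 * \<tau> e)"
        using b0 by (simp add: sum_nonneg ennreal_plus distrib_right)
      finally show ?case .
    qed
    \<comment> \<open>Under the assumed summability \<open>s n\<close> tends to
      \<open>\<alpha>\<close>, so the part of \<open>A - \<alpha>\<close> on the remainders tends to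
      0 even in norm, and the slices exhaust the positive part.\<close>
    have lim0: "(\<lambda>n. (?B o\<^sub>L R n) \<cdot> x) \<longlonglongrightarrow> 0" for x
    proof (rule LIMSEQ_imp_Suc, rule Lim_null_comparison)
      have nb: "norm (?B o\<^sub>L R (Suc n)) \<le> s n - \<alpha>" for n
      proof (rule norm_le_if_form_le[OF Bpsd[OF Rm RE]])
        show "0 \<le> s n - \<alpha>" using s\<alpha>[of n] by simp
        fix y
        have "inner ((?B o\<^sub>L R (Suc n)) \<cdot> y) y \<le> (s n - \<alpha>) * (norm (R (Suc n) \<cdot> y))\<^sup>2"
          unfolding form[OF Rm] using up[of n y] by (simp add: left_diff_distrib)
        also have "\<dots> \<le> (s n - \<alpha>) * (norm y)\<^sup>2"
          using s\<alpha>[of n] rproj_norm_le[OF mprojD(2)[OF Rm(1)]] by (intro mult_left_mono power_mono) auto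
        finally show "inner ((?B o\<^sub>L R (Suc n)) \<cdot> y) y \<le> (s n - \<alpha>) * (norm y)\<^sup>2" .
      qed
      have "norm ((?B o\<^sub>L R (Suc n)) \<cdot> x) \<le> (s n - \<alpha>) * norm x" for n
        by (rule order_trans[OF norm_blinfun mult_right_mono[OF nb norm_ge_zero]])
      thus "\<forall>\<^sub>F n in sequentially. norm ((?B o\<^sub>L R (Suc n)) \<cdot> x) \<le> (s n - \<alpha>) * norm x" by simp
      have "(\<lambda>n. (s n - \<alpha>) * norm x) \<longlonglongrightarrow> 0 * norm x"
        by (intro tendsto_intros summable_LIMSEQ_zero sm)
      thus "(\<lambda>n. (s n - \<alpha>) * norm x) \<longlonglongrightarrow> 0" by simp
    qed
    have FL: "(\<lambda>n. F n \<cdot> x) \<longlonglongrightarrow> (?B o\<^sub>L ?E) \<cdot> x" for x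
      using tendsto_diff[OF tendsto_const[of "(?B o\<^sub>L ?E) \<cdot> x"] lim0[of x]]
      by (simp add: F_def blinfun.diff_left)
    have "\<tau> (?B o\<^sub>L ?E) = (SUP n. \<tau> (F n))"
    proof (rule tr_normal[of F, OF _ _ _ FL])
      show "psd (F (Suc n) - F n)" for n using Bpsd[OF Gm GE] by (simp add: FS)
    qed (use Fp in auto)
    also have "\<dots> \<le> ennreal (suminf b) * (2 * \<tau> e)"
    proof (rule SUP_least)
      fix n
      have "(\<Sum>k<n. b k) \<le> suminf b" by (rule sum_le_suminf[OF \<open>summable b\<close>]) (use b0 in auto)
      hence "ennreal (\<Sum>k<n. b k) * (2 * \<tau> e) \<le> ennreal (suminf b) * (2 * \<tau> e)"
        by (intro mult_right_mono ennreal_leI) auto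
      thus "\<tau> (F n) \<le> ennreal (suminf b) * (2 * \<tau> e)" using tF[of n] by (rule order_trans[rotated])
    qed
    also have "\<dots> < \<infinity>" using e(3) by (simp add: ennreal_mult_less_top)
    finally show False using K by simp
  qed
  show ?thesis
  proof (rule that[of G s])
    show "G i \<cdot> (G j \<cdot> x) = 0" if "i \<noteq> j" for i j x
      by (rule orthogonal_remainders(1)[where R = R and J = G, OF Rm(1) Gm(1) RG RS that])
  qed (rule Gm eG low s\<alpha> dec ns)+
qed

end

section \<open>Exhausting the identity\<close>

text \<open>If the limit \<open>L\<close> were positive, \<open>d n\<close> would be dominated by a
  multiple of the telescoping differences \<open>a n - a (Suc n)\<close> and would be summable. The
  square is what Cauchy-Schwarz delivers in \<open>exhaustion\<close>.\<close>

lemma decseq_to_zero: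
  fixes a d :: "nat \<Rightarrow> real"
  assumes a0: "\<And>n. 0 \<le> a n" and dec: "\<And>n. a (Suc n) \<le> a n"
    and d0: "\<And>n. 0 \<le> d n" and step: "\<And>n. N \<le> n \<Longrightarrow> d n * (a n)\<^sup>2 \<le> C * (a n - a (Suc n))" and ns: "\<not> summable d"
  shows "a \<longlonglongrightarrow> 0"
proof -
  have "decseq a" using dec by (rule decseq_SucI)
  then obtain L where L: "a \<longlonglongrightarrow> L" "\<And>n. L \<le> a n" using decseq_convergent[of a 0] a0 by blast
  have L0: "0 \<le> L" using LIMSEQ_le_const[OF L(1)] a0 by blast
  have "L = 0"
  proof (rule ccontr)
    assume "L \<noteq> 0"
    hence Lp: "0 < L" using L0 by simp
    have "summable (\<lambda>n. a n - a (Suc n))" using telescope_summable'[OF L(1)] .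
    hence "summable (\<lambda>n. C / L\<^sup>2 * (a n - a (Suc n)))" by (rule summable_mult)
    moreover have "norm (d n) \<le> C / L\<^sup>2 * (a n - a (Suc n))" if "N \<le> n" for n
    proof -
      have "d n * L\<^sup>2 \<le> d n * (a n)\<^sup>2" using L0 L(2) d0 by (intro mult_left_mono power_mono) auto
      hence "d n * L\<^sup>2 \<le> C * (a n - a (Suc n))" using step[OF that] by linarith
      thus ?thesis using Lp d0[of n] by (simp add: field_simps)
    qed
    ultimately have "summable d" by (rule summable_comparison_test'[where N = N])
    thus False using ns by simp
  qed
  thus ?thesis using L(1) by simp
qed

lemma null_limit_closed:
  fixes T :: "nat \<Rightarrow> 'a::real_normed_vector \<Rightarrow>\<^sub>L 'a"
  assumes T: "\<And>n x. norm (T n \<cdot> x) \<le> norm x" and f: "\<And>m. (\<lambda>n. T n \<cdot> f m) \<longlonglongrightarrow> 0" "f \<longlonglongrightarrow> x"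
  shows "(\<lambda>n. T n \<cdot> x) \<longlonglongrightarrow> 0"
proof (rule LIMSEQ_I)
  fix r :: real assume r: "0 < r"
  then obtain m where m: "norm (f m - x) < r / 2" using LIMSEQ_D[OF f(2), of "r / 2"] by auto
  obtain N where N: "\<And>n. n \<ge> N \<Longrightarrow> norm (T n \<cdot> f m - 0) < r / 2"
    using LIMSEQ_D[OF f(1)[of m], of "r / 2"] r by auto
  have "norm (T n \<cdot> x - 0) < r" if "n \<ge> N" for n
  proof -
    have "T n \<cdot> x = T n \<cdot> f m - T n \<cdot> (f m - x)" by (simp add: blinfun.diff_right)
    hence "norm (T n \<cdot> x) \<le> norm (T n \<cdot> f m) + norm (T n \<cdot> (f m - x))" by (metis norm_triangle_ineq4)
    also have "\<dots> < r / 2 + r / 2" using N[OF that] m T[of n "f m - x"] by simp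
    finally show ?thesis by simp
  qed
  thus "\<exists>no. \<forall>n\<ge>no. norm (T n \<cdot> x - 0) < r" by blast
qed

context real_factor
begin

text \<open>The identity is split into the complement of all \<open>P n\<close> and the single
  \<open>P n\<close>, and each of these blocks into pieces equivalent to parts of \<open>e\<close>.
  Block 0 is the complement and block \<open>Suc j\<close> is \<open>P j\<close>, so a target in
  block \<open>i\<close> is orthogonal to \<open>P m\<close> for all \<open>m \<ge> i\<close>: from
  stage \<open>\<nu> k\<close> on, target \<open>k\<close> avoids the pieces still in reserve. The
  last conclusion says that strong convergence to 0 of contractions can be tested on the
  targets.\<close>

lemma orthogonal_targets:
  assumes e: "mproj e" "e \<noteq> 0" and P: "\<And>n::nat. mproj (P n)" "\<And>m n x. m \<noteq> n \<Longrightarrow> P m \<cdot> (P n \<cdot> x) = 0"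
  obtains U \<nu> where "\<And>k::nat. U k \<in> M" "\<And>k. rproj (radj (U k) o\<^sub>L U k)" "\<And>k x. U k \<cdot> (e \<cdot> x) = U k \<cdot> x"
    "\<forall>k m x. \<nu> k \<le> (m::nat) \<longrightarrow> P m \<cdot> (U k \<cdot> x) = 0"
    "\<forall>T :: nat \<Rightarrow> 'a \<Rightarrow>\<^sub>L 'a. (\<forall>n x. norm (T n \<cdot> x) \<le> norm x) \<longrightarrow>
      (\<forall>k x. (\<lambda>n::nat. T n \<cdot> (U k \<cdot> (radj (U k) \<cdot> x))) \<longlonglongrightarrow> 0) \<longrightarrow> (\<forall>x. (\<lambda>n. T n \<cdot> x) \<longlonglongrightarrow> 0)"
proof -
  obtain Q where Q: "mproj Q" "\<And>x. (\<lambda>i. P i \<cdot> x) sums (Q \<cdot> x)" "\<And>i x. P i \<cdot> (Q \<cdot> x) = P i \<cdot> x"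
    by (rule mproj_sums[of P]) (use P that in blast)+
  define G where "G i = (case i of 0 \<Rightarrow> id_blinfun - Q | Suc j \<Rightarrow> P j)" for i
  have G: "mproj (G i)" for i using P(1) Q(1) by (simp add: G_def split: nat.split)
  have PG: "P m \<cdot> (G i \<cdot> x) = 0" if "i \<le> m" for m i x
    using that P(2) by (auto simp: G_def op_simps Q(3) split: nat.split)
  define pr where "pr i V \<longleftrightarrow> (\<forall>k::nat. V k \<in> M \<and> rproj (radj (V k) o\<^sub>L V k) \<and>
    (\<forall>x. V k \<cdot> (e \<cdot> x) = V k \<cdot> x) \<and> (\<forall>x. G i \<cdot> (V k \<cdot> x) = V k \<cdot> x)) \<and>
    (\<forall>x. (\<lambda>k. V k \<cdot> (radj (V k) \<cdot> x)) sums (G i \<cdot> x))" for i V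
  have "\<exists>V. pr i V" for i
  proof (rule projection_partition[OF e G[of i]])
    fix V
    assume "\<And>k::nat. V k \<in> M" "\<And>k. rproj (radj (V k) o\<^sub>L V k)" "\<And>k x. V k \<cdot> (e \<cdot> x) = V k \<cdot> x"
      "\<And>k x. G i \<cdot> (V k \<cdot> x) = V k \<cdot> x" "\<And>x. (\<lambda>k. V k \<cdot> (radj (V k) \<cdot> x)) sums (G i \<cdot> x)"
    hence "pr i V" by (simp add: pr_def)
    thus "\<exists>V. pr i V" by (rule exI[of "pr i"])
  qed
  then obtain V where V: "\<And>i. pr i (V i)" by metis
  define U where "U k = V (fst (prod_decode k)) (snd (prod_decode k))" for k
  show ?thesis
  proof (rule that[of U "\<lambda>k. fst (prod_decode k)"])
    show "U k \<in> M" "rproj (radj (U k) o\<^sub>L U k)" "U k \<cdot> (e \<cdot> x) = U k \<cdot> x" for k x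
      using V by (simp_all add: U_def pr_def)
    have GU: "G (fst (prod_decode k)) \<cdot> (U k \<cdot> x) = U k \<cdot> x" for k x
      using V by (simp add: U_def pr_def)
    show "\<forall>k m x. fst (prod_decode k) \<le> m \<longrightarrow> P m \<cdot> (U k \<cdot> x) = 0"
    proof (intro allI impI)
      fix k m x assume "fst (prod_decode k) \<le> m"
      from PG[OF this, of "U k \<cdot> x"] show "P m \<cdot> (U k \<cdot> x) = 0" by (simp add: GU)
    qed
    show "\<forall>T :: nat \<Rightarrow> 'a \<Rightarrow>\<^sub>L 'a. (\<forall>n x. norm (T n \<cdot> x) \<le> norm x) \<longrightarrow>
      (\<forall>k x. (\<lambda>n::nat. T n \<cdot> (U k \<cdot> (radj (U k) \<cdot> x))) \<longlonglongrightarrow> 0) \<longrightarrow> (\<forall>x. (\<lambda>n. T n \<cdot> x) \<longlonglongrightarrow> 0)"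
    proof (intro allI impI)
    fix T :: "nat \<Rightarrow> 'a \<Rightarrow>\<^sub>L 'a" and x
    assume T': "\<forall>n x. norm (T n \<cdot> x) \<le> norm x"
      and U0': "\<forall>k x. (\<lambda>n. T n \<cdot> (U k \<cdot> (radj (U k) \<cdot> x))) \<longlonglongrightarrow> 0"
    note T = T'[rule_format] and U0 = U0'[rule_format]
    have sumsN: "(\<lambda>n. T n \<cdot> y) \<longlonglongrightarrow> 0" if f: "f sums y" "\<And>k. (\<lambda>n. T n \<cdot> f k) \<longlonglongrightarrow> 0" for f y
    proof (rule null_limit_closed[OF T])
      show "(\<lambda>m. sum f {..<m}) \<longlonglongrightarrow> y" using f(1) by (simp add: sums_def)
      show "(\<lambda>n. T n \<cdot> sum f {..<m}) \<longlonglongrightarrow> 0" for m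
        unfolding blinfun.sum_right by (rule tendsto_null_sum) (rule f(2))
    qed
    have G0: "(\<lambda>n. T n \<cdot> (G i \<cdot> y)) \<longlonglongrightarrow> 0" for i y
    proof (rule sumsN)
      show "(\<lambda>k. V i k \<cdot> (radj (V i k) \<cdot> y)) sums (G i \<cdot> y)" using V by (simp add: pr_def)
      show "(\<lambda>n. T n \<cdot> (V i k \<cdot> (radj (V i k) \<cdot> y))) \<longlonglongrightarrow> 0" for k
        using U0[of "prod_encode (i, k)" y] by (simp add: U_def)
    qed
    have "(\<lambda>n. T n \<cdot> (Q \<cdot> x)) \<longlonglongrightarrow> 0"
    proof (rule sumsN[OF Q(2)])
      show "(\<lambda>n. T n \<cdot> (P k \<cdot> x)) \<longlonglongrightarrow> 0" for k using G0[of "Suc k" x] by (simp add: G_def)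
    qed
    moreover have "(\<lambda>n. T n \<cdot> (x - Q \<cdot> x)) \<longlonglongrightarrow> 0" using G0[of 0 x] by (simp add: G_def blinfun.diff_left)
    ultimately have "(\<lambda>n. T n \<cdot> (Q \<cdot> x) + T n \<cdot> (x - Q \<cdot> x)) \<longlonglongrightarrow> 0 + 0" by (rule tendsto_add)
    thus "(\<lambda>n. T n \<cdot> x) \<longlonglongrightarrow> 0" by (simp flip: blinfun.add_right)
    qed
  qed
qed

text \<open>One step of the construction. With \<open>T\<close> the part of the identity that is still to be covered, the
  operator \<open>Z = \<surd>\<delta> T V W\<^sup>* + X\<close> satisfies \<open>Z\<^sup>* A Z = B\<close> and \<open>Z Z\<^sup>* \<le> T\<close>, and it covers a fixed
  proportion of the target \<open>V V\<^sup>*\<close>; the summand \<open>X\<close>, whose range lies in the fresh piece \<open>P\<close>, corrects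
  the compression of \<open>A\<close>.\<close>

lemma cover_step:
  assumes A: "A \<in> M" "psd A" and P: "mproj P" "ocomm A P"
    and T: "T \<in> M" "psd T" "psd (id_blinfun - T)" "\<And>x. P \<cdot> (T \<cdot> x) = P \<cdot> x"
    and V: "V \<in> M" "rproj (radj V o\<^sub>L V)" "\<And>x. V \<cdot> (e \<cdot> x) = V \<cdot> x" "\<And>x. P \<cdot> (V \<cdot> x) = 0" and e: "mproj e"
    and W: "W \<in> M" and \<delta>: "0 \<le> \<delta>" "\<delta> \<noteq> 0 \<Longrightarrow> (\<And>x. radj W \<cdot> (W \<cdot> x) = e \<cdot> x)"
    and res: "\<And>D. D \<in> M \<Longrightarrow> psd D \<Longrightarrow> (\<And>x. inner (D \<cdot> x) x \<le> \<delta> * norm A * (norm (radj W \<cdot> x))\<^sup>2) \<Longrightarrow>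
      \<exists>X\<in>M. (\<forall>x. P \<cdot> (X \<cdot> x) = X \<cdot> x) \<and> (\<forall>x. radj X \<cdot> (A \<cdot> (X \<cdot> x)) = B \<cdot> x - D \<cdot> x) \<and>
        (\<forall>x. (norm (X \<cdot> x))\<^sup>2 + \<delta> * (norm (radj W \<cdot> x))\<^sup>2 \<le> (norm x)\<^sup>2)"
  shows "\<exists>Z\<in>M. (\<forall>x. radj Z \<cdot> (A \<cdot> (Z \<cdot> x)) = B \<cdot> x) \<and> (\<forall>x. (norm (radj Z \<cdot> x))\<^sup>2 \<le> inner (T \<cdot> x) x) \<and>
    (\<forall>Q. rproj Q \<longrightarrow> (\<forall>x. Q \<cdot> (P \<cdot> x) = 0) \<longrightarrow> (\<forall>x. Q \<cdot> (T \<cdot> x) = Q \<cdot> x) \<longrightarrow> (\<forall>x. Q \<cdot> (V \<cdot> x) = 0) \<longrightarrow> (\<forall>x. Q \<cdot> (Z \<cdot> x) = 0)) \<and>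
    (\<forall>y. P \<cdot> y = 0 \<longrightarrow> (norm (radj Z \<cdot> y))\<^sup>2 = \<delta> * (norm (radj V \<cdot> (T \<cdot> y)))\<^sup>2)"
proof -
  note Asym = psd_sym[OF A(2)] and Tsym = psd_sym[OF T(2)] and Psym = rproj_sym[OF mprojD(2)[OF P(1)]]
  have AP: "A \<cdot> (P \<cdot> x) = P \<cdot> (A \<cdot> x)" for x by (rule ocommD[OF P(2)])
  have TP: "T \<cdot> (P \<cdot> x) = P \<cdot> x" for x
    by (rule inner_eq_all_imp_eq) (simp add: sym_opD[OF Tsym] sym_opD[OF Psym] T(4))
  define V0 where "V0 = V o\<^sub>L radj W"
  have V0M: "V0 \<in> M" using V(1) W by (auto simp: V0_def)
  have V0n: "norm (V0 \<cdot> x) \<le> norm (radj W \<cdot> x)" for x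
    unfolding V0_def using partial_isometry_radj(4)[OF V(2)] by simp
  have PV0: "P \<cdot> (V0 \<cdot> x) = 0" for x by (simp add: V0_def V(4))
  \<comment> \<open>The compression of \<open>A\<close> by the main part of \<open>Z\<close>. It
    depends on \<open>T\<close>, hence on the whole history, which is why \<open>res\<close> has to
    accept every positive \<open>D\<close> within the bound.\<close>
  define D where "D = \<delta> *\<^sub>R (radj V0 o\<^sub>L T o\<^sub>L A o\<^sub>L T o\<^sub>L V0)"
  have Dx: "D \<cdot> x = \<delta> *\<^sub>R (radj V0 \<cdot> (T \<cdot> (A \<cdot> (T \<cdot> (V0 \<cdot> x)))))" for x by (simp add: D_def blinfun.scaleR_left)
  have DM: "D \<in> M" using V0M T(1) A(1) by (auto simp: D_def)
  have iD: "inner (D \<cdot> x) x = \<delta> * inner (A \<cdot> (T \<cdot> (V0 \<cdot> x))) (T \<cdot> (V0 \<cdot> x))" for x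
    by (simp add: Dx sym_opD[OF Tsym] flip: radj')
  have Dpsd: "psd D"
    unfolding psd_def
  proof (intro conjI allI)
    have "radj A = A" "radj T = T" using Asym Tsym by (simp_all add: sym_op_radj)
    hence "radj D = D" by (intro blinfun_eqI) (simp add: D_def blinfun.scaleR_left)
    thus "sym_op D" by (simp add: sym_op_radj)
    show "0 \<le> inner (D \<cdot> x) x" for x unfolding iD using \<delta>(1) psd_ge0[OF A(2)] by simp
  qed
  have Tc: "norm (T \<cdot> x) \<le> norm x" for x by (rule psd_contraction[OF T(2,3)])
  have Dle: "inner (D \<cdot> x) x \<le> \<delta> * norm A * (norm (radj W \<cdot> x))\<^sup>2" for x
  proof -
    have "inner (A \<cdot> (T \<cdot> (V0 \<cdot> x))) (T \<cdot> (V0 \<cdot> x)) \<le> norm A * (norm (T \<cdot> (V0 \<cdot> x)))\<^sup>2" by (rule inner_le_norm)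
    also have "\<dots> \<le> norm A * (norm (radj W \<cdot> x))\<^sup>2"
      by (intro mult_left_mono power_mono order_trans[OF Tc V0n]) simp_all
    finally show ?thesis unfolding iD using \<delta>(1) by (simp add: mult_left_mono mult.assoc)
  qed
  from res[OF DM Dpsd Dle] obtain X where X: "X \<in> M" "\<And>x. P \<cdot> (X \<cdot> x) = X \<cdot> x"
    "\<And>x. radj X \<cdot> (A \<cdot> (X \<cdot> x)) = B \<cdot> x - D \<cdot> x"
    "\<And>x. (norm (X \<cdot> x))\<^sup>2 + \<delta> * (norm (radj W \<cdot> x))\<^sup>2 \<le> (norm x)\<^sup>2" by blast
  have TX: "T \<cdot> (X \<cdot> x) = X \<cdot> x" for x using TP[of "X \<cdot> x"] by (simp add: X(2))
  have XP: "radj X \<cdot> (P \<cdot> x) = radj X \<cdot> x" for x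
    by (rule inner_eq_all_imp_eq) (simp add: sym_opD[OF Psym] X(2) flip: radj')
  define Z where "Z = sqrt \<delta> *\<^sub>R (T o\<^sub>L V0) + X"
  have Zx: "Z \<cdot> x = sqrt \<delta> *\<^sub>R (T \<cdot> (V0 \<cdot> x)) + X \<cdot> x" for x
    by (simp add: Z_def blinfun.add_left blinfun.scaleR_left)
  have "radj T = T" using Tsym by (simp add: sym_op_radj)
  hence rZ: "radj Z \<cdot> x = sqrt \<delta> *\<^sub>R (radj V0 \<cdot> (T \<cdot> x)) + radj X \<cdot> x" for x
    by (simp add: Z_def blinfun.add_left blinfun.scaleR_left)
  have PTV0: "P \<cdot> (T \<cdot> (V0 \<cdot> x)) = 0" for x by (simp add: T(4) PV0)
  \<comment> \<open>The cross terms vanish: the range of \<open>X\<close> lies in that of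
    \<open>P\<close>, which commutes with \<open>A\<close>, and \<open>P\<close> annihilates the
    range of \<open>T V0\<close>.\<close>
  have V0TA: "radj V0 \<cdot> (T \<cdot> (A \<cdot> (X \<cdot> x))) = 0" for x
  proof (rule inner_eq_all_imp_eq)
    fix z
    have "inner (radj V0 \<cdot> (T \<cdot> (A \<cdot> (X \<cdot> x)))) z = inner (A \<cdot> (P \<cdot> (X \<cdot> x))) (T \<cdot> (V0 \<cdot> z))"
      by (simp add: X(2) sym_opD[OF Tsym] flip: radj')
    also have "\<dots> = 0" by (simp only: AP sym_opD[OF Psym] PTV0 inner_zero_right)
    finally show "inner (radj V0 \<cdot> (T \<cdot> (A \<cdot> (X \<cdot> x)))) z = inner 0 z" by simp
  qed
  have XAT: "radj X \<cdot> (A \<cdot> (T \<cdot> (V0 \<cdot> x))) = 0" for x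
    using XP[of "A \<cdot> (T \<cdot> (V0 \<cdot> x))"] by (simp add: PTV0 flip: AP)
  have comp: "radj Z \<cdot> (A \<cdot> (Z \<cdot> x)) = B \<cdot> x" for x
    using \<delta>(1) by (simp add: rZ Zx blinfun.add_right blinfun.scaleR_right V0TA XAT X(3) Dx)
  have le: "(norm (radj Z \<cdot> x))\<^sup>2 \<le> inner (T \<cdot> x) x" for x
  proof -
    define u where "u = radj Z \<cdot> x"
    \<comment> \<open>As \<open>T\<close> fixes the range of \<open>P\<close>, the vector
      \<open>Z u\<close> equals \<open>T y\<close>. The budget shared by \<open>X\<close> and
      \<open>W\<close> bounds the form of \<open>T\<close> at \<open>y\<close> by the squared norm
      of \<open>u\<close>, and Cauchy-Schwarz for this form gives the claim.\<close>
    define y where "y = sqrt \<delta> *\<^sub>R (V0 \<cdot> u) + X \<cdot> u"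
    have "(norm u)\<^sup>2 = inner (Z \<cdot> u) x" by (simp add: power2_norm_eq_inner u_def radj)
    also have "Z \<cdot> u = T \<cdot> y" by (simp add: Zx y_def blinfun.add_right blinfun.scaleR_right TX)
    finally have 1: "(norm u)\<^sup>2 = inner (T \<cdot> y) x" .
    have o: "inner (T \<cdot> (V0 \<cdot> u)) (X \<cdot> u) = 0"
    proof -
      have "inner (T \<cdot> (V0 \<cdot> u)) (P \<cdot> (X \<cdot> u)) = 0" by (simp only: PTV0 inner_zero_left flip: sym_opD[OF Psym])
      thus ?thesis by (simp only: X(2))
    qed
    have "inner (T \<cdot> y) y = \<delta> * inner (T \<cdot> (V0 \<cdot> u)) (V0 \<cdot> u) + (norm (X \<cdot> u))\<^sup>2"
      using \<delta>(1) o sym_op_swap[OF Tsym, of "V0 \<cdot> u" "X \<cdot> u"]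
      by (simp add: y_def op_simps TX inner_commute power2_norm_eq_inner)
    also have "\<dots> \<le> \<delta> * (norm (radj W \<cdot> u))\<^sup>2 + (norm (X \<cdot> u))\<^sup>2"
    proof -
      have "inner (T \<cdot> (V0 \<cdot> u)) (V0 \<cdot> u) \<le> inner (V0 \<cdot> u) (V0 \<cdot> u)"
        using psd_ge0[OF T(3), of "V0 \<cdot> u"] by (simp add: op_simps)
      also have "\<dots> \<le> (norm (radj W \<cdot> u))\<^sup>2"
        using V0n[of u] by (simp add: power_mono flip: power2_norm_eq_inner)
      finally show ?thesis using \<delta>(1) by (simp add: mult_left_mono)
    qed
    also have "\<dots> \<le> (norm u)\<^sup>2" using X(4)[of u] by simp
    finally have 2: "inner (T \<cdot> y) y \<le> (norm u)\<^sup>2" .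
    have "((norm u)\<^sup>2)\<^sup>2 \<le> inner (T \<cdot> y) y * inner (T \<cdot> x) x"
      unfolding 1 by (rule psd_cauchy_schwarz[OF T(2)])
    also have "\<dots> \<le> (norm u)\<^sup>2 * inner (T \<cdot> x) x" by (intro mult_right_mono 2 psd_ge0 T)
    finally have 3: "(norm u)\<^sup>2 * (norm u)\<^sup>2 \<le> (norm u)\<^sup>2 * inner (T \<cdot> x) x" by (simp only: power2_eq_square)
    have "(norm u)\<^sup>2 \<le> inner (T \<cdot> x) x"
    proof (cases "u = 0")
      case True thus ?thesis using psd_ge0[OF T(2), of x] by simp
    next
      case False
      hence "0 < (norm u)\<^sup>2" by simp
      from mult_left_le_imp_le[OF 3 this] show ?thesis .
    qed
    thus ?thesis by (simp add: u_def)
  qed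
  have avoid: "Q \<cdot> (Z \<cdot> x) = 0"
    if Q: "rproj Q" "\<And>x. Q \<cdot> (P \<cdot> x) = 0" "\<And>x. Q \<cdot> (T \<cdot> x) = Q \<cdot> x" "\<And>x. Q \<cdot> (V \<cdot> x) = 0" for Q x
  proof -
    have "Q \<cdot> (X \<cdot> x) = 0" using Q(2)[of "X \<cdot> x"] by (simp add: X(2))
    thus ?thesis by (simp add: Zx blinfun.add_right blinfun.scaleR_right Q(3) V0_def Q(4))
  qed
  \<comment> \<open>On vectors orthogonal to \<open>P\<close> only the main part contributes, and
    for nonzero \<open>\<delta>\<close> the operator \<open>W\<close> is isometric on the range of
    \<open>radj V\<close>.\<close>
  have cover: "(norm (radj Z \<cdot> y))\<^sup>2 = \<delta> * (norm (radj V \<cdot> (T \<cdot> y)))\<^sup>2" if y: "P \<cdot> y = 0" for y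
  proof -
    have "radj X \<cdot> y = 0" using XP[of y] y by simp
    hence n: "(norm (radj Z \<cdot> y))\<^sup>2 = \<delta> * (norm (W \<cdot> (radj V \<cdot> (T \<cdot> y))))\<^sup>2"
      using \<delta>(1) by (simp add: rZ V0_def power_mult_distrib)
    show ?thesis
    proof (cases "\<delta> = 0")
      case False
      note WW = \<delta>(2)[OF False]
      have eV: "e \<cdot> (radj V \<cdot> x) = radj V \<cdot> x" for x
        by (rule inner_eq_all_imp_eq) (simp add: sym_opD[OF rproj_sym[OF mprojD(2)[OF e]]] V(3) flip: radj')
      have "(norm (W \<cdot> (radj V \<cdot> (T \<cdot> y))))\<^sup>2 = (norm (radj V \<cdot> (T \<cdot> y)))\<^sup>2"
        using partial_isometry(4)[OF mprojD(2)[OF e], of W] WW by (simp add: eV)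
      thus ?thesis by (simp add: n)
    qed (simp add: n)
  qed
  have "Z \<in> M" unfolding Z_def by (intro closure_simps T(1) V0M X(1))
  thus ?thesis using comp le avoid cover by blast
qed

text \<open>Let \<open>a n\<close> be the form of \<open>T n\<close> at a vector \<open>y\<close> of
  target \<open>k\<close>. Once the target is clear of the reserved pieces, every stage with
  \<open>\<kappa> n = k\<close> gives \<open>\<delta> n * (a n)\<^sup>2 \<le> (norm y)\<^sup>2 * (a
  n - a (Suc n))\<close>, and \<open>div\<close> sends \<open>a n\<close> to 0. The hypothesis
  \<open>res\<close> packages what the strict and the slack case have to supply at each
  stage.\<close>

lemma exhaustion:
  fixes \<kappa> :: "nat \<Rightarrow> nat"
  assumes A: "A \<in> M" "psd A"
    and P: "\<And>n::nat. mproj (P n)" "\<And>n. ocomm A (P n)" "\<And>m n x. m \<noteq> n \<Longrightarrow> P m \<cdot> (P n \<cdot> x) = 0"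
    and e: "mproj e" "e \<noteq> 0"
    and W: "\<And>n. W n \<in> M" and \<delta>: "\<And>n. 0 \<le> \<delta> n" "\<And>n x. \<delta> n \<noteq> 0 \<Longrightarrow> radj (W n) \<cdot> (W n \<cdot> x) = e \<cdot> x"
    and res: "\<And>n D. D \<in> M \<Longrightarrow> psd D \<Longrightarrow> (\<And>x. inner (D \<cdot> x) x \<le> \<delta> n * norm A * (norm (radj (W n) \<cdot> x))\<^sup>2) \<Longrightarrow>
      \<exists>X\<in>M. (\<forall>x. P n \<cdot> (X \<cdot> x) = X \<cdot> x) \<and> (\<forall>x. radj X \<cdot> (A \<cdot> (X \<cdot> x)) = B n \<cdot> x - D \<cdot> x) \<and>
        (\<forall>x. (norm (X \<cdot> x))\<^sup>2 + \<delta> n * (norm (radj (W n) \<cdot> x))\<^sup>2 \<le> (norm x)\<^sup>2)"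
    and div: "\<And>k. \<not> summable (\<lambda>n. if \<kappa> n = k then \<delta> n else 0)"
  obtains Z where "\<And>n. Z n \<in> M" "\<And>n x. radj (Z n) \<cdot> (A \<cdot> (Z n \<cdot> x)) = B n \<cdot> x"
    "\<And>m n x. n < m \<Longrightarrow> P m \<cdot> (Z n \<cdot> x) = 0" "\<And>x. (\<lambda>n. Z n \<cdot> (radj (Z n) \<cdot> x)) sums x"
proof -
  obtain U \<nu> where U: "\<And>k::nat. U k \<in> M" "\<And>k. rproj (radj (U k) o\<^sub>L U k)" "\<And>k x. U k \<cdot> (e \<cdot> x) = U k \<cdot> x"
    "\<forall>k m x. \<nu> k \<le> (m::nat) \<longrightarrow> P m \<cdot> (U k \<cdot> x) = 0"
    and total: "\<forall>T :: nat \<Rightarrow> 'a \<Rightarrow>\<^sub>L 'a. (\<forall>n x. norm (T n \<cdot> x) \<le> norm x) \<longrightarrow>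
      (\<forall>k x. (\<lambda>n::nat. T n \<cdot> (U k \<cdot> (radj (U k) \<cdot> x))) \<longlonglongrightarrow> 0) \<longrightarrow> (\<forall>x. (\<lambda>n. T n \<cdot> x) \<longlonglongrightarrow> 0)"
    by (rule orthogonal_targets[OF e P(1)], rule P(3), assumption) (rule that)
  \<comment> \<open>Visits made before the target is orthogonal to the pieces still in reserve are
    wasted by \<open>V n = 0\<close>; only finitely many visits to each target are lost.\<close>
  define V where "V n = (if \<nu> (\<kappa> n) \<le> n then U (\<kappa> n) else 0)" for n
  have V: "V n \<in> M" "rproj (radj (V n) o\<^sub>L V n)" "V n \<cdot> (e \<cdot> x) = V n \<cdot> x" for n x
    using U by (simp_all add: V_def)
  have PV: "P m \<cdot> (V n \<cdot> x) = 0" if "n \<le> m" for m n x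
    using U(4) that by (simp add: V_def)
  define inv where "inv n T \<longleftrightarrow> T \<in> M \<and> psd T \<and> psd (id_blinfun - T) \<and> (\<forall>m\<ge>n. \<forall>x. P m \<cdot> (T \<cdot> x) = P m \<cdot> x)" for n T
  define rel where "rel n T Z \<longleftrightarrow> Z \<in> M \<and> (\<forall>x. radj Z \<cdot> (A \<cdot> (Z \<cdot> x)) = B n \<cdot> x) \<and> (\<forall>m>n. \<forall>x. P m \<cdot> (Z \<cdot> x) = 0) \<and>
    (\<forall>y. P n \<cdot> y = 0 \<longrightarrow> (norm (radj Z \<cdot> y))\<^sup>2 = \<delta> n * (norm (radj (V n) \<cdot> (T \<cdot> y)))\<^sup>2)" for n T Z
  have step: "\<exists>T'. inv (Suc n) T' \<and> (\<exists>Z. T' = T - (Z o\<^sub>L radj Z) \<and> rel n T Z)" if "inv n T" for n T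
  proof -
    have T: "T \<in> M" "psd T" "psd (id_blinfun - T)" "\<And>m x. n \<le> m \<Longrightarrow> P m \<cdot> (T \<cdot> x) = P m \<cdot> x"
      using that by (simp_all add: inv_def)
    have "\<exists>Z\<in>M. (\<forall>x. radj Z \<cdot> (A \<cdot> (Z \<cdot> x)) = B n \<cdot> x) \<and> (\<forall>x. (norm (radj Z \<cdot> x))\<^sup>2 \<le> inner (T \<cdot> x) x) \<and>
      (\<forall>Q. rproj Q \<longrightarrow> (\<forall>x. Q \<cdot> (P n \<cdot> x) = 0) \<longrightarrow> (\<forall>x. Q \<cdot> (T \<cdot> x) = Q \<cdot> x) \<longrightarrow> (\<forall>x. Q \<cdot> (V n \<cdot> x) = 0) \<longrightarrow> (\<forall>x. Q \<cdot> (Z \<cdot> x) = 0)) \<and>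
      (\<forall>y. P n \<cdot> y = 0 \<longrightarrow> (norm (radj Z \<cdot> y))\<^sup>2 = \<delta> n * (norm (radj (V n) \<cdot> (T \<cdot> y)))\<^sup>2)"
    proof (rule cover_step[where W = "W n" and e = e])
      show "radj (W n) \<cdot> (W n \<cdot> x) = e \<cdot> x" if "\<delta> n \<noteq> 0" for x by (rule \<delta>(2)[OF that])
      show "P n \<cdot> (T \<cdot> x) = P n \<cdot> x" "P n \<cdot> (V n \<cdot> x) = 0" for x
        by (rule T(4)[OF order_refl], rule PV[OF order_refl])
      show "\<exists>X\<in>M. (\<forall>x. P n \<cdot> (X \<cdot> x) = X \<cdot> x) \<and> (\<forall>x. radj X \<cdot> (A \<cdot> (X \<cdot> x)) = B n \<cdot> x - D \<cdot> x) \<and>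
          (\<forall>x. (norm (X \<cdot> x))\<^sup>2 + \<delta> n * (norm (radj (W n) \<cdot> x))\<^sup>2 \<le> (norm x)\<^sup>2)"
        if "D \<in> M" "psd D" "\<And>x. inner (D \<cdot> x) x \<le> \<delta> n * norm A * (norm (radj (W n) \<cdot> x))\<^sup>2" for D
        by (rule res[OF that])
    qed (rule A P(1,2) T(1-3) V e(1) W \<delta>(1))+
    then obtain Z where Z: "Z \<in> M" "\<And>x. radj Z \<cdot> (A \<cdot> (Z \<cdot> x)) = B n \<cdot> x" "\<And>x. (norm (radj Z \<cdot> x))\<^sup>2 \<le> inner (T \<cdot> x) x"
      "\<And>Q x. rproj Q \<Longrightarrow> (\<forall>x. Q \<cdot> (P n \<cdot> x) = 0) \<Longrightarrow> (\<forall>x. Q \<cdot> (T \<cdot> x) = Q \<cdot> x) \<Longrightarrow> (\<forall>x. Q \<cdot> (V n \<cdot> x) = 0) \<Longrightarrow> Q \<cdot> (Z \<cdot> x) = 0"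
      "\<And>y. P n \<cdot> y = 0 \<Longrightarrow> (norm (radj Z \<cdot> y))\<^sup>2 = \<delta> n * (norm (radj (V n) \<cdot> (T \<cdot> y)))\<^sup>2" by (elim bexE conjE) metis
    have PZ: "P m \<cdot> (Z \<cdot> x) = 0" if "n < m" for m x
      by (rule Z(4)) (use that P T PV in auto)
    have rel: "rel n T Z" using Z PZ by (simp add: rel_def)
    let ?T' = "T - (Z o\<^sub>L radj Z)"
    have ZZ: "psd (Z o\<^sub>L radj Z)" by (rule psd_radj_compose)
    have iZ: "inner ((Z o\<^sub>L radj Z) \<cdot> x) x = (norm (radj Z \<cdot> x))\<^sup>2" for x by (simp add: power2_norm_eq_inner radj)
    have "psd ?T'" unfolding psd_diff_iff iZ using Z(3) psd_sym[OF T(2)] psd_sym[OF ZZ] by simp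
    moreover have "psd (id_blinfun - ?T')"
    proof -
      have "id_blinfun - ?T' = (id_blinfun - T) + (Z o\<^sub>L radj Z)" by simp
      thus ?thesis using T(3) ZZ by (metis psd_simps(3))
    qed
    moreover have "?T' \<in> M" using T(1) Z(1) by blast
    ultimately have "inv (Suc n) ?T'" using T(4) PZ by (simp add: inv_def op_simps)
    thus ?thesis using rel by (intro exI[of _ ?T'] conjI exI[of _ Z] refl)
  qed
  have inv0: "inv 0 id_blinfun" by (simp add: inv_def)
  obtain T where T0: "T 0 = id_blinfun" and T: "\<And>n. inv n (T n)" "\<And>n. \<exists>Z. T (Suc n) = T n - (Z o\<^sub>L radj Z) \<and> rel n (T n) Z"
  proof -
    have "\<exists>f. \<forall>n. (inv n (f n) \<and> (n = 0 \<longrightarrow> f n = id_blinfun)) \<and> (\<exists>Z. f (Suc n) = f n - (Z o\<^sub>L radj Z) \<and> rel n (f n) Z)"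
      by (rule dependent_nat_choice[of "\<lambda>n R. inv n R \<and> (n = 0 \<longrightarrow> R = id_blinfun)" "\<lambda>n G G'. \<exists>Z. G' = G - (Z o\<^sub>L radj Z) \<and> rel n G Z"])
        (use inv0 step in auto)
    thus thesis using that by (elim exE) blast
  qed
  define Z where "Z n = (SOME Z. T (Suc n) = T n - (Z o\<^sub>L radj Z) \<and> rel n (T n) Z)" for n
  have TS: "T (Suc n) = T n - (Z n o\<^sub>L radj (Z n))" and rel: "rel n (T n) (Z n)" for n
    using someI_ex[OF T(2)[of n]] unfolding Z_def by (rule conjunct1, rule conjunct2)
  have Tp: "psd (T n)" "psd (id_blinfun - T n)" for n using T(1)[of n] by (simp_all add: inv_def)
  have Tc: "norm (T n \<cdot> x) \<le> norm x" for n x by (rule psd_contraction[OF Tp])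
  have Tle: "(norm (T n \<cdot> x))\<^sup>2 \<le> inner (T n \<cdot> x) x" for n x
  proof -
    have "inner (T n \<cdot> y) y \<le> 1 * (norm y)\<^sup>2" for y
      using psd_ge0[OF Tp(2), of n y] by (simp add: op_simps power2_norm_eq_inner)
    from psd_norm_sq_le[OF Tp(1) this] show ?thesis by simp
  qed
  have TSi: "inner (T (Suc n) \<cdot> x) x = inner (T n \<cdot> x) x - (norm (radj (Z n) \<cdot> x))\<^sup>2" for n x
    by (simp add: TS op_simps power2_norm_eq_inner radj)
  have U0: "(\<lambda>n. T n \<cdot> (U k \<cdot> (radj (U k) \<cdot> x))) \<longlonglongrightarrow> 0" for k x
  proof -
    define y where "y = U k \<cdot> (radj (U k) \<cdot> x)"
    have Uy: "U k \<cdot> (radj (U k) \<cdot> y) = y" using partial_isometry_radj(1)[OF U(2)] by (simp add: y_def)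
    have Uc: "norm (radj (U k) \<cdot> z) \<le> norm z" for z by (rule partial_isometry_radj(5)[OF U(2)])
    have "(\<lambda>n. inner (T n \<cdot> y) y) \<longlonglongrightarrow> 0"
    proof (rule decseq_to_zero[of _ "\<lambda>n. if \<kappa> n = k then \<delta> n else 0" "\<nu> k" "(norm y)\<^sup>2"])
      show "0 \<le> inner (T n \<cdot> y) y" for n by (rule psd_ge0[OF Tp(1)])
      show "inner (T (Suc n) \<cdot> y) y \<le> inner (T n \<cdot> y) y" for n unfolding TSi by simp
      show "0 \<le> (if \<kappa> n = k then \<delta> n else 0)" for n using \<delta>(1) by simp
      show "\<not> summable (\<lambda>n. if \<kappa> n = k then \<delta> n else 0)" by (rule div)
      fix n assume n: "\<nu> k \<le> n"
      show "(if \<kappa> n = k then \<delta> n else 0) * (inner (T n \<cdot> y) y)\<^sup>2 \<le> (norm y)\<^sup>2 * (inner (T n \<cdot> y) y - inner (T (Suc n) \<cdot> y) y)"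
      proof (cases "\<kappa> n = k")
        case True
        hence Vn: "V n = U k" using n by (simp add: V_def)
        have "P n \<cdot> y = 0" using U(4) n by (simp add: y_def)
        hence Zy: "(norm (radj (Z n) \<cdot> y))\<^sup>2 = \<delta> n * (norm (radj (U k) \<cdot> (T n \<cdot> y)))\<^sup>2"
          using rel[of n] Vn by (simp add: rel_def)
        \<comment> \<open>Since \<open>y\<close> lies in the target, its energy is an inner product
          of images under \<open>radj (U k)\<close>, and Cauchy-Schwarz compares it with the amount
          covered at this stage.\<close>
        have "inner (T n \<cdot> y) y = inner (T n \<cdot> y) (U k \<cdot> (radj (U k) \<cdot> y))" by (simp only: Uy)
        also have "\<dots> = inner (radj (U k) \<cdot> (T n \<cdot> y)) (radj (U k) \<cdot> y)" by (rule radj')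
        also have "\<dots> \<le> norm (radj (U k) \<cdot> (T n \<cdot> y)) * norm (radj (U k) \<cdot> y)" by (rule norm_cauchy_schwarz)
        also have "\<dots> \<le> norm (radj (U k) \<cdot> (T n \<cdot> y)) * norm y" by (intro mult_left_mono Uc) simp
        finally have "(inner (T n \<cdot> y) y)\<^sup>2 \<le> (norm (radj (U k) \<cdot> (T n \<cdot> y)) * norm y)\<^sup>2"
          using psd_ge0[OF Tp(1)] by (intro power_mono) auto
        hence "\<delta> n * (inner (T n \<cdot> y) y)\<^sup>2 \<le> \<delta> n * (norm (radj (U k) \<cdot> (T n \<cdot> y)) * norm y)\<^sup>2"
          using \<delta>(1) by (rule mult_left_mono)
        also have "\<dots> = (norm y)\<^sup>2 * (norm (radj (Z n) \<cdot> y))\<^sup>2" unfolding Zy by (simp add: power_mult_distrib)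
        finally show ?thesis using True by (simp add: TSi)
      qed (simp add: TSi)
    qed
    hence "(\<lambda>n. (norm (T n \<cdot> y))\<^sup>2) \<longlonglongrightarrow> 0"
      by (rule tendsto_sandwich[rotated 2, OF tendsto_const]) (use Tle in auto)
    hence "(\<lambda>n. norm (T n \<cdot> y)) \<longlonglongrightarrow> 0" by (simp add: power_tendsto_0_iff)
    thus ?thesis unfolding y_def by (rule tendsto_norm_zero_cancel)
  qed
  have Tlim: "(\<lambda>n. T n \<cdot> x) \<longlonglongrightarrow> 0" for x using total Tc U0 by blast
  show ?thesis
  proof (rule that[of Z])
    show "Z n \<in> M" "radj (Z n) \<cdot> (A \<cdot> (Z n \<cdot> x)) = B n \<cdot> x" for n x using rel[of n] by (simp_all add: rel_def)
    show "P m \<cdot> (Z n \<cdot> x) = 0" if "n < m" for m n x using rel[of n] that by (simp add: rel_def)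
    fix x
    have "(\<Sum>k<n. Z k \<cdot> (radj (Z k) \<cdot> x)) = x - T n \<cdot> x" for n
      by (induction n) (simp_all add: T0 TS op_simps)
    moreover have "(\<lambda>n. x - T n \<cdot> x) \<longlonglongrightarrow> x - 0" by (intro tendsto_intros Tlim)
    ultimately show "(\<lambda>n. Z n \<cdot> (radj (Z n) \<cdot> x)) sums x" by (simp add: sums_def)
  qed
qed



lemma decomposition:
  assumes A: "A \<in> M" "psd A"
    and P: "\<And>n::nat. ocomm A (P n)" "\<And>n. big (P n)"
    and Z: "\<And>n. Z n \<in> M" "\<And>n x. radj (Z n) \<cdot> (A \<cdot> (Z n \<cdot> x)) = B n \<cdot> x"
      "\<And>m n x. n < m \<Longrightarrow> P m \<cdot> (Z n \<cdot> x) = 0" "\<And>x. (\<lambda>n. Z n \<cdot> (radj (Z n) \<cdot> x)) sums x"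
  obtains X where "\<And>n. X n \<in> M" "\<And>n. radj (X n) o\<^sub>L X n = B n" "\<And>n. \<exists>Q. big Q \<and> (\<forall>x. X n \<cdot> (radj (X n) \<cdot> (Q \<cdot> x)) = 0)"
    "\<And>x. (\<lambda>n. X n \<cdot> (radj (X n) \<cdot> x)) sums (A \<cdot> x)"
proof -
  define R where "R = osqrt A"
  note R = osqrt[OF A(2), folded R_def]
  have Rr: "radj R = R" using R(5) by (simp add: sym_op_radj)
  define X where "X n = R o\<^sub>L Z n" for n
  have RP: "R \<cdot> (P m \<cdot> x) = P m \<cdot> (R \<cdot> x)" for m x
    using R(4)[of "P m"] P(1)[of m] by (simp add: ocomm_def)
  show ?thesis
  proof (rule that[of X])
    show "X n \<in> M" for n unfolding X_def using osqrt_closed[OF A] Z(1) by (auto simp: R_def)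
    show "radj (X n) o\<^sub>L X n = B n" for n
      by (rule blinfun_eqI) (simp add: X_def Rr R(3) Z(2))
    fix n
    have Pm: "rproj (P (Suc n))" using P(2) by (auto simp: big_def)
    have "radj (Z n) \<cdot> (P (Suc n) \<cdot> x) = 0" for x
      by (rule inner_eq_all_imp_eq) (simp add: sym_opD[OF rproj_sym[OF Pm]] Z(3) flip: radj')
    hence "X n \<cdot> (radj (X n) \<cdot> (P (Suc n) \<cdot> x)) = 0" for x by (simp add: X_def Rr RP)
    thus "\<exists>Q. big Q \<and> (\<forall>x. X n \<cdot> (radj (X n) \<cdot> (Q \<cdot> x)) = 0)" using P(2) by blast
  next
    fix x
    have "(\<lambda>n. R \<cdot> (Z n \<cdot> (radj (Z n) \<cdot> (R \<cdot> x)))) sums (R \<cdot> (R \<cdot> x))"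
      by (rule bounded_linear.sums[OF blinfun.bounded_linear_right Z(4)])
    thus "(\<lambda>n. X n \<cdot> (radj (X n) \<cdot> x)) sums (A \<cdot> x)" by (simp add: X_def Rr R(3))
  qed
qed

end

section \<open>Divergent series along classes\<close>

text \<open>By monotonicity a block of \<open>q\<close> consecutive terms is at most
  \<open>q\<close> times the term of the progression in the preceding block; the very first block is
  bounded by \<open>q * d 0\<close>.\<close>

lemma summable_of_progression:
  fixes d :: "nat \<Rightarrow> real"
  assumes d: "\<And>n. 0 \<le> d n" "antimono d" and q: "0 < q" and s: "summable (\<lambda>i. d (q * i + r))" and r: "r < q"
  shows "summable d"
proof -
  let ?f = "\<lambda>i. d (q * i + r)"
  have bound: "sum d {..<m * q} \<le> real q * d 0 + real q * suminf ?f" for m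
  proof (cases m)
    case (Suc m')
    have "sum d {..<m * q} = (\<Sum>i<m. sum d {i * q..<i * q + q})" by (rule sum.nat_group[symmetric])
    also have "\<dots> = sum d {0..<q} + (\<Sum>i<m'. sum d {Suc i * q..<Suc i * q + q})"
      unfolding Suc by (subst sum.lessThan_Suc_shift) simp
    also have "\<dots> \<le> real q * d 0 + (\<Sum>i<m'. real q * ?f i)"
    proof (intro add_mono sum_mono)
      have "sum d {0..<q} \<le> of_nat (card {0..<q}) * d 0"
        by (rule sum_bounded_above) (use d(2) in \<open>auto dest: antimonoD\<close>)
      thus "sum d {0..<q} \<le> real q * d 0" by simp
      fix i
      have "sum d {Suc i * q..<Suc i * q + q} \<le> of_nat (card {Suc i * q..<Suc i * q + q}) * ?f i"
      proof (rule sum_bounded_above)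
        fix n assume "n \<in> {Suc i * q..<Suc i * q + q}"
        hence "q * i + r \<le> n" using r by (simp add: mult.commute)
        thus "d n \<le> ?f i" by (rule antimonoD[OF d(2)])
      qed
      thus "sum d {Suc i * q..<Suc i * q + q} \<le> real q * ?f i" by simp
    qed
    also have "\<dots> \<le> real q * d 0 + real q * suminf ?f"
      by (simp flip: sum_distrib_left) (intro mult_left_mono sum_le_suminf s, auto simp: d)
    finally show ?thesis .
  qed (simp add: d suminf_nonneg[OF s])
  show ?thesis
  proof (rule summableI_nonneg_bounded[OF d(1)])
    fix n
    have "n \<le> n * q" using q by simp
    hence "sum d {..<n} \<le> sum d {..<n * q}" by (intro sum_mono2) (auto simp: d)
    thus "sum d {..<n} \<le> real q * d 0 + real q * suminf ?f" using bound[of n] by linarith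
  qed
qed

text \<open>The classes are the 2-adic valuations: each of them contains an arithmetic progression, along
  which a decreasing divergent series still diverges.\<close>

lemma divergent_classes:
  fixes d :: "nat \<Rightarrow> real"
  assumes d: "\<And>n. 0 \<le> d n" "antimono d" "\<not> summable d" and I: "infinite I"
  obtains \<kappa> \<rho> :: "nat \<Rightarrow> nat" where "inj_on \<rho> I"
    "\<And>k. \<not> summable (\<lambda>n. if \<kappa> n = k then (if n \<in> I then d (\<rho> n) else 0) else 0)"
proof -
  \<comment> \<open>The rank of an index within \<open>I\<close>, so that the terms of
    \<open>d\<close> are consumed in order along \<open>I\<close> and none is used twice.\<close>
  define \<rho> where "\<rho> = inv_into UNIV (enumerate I)"
  define \<kappa> where "\<kappa> n = multiplicity 2 (Suc (\<rho> n))" for n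
  have inj: "inj (enumerate I)" using strict_mono_enumerate[OF I] strict_mono_imp_inj_on by blast
  have \<rho>: "\<rho> (enumerate I r) = r" for r unfolding \<rho>_def using inj by simp
  have "inj_on \<rho> I"
    unfolding \<rho>_def by (rule inj_on_inv_into) (simp add: range_enumerate[OF I])
  moreover have "\<not> summable (\<lambda>n. if \<kappa> n = k then (if n \<in> I then d (\<rho> n) else 0) else 0)" for k
  proof
    let ?g = "\<lambda>n. if \<kappa> n = k then (if n \<in> I then d (\<rho> n) else 0) else 0"
    \<comment> \<open>The members of \<open>I\<close> of class \<open>k\<close>: their ranks
      \<open>r\<close> satisfy \<open>Suc r = 2 ^ k * (2 * i + 1)\<close> and form a progression of
      step \<open>2 ^ Suc k\<close>.\<close>
    define h where "h i = enumerate I (2 ^ Suc k * i + (2 ^ k - 1))" for i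
    assume "summable ?g"
    moreover have "inj h"
    proof (rule injI)
      fix x y assume "h x = h y"
      hence "2 ^ Suc k * x + (2 ^ k - 1) = 2 ^ Suc k * y + (2 ^ k - 1)" unfolding h_def by (rule injD[OF inj])
      thus "x = y" by (simp only: add_right_cancel) simp
    qed
    ultimately have "summable (?g \<circ> h)" by (intro summable_reindex) (auto simp: d)
    moreover have "?g (h i) = d (2 ^ Suc k * i + (2 ^ k - 1))" for i
    proof -
      have e: "Suc (2 ^ Suc k * i + (2 ^ k - 1)) = 2 ^ k * (2 * i + 1)" by (simp add: algebra_simps)
      have "multiplicity 2 (2 ^ k * (2 * i + 1) :: nat) = k"
      proof (rule multiplicity_eqI)
        show "\<not> (2::nat) ^ Suc k dvd 2 ^ k * (2 * i + 1)"
        proof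
          assume "(2::nat) ^ Suc k dvd 2 ^ k * (2 * i + 1)"
          hence "2 ^ k * 2 dvd 2 ^ k * (2 * i + 1)" by (simp only: power_Suc2)
          hence "2 dvd 2 * i + 1" by (subst (asm) nat_mult_dvd_cancel1) auto
          thus False by presburger
        qed
      qed simp
      hence "\<kappa> (h i) = k" unfolding \<kappa>_def h_def \<rho> e .
      thus ?thesis by (simp add: h_def \<rho> enumerate_in_set[OF I])
    qed
    ultimately have "summable (\<lambda>i. d (2 ^ Suc k * i + (2 ^ k - 1)))" by (simp add: o_def)
    moreover have "(2::nat) ^ k - 1 < 2 ^ Suc k" by (simp add: less_imp_diff_less)
    ultimately have "summable d" by (intro summable_of_progression[OF d(1,2)]) auto
    thus False using d(3) by simp
  qed
  ultimately show ?thesis by (rule that)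
qed

section \<open>Compressions onto reserved pieces\<close>

context real_factor
begin

text \<open>Composing \<open>Y\<close> with the inverse square root of \<open>A\<close> on
  \<open>P\<close> turns the Gram operator of \<open>Y\<close> into a compression of
  \<open>A\<close>; the lower bound \<open>l\<close> limits the price to a factor
  \<open>1 / l\<close>.\<close>

lemma compress_lift:
  assumes A: "A \<in> M" "psd A" and P: "mproj P" "ocomm A P"
    and l: "0 < l" "\<And>x. l * (norm (P \<cdot> x))\<^sup>2 \<le> inner (A \<cdot> (P \<cdot> x)) (P \<cdot> x)"
    and Y: "Y \<in> M" "\<And>x. P \<cdot> (Y \<cdot> x) = Y \<cdot> x"
  obtains X where "X \<in> M" "\<And>x. P \<cdot> (X \<cdot> x) = X \<cdot> x" "\<And>x. radj X \<cdot> (A \<cdot> (X \<cdot> x)) = radj Y \<cdot> (Y \<cdot> x)"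
    "\<And>x. l * (norm (X \<cdot> x))\<^sup>2 \<le> (norm (Y \<cdot> x))\<^sup>2"
proof -
  show ?thesis
  proof (rule normalizer_exists[OF A(2) mprojD(2)[OF P(1)] P(2) l])
    fix h assume h: "psd h" "\<And>x. P \<cdot> (h \<cdot> x) = h \<cdot> x" "\<And>x. h \<cdot> (A \<cdot> (h \<cdot> x)) = P \<cdot> x"
      "\<And>x. l * (norm (h \<cdot> x))\<^sup>2 \<le> (norm (P \<cdot> x))\<^sup>2"
      and hc: "\<And>Z. ocomm Z A \<Longrightarrow> ocomm Z P \<Longrightarrow> ocomm Z h"
    have hM: "h \<in> M" by (rule memI, rule hc) (rule mem_ocomm[OF A(1)] mem_ocomm[OF mprojD(1)[OF P(1)]], assumption)+
    have hr: "radj h = h" using psd_sym[OF h(1)] by (simp add: sym_op_radj)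
    show thesis
    proof (rule that[of "h o\<^sub>L Y"])
      show "h o\<^sub>L Y \<in> M" using hM Y(1) by blast
      show "P \<cdot> ((h o\<^sub>L Y) \<cdot> x) = (h o\<^sub>L Y) \<cdot> x" for x by (simp add: h(2))
      show "radj (h o\<^sub>L Y) \<cdot> (A \<cdot> ((h o\<^sub>L Y) \<cdot> x)) = radj Y \<cdot> (Y \<cdot> x)" for x by (simp add: hr h(3) Y(2))
      show "l * (norm ((h o\<^sub>L Y) \<cdot> x))\<^sup>2 \<le> (norm (Y \<cdot> x))\<^sup>2" for x using h(4)[of "Y \<cdot> x"] by (simp add: Y(2))
    qed
  qed
qed

text \<open>An infinite \<open>P\<close> contains an isometric image of the whole space, so the
  square root of any positive \<open>K\<close> of \<open>M\<close> fits into it and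
  \<open>compress_lift\<close> applies.\<close>

lemma compress_psd:
  assumes A: "A \<in> M" "psd A" and P: "big P" "ocomm A P"
    and l: "0 < l" "\<And>x. l * (norm (P \<cdot> x))\<^sup>2 \<le> inner (A \<cdot> (P \<cdot> x)) (P \<cdot> x)" and K: "K \<in> M" "psd K"
  obtains X where "X \<in> M" "\<And>x. P \<cdot> (X \<cdot> x) = X \<cdot> x" "\<And>x. radj X \<cdot> (A \<cdot> (X \<cdot> x)) = K \<cdot> x"
    "\<And>x. l * (norm (X \<cdot> x))\<^sup>2 \<le> inner (K \<cdot> x) x"
proof -
  have Pm: "mproj P" using P(1) by (simp add: big_def)
  obtain U where U: "emb U id_blinfun P" using P(1) by (auto simp: big_def subeq_def)
  note Ud = embD[OF U]
  note R = osqrt[OF K(2)]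
  let ?Y = "U o\<^sub>L osqrt K"
  have Yr: "radj ?Y \<cdot> (?Y \<cdot> x) = K \<cdot> x" for x
    using R(5) by (simp add: Ud(2) R(3) sym_op_radj)
  have Yn: "(norm (?Y \<cdot> x))\<^sup>2 = inner (K \<cdot> x) x" for x
    using Yr[of x] radj'[of "?Y \<cdot> x" ?Y x] by (simp only: power2_norm_eq_inner)
  show ?thesis
  proof (rule compress_lift[OF A Pm P(2) l, of ?Y])
    show "?Y \<in> M" using Ud(1) osqrt_closed[OF K] by blast
    show "P \<cdot> (?Y \<cdot> x) = ?Y \<cdot> x" for x by (simp add: Ud(3))
    fix X assume X: "X \<in> M" "\<And>x. P \<cdot> (X \<cdot> x) = X \<cdot> x" "\<And>x. radj X \<cdot> (A \<cdot> (X \<cdot> x)) = radj ?Y \<cdot> (?Y \<cdot> x)"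
      "\<And>x. l * (norm (X \<cdot> x))\<^sup>2 \<le> (norm (?Y \<cdot> x))\<^sup>2"
    show thesis by (rule that[OF X(1,2)]) (use X(3,4) in \<open>simp_all only: Yr Yn\<close>)
  qed
qed

text \<open>A single piece is only known to contain a copy of \<open>e\<close>; an infinite
  orthogonal family of pieces adds up to an infinite projection, and common lower bounds of
  \<open>A\<close> and orthogonality relations pass to the sum.\<close>

lemma group_pieces:
  assumes A: "A \<in> M" "psd A" and e: "mproj e" "e \<noteq> 0"
    and J: "\<And>k::nat. mproj (J k)" "\<And>k. ocomm A (J k)" "\<And>k. subeq e (J k)"
      "\<And>i j x. i \<noteq> j \<Longrightarrow> J i \<cdot> (J j \<cdot> x) = 0"
  obtains P where "big P" "ocomm A P" "\<And>k x. P \<cdot> (J k \<cdot> x) = J k \<cdot> x"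
    "\<And>l. (\<And>k x. l * (norm (J k \<cdot> x))\<^sup>2 \<le> inner (A \<cdot> (J k \<cdot> x)) (J k \<cdot> x)) \<Longrightarrow>
      (\<forall>x. l * (norm (P \<cdot> x))\<^sup>2 \<le> inner (A \<cdot> (P \<cdot> x)) (P \<cdot> x))"
    "\<And>Q. (\<And>k x. Q \<cdot> (J k \<cdot> x) = 0) \<Longrightarrow> (\<forall>x. Q \<cdot> (P \<cdot> x) = 0)"
proof -
  obtain P where P: "mproj P" "\<And>x. (\<lambda>k. J k \<cdot> x) sums (P \<cdot> x)" "\<And>k x. P \<cdot> (J k \<cdot> x) = J k \<cdot> x"
    by (rule mproj_sums[of J]) (use J that in blast)+
  have AP: "ocomm A P" by (rule sums_ocomm[OF P(2) J(2)])
  have form: "inner (A \<cdot> (Q \<cdot> x)) x = inner (A \<cdot> (Q \<cdot> x)) (Q \<cdot> x)" if "mproj Q" "ocomm A Q" for Q x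
    using sym_opD[OF rproj_sym[OF mprojD(2)[OF that(1)]], of "A \<cdot> (Q \<cdot> x)" x] mprojD(2)[OF that(1)]
    by (simp add: ocommD[OF that(2), symmetric])
  show ?thesis
  proof (rule that[of P])
    show "big P" by (rule big_of_copies[OF e J(1,3) _ P(1,3)]) (rule J(4))
    show "\<forall>x. l * (norm (P \<cdot> x))\<^sup>2 \<le> inner (A \<cdot> (P \<cdot> x)) (P \<cdot> x)"
      if l: "\<And>k x. l * (norm (J k \<cdot> x))\<^sup>2 \<le> inner (A \<cdot> (J k \<cdot> x)) (J k \<cdot> x)" for l
    proof
      fix x
      have "(\<lambda>k. l * inner (J k \<cdot> x) x) sums (l * inner (P \<cdot> x) x)"
        by (intro sums_mult bounded_linear.sums[OF bounded_linear_inner_left P(2)])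
      moreover have "(\<lambda>k. inner (A \<cdot> (J k \<cdot> x)) x) sums inner (A \<cdot> (P \<cdot> x)) x"
        by (intro bounded_linear.sums[OF bounded_linear_inner_left]
            bounded_linear.sums[OF blinfun.bounded_linear_right] P(2))
      ultimately have "l * inner (P \<cdot> x) x \<le> inner (A \<cdot> (P \<cdot> x)) x"
        by (rule sums_le[rotated]) (use l in \<open>simp add: form[OF J(1,2)] rproj_inner[OF mprojD(2)[OF J(1)]]\<close>)
      thus "l * (norm (P \<cdot> x))\<^sup>2 \<le> inner (A \<cdot> (P \<cdot> x)) (P \<cdot> x)"
        by (simp add: form[OF P(1) AP] rproj_inner[OF mprojD(2)[OF P(1)]])
    qed
    show "\<forall>x. Q \<cdot> (P \<cdot> x) = 0" if "\<And>k x. Q \<cdot> (J k \<cdot> x) = 0" for Q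
    proof
      fix x
      have "(\<lambda>k. Q \<cdot> (J k \<cdot> x)) sums (Q \<cdot> (P \<cdot> x))"
        by (rule bounded_linear.sums[OF blinfun.bounded_linear_right P(2)])
      thus "Q \<cdot> (P \<cdot> x) = 0" unfolding that using sums_unique2 sums_zero by blast
    qed
  qed (rule AP P(3))+
qed

text \<open>The range condition puts \<open>W o\<^sub>L radj W\<close> below the spectral
  projection, on which \<open>B\<close> is at least \<open>\<beta>\<close>; the rest of
  \<open>B\<close> only adds to the form.\<close>

lemma lower_bound_by_range:
  assumes B: "B \<in> M" "psd B" and S: "S \<in> sets borel" "S \<subseteq> {\<beta>..}" and W: "\<And>x. spec B S \<cdot> (W \<cdot> x) = W \<cdot> x"
    "\<And>x. norm (radj W \<cdot> x) \<le> norm x" and \<beta>: "0 \<le> \<beta>"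
  shows "norm (radj W \<cdot> x) \<le> norm (spec B S \<cdot> x)" "\<beta> * (norm (radj W \<cdot> x))\<^sup>2 \<le> inner (B \<cdot> x) x"
proof -
  note Bsym = psd_sym[OF B(2)]
  let ?F = "spec B S"
  have F: "rproj ?F" by (rule spec(1)[OF Bsym S(1)])
  have "radj W \<cdot> x = radj W \<cdot> (?F \<cdot> x)" for x
    by (rule inner_eq_all_imp_eq) (simp add: sym_opD[OF rproj_sym[OF F]] W(1) flip: radj')
  thus 1: "norm (radj W \<cdot> x) \<le> norm (?F \<cdot> x)" by (metis W(2))
  have BF: "?F \<cdot> (B \<cdot> x) = B \<cdot> (?F \<cdot> x)" for x by (rule spec_ocomm[OF Bsym S(1), symmetric])
  have o: "inner (B \<cdot> (?F \<cdot> x)) (x - ?F \<cdot> x) = 0"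
  proof -
    have "inner (?F \<cdot> (B \<cdot> x)) (x - ?F \<cdot> x) = inner (B \<cdot> x) (?F \<cdot> (x - ?F \<cdot> x))" by (rule sym_opD[OF rproj_sym[OF F]])
    thus ?thesis using F by (simp add: BF blinfun.diff_right)
  qed
  have "\<beta> * (norm (radj W \<cdot> x))\<^sup>2 \<le> \<beta> * (norm (?F \<cdot> x))\<^sup>2" using 1 \<beta> by (intro mult_left_mono power_mono) auto
  also have "\<dots> \<le> inner (B \<cdot> (?F \<cdot> x)) (?F \<cdot> x)" by (rule spec_ge[OF Bsym S])
  also have "\<dots> \<le> inner (B \<cdot> (?F \<cdot> x)) (?F \<cdot> x) + inner (B \<cdot> (x - ?F \<cdot> x)) (x - ?F \<cdot> x)"
    using psd_ge0[OF B(2)] by simp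
  also have "\<dots> = inner (B \<cdot> x) x"
    using o sym_op_swap[OF Bsym, of "?F \<cdot> x" x] by (simp add: op_simps)
  finally show "\<beta> * (norm (radj W \<cdot> x))\<^sup>2 \<le> inner (B \<cdot> x) x" .
qed

text \<open>\<open>B - D\<close> is divided into \<open>\<beta> / 2\<close> times
  \<open>W o\<^sub>L radj W\<close>, compressed onto \<open>G\<close> where \<open>A\<close> is at
  least \<open>s\<close>, and a rest, compressed onto \<open>P\<close> where \<open>A\<close> is at
  least \<open>\<alpha>\<close>. Moving the first part to the higher level saves
  \<open>\<beta> / 2 * (1 / \<alpha> - 1 / s)\<close> of the budget, and \<open>\<delta>\<close> is
  paid from this saving. The other half of \<open>\<beta>\<close> keeps the rest positive after
  \<open>D\<close> is subtracted.\<close>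

lemma resource_slack:
  assumes A: "A \<in> M" "psd A" and B: "B \<in> M" "psd B" "\<And>x. inner (B \<cdot> x) x \<le> \<alpha> * (norm x)\<^sup>2" and \<alpha>: "0 < \<alpha>" "\<alpha> < s"
    and P: "big P" "ocomm A P" "\<And>x. \<alpha> * (norm (P \<cdot> x))\<^sup>2 \<le> inner (A \<cdot> (P \<cdot> x)) (P \<cdot> x)"
    and G: "mproj G" "ocomm A G" "\<And>x. s * (norm (G \<cdot> x))\<^sup>2 \<le> inner (A \<cdot> (G \<cdot> x)) (G \<cdot> x)" "\<And>x. P \<cdot> (G \<cdot> x) = 0"
    and e: "mproj e" and w: "emb w e G" and W: "emb W e (spec B {\<beta><..})" and \<beta>: "0 < \<beta>"
    and \<delta>: "0 \<le> \<delta>" "\<delta> * norm A \<le> \<beta> / 2" "\<delta> \<le> \<beta> / 2 * (1 / \<alpha> - 1 / s)"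
    and D: "D \<in> M" "psd D" "\<And>x. inner (D \<cdot> x) x \<le> \<delta> * norm A * (norm (radj W \<cdot> x))\<^sup>2"
  shows "\<exists>X\<in>M. (\<forall>x. (P + G) \<cdot> (X \<cdot> x) = X \<cdot> x) \<and> (\<forall>x. radj X \<cdot> (A \<cdot> (X \<cdot> x)) = B \<cdot> x - D \<cdot> x) \<and>
        (\<forall>x. (norm (X \<cdot> x))\<^sup>2 + \<delta> * (norm (radj W \<cdot> x))\<^sup>2 \<le> (norm x)\<^sup>2)"
proof -
  note Wd = embD[OF W] and wd = embD[OF w]
  have Pm: "mproj P" using P(1) by (simp add: big_def)
  have GP: "G \<cdot> (P \<cdot> x) = 0" for x by (rule rproj_orth_sym[of P]) (use Pm G in auto)
  have Wc: "norm (radj W \<cdot> x) \<le> norm x" for x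
    using contraction_radj[of W 1 x] partial_isometry(5)[OF mprojD(2)[OF e] Wd(2)] by simp
  have We: "e \<cdot> (radj W \<cdot> x) = radj W \<cdot> x" for x by (rule partial_isometry(2)[OF mprojD(2)[OF e] Wd(2)])
  have lowB: "\<beta> * (norm (radj W \<cdot> x))\<^sup>2 \<le> inner (B \<cdot> x) x" for x
    by (rule lower_bound_by_range(2)[OF B(1,2) _ _ Wd(3) Wc]) (use \<beta> in auto)
  define c where "c = sqrt (\<beta> / 2)"
  have c2: "c * c = \<beta> / 2" using \<beta> by (simp add: c_def)
  define Y where "Y = c *\<^sub>R (w o\<^sub>L radj W)"
  have Yx: "Y \<cdot> x = c *\<^sub>R (w \<cdot> (radj W \<cdot> x))" for x by (simp add: Y_def blinfun.scaleR_left)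
  have YM: "Y \<in> M" using wd(1) Wd(1) by (auto simp: Y_def)
  have GY: "G \<cdot> (Y \<cdot> x) = Y \<cdot> x" for x by (simp add: Yx blinfun.scaleR_right wd(3))
  have rY: "radj Y \<cdot> (Y \<cdot> x) = (\<beta> / 2) *\<^sub>R (W \<cdot> (radj W \<cdot> x))" for x
    by (simp add: Y_def blinfun.scaleR_left blinfun.scaleR_right wd(2) We c2)
  have nY: "(norm (Y \<cdot> x))\<^sup>2 = \<beta> / 2 * (norm (radj W \<cdot> x))\<^sup>2" for x
    using c2 by (simp add: Yx power_mult_distrib partial_isometry(4)[OF mprojD(2)[OF e] wd(2)] We power2_eq_square[of c])
  have s0: "0 < s" using \<alpha> by simp
  obtain X1 where X1: "X1 \<in> M" "\<And>x. G \<cdot> (X1 \<cdot> x) = X1 \<cdot> x" "\<And>x. radj X1 \<cdot> (A \<cdot> (X1 \<cdot> x)) = radj Y \<cdot> (Y \<cdot> x)"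
    "\<And>x. s * (norm (X1 \<cdot> x))\<^sup>2 \<le> (norm (Y \<cdot> x))\<^sup>2"
    by (rule compress_lift[OF A G(1,2) s0 G(3) YM GY]) (rule that)
  define K where "K = B - D - (\<beta> / 2) *\<^sub>R (W o\<^sub>L radj W)"
  have Kx: "inner (K \<cdot> x) x = inner (B \<cdot> x) x - inner (D \<cdot> x) x - \<beta> / 2 * (norm (radj W \<cdot> x))\<^sup>2" for x
    by (simp add: K_def op_simps power2_norm_eq_inner radj)
  have KM: "K \<in> M" unfolding K_def using B(1) D(1) Wd(1) by blast
  have Kp: "psd K"
    unfolding psd_def
  proof (intro conjI allI)
    have "sym_op (W o\<^sub>L radj W)" by (rule psd_sym[OF psd_radj_compose(2)])
    thus "sym_op K" unfolding K_def using psd_sym[OF B(2)] psd_sym[OF D(2)] by simp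
    fix x
    have "\<delta> * norm A * (norm (radj W \<cdot> x))\<^sup>2 \<le> \<beta> / 2 * (norm (radj W \<cdot> x))\<^sup>2"
      by (intro mult_right_mono \<delta>(2)) simp
    thus "0 \<le> inner (K \<cdot> x) x" unfolding Kx using D(3)[of x] lowB[of x] by simp
  qed
  obtain X2 where X2: "X2 \<in> M" "\<And>x. P \<cdot> (X2 \<cdot> x) = X2 \<cdot> x" "\<And>x. radj X2 \<cdot> (A \<cdot> (X2 \<cdot> x)) = K \<cdot> x"
    "\<And>x. \<alpha> * (norm (X2 \<cdot> x))\<^sup>2 \<le> inner (K \<cdot> x) x"
    by (rule compress_psd[OF A P(1,2) \<alpha>(1) P(3) KM Kp]) (rule that)
  have GX2: "G \<cdot> (X2 \<cdot> x) = 0" and PX1: "P \<cdot> (X1 \<cdot> x) = 0" for x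
    using GP[of "X2 \<cdot> x"] G(4)[of "X1 \<cdot> x"] by (simp_all add: X1(2) X2(2))
  have rX1: "radj X1 \<cdot> (G \<cdot> x) = radj X1 \<cdot> x" and rX2: "radj X2 \<cdot> (P \<cdot> x) = radj X2 \<cdot> x" for x
    by (rule inner_eq_all_imp_eq, simp add: sym_opD[OF rproj_sym] mprojD[OF G(1)] mprojD[OF Pm] X1(2) X2(2) flip: radj')+
  have cross1: "radj X1 \<cdot> (A \<cdot> (X2 \<cdot> x)) = 0" for x
    using rX1[of "A \<cdot> (X2 \<cdot> x)"] by (simp add: GX2 flip: ocommD[OF G(2)])
  have cross2: "radj X2 \<cdot> (A \<cdot> (X1 \<cdot> x)) = 0" for x
    using rX2[of "A \<cdot> (X1 \<cdot> x)"] by (simp add: PX1 flip: ocommD[OF P(2)])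
  show ?thesis
  proof (intro bexI[of _ "X1 + X2"] conjI allI)
    show "X1 + X2 \<in> M" using X1(1) X2(1) by blast
    fix x
    show "(P + G) \<cdot> ((X1 + X2) \<cdot> x) = (X1 + X2) \<cdot> x"
      by (simp add: blinfun.add_left blinfun.add_right PX1 GX2 X1(2) X2(2))
    show "radj (X1 + X2) \<cdot> (A \<cdot> ((X1 + X2) \<cdot> x)) = B \<cdot> x - D \<cdot> x"
      by (simp add: blinfun.add_left blinfun.add_right cross1 cross2 X1(3) X2(3) rY K_def blinfun.diff_left blinfun.scaleR_left)
    have "inner (X1 \<cdot> x) (X2 \<cdot> x) = 0"
    proof -
      have "inner (G \<cdot> (X1 \<cdot> x)) (X2 \<cdot> x) = inner (X1 \<cdot> x) (G \<cdot> (X2 \<cdot> x))"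
        by (rule sym_opD[OF rproj_sym[OF mprojD(2)[OF G(1)]]])
      thus ?thesis by (simp add: X1(2) GX2)
    qed
    hence n: "(norm ((X1 + X2) \<cdot> x))\<^sup>2 = (norm (X1 \<cdot> x))\<^sup>2 + (norm (X2 \<cdot> x))\<^sup>2"
      by (simp add: blinfun.add_left norm_add_square)
    define q where "q = (norm (radj W \<cdot> x))\<^sup>2"
    have q0: "0 \<le> q" by (simp add: q_def)
    have "(norm (X1 \<cdot> x))\<^sup>2 \<le> \<beta> / 2 * q / s"
      using X1(4)[of x] s0 by (simp add: nY q_def field_simps)
    moreover have "(norm (X2 \<cdot> x))\<^sup>2 \<le> (\<alpha> * (norm x)\<^sup>2 - \<beta> / 2 * q) / \<alpha>"
    proof -
      have "\<alpha> * (norm (X2 \<cdot> x))\<^sup>2 \<le> \<alpha> * (norm x)\<^sup>2 - \<beta> / 2 * q"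
        using X2(4)[of x] B(3)[of x] psd_ge0[OF D(2), of x] unfolding Kx q_def by linarith
      thus ?thesis using \<alpha>(1) by (simp add: field_simps)
    qed
    moreover have "\<delta> * q \<le> \<beta> / 2 * (1 / \<alpha> - 1 / s) * q" by (intro mult_right_mono \<delta>(3) q0)
    moreover have "\<beta> / 2 * q / s + (\<alpha> * (norm x)\<^sup>2 - \<beta> / 2 * q) / \<alpha> + \<beta> / 2 * (1 / \<alpha> - 1 / s) * q = (norm x)\<^sup>2"
      using \<alpha>(1) s0 by (simp add: field_simps)
    ultimately show "(norm ((X1 + X2) \<cdot> x))\<^sup>2 + \<delta> * (norm (radj W \<cdot> x))\<^sup>2 \<le> (norm x)\<^sup>2"
      unfolding n q_def[symmetric] by linarith
  qed
qed

lemma psd_nonpos_zero: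
  assumes "psd D" "\<And>x. inner (D \<cdot> x) x \<le> 0"
  shows "D \<cdot> x = 0"
  using psd_kernel[OF assms(1)] assms(2)[of x] psd_ge0[OF assms(1), of x] by simp

text \<open>For stages that cover nothing: the bound forces \<open>D\<close> to be 0, and the whole
  budget goes into compressing \<open>B\<close> at level \<open>\<alpha>\<close>.\<close>

lemma resource_plain:
  assumes A: "A \<in> M" "psd A" and B: "B \<in> M" "psd B" "\<And>x. inner (B \<cdot> x) x \<le> \<alpha> * (norm x)\<^sup>2" and \<alpha>: "0 < \<alpha>"
    and P: "big P" "ocomm A P" "\<And>x. \<alpha> * (norm (P \<cdot> x))\<^sup>2 \<le> inner (A \<cdot> (P \<cdot> x)) (P \<cdot> x)"
    and D: "psd D" "\<And>x. inner (D \<cdot> x) x \<le> 0"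
  shows "\<exists>X\<in>M. (\<forall>x. P \<cdot> (X \<cdot> x) = X \<cdot> x) \<and> (\<forall>x. radj X \<cdot> (A \<cdot> (X \<cdot> x)) = B \<cdot> x - D \<cdot> x) \<and>
        (\<forall>x. (norm (X \<cdot> x))\<^sup>2 \<le> (norm x)\<^sup>2)"
proof (rule compress_psd[OF A P(1,2) \<alpha> P(3) B(1,2)])
  fix X assume X: "X \<in> M" "\<And>x. P \<cdot> (X \<cdot> x) = X \<cdot> x" "\<And>x. radj X \<cdot> (A \<cdot> (X \<cdot> x)) = B \<cdot> x"
    "\<And>x. \<alpha> * (norm (X \<cdot> x))\<^sup>2 \<le> inner (B \<cdot> x) x"
  have "\<alpha> * (norm (X \<cdot> x))\<^sup>2 \<le> \<alpha> * (norm x)\<^sup>2" for x by (rule order_trans[OF X(4) B(3)])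
  hence "(norm (X \<cdot> x))\<^sup>2 \<le> (norm x)\<^sup>2" for x using \<alpha> by simp
  thus ?thesis using X psd_nonpos_zero[OF D] by (intro bexI[of _ X]) auto
qed

end

section \<open>Resources below a strict bound\<close>

text \<open>A partition of the half-line below \<open>\<alpha>\<close> when \<open>t\<close>
  increases to \<open>\<alpha>\<close>. On block \<open>i\<close> the operator \<open>B\<close> is
  at most \<open>t i\<close>, and this block is sent to a piece where \<open>A\<close> is at least
  \<open>t (Suc i)\<close>.\<close>

primrec spec_block :: "(nat \<Rightarrow> real) \<Rightarrow> nat \<Rightarrow> real set" where
  "spec_block t 0 = {..t 0}"
| "spec_block t (Suc i) = {t i<..t (Suc i)}"

lemma spec_block:
  assumes t: "mono t" "\<And>i. t i < \<alpha>" "t \<longlonglongrightarrow> \<alpha>"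
  shows "spec_block t i \<in> sets borel" "spec_block t i \<subseteq> {..t i}" "disjoint_family (spec_block t)"
    "(\<Union>i. spec_block t i) = {..<\<alpha>}"
proof -
  show 1: "spec_block t i \<in> sets borel" "spec_block t i \<subseteq> {..t i}" for i by (cases i; auto)+
  have lt: "spec_block t i \<inter> spec_block t j = {}" if "i < j" for i j
  proof -
    from \<open>i < j\<close> obtain j' where j: "j = Suc j'" by (cases j) auto
    have "t i \<le> t j'" using that t(1) by (auto simp: j mono_def)
    thus ?thesis using 1(2)[of i] by (force simp: j)
  qed
  show "disjoint_family (spec_block t)"
    unfolding disjoint_family_on_def using lt by (metis Int_commute nat_neq_iff)
  have "{..t i} \<subseteq> (\<Union>i. spec_block t i)" for i
  proof (induction i)
    case (Suc i)
    have "{..t (Suc i)} \<subseteq> {..t i} \<union> spec_block t (Suc i)" by auto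
    thus ?case using Suc by blast
  qed (use UN_upper[of 0 UNIV "spec_block t"] in simp)
  moreover have "\<exists>i. x \<le> t i" if "x < \<alpha>" for x
    using order_tendstoD(1)[OF t(3) that] by (auto simp: eventually_sequentially intro: less_imp_le)
  ultimately have "{..<\<alpha>} \<subseteq> (\<Union>i. spec_block t i)" by force
  moreover have "spec_block t i \<subseteq> {..<\<alpha>}" for i using 1(2)[of i] t(2)[of i] by force
  ultimately show "(\<Union>i. spec_block t i) = {..<\<alpha>}" by blast
qed

context real_factor
begin

text \<open>The \<open>T i\<close> have orthogonal initial spaces and ranges in the orthogonal
  \<open>Q i\<close>. Since these commute with \<open>A\<close>, the images under the square root of
  \<open>A\<close> are orthogonal too, and the compression of \<open>A\<close> by the sum is found
  by adding forms.\<close>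

lemma lift_diagonal:
  assumes A: "A \<in> M" "psd A" and Q: "\<And>i::nat. mproj (Q i)" "\<And>i. ocomm A (Q i)" "\<And>i j x. i \<noteq> j \<Longrightarrow> Q i \<cdot> (Q j \<cdot> x) = 0"
    and P: "\<And>i x. P \<cdot> (Q i \<cdot> x) = Q i \<cdot> x"
    and E: "\<And>i. rproj (E i)" "\<And>i j x. i \<noteq> j \<Longrightarrow> E i \<cdot> (E j \<cdot> x) = 0"
    and T: "\<And>i. T i \<in> M" "\<And>i x. Q i \<cdot> (T i \<cdot> x) = T i \<cdot> x" "\<And>i x. T i \<cdot> (E i \<cdot> x) = T i \<cdot> x" "\<And>i x. norm (T i \<cdot> x) \<le> norm x"
    and C: "sym_op C" "\<And>x. (\<lambda>i. inner (A \<cdot> (T i \<cdot> x)) (T i \<cdot> x)) sums inner (C \<cdot> x) x"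
  obtains X where "X \<in> M" "\<And>x. P \<cdot> (X \<cdot> x) = X \<cdot> x" "\<And>x. radj X \<cdot> (A \<cdot> (X \<cdot> x)) = C \<cdot> x"
    "\<And>x. (\<lambda>i. (norm (T i \<cdot> x))\<^sup>2) sums (norm (X \<cdot> x))\<^sup>2"
proof -
  note R = osqrt[OF A(2)]
  have QA: "inner (A \<cdot> (T i \<cdot> x)) (T j \<cdot> y) = 0" "inner (T i \<cdot> x) (T j \<cdot> y) = 0" if "i \<noteq> j" for i j x y
  proof -
    note sym = sym_opD[OF rproj_sym[OF mprojD(2)[OF Q(1)]]]
    have "inner (Q j \<cdot> (A \<cdot> (Q i \<cdot> (T i \<cdot> x)))) (T j \<cdot> y) = 0" "inner (Q j \<cdot> (Q i \<cdot> (T i \<cdot> x))) (T j \<cdot> y) = 0"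
      using that by (simp_all add: ocommD[OF Q(2), symmetric] Q(3))
    thus "inner (A \<cdot> (T i \<cdot> x)) (T j \<cdot> y) = 0" "inner (T i \<cdot> x) (T j \<cdot> y) = 0"
      by (simp_all only: sym T(2))
  qed
  obtain X where X: "\<And>x. (\<lambda>i. T i \<cdot> x) sums (X \<cdot> x)" "\<And>x. (\<lambda>i. (norm (T i \<cdot> x))\<^sup>2) sums (norm (X \<cdot> x))\<^sup>2"
    by (rule orth_sum_op[of E T]) (use E T QA(2) that in blast)+
  show ?thesis
  proof (rule that)
    show "X \<in> M" by (rule sums_closed[OF T(1) X(1)])
    show "(\<lambda>i. (norm (T i \<cdot> x))\<^sup>2) sums (norm (X \<cdot> x))\<^sup>2" for x by (rule X(2))
    show "P \<cdot> (X \<cdot> x) = X \<cdot> x" for x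
    proof (rule sums_unique2[OF _ X(1)])
      have "P \<cdot> (T i \<cdot> x) = T i \<cdot> x" for i using P[of i "T i \<cdot> x"] by (simp only: T(2))
      moreover have "(\<lambda>i. P \<cdot> (T i \<cdot> x)) sums (P \<cdot> (X \<cdot> x))"
        by (rule bounded_linear.sums[OF blinfun.bounded_linear_right X(1)])
      ultimately show "(\<lambda>i. T i \<cdot> x) sums (P \<cdot> (X \<cdot> x))" by simp
    qed
    have "radj X o\<^sub>L A o\<^sub>L X = C"
    proof (rule sym_op_eqI[OF _ C(1)])
      show "sym_op (radj X o\<^sub>L A o\<^sub>L X)"
        by (simp add: sym_op_def sym_opD[OF psd_sym[OF A(2)]] flip: radj radj')
      fix x
      let ?v = "\<lambda>i. osqrt A \<cdot> (T i \<cdot> x)"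
      have nv: "(norm (?v i))\<^sup>2 = inner (A \<cdot> (T i \<cdot> x)) (T i \<cdot> x)" for i by (rule R(6))
      have "inner (?v i) (?v j) = 0" if "i \<noteq> j" for i j
        using QA(1)[OF that, of x x] by (simp add: sym_opD[OF R(5), symmetric] R(3))
      moreover have "summable (\<lambda>i. (norm (?v i))\<^sup>2)" unfolding nv using C(2) by (rule sums_summable)
      ultimately have "(\<lambda>i. (norm (?v i))\<^sup>2) sums (norm (suminf ?v))\<^sup>2" by (rule summable_orth(2))
      moreover have "?v sums (osqrt A \<cdot> (X \<cdot> x))"
        by (rule bounded_linear.sums[OF blinfun.bounded_linear_right X(1)])
      ultimately have "(\<lambda>i. (norm (?v i))\<^sup>2) sums (norm (osqrt A \<cdot> (X \<cdot> x)))\<^sup>2" by (simp only: sums_unique[symmetric])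
      hence "(\<lambda>i. inner (A \<cdot> (T i \<cdot> x)) (T i \<cdot> x)) sums inner (A \<cdot> (X \<cdot> x)) (X \<cdot> x)" by (simp only: nv R(6))
      hence "inner (A \<cdot> (X \<cdot> x)) (X \<cdot> x) = inner (C \<cdot> x) x" using C(2) by (rule sums_unique2)
      thus "inner ((radj X o\<^sub>L A o\<^sub>L X) \<cdot> x) x = inner (C \<cdot> x) x" by (simp flip: radj')
    qed
    thus "radj X \<cdot> (A \<cdot> (X \<cdot> x)) = C \<cdot> x" for x by auto
  qed
qed

text \<open>Block \<open>i\<close> costs at most the fraction \<open>t i / t (Suc i) \<le> 1\<close>
  of its share of the budget, so \<open>B\<close> may have spectrum arbitrarily close to
  \<open>\<alpha>\<close>. The first block contains the spectral projection for (\<beta>,\<gamma>],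
  hence all of \<open>D\<close> and the range of \<open>W\<close>, and provides the saving
  \<open>1 - t 0 / t (Suc 0)\<close> from which \<open>\<delta>\<close> is paid.\<close>

lemma resource_strict:
  assumes A: "A \<in> M" "psd A" and B: "B \<in> M" "psd B" "spec B {\<alpha>..} = 0"
    and t: "mono t" "\<And>i. t i < \<alpha>" "t \<longlonglongrightarrow> \<alpha>" "0 < t 0" "\<gamma> \<le> t 0" and \<beta>: "0 < \<beta>"
    and Q: "\<And>i::nat. big (Q i)" "\<And>i. ocomm A (Q i)" "\<And>i j x. i \<noteq> j \<Longrightarrow> Q i \<cdot> (Q j \<cdot> x) = 0"
      "\<And>i x. t (Suc i) * (norm (Q i \<cdot> x))\<^sup>2 \<le> inner (A \<cdot> (Q i \<cdot> x)) (Q i \<cdot> x)"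
    and P: "\<And>i x. P \<cdot> (Q i \<cdot> x) = Q i \<cdot> x"
    and W: "\<And>x. spec B {\<beta><..\<gamma>} \<cdot> (W \<cdot> x) = W \<cdot> x" "\<And>x. norm (radj W \<cdot> x) \<le> norm x"
    and \<delta>: "0 \<le> \<delta>" "\<delta> * norm A \<le> \<beta>" "\<delta> \<le> 1 - t 0 / t (Suc 0)"
    and D: "D \<in> M" "psd D" "\<And>x. inner (D \<cdot> x) x \<le> \<delta> * norm A * (norm (radj W \<cdot> x))\<^sup>2"
  shows "\<exists>X\<in>M. (\<forall>x. P \<cdot> (X \<cdot> x) = X \<cdot> x) \<and> (\<forall>x. radj X \<cdot> (A \<cdot> (X \<cdot> x)) = B \<cdot> x - D \<cdot> x) \<and>
        (\<forall>x. (norm (X \<cdot> x))\<^sup>2 + \<delta> * (norm (radj W \<cdot> x))\<^sup>2 \<le> (norm x)\<^sup>2)"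
proof -
  note Bs = psd_sym[OF B(2)] and blk = spec_block[OF t(1-3)]
  have tpos: "0 < t i" for i using t(4) monoD[OF t(1), of 0 i] by simp
  define E where "E i = spec B (spec_block t i)" for i
  let ?F = "spec B {\<beta><..\<gamma>}"
  have E: "rproj (E i)" for i unfolding E_def by (rule spec(1)[OF Bs blk(1)])
  have EE: "E i \<cdot> (E j \<cdot> x) = 0" if "i \<noteq> j" for i j x
    unfolding E_def by (rule spec_disjoint[OF Bs blk(1) blk(1) disjoint_family_onD[OF blk(3) UNIV_I UNIV_I that]])
  have "spec B ({..<\<alpha>} \<union> {\<alpha>..}) = spec B {..<\<alpha>} + spec B {\<alpha>..}" by (rule spec_Un[OF Bs]) auto
  moreover have "{..<\<alpha>} \<union> {\<alpha>..} = UNIV" by auto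
  ultimately have "spec B {..<\<alpha>} = id_blinfun" using B(3) by (simp add: spec_UNIV[OF Bs])
  moreover have "(\<lambda>n. spec B (spec_block t n) \<cdot> x) sums (spec B (\<Union>n. spec_block t n) \<cdot> x)" for x
    by (rule spec_sums[OF Bs _ blk(3)]) (use blk(1) in auto)
  ultimately have sumE: "(\<lambda>i. E i \<cdot> x) sums x" for x by (simp add: E_def blk(4))
  have BE: "B \<cdot> (E i \<cdot> x) = E i \<cdot> (B \<cdot> x)" for i x unfolding E_def by (rule spec_ocomm[OF Bs blk(1)])
  have Elow: "inner (B \<cdot> (E i \<cdot> x)) (E i \<cdot> x) \<le> t i * (norm (E i \<cdot> x))\<^sup>2" for i x
    unfolding E_def by (rule spec_le[OF Bs blk(1,2)])
  have FE0: "?F \<cdot> (E 0 \<cdot> x) = ?F \<cdot> x" for x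
    unfolding E_def by (rule spec_mono(2)[OF Bs]) (use t(5) in auto)
  have FE: "?F \<cdot> (E (Suc i) \<cdot> x) = 0" for i x
    unfolding E_def
  proof (rule spec_disjoint[OF Bs])
    show "{\<beta><..\<gamma>} \<inter> spec_block t (Suc i) = {}" using t(5) monoD[OF t(1), of 0 i] by auto
  qed (use blk(1) in auto)
  have Fb: "{\<beta><..\<gamma>} \<in> sets borel" "{\<beta><..\<gamma>} \<subseteq> {\<beta>..}" by auto
  note WF = lower_bound_by_range[OF B(1,2) Fb W less_imp_le[OF \<beta>]]
  have D0: "D \<cdot> y = 0" if "?F \<cdot> y = 0" for y
    using psd_kernel[OF D(2), of y] D(3)[of y] psd_ge0[OF D(2), of y] WF(1)[of y] that by simp
  have DE: "D \<cdot> (E (Suc i) \<cdot> x) = 0" for i x by (rule D0[OF FE])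
  have DE0: "D \<cdot> (E 0 \<cdot> x) = D \<cdot> x" for x
    using D0[of "x - E 0 \<cdot> x"] by (simp add: blinfun.diff_right FE0)
  have Qm: "mproj (Q i)" for i using Q(1) by (simp add: big_def)
  define K where "K = B - D"
  have Kx: "K \<cdot> x = B \<cdot> x - D \<cdot> x" for x by (simp add: K_def blinfun.diff_left)
  have KM: "K \<in> M" unfolding K_def using B(1) D(1) by blast
  have Ks: "sym_op K" unfolding K_def using Bs psd_sym[OF D(2)] by simp
  have Kp: "psd K"
    unfolding psd_def
  proof (intro conjI allI Ks)
    fix x
    have "\<delta> * norm A * (norm (radj W \<cdot> x))\<^sup>2 \<le> \<beta> * (norm (radj W \<cdot> x))\<^sup>2"
      by (intro mult_right_mono \<delta>(2)) simp
    thus "0 \<le> inner (K \<cdot> x) x" using D(3)[of x] WF(2)[of x] by (simp add: Kx inner_diff_left)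
  qed
  have form: "inner (K \<cdot> (E i \<cdot> x)) (E i \<cdot> x) = inner (B \<cdot> (E i \<cdot> x)) x - (if i = 0 then inner (D \<cdot> x) x else 0)" for i x
  proof -
    have "inner (B \<cdot> (E i \<cdot> x)) (E i \<cdot> x) = inner (E i \<cdot> (B \<cdot> (E i \<cdot> x))) x"
      by (rule sym_opD[OF rproj_sym[OF E], symmetric])
    hence "inner (B \<cdot> (E i \<cdot> x)) (E i \<cdot> x) = inner (B \<cdot> (E i \<cdot> x)) x"
      using E by (simp add: BE)
    moreover have "inner (D \<cdot> (E i \<cdot> x)) (E i \<cdot> x) = (if i = 0 then inner (D \<cdot> x) x else 0)"
      using DE sym_opD[OF psd_sym[OF D(2)], of x "E 0 \<cdot> x"] sym_opD[OF psd_sym[OF D(2)], of x x] by (cases i) (auto simp: DE0)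
    ultimately show ?thesis by (simp add: Kx inner_diff_left)
  qed
  have "\<exists>T. T \<in> M \<and> (\<forall>x. Q i \<cdot> (T \<cdot> x) = T \<cdot> x) \<and> (\<forall>x. radj T \<cdot> (A \<cdot> (T \<cdot> x)) = E i \<cdot> (K \<cdot> (E i \<cdot> x))) \<and>
      (\<forall>x. t (Suc i) * (norm (T \<cdot> x))\<^sup>2 \<le> inner (E i \<cdot> (K \<cdot> (E i \<cdot> x))) x)" for i
  proof (rule compress_psd[OF A Q(1,2) tpos Q(4), of "E i o\<^sub>L K o\<^sub>L E i" i])
    show "E i o\<^sub>L K o\<^sub>L E i \<in> M" using KM spec_closed[OF B(1) Bs blk(1)] unfolding E_def by blast
    show "psd (E i o\<^sub>L K o\<^sub>L E i)" by (rule psd_sandwich[OF Kp rproj_sym[OF E]])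
  qed auto
  then obtain T where T: "\<And>i. T i \<in> M" "\<And>i x. Q i \<cdot> (T i \<cdot> x) = T i \<cdot> x"
    "\<And>i x. radj (T i) \<cdot> (A \<cdot> (T i \<cdot> x)) = E i \<cdot> (K \<cdot> (E i \<cdot> x))"
    "\<And>i x. t (Suc i) * (norm (T i \<cdot> x))\<^sup>2 \<le> inner (E i \<cdot> (K \<cdot> (E i \<cdot> x))) x" by metis
  have Tn: "t (Suc i) * (norm (T i \<cdot> x))\<^sup>2 \<le> t i * (norm (E i \<cdot> x))\<^sup>2" for i x
  proof -
    have "inner (E i \<cdot> (K \<cdot> (E i \<cdot> x))) x = inner (K \<cdot> (E i \<cdot> x)) (E i \<cdot> x)"
      by (rule sym_opD[OF rproj_sym[OF E]])
    also have "\<dots> \<le> inner (B \<cdot> (E i \<cdot> x)) (E i \<cdot> x)"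
      using psd_ge0[OF D(2)] by (simp add: Kx inner_diff_left)
    finally show ?thesis using T(4)[of i x] Elow[of i x] by linarith
  qed
  have Tn': "(norm (T i \<cdot> x))\<^sup>2 \<le> (norm (E i \<cdot> x))\<^sup>2" for i x
  proof -
    have "t i * (norm (E i \<cdot> x))\<^sup>2 \<le> t (Suc i) * (norm (E i \<cdot> x))\<^sup>2"
      by (intro mult_right_mono monoD[OF t(1)]) auto
    hence "t (Suc i) * (norm (T i \<cdot> x))\<^sup>2 \<le> t (Suc i) * (norm (E i \<cdot> x))\<^sup>2" using Tn[of i x] by linarith
    thus ?thesis using tpos[of "Suc i"] by simp
  qed
  have Tc: "norm (T i \<cdot> x) \<le> norm x" for i x
    using Tn'[of i x] rproj_norm_le[OF E, of i x] by (simp add: power2_le_iff_abs_le)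
  have TE: "T i \<cdot> (E i \<cdot> x) = T i \<cdot> x" for i x
  proof -
    have "(norm (T i \<cdot> (x - E i \<cdot> x)))\<^sup>2 \<le> (norm (E i \<cdot> (x - E i \<cdot> x)))\<^sup>2" by (rule Tn')
    thus ?thesis using E by (simp add: blinfun.diff_right)
  qed
  have sums_form: "(\<lambda>i. inner (A \<cdot> (T i \<cdot> x)) (T i \<cdot> x)) sums inner (K \<cdot> x) x" for x
  proof -
    have "inner (A \<cdot> (T i \<cdot> x)) (T i \<cdot> x) = inner (K \<cdot> (E i \<cdot> x)) (E i \<cdot> x)" for i
    proof -
      have "inner (A \<cdot> (T i \<cdot> x)) (T i \<cdot> x) = inner (radj (T i) \<cdot> (A \<cdot> (T i \<cdot> x))) x" by (rule radj')
      also have "\<dots> = inner (K \<cdot> (E i \<cdot> x)) (E i \<cdot> x)" unfolding T(3) by (rule sym_opD[OF rproj_sym[OF E]])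
      finally show ?thesis .
    qed
    moreover have "(\<lambda>i. inner (B \<cdot> (E i \<cdot> x)) x) sums inner (B \<cdot> x) x"
      by (intro bounded_linear.sums[OF bounded_linear_inner_left]
            bounded_linear.sums[OF blinfun.bounded_linear_right] sumE)
    from sums_diff[OF this sums_single[of 0 "\<lambda>_. inner (D \<cdot> x) x"]]
    have "(\<lambda>i. inner (K \<cdot> (E i \<cdot> x)) (E i \<cdot> x)) sums inner (K \<cdot> x) x"
      unfolding form by (simp add: Kx inner_diff_left)
    ultimately show ?thesis by simp
  qed
  obtain X where X: "X \<in> M" "\<And>x. P \<cdot> (X \<cdot> x) = X \<cdot> x" "\<And>x. radj X \<cdot> (A \<cdot> (X \<cdot> x)) = K \<cdot> x"
    "\<And>x. (\<lambda>i. (norm (T i \<cdot> x))\<^sup>2) sums (norm (X \<cdot> x))\<^sup>2"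
    by (rule lift_diagonal[OF A Qm Q(2,3) P E EE T(1,2) TE Tc Ks sums_form]) (assumption, assumption, rule that)
  show ?thesis
  proof (intro bexI[OF _ X(1)] conjI allI)
    fix x
    show "P \<cdot> (X \<cdot> x) = X \<cdot> x" "radj X \<cdot> (A \<cdot> (X \<cdot> x)) = B \<cdot> x - D \<cdot> x" by (simp_all add: X(2,3) Kx)
    let ?c = "1 - t 0 / t (Suc 0)"
    have "(\<lambda>i. inner (E i \<cdot> x) x) sums inner x x"
      by (rule bounded_linear.sums[OF bounded_linear_inner_left sumE])
    hence "(\<lambda>i. (norm (E i \<cdot> x))\<^sup>2) sums (norm x)\<^sup>2" by (simp add: rproj_inner[OF E] power2_norm_eq_inner[of x])
    from sums_diff[OF this sums_single[of 0 "\<lambda>_. ?c * (norm (E 0 \<cdot> x))\<^sup>2"]]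
    have "(\<lambda>i. (norm (E i \<cdot> x))\<^sup>2 - (if i = 0 then ?c * (norm (E 0 \<cdot> x))\<^sup>2 else 0)) sums
      ((norm x)\<^sup>2 - ?c * (norm (E 0 \<cdot> x))\<^sup>2)" .
    moreover have "(norm (T i \<cdot> x))\<^sup>2 \<le> (norm (E i \<cdot> x))\<^sup>2 - (if i = 0 then ?c * (norm (E 0 \<cdot> x))\<^sup>2 else 0)" for i
    proof (cases "i = 0")
      case True
      have "(norm (T 0 \<cdot> x))\<^sup>2 \<le> t 0 / t (Suc 0) * (norm (E 0 \<cdot> x))\<^sup>2"
        using Tn[of 0 x] tpos[of "Suc 0"] by (simp add: field_simps)
      thus ?thesis by (simp add: True left_diff_distrib)
    qed (use Tn' in simp)
    ultimately have "(norm (X \<cdot> x))\<^sup>2 \<le> (norm x)\<^sup>2 - ?c * (norm (E 0 \<cdot> x))\<^sup>2"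
      by (intro sums_le[OF _ X(4)])
    moreover have "\<delta> * (norm (radj W \<cdot> x))\<^sup>2 \<le> ?c * (norm (E 0 \<cdot> x))\<^sup>2"
    proof (intro mult_mono \<delta>(3) power_mono)
      have "norm (?F \<cdot> x) \<le> norm (E 0 \<cdot> x)"
        using rproj_norm_le[OF spec(1)[OF Bs, of "{\<beta><..\<gamma>}"], of "E 0 \<cdot> x"] by (simp add: FE0)
      thus "norm (radj W \<cdot> x) \<le> norm (E 0 \<cdot> x)" using WF(1)[of x] by linarith
      show "0 \<le> ?c" using tpos[of "Suc 0"] monoD[OF t(1), of 0 "Suc 0"] by simp
    qed auto
    ultimately show "(norm (X \<cdot> x))\<^sup>2 + \<delta> * (norm (radj W \<cdot> x))\<^sup>2 \<le> (norm x)\<^sup>2" by linarith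
  qed
qed


section \<open>Distributing the reserved pieces over stages and blocks, with a constant
  proportion\<close>

lemma emb_radj_contraction: "emb W e f \<Longrightarrow> mproj e \<Longrightarrow> norm (radj W \<cdot> x) \<le> norm x"
  using contraction_radj[of W 1 x] partial_isometry(5)[OF mprojD(2) embD(2)] by simp

text \<open>Every stage \<open>n\<close> needs its own infinite piece for every block
  \<open>i\<close>, so the reserved sequence is indexed by triples. The code of a triple is at least
  \<open>i\<close> and \<open>t\<close> increases, so every member of group (n,i) meets the bound
  \<open>t (Suc i)\<close>.\<close>

lemma strict_targets:
  fixes B :: "nat \<Rightarrow> 'a \<Rightarrow>\<^sub>L 'a"
  assumes A: "A \<in> M" "psd A"
    and F1: "\<And>P Q. mproj P \<Longrightarrow> mproj Q \<Longrightarrow> (\<And>x. P \<cdot> (Q \<cdot> x) = 0) \<Longrightarrow> big (P + Q) \<Longrightarrow> big P \<or> big Q"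
    and F2: "\<And>J P. (\<And>n. mproj (J n)) \<Longrightarrow> (\<And>n x. J (Suc n) \<cdot> (J n \<cdot> x) = J n \<cdot> x) \<Longrightarrow>
      (\<And>x. (\<lambda>n::nat. J n \<cdot> x) \<longlonglongrightarrow> P \<cdot> x) \<Longrightarrow> big P \<Longrightarrow> \<exists>n. subeq e (J n)"
    and e: "mproj e" "e \<noteq> 0"
    and inf: "\<And>l. l < \<alpha> \<Longrightarrow> big (spec A {l<..})" and t: "mono t" "\<And>i::nat. t i < \<alpha>"
  obtains Q P where "\<And>n i::nat. big (Q n i)" "\<And>n i. ocomm A (Q n i)" "\<And>n i j x. i \<noteq> j \<Longrightarrow> Q n i \<cdot> (Q n j \<cdot> x) = 0"
    "\<And>n i x. t (Suc i) * (norm (Q n i \<cdot> x))\<^sup>2 \<le> inner (A \<cdot> (Q n i \<cdot> x)) (Q n i \<cdot> x)"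
    "\<And>n i x. P n \<cdot> (Q n i \<cdot> x) = Q n i \<cdot> x" "\<And>n::nat. big (P n)" "\<And>n. ocomm A (P n)"
    "\<And>m n x. m \<noteq> n \<Longrightarrow> P m \<cdot> (P n \<cdot> x) = 0"
proof -
  obtain J where J: "\<And>k. mproj (J k)" "\<And>k. ocomm A (J k)" "\<And>k. subeq e (J k)"
    "\<And>k x. t (Suc k) * (norm (J k \<cdot> x))\<^sup>2 \<le> inner (A \<cdot> (J k \<cdot> x)) (J k \<cdot> x)"
    "\<And>i j x. i \<noteq> j \<Longrightarrow> J i \<cdot> (J j \<cdot> x) = 0"
    by (rule reserve[where t = "\<lambda>k. t (Suc k)", OF A F1 F2 e(1) inf t(2)]) (assumption | rule that)+
  define \<iota> where "\<iota> n i l = prod_encode (n, prod_encode (i, l))" for n i l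
  have inj: "\<iota> n i l = \<iota> m j k \<longleftrightarrow> n = m \<and> i = j \<and> l = k" for n i l m j k
    by (simp add: \<iota>_def prod_encode_eq)
  define \<Phi> where "\<Phi> n i Q \<longleftrightarrow> big Q \<and> ocomm A Q \<and> (\<forall>x. t (Suc i) * (norm (Q \<cdot> x))\<^sup>2 \<le> inner (A \<cdot> (Q \<cdot> x)) (Q \<cdot> x)) \<and>
      (\<forall>R :: 'a \<Rightarrow>\<^sub>L 'a. (\<forall>l x. R \<cdot> (J (\<iota> n i l) \<cdot> x) = 0) \<longrightarrow> (\<forall>x. R \<cdot> (Q \<cdot> x) = 0))" for n i Q
  have \<Phi>: "\<exists>Q. \<Phi> n i Q" for n i
  proof (rule group_pieces[OF A e J(1-3), of "\<iota> n i"])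
    show "J (\<iota> n i k) \<cdot> (J (\<iota> n i l) \<cdot> x) = 0" if "k \<noteq> l" for k l x
      by (rule J(5)) (simp add: inj that)
    have low: "t (Suc i) * (norm (J (\<iota> n i l) \<cdot> x))\<^sup>2 \<le> inner (A \<cdot> (J (\<iota> n i l) \<cdot> x)) (J (\<iota> n i l) \<cdot> x)" for l x
    proof -
      have "i \<le> \<iota> n i l" unfolding \<iota>_def by (rule order_trans[OF le_prod_encode_1 le_prod_encode_2])
      hence "t (Suc i) * (norm (J (\<iota> n i l) \<cdot> x))\<^sup>2 \<le> t (Suc (\<iota> n i l)) * (norm (J (\<iota> n i l) \<cdot> x))\<^sup>2"
        by (intro mult_right_mono monoD[OF t(1)]) auto
      thus ?thesis using J(4) by (rule order_trans)
    qed
    fix Q assume Q: "big Q" "ocomm A Q"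
      and Ql: "\<And>l. (\<And>k x. l * (norm (J (\<iota> n i k) \<cdot> x))\<^sup>2 \<le> inner (A \<cdot> (J (\<iota> n i k) \<cdot> x)) (J (\<iota> n i k) \<cdot> x)) \<Longrightarrow>
        (\<forall>x. l * (norm (Q \<cdot> x))\<^sup>2 \<le> inner (A \<cdot> (Q \<cdot> x)) (Q \<cdot> x))"
      and Q0: "\<And>R :: 'a \<Rightarrow>\<^sub>L 'a. (\<And>k x. R \<cdot> (J (\<iota> n i k) \<cdot> x) = 0) \<Longrightarrow> (\<forall>x. R \<cdot> (Q \<cdot> x) = 0)"
    show ?thesis
      unfolding \<Phi>_def
    proof (intro exI[of _ Q] conjI Q Ql low allI impI)
      fix R :: "'a \<Rightarrow>\<^sub>L 'a" and x assume "\<forall>l x. R \<cdot> (J (\<iota> n i l) \<cdot> x) = 0"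
      hence "\<forall>x. R \<cdot> (Q \<cdot> x) = 0" by (intro Q0) simp
      thus "R \<cdot> (Q \<cdot> x) = 0" by simp
    qed
  qed
  define Q where "Q n i = (SOME Q. \<Phi> n i Q)" for n i
  have \<Phi>': "\<Phi> n i (Q n i)" for n i unfolding Q_def by (rule someI_ex[OF \<Phi>])
  hence Q: "big (Q n i)" "ocomm A (Q n i)" "t (Suc i) * (norm (Q n i \<cdot> x))\<^sup>2 \<le> inner (A \<cdot> (Q n i \<cdot> x)) (Q n i \<cdot> x)" for n i x
    by (simp_all add: \<Phi>_def)
  note Q0 = \<Phi>'[unfolded \<Phi>_def, THEN conjunct2, THEN conjunct2, THEN conjunct2, rule_format]
  have Qm: "mproj (Q n i)" for n i using Q(1) by (simp add: big_def)
  have Qo: "Q n i \<cdot> (Q m j \<cdot> x) = 0" if ne: "n \<noteq> m \<or> i \<noteq> j" for n i m j x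
  proof (rule Q0)
    fix l x
    have "J (\<iota> m j l) \<cdot> (Q n i \<cdot> y) = 0" for y
      by (rule Q0, rule J(5)) (use ne inj in auto)
    thus "Q n i \<cdot> (J (\<iota> m j l) \<cdot> x) = 0"
      by (rule rproj_orth_sym[OF mprojD(2)[OF J(1)] mprojD(2)[OF Qm]])
  qed
  have "\<exists>P. mproj P \<and> (\<forall>x. (\<lambda>i. Q n i \<cdot> x) sums (P \<cdot> x)) \<and> (\<forall>i x. P \<cdot> (Q n i \<cdot> x) = Q n i \<cdot> x)" for n
    by (rule mproj_sums[of "Q n"]) (use Qm Qo in auto)
  then obtain P where P: "\<And>n. mproj (P n)" "\<And>n x. (\<lambda>i. Q n i \<cdot> x) sums (P n \<cdot> x)"
    "\<And>n i x. P n \<cdot> (Q n i \<cdot> x) = Q n i \<cdot> x" by metis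
  have P0: "R \<cdot> (P n \<cdot> x) = 0" if "\<And>i x. R \<cdot> (Q n i \<cdot> x) = 0" for R :: "'a \<Rightarrow>\<^sub>L 'a" and n x
  proof -
    have "(\<lambda>i. R \<cdot> (Q n i \<cdot> x)) sums (R \<cdot> (P n \<cdot> x))"
      by (rule bounded_linear.sums[OF blinfun.bounded_linear_right P(2)])
    thus ?thesis unfolding that using sums_unique2 sums_zero by blast
  qed
  show ?thesis
  proof (rule that[of Q P])
    show "Q n i \<cdot> (Q n j \<cdot> x) = 0" if "i \<noteq> j" for n i j x by (rule Qo) (use that in simp)
    show "big (P n)" for n by (rule big_mono[OF Q(1) P(1,3)])
    show "ocomm A (P n)" for n by (rule sums_ocomm[OF P(2) Q(2)])
    show "P m \<cdot> (P n \<cdot> x) = 0" if ne: "m \<noteq> n" for m n x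
    proof (rule P0)
      fix i y
      have "Q n i \<cdot> (P m \<cdot> z) = 0" for z by (rule P0, rule Qo) (use ne in auto)
      thus "P m \<cdot> (Q n i \<cdot> y) = 0"
        by (rule rproj_orth_sym[OF mprojD(2)[OF Qm] mprojD(2)[OF P(1)]])
    qed
  qed (rule Q P(3))+
qed

lemma strict_case:
  fixes B :: "nat \<Rightarrow> 'a \<Rightarrow>\<^sub>L 'a"
  assumes A: "A \<in> M" "psd A"
    and F1: "\<And>P Q. mproj P \<Longrightarrow> mproj Q \<Longrightarrow> (\<And>x. P \<cdot> (Q \<cdot> x) = 0) \<Longrightarrow> big (P + Q) \<Longrightarrow> big P \<or> big Q"
    and F2: "\<And>J P. (\<And>n. mproj (J n)) \<Longrightarrow> (\<And>n x. J (Suc n) \<cdot> (J n \<cdot> x) = J n \<cdot> x) \<Longrightarrow>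
      (\<And>x. (\<lambda>n::nat. J n \<cdot> x) \<longlonglongrightarrow> P \<cdot> x) \<Longrightarrow> big P \<Longrightarrow> \<exists>n. subeq e (J n)"
    and e: "mproj e" "e \<noteq> 0"
    and inf: "\<And>l. l < \<alpha> \<Longrightarrow> big (spec A {l<..})"
    and B: "\<And>n. B n \<in> M" "\<And>n. psd (B n)" "\<And>n. spec (B n) {\<alpha>..} = 0"
    and \<beta>: "0 < \<beta>" "\<beta> < \<gamma>" "\<gamma> < \<alpha>" and I: "infinite {n. subeq e (spec (B n) {\<beta><..\<gamma>})}"
  obtains X where "\<And>n. X n \<in> M" "\<And>n. radj (X n) o\<^sub>L X n = B n" "\<And>n. \<exists>Q. big Q \<and> (\<forall>x. X n \<cdot> (radj (X n) \<cdot> (Q \<cdot> x)) = 0)"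
    "\<And>x. (\<lambda>n. X n \<cdot> (radj (X n) \<cdot> x)) sums (A \<cdot> x)"
proof -
  let ?I = "{n. subeq e (spec (B n) {\<beta><..\<gamma>})}"
  \<comment> \<open>Increases to \<open>\<alpha>\<close> and starts at \<open>\<gamma>\<close>, so
    that (\<beta>,\<gamma>] lies in the first block.\<close>
  define t where "t i = \<alpha> - (\<alpha> - \<gamma>) * inverse (real (Suc i))" for i
  have tm: "mono t"
    unfolding t_def mono_def using \<beta>(3) by (intro allI impI diff_left_mono mult_left_mono) auto
  have tl: "t i < \<alpha>" for i using \<beta>(3) by (simp add: t_def)
  have "t \<longlonglongrightarrow> \<alpha> - (\<alpha> - \<gamma>) * 0"
    unfolding t_def by (intro tendsto_intros LIMSEQ_inverse_real_of_nat)
  hence tt: "t \<longlonglongrightarrow> \<alpha>" by simp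
  have t0: "t 0 = \<gamma>" by (simp add: t_def)
  have t1: "t 0 < t (Suc 0)" using \<beta>(3) by (simp add: t_def field_simps)
  have tpos: "0 < t 0" "\<gamma> \<le> t 0" using \<beta> by (simp_all add: t0)
  obtain Q P where Q: "\<And>n i::nat. big (Q n i)" "\<And>n i. ocomm A (Q n i)" "\<And>n i j x. i \<noteq> j \<Longrightarrow> Q n i \<cdot> (Q n j \<cdot> x) = 0"
    "\<And>n i x. t (Suc i) * (norm (Q n i \<cdot> x))\<^sup>2 \<le> inner (A \<cdot> (Q n i \<cdot> x)) (Q n i \<cdot> x)"
    and P: "\<And>n i x. P n \<cdot> (Q n i \<cdot> x) = Q n i \<cdot> x" "\<And>n::nat. big (P n)" "\<And>n. ocomm A (P n)"
    "\<And>m n x. m \<noteq> n \<Longrightarrow> P m \<cdot> (P n \<cdot> x) = 0"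
    by (rule strict_targets[OF A F1 F2 e inf tm tl]) (assumption | rule that)+
  \<comment> \<open>The two limits on the proportion in \<open>resource_strict\<close>: the
    compression of \<open>A\<close> is paid from \<open>\<beta>\<close>, and the proportion from the
    saving of the first block. Adding 1 to the norm avoids a division by zero.\<close>
  define c where "c = min (\<beta> / (norm A + 1)) (1 - t 0 / t (Suc 0))"
  have "0 < norm A + 1" by (simp add: add_nonneg_pos)
  hence c: "0 < c" using \<beta>(1) t1 tpos(1) by (simp add: c_def)
  have "c * norm A \<le> \<beta> / (norm A + 1) * (norm A + 1)" using \<beta>(1) c by (intro mult_mono) (auto simp: c_def)
  hence cA: "c * norm A \<le> \<beta>" using \<open>0 < norm A + 1\<close> by simp
  have ct: "c \<le> 1 - t 0 / t (Suc 0)" by (simp add: c_def)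
  obtain \<kappa> \<rho> :: "nat \<Rightarrow> nat" where \<kappa>: "\<And>k. \<not> summable (\<lambda>n. if \<kappa> n = k then (if n \<in> ?I then c else 0) else 0)"
  proof (rule divergent_classes[of "\<lambda>_. c" ?I])
    show "antimono (\<lambda>_::nat. c)" by (simp add: antimono_def)
  qed (use c I that in \<open>auto simp: summable_const_iff\<close>)
  define \<delta> where "\<delta> n = (if n \<in> ?I then c else 0)" for n
  have "\<exists>W. (n \<in> ?I \<longrightarrow> emb W e (spec (B n) {\<beta><..\<gamma>})) \<and> (n \<notin> ?I \<longrightarrow> W = 0)" for n
    by (auto simp: subeq_def)
  then obtain W where W: "\<And>n. n \<in> ?I \<Longrightarrow> emb (W n) e (spec (B n) {\<beta><..\<gamma>})" "\<And>n. n \<notin> ?I \<Longrightarrow> W n = 0" by metis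
  have r0: "radj 0 = (0 :: 'a \<Rightarrow>\<^sub>L 'a)" by (rule radj_eqI) simp
  have WM: "W n \<in> M" for n using W[of n] embD(1) by (cases "n \<in> ?I") auto
  have WF: "spec (B n) {\<beta><..\<gamma>} \<cdot> (W n \<cdot> x) = W n \<cdot> x" for n x
  proof (cases "n \<in> ?I")
    case True show ?thesis by (rule embD(3)[OF W(1)[OF True]])
  qed (simp add: W(2))
  have Wc: "norm (radj (W n) \<cdot> x) \<le> norm x" for n x
  proof (cases "n \<in> ?I")
    case True show ?thesis by (rule emb_radj_contraction[OF W(1)[OF True] e(1)])
  qed (simp add: W(2) r0)
  have Pm: "mproj (P n)" for n using P(2) by (simp add: big_def)
  obtain Z where Z: "\<And>n. Z n \<in> M" "\<And>n x. radj (Z n) \<cdot> (A \<cdot> (Z n \<cdot> x)) = B n \<cdot> x"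
    "\<And>m n x. n < m \<Longrightarrow> P m \<cdot> (Z n \<cdot> x) = 0" "\<And>x. (\<lambda>n. Z n \<cdot> (radj (Z n) \<cdot> x)) sums x"
  proof (rule exhaustion[where A = A and P = P and e = e and W = W and \<delta> = \<delta> and \<kappa> = \<kappa> and B = B])
    show "0 \<le> \<delta> n" for n using c by (simp add: \<delta>_def)
    show "radj (W n) \<cdot> (W n \<cdot> x) = e \<cdot> x" if "\<delta> n \<noteq> 0" for n x
      by (rule embD(2)[OF W(1)]) (use that in \<open>simp add: \<delta>_def split: if_splits\<close>)
    show "\<not> summable (\<lambda>n. if \<kappa> n = k then \<delta> n else 0)" for k unfolding \<delta>_def by (rule \<kappa>)
    fix n D assume D: "D \<in> M" "psd D" "\<And>x. inner (D \<cdot> x) x \<le> \<delta> n * norm A * (norm (radj (W n) \<cdot> x))\<^sup>2"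
    have d: "0 \<le> \<delta> n" "\<delta> n * norm A \<le> \<beta>" "\<delta> n \<le> 1 - t 0 / t (Suc 0)"
      using c cA ct \<beta>(1) by (simp_all add: \<delta>_def)
    show "\<exists>X\<in>M. (\<forall>x. P n \<cdot> (X \<cdot> x) = X \<cdot> x) \<and> (\<forall>x. radj X \<cdot> (A \<cdot> (X \<cdot> x)) = B n \<cdot> x - D \<cdot> x) \<and>
        (\<forall>x. (norm (X \<cdot> x))\<^sup>2 + \<delta> n * (norm (radj (W n) \<cdot> x))\<^sup>2 \<le> (norm x)\<^sup>2)"
      by (rule resource_strict[where Q = "Q n" and t = t, OF A B tm tl tt tpos \<beta>(1) Q P(1) WF Wc d D])
  qed (rule A Pm P e WM that; assumption)+
  show ?thesis
    by (rule decomposition[OF A P(3,2) Z]) (assumption | rule that)+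
qed

end

section \<open>Resources from an infinite slack\<close>

context trace_factor
begin

text \<open>Slices of odd index are grouped into infinite pieces used at level
  \<open>\<alpha>\<close>. Those of even index stay single, because their individual levels above
  \<open>\<alpha>\<close> are the source of the savings.\<close>

lemma slack_targets:
  assumes A: "A \<in> M" "psd A" and G: "\<And>k::nat. mproj (G k)" "\<And>k. ocomm A (G k)" "\<And>k. subeq e (G k)"
      "\<And>i j x. i \<noteq> j \<Longrightarrow> G i \<cdot> (G j \<cdot> x) = 0" and e: "mproj e" "e \<noteq> 0"
    and low: "\<And>k x. \<alpha> * (norm (G k \<cdot> x))\<^sup>2 \<le> inner (A \<cdot> (G k \<cdot> x)) (G k \<cdot> x)"
  obtains P where "\<And>n::nat. big (P n)" "\<And>n. ocomm A (P n)"
    "\<And>n x. \<alpha> * (norm (P n \<cdot> x))\<^sup>2 \<le> inner (A \<cdot> (P n \<cdot> x)) (P n \<cdot> x)"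
    "\<And>m n x. m \<noteq> n \<Longrightarrow> P m \<cdot> (P n \<cdot> x) = 0" "\<And>n r x. P n \<cdot> (G (2 * r) \<cdot> x) = 0" "\<And>n r x. G (2 * r) \<cdot> (P n \<cdot> x) = 0"
proof -
  define \<iota> where "\<iota> n l = Suc (2 * prod_encode (n, l))" for n l
  have inj: "\<iota> n l = \<iota> m k \<longleftrightarrow> n = m \<and> l = k" for n l m k
    by (simp add: \<iota>_def prod_encode_eq)
  have odd: "2 * r \<noteq> \<iota> n l" for r n l unfolding \<iota>_def by presburger
  define \<Phi> where "\<Phi> n Q \<longleftrightarrow> big Q \<and> ocomm A Q \<and> (\<forall>x. \<alpha> * (norm (Q \<cdot> x))\<^sup>2 \<le> inner (A \<cdot> (Q \<cdot> x)) (Q \<cdot> x)) \<and>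
      (\<forall>R :: 'a \<Rightarrow>\<^sub>L 'a. (\<forall>l x. R \<cdot> (G (\<iota> n l) \<cdot> x) = 0) \<longrightarrow> (\<forall>x. R \<cdot> (Q \<cdot> x) = 0))" for n Q
  have \<Phi>: "\<exists>Q. \<Phi> n Q" for n
  proof (rule group_pieces[OF A e G(1-3), of "\<iota> n"])
    show "G (\<iota> n k) \<cdot> (G (\<iota> n l) \<cdot> x) = 0" if "k \<noteq> l" for k l x
      by (rule G(4)) (simp add: inj that)
    fix Q assume Q: "big Q" "ocomm A Q"
      and Ql: "\<And>l. (\<And>k x. l * (norm (G (\<iota> n k) \<cdot> x))\<^sup>2 \<le> inner (A \<cdot> (G (\<iota> n k) \<cdot> x)) (G (\<iota> n k) \<cdot> x)) \<Longrightarrow>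
        (\<forall>x. l * (norm (Q \<cdot> x))\<^sup>2 \<le> inner (A \<cdot> (Q \<cdot> x)) (Q \<cdot> x))"
      and Q0: "\<And>R :: 'a \<Rightarrow>\<^sub>L 'a. (\<And>k x. R \<cdot> (G (\<iota> n k) \<cdot> x) = 0) \<Longrightarrow> (\<forall>x. R \<cdot> (Q \<cdot> x) = 0)"
    show ?thesis
      unfolding \<Phi>_def
    proof (intro exI[of _ Q] conjI Q Ql low allI impI)
      fix R :: "'a \<Rightarrow>\<^sub>L 'a" and x assume "\<forall>l x. R \<cdot> (G (\<iota> n l) \<cdot> x) = 0"
      hence "\<forall>x. R \<cdot> (Q \<cdot> x) = 0" by (intro Q0) simp
      thus "R \<cdot> (Q \<cdot> x) = 0" by simp
    qed
  qed
  define P where "P n = (SOME Q. \<Phi> n Q)" for n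
  have \<Phi>': "\<Phi> n (P n)" for n unfolding P_def by (rule someI_ex[OF \<Phi>])
  hence P: "big (P n)" "ocomm A (P n)" "\<alpha> * (norm (P n \<cdot> x))\<^sup>2 \<le> inner (A \<cdot> (P n \<cdot> x)) (P n \<cdot> x)" for n x
    by (simp_all add: \<Phi>_def)
  note P0 = \<Phi>'[unfolded \<Phi>_def, THEN conjunct2, THEN conjunct2, THEN conjunct2, rule_format]
  have Pm: "mproj (P n)" for n using P(1) by (simp add: big_def)
  have GP: "G (2 * r) \<cdot> (P n \<cdot> x) = 0" for r n x by (rule P0, rule G(4)) (rule odd)
  show ?thesis
  proof (rule that[of P])
    show "G (2 * r) \<cdot> (P n \<cdot> x) = 0" for r n x by (rule GP)
    show "P n \<cdot> (G (2 * r) \<cdot> x) = 0" for r n x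
      by (rule rproj_orth_sym[OF mprojD(2)[OF G(1)] mprojD(2)[OF Pm]]) (rule GP)
    show "P m \<cdot> (P n \<cdot> x) = 0" if ne: "m \<noteq> n" for m n x
    proof (rule P0)
      fix l y
      have "G (\<iota> n l) \<cdot> (P m \<cdot> z) = 0" for z by (rule P0, rule G(4)) (use ne inj in auto)
      thus "P m \<cdot> (G (\<iota> n l) \<cdot> y) = 0"
        by (rule rproj_orth_sym[OF mprojD(2)[OF G(1)] mprojD(2)[OF Pm]])
    qed
  qed (rule P)+
qed

lemma slack_case:
  fixes B :: "nat \<Rightarrow> 'a \<Rightarrow>\<^sub>L 'a"
  assumes A: "A \<in> M" "psd A"
    and fin: "\<And>s. \<alpha> < s \<Longrightarrow> \<tau> (spec A {s<..}) < \<infinity>"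
    and K: "\<tau> ((A - \<alpha> *\<^sub>R id_blinfun) o\<^sub>L spec A {\<alpha><..}) = \<infinity>"
    and e: "mproj e" "e \<noteq> 0" "\<tau> e < \<infinity>"
    and B: "\<And>n. B n \<in> M" "\<And>n. psd (B n)" "\<And>n x. inner (B n \<cdot> x) x \<le> \<alpha> * (norm x)\<^sup>2" and \<alpha>: "0 < \<alpha>"
    and \<beta>: "0 < \<beta>" and I: "infinite {n. subeq e (spec (B n) {\<beta><..})}"
  obtains X where "\<And>n. X n \<in> M" "\<And>n. radj (X n) o\<^sub>L X n = B n" "\<And>n. \<exists>Q. big Q \<and> (\<forall>x. X n \<cdot> (radj (X n) \<cdot> (Q \<cdot> x)) = 0)"
    "\<And>x. (\<lambda>n. X n \<cdot> (radj (X n) \<cdot> x)) sums (A \<cdot> x)"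
proof -
  let ?I = "{n. subeq e (spec (B n) {\<beta><..})}"
  obtain G s where G: "\<And>k::nat. mproj (G k)" "\<And>k. ocomm A (G k)" "\<And>k. subeq e (G k)"
    "\<And>i j x. i \<noteq> j \<Longrightarrow> G i \<cdot> (G j \<cdot> x) = 0"
    "\<And>k x. s k * (norm (G k \<cdot> x))\<^sup>2 \<le> inner (A \<cdot> (G k \<cdot> x)) (G k \<cdot> x)"
    and s: "\<And>k. \<alpha> < s k" "\<And>k. s (Suc k) \<le> s k" "\<not> summable (\<lambda>k. s k - \<alpha>)"
    by (rule slices[OF A fin K e]) (assumption | rule that)+
  have low: "\<alpha> * (norm (G k \<cdot> x))\<^sup>2 \<le> inner (A \<cdot> (G k \<cdot> x)) (G k \<cdot> x)" for k x
  proof (rule order_trans[OF _ G(5)])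
    show "\<alpha> * (norm (G k \<cdot> x))\<^sup>2 \<le> s k * (norm (G k \<cdot> x))\<^sup>2" using s(1)[of k] by (intro mult_right_mono) auto
  qed
  have sA: "s k \<le> norm A" for k
  proof -
    have "G k \<noteq> 0"
    proof
      assume "G k = 0"
      then obtain w where "emb w e 0" using G(3)[of k] by (auto simp: subeq_def)
      note w = embD[OF this]
      have "e \<cdot> x = 0" for x using w(2)[of x] w(3)[of x, symmetric] by simp
      thus False using e(2) by (metis blinfun_eqI zero_blinfun.rep_eq)
    qed
    then obtain x where x: "G k \<cdot> x \<noteq> 0" by (metis blinfun_eqI zero_blinfun.rep_eq)
    have "s k * (norm (G k \<cdot> x))\<^sup>2 \<le> norm A * (norm (G k \<cdot> x))\<^sup>2"
      by (rule order_trans[OF G(5) inner_le_norm])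
    thus ?thesis using x by simp
  qed
  have A0: "0 < norm A" using \<alpha> s(1)[of 0] sA[of 0] by linarith
  obtain P' where P': "\<And>n::nat. big (P' n)" "\<And>n. ocomm A (P' n)"
    "\<And>n x. \<alpha> * (norm (P' n \<cdot> x))\<^sup>2 \<le> inner (A \<cdot> (P' n \<cdot> x)) (P' n \<cdot> x)"
    "\<And>m n x. m \<noteq> n \<Longrightarrow> P' m \<cdot> (P' n \<cdot> x) = 0" "\<And>n r x. P' n \<cdot> (G (2 * r) \<cdot> x) = 0" "\<And>n r x. G (2 * r) \<cdot> (P' n \<cdot> x) = 0"
    by (rule slack_targets[OF A G(1-4) e(1,2) low]) (assumption | rule that)+
  have P'm: "mproj (P' n)" for n using P'(1) by (simp add: big_def)
  \<comment> \<open>From \<open>\<alpha> < s\<close> and \<open>s \<le> norm A\<close> it follows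
    that \<open>\<delta> * norm A\<close> is at most \<open>\<beta> / 2\<close>, and, as
    \<open>\<alpha> * s\<close> is at most the square of \<open>norm A\<close>, that
    \<open>\<delta>\<close> is at most the saving
    \<open>\<beta> / 2 * (1 / \<alpha> - 1 / s)\<close>.\<close>
  define c where "c = \<beta> / (2 * (norm A)\<^sup>2)"
  have c: "0 < c" using \<beta> A0 by (simp add: c_def)
  define d where "d r = c * (s (2 * r) - \<alpha>)" for r
  have sd: "antimono s" by (rule decseq_SucI) (rule s(2))
  have dn: "0 \<le> d r" for r unfolding d_def using c s(1)[of "2 * r"] by simp
  have da: "antimono d"
    unfolding d_def antimono_def using c antimonoD[OF sd] by (intro allI impI mult_left_mono diff_right_mono) auto
  \<comment> \<open>As \<open>s\<close> decreases, the slices of even index inherit the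
    divergence.\<close>
  have dd: "\<not> summable d"
  proof
    assume "summable d"
    hence "summable (\<lambda>r. d r / c)" by (rule summable_divide)
    hence "summable (\<lambda>r. s (2 * r + 0) - \<alpha>)" using c by (simp add: d_def)
    hence "summable (\<lambda>k. s k - \<alpha>)"
    proof (rule summable_of_progression[rotated 3])
      show "antimono (\<lambda>k. s k - \<alpha>)"
        unfolding antimono_def using antimonoD[OF sd] by (intro allI impI diff_right_mono) auto
    qed (use s(1) less_imp_le in \<open>auto simp: less_imp_le\<close>)
    thus False using s(3) by simp
  qed
  obtain \<kappa> \<rho> :: "nat \<Rightarrow> nat" where \<rho>: "inj_on \<rho> ?I"
    and \<kappa>: "\<And>k. \<not> summable (\<lambda>n. if \<kappa> n = k then (if n \<in> ?I then d (\<rho> n) else 0) else 0)"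
    by (rule divergent_classes[OF dn da dd I]) (rule that)
  define \<delta> where "\<delta> n = (if n \<in> ?I then d (\<rho> n) else 0)" for n
  \<comment> \<open>Each stage that covers something receives one even slice of its own, selected by
    its rank; injectivity of \<open>\<rho>\<close> on the index set keeps the pieces
    orthogonal.\<close>
  define H where "H n = (if n \<in> ?I then G (2 * \<rho> n) else 0)" for n
  have H: "mproj (H n)" "ocomm A (H n)" for n using G(1,2) by (simp_all add: H_def)
  have HH: "H m \<cdot> (H n \<cdot> x) = 0" if "m \<noteq> n" for m n x
  proof -
    have "\<rho> m \<noteq> \<rho> n" if "m \<in> ?I" "n \<in> ?I" using inj_onD[OF \<rho> _ that] \<open>m \<noteq> n\<close> by blast
    thus ?thesis unfolding H_def using G(4) by auto
  qed
  have PH: "P' n \<cdot> (H m \<cdot> x) = 0" "H m \<cdot> (P' n \<cdot> x) = 0" for m n x by (simp_all add: H_def P'(5,6))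
  define P where "P n = P' n + H n" for n
  have Pm: "mproj (P n)" for n unfolding P_def by (rule mproj_add[OF P'm H(1)]) (rule PH)
  have Pc: "ocomm A (P n)" for n unfolding P_def using P'(2) H(2) by simp
  have Po: "P m \<cdot> (P n \<cdot> x) = 0" if "m \<noteq> n" for m n x
    by (simp add: P_def op_simps PH HH[OF that] P'(4)[OF that])
  have Pb: "big (P n)" for n
    by (rule big_mono[OF P'(1)[of n] Pm]) (use P'm in \<open>simp add: P_def op_simps PH mprojD\<close>)
  have "\<exists>W. (n \<in> ?I \<longrightarrow> emb W e (spec (B n) {\<beta><..})) \<and> (n \<notin> ?I \<longrightarrow> W = 0)" for n
    by (auto simp: subeq_def)
  then obtain W where W: "\<And>n. n \<in> ?I \<Longrightarrow> emb (W n) e (spec (B n) {\<beta><..})" "\<And>n. n \<notin> ?I \<Longrightarrow> W n = 0" by metis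
  have WM: "W n \<in> M" for n using W[of n] embD(1) by (cases "n \<in> ?I") auto
  obtain w where w: "\<And>k. emb (w k) e (G k)" using G(3) unfolding subeq_def by metis
  obtain Z where Z: "\<And>n. Z n \<in> M" "\<And>n x. radj (Z n) \<cdot> (A \<cdot> (Z n \<cdot> x)) = B n \<cdot> x"
    "\<And>m n x. n < m \<Longrightarrow> P m \<cdot> (Z n \<cdot> x) = 0" "\<And>x. (\<lambda>n. Z n \<cdot> (radj (Z n) \<cdot> x)) sums x"
  proof (rule exhaustion[where A = A and P = P and e = e and W = W and \<delta> = \<delta> and \<kappa> = \<kappa> and B = B])
    show "0 \<le> \<delta> n" for n using dn by (simp add: \<delta>_def)
    show "radj (W n) \<cdot> (W n \<cdot> x) = e \<cdot> x" if "\<delta> n \<noteq> 0" for n x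
      by (rule embD(2)[OF W(1)]) (use that in \<open>simp add: \<delta>_def split: if_splits\<close>)
    show "\<not> summable (\<lambda>n. if \<kappa> n = k then \<delta> n else 0)" for k unfolding \<delta>_def by (rule \<kappa>)
    fix n D assume D: "D \<in> M" "psd D" "\<And>x. inner (D \<cdot> x) x \<le> \<delta> n * norm A * (norm (radj (W n) \<cdot> x))\<^sup>2"
    show "\<exists>X\<in>M. (\<forall>x. P n \<cdot> (X \<cdot> x) = X \<cdot> x) \<and> (\<forall>x. radj X \<cdot> (A \<cdot> (X \<cdot> x)) = B n \<cdot> x - D \<cdot> x) \<and>
        (\<forall>x. (norm (X \<cdot> x))\<^sup>2 + \<delta> n * (norm (radj (W n) \<cdot> x))\<^sup>2 \<le> (norm x)\<^sup>2)"
    proof (cases "n \<in> ?I")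
      case True
      let ?s = "s (2 * \<rho> n)"
      have \<delta>: "\<delta> n = c * (?s - \<alpha>)" using True by (simp add: \<delta>_def d_def)
      have s1: "\<alpha> < ?s" "?s \<le> norm A" by (rule s(1), rule sA)
      have d0: "0 \<le> \<delta> n" using True dn by (simp add: \<delta>_def)
      have "(?s - \<alpha>) * norm A \<le> norm A * norm A" using s1 \<alpha> by (intro mult_right_mono) auto
      hence "c * ((?s - \<alpha>) * norm A) \<le> c * (norm A * norm A)" using c by (intro mult_left_mono) auto
      moreover have "c * (norm A * norm A) = \<beta> / 2" using A0 by (simp add: c_def power2_eq_square)
      ultimately have d1: "\<delta> n * norm A \<le> \<beta> / 2" by (simp add: \<delta> mult.assoc)
      have "\<alpha> * ?s \<le> (norm A)\<^sup>2" unfolding power2_eq_square using s1 \<alpha> by (intro mult_mono) auto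
      hence "(?s - \<alpha>) / (norm A)\<^sup>2 \<le> (?s - \<alpha>) / (\<alpha> * ?s)" using s1 \<alpha> A0 by (intro divide_left_mono) auto
      also have "\<dots> = 1 / \<alpha> - 1 / ?s" using s1 \<alpha> by (simp add: field_simps)
      finally have "\<beta> / 2 * ((?s - \<alpha>) / (norm A)\<^sup>2) \<le> \<beta> / 2 * (1 / \<alpha> - 1 / ?s)"
        using \<beta> by (intro mult_left_mono) auto
      moreover have "\<delta> n = \<beta> / 2 * ((?s - \<alpha>) / (norm A)\<^sup>2)" by (simp add: \<delta> c_def)
      ultimately have d2: "\<delta> n \<le> \<beta> / 2 * (1 / \<alpha> - 1 / ?s)" by simp
      have "P n = P' n + G (2 * \<rho> n)" using True by (simp add: P_def H_def)
      thus ?thesis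
        using resource_slack[OF A B \<alpha> s1(1) P'(1-3) G(1,2,5) P'(5) e(1) w W(1)[OF True] \<beta> d0 d1 d2 D] by simp
    next
      case False
      hence z: "\<delta> n = 0" "P n = P' n" by (simp_all add: \<delta>_def P_def H_def)
      have "inner (D \<cdot> x) x \<le> 0" for x using D(3)[of x] z by simp
      from resource_plain[OF A B \<alpha> P'(1-3) D(2) this] show ?thesis unfolding z by simp
    qed
  qed (rule A Pm Pc Po e WM that; assumption)+
  show ?thesis
    by (rule decomposition[OF A Pc Pb Z]) (assumption | rule that)+
qed

end

section \<open>Complex Hilbert spaces\<close>

lemma cinner_scaleC_right: "cinner x (c *\<^sub>C y) = cnj c * cinner x y"
  by (subst (1 2) cinner_commute) (simp add: cinner_scaleC_left)

lemma inner_iscale: "inner (\<i> *\<^sub>C x) (\<i> *\<^sub>C y) = inner x (y :: 'a::chilbert_space)"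
  "inner (\<i> *\<^sub>C x) y = - inner x (\<i> *\<^sub>C (y :: 'a::chilbert_space))"
  by (simp_all add: inner_eq_Re_cinner cinner_scaleC_left cinner_scaleC_right)

lemma cinner_eq: "cinner x y = Complex (inner x y) (inner x (\<i> *\<^sub>C y))"
  by (rule complex_eqI) (simp_all add: inner_eq_Re_cinner cinner_scaleC_right)

definition imult :: "'a::chilbert_space oper" where
  "imult = Blinfun (\<lambda>x. \<i> *\<^sub>C x)"

lemma imult [simp]: "imult \<cdot> x = \<i> *\<^sub>C x"
proof -
  have "bounded_linear (\<lambda>x :: 'a. \<i> *\<^sub>C x)"
  proof (rule bounded_linear_intro[where K = 1])
    show "norm (\<i> *\<^sub>C x) \<le> norm x * 1" for x :: 'a
      by (simp add: norm_eq_sqrt_inner inner_iscale(1))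
  qed (simp_all add: scaleC_add_right scaleR_eq_scaleC scaleC_scaleC mult.commute)
  thus ?thesis by (simp add: imult_def bounded_linear_Blinfun_apply)
qed

lemma radj_imult: "radj imult = - imult"
  by (rule radj_eqI) (simp add: inner_iscale(2) blinfun.minus_left)

lemma scaleC_eq: "c *\<^sub>C x = Re c *\<^sub>R x + Im c *\<^sub>R (\<i> *\<^sub>C (x :: 'a::chilbert_space))"
  by (simp add: scaleR_eq_scaleC scaleC_scaleC flip: scaleC_add_left) (simp add: mult.commute flip: complex_eq)

lemma iscale_iscale [simp]: "\<i> *\<^sub>C \<i> *\<^sub>C x = - (x :: 'a::chilbert_space)"
  using scaleR_eq_scaleC[of "-1" x] by (simp add: scaleC_scaleC)

lemma iscale_minus: "\<i> *\<^sub>C (- x) = - (\<i> *\<^sub>C (x :: 'a::chilbert_space))"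
  using blinfun.minus_right[of imult x] by simp

lemma clin_ops_iff: "T \<in> clin_ops \<longleftrightarrow> ocomm imult T"
proof
  assume "ocomm imult T"
  hence "T \<cdot> (\<i> *\<^sub>C x) = \<i> *\<^sub>C (T \<cdot> x)" for x by (simp add: ocomm_def)
  hence "T \<cdot> (c *\<^sub>C x) = c *\<^sub>C (T \<cdot> x)" for c x
    unfolding scaleC_eq[of c x] scaleC_eq[of c "T \<cdot> x"] by (simp add: op_simps)
  thus "T \<in> clin_ops" by (simp add: clin_ops_def)
qed (simp add: clin_ops_def ocomm_def)

lemma clin_radj: "T \<in> clin_ops \<Longrightarrow> radj T \<in> clin_ops"
proof -
  assume "T \<in> clin_ops"
  hence "imult o\<^sub>L T = T o\<^sub>L imult" by (intro blinfun_eqI) (simp add: clin_ops_iff ocomm_def)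
  hence "radj (imult o\<^sub>L T) = radj (T o\<^sub>L imult)" by simp
  hence "(radj T o\<^sub>L - imult) \<cdot> x = (- imult o\<^sub>L radj T) \<cdot> x" for x by (simp add: radj_imult)
  thus ?thesis by (simp add: clin_ops_iff ocomm_def op_simps blinfun.minus_left blinfun.minus_right)
qed

lemma adj_eq_radj: "T \<in> clin_ops \<Longrightarrow> adj T = radj T"
  unfolding adj_def
proof (rule the_equality)
  assume T: "T \<in> clin_ops"
  have "\<i> *\<^sub>C (radj T \<cdot> y) = radj T \<cdot> (\<i> *\<^sub>C y)" for y
    using clin_radj[OF T] by (simp add: clin_ops_def)
  thus "\<forall>x y. cinner (T \<cdot> x) y = cinner x (radj T \<cdot> y)" by (simp add: cinner_eq radj)
  fix S assume "\<forall>x y. cinner (T \<cdot> x) y = cinner x (S \<cdot> y)"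
  thus "S = radj T" by (intro radj_eqI[symmetric]) (simp add: inner_eq_Re_cinner)
qed

text \<open>A complex form that is real on the diagonal polarises, at \<open>x\<close> and
  \<open>- (\<i> *\<^sub>C y)\<close>, to symmetry of the real form.\<close>

lemma positive_op_iff: "positive_op T \<longleftrightarrow> T \<in> clin_ops \<and> psd T"
proof (cases "T \<in> clin_ops")
  case True
  hence c: "T \<cdot> (\<i> *\<^sub>C x) = \<i> *\<^sub>C (T \<cdot> x)" for x by (simp add: clin_ops_def)
  have pos: "cinner (T \<cdot> x) x \<in> \<real>\<^sub>\<ge>\<^sub>0 \<longleftrightarrow> 0 \<le> inner (T \<cdot> x) x \<and> inner (T \<cdot> x) (\<i> *\<^sub>C x) = 0" for x
    by (simp add: complex_nonneg_Reals_iff cinner_eq)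
  have "(\<forall>x. inner (T \<cdot> x) (\<i> *\<^sub>C x) = 0) \<longleftrightarrow> sym_op T"
  proof
    assume a: "\<forall>x. inner (T \<cdot> x) (\<i> *\<^sub>C x) = 0"
    have "inner (T \<cdot> x) y = inner x (T \<cdot> y)" for x y
    proof -
      let ?z = "- (\<i> *\<^sub>C y)"
      have z: "\<i> *\<^sub>C ?z = y" by (simp add: iscale_minus)
      have "inner (T \<cdot> (x + ?z)) (\<i> *\<^sub>C (x + ?z)) = inner (T \<cdot> x) (\<i> *\<^sub>C x) + inner (T \<cdot> x) y +
          (inner (T \<cdot> ?z) (\<i> *\<^sub>C x) + inner (T \<cdot> ?z) (\<i> *\<^sub>C ?z))"
        by (simp only: scaleC_add_right z blinfun.add_right inner_add_left inner_add_right)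
      hence "inner (T \<cdot> x) y + inner (T \<cdot> ?z) (\<i> *\<^sub>C x) = 0" by (simp only: a[rule_format] add_0 add_0_right)
      moreover have "inner (T \<cdot> ?z) (\<i> *\<^sub>C x) = - inner (\<i> *\<^sub>C (T \<cdot> ?z)) x" by (simp add: inner_iscale(2))
      moreover have "\<i> *\<^sub>C (T \<cdot> ?z) = T \<cdot> y" by (simp only: c[symmetric] z)
      ultimately show ?thesis by (simp add: inner_commute)
    qed
    thus "sym_op T" by (simp add: sym_op_def)
  next
    assume s: "sym_op T"
    have "inner (T \<cdot> x) (\<i> *\<^sub>C x) = - inner (T \<cdot> x) (\<i> *\<^sub>C x)" for x
      using sym_opD[OF s, of x "\<i> *\<^sub>C x"] inner_iscale(2)[of "T \<cdot> x" x]
      by (simp add: c inner_commute inner_iscale(2))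
    thus "\<forall>x. inner (T \<cdot> x) (\<i> *\<^sub>C x) = 0" by simp
  qed
  thus ?thesis by (auto simp: positive_op_def psd_def pos True)
qed (simp add: positive_op_def)

lemma is_proj_iff: "is_proj P \<longleftrightarrow> P \<in> clin_ops \<and> rproj P"
proof (cases "P \<in> clin_ops")
  case True
  have "P o\<^sub>L P = P \<longleftrightarrow> (\<forall>x. P \<cdot> (P \<cdot> x) = P \<cdot> x)"
    by (metis blinfun_apply_blinfun_compose blinfun_eqI)
  thus ?thesis by (auto simp: is_proj_def rproj_def sym_op_radj adj_eq_radj True)
qed (simp add: is_proj_def)

lemma clin_ops_simps [simp]:
  "id_blinfun \<in> clin_ops" "0 \<in> clin_ops" "S \<in> clin_ops \<Longrightarrow> T \<in> clin_ops \<Longrightarrow> S + T \<in> clin_ops"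
  "S \<in> clin_ops \<Longrightarrow> T \<in> clin_ops \<Longrightarrow> S - T \<in> clin_ops" "S \<in> clin_ops \<Longrightarrow> T \<in> clin_ops \<Longrightarrow> S o\<^sub>L T \<in> clin_ops"
  "T \<in> clin_ops \<Longrightarrow> r *\<^sub>R T \<in> clin_ops"
  by (simp_all add: clin_ops_iff)

lemma op_le_proj_iff: "is_proj P \<Longrightarrow> is_proj Q \<Longrightarrow> P \<preceq> Q \<longleftrightarrow> (\<forall>x. Q \<cdot> (P \<cdot> x) = P \<cdot> x)"
  by (simp add: op_le_def positive_op_iff is_proj_iff psd_def rproj_sym op_simps flip: rproj_le_iff)

lemma clin_spec: "T \<in> clin_ops \<Longrightarrow> sym_op T \<Longrightarrow> S \<in> sets borel \<Longrightarrow> spec T S \<in> clin_ops"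
  by (simp add: clin_ops_iff spec(3))

section \<open>Uniqueness of the spectral calculus\<close>

lemma cinner_sym_op:
  assumes "T \<in> clin_ops" "psd T"
  shows "cinner (T \<cdot> x) x = of_real (inner (T \<cdot> x) x)"
proof -
  have "cinner (T \<cdot> x) x \<in> \<real>\<^sub>\<ge>\<^sub>0" using assms positive_op_iff by (auto simp: positive_op_def)
  thus ?thesis by (simp add: complex_eq_iff complex_nonneg_Reals_iff inner_eq_Re_cinner)
qed

lemma scalar_measure_spec:
  assumes "sym_op T"
  shows "scalar_measure (spec T) x = spec_meas T x"
proof -
  interpret finite_measure "spec_meas T x" by (rule finite_spec_meas[OF assms])
  have "measure_of (space (spec_meas T x)) (sets (spec_meas T x)) (emeasure (spec_meas T x)) = scalar_measure (spec T) x"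
    unfolding scalar_measure_def space_spec_meas[OF assms] sets_spec_meas[OF assms]
  proof (rule measure_of_eq)
    fix S assume "S \<in> sigma_sets UNIV (sets (borel :: real measure))"
    hence "S \<in> sets borel" using sets.sigma_sets_eq[of "borel :: real measure"] by simp
    thus "emeasure (spec_meas T x) S = ennreal (Re (cinner (spec T S \<cdot> x) x))"
      by (simp add: emeasure_eq_measure spec(2)[OF assms] inner_eq_Re_cinner)
  qed simp
  thus ?thesis by (simp add: measure_of_of_measure)
qed

lemma spectral_measure_of_spec:
  assumes T: "T \<in> clin_ops" "psd T"
  shows "spectral_measure_of (spec T) T"
proof -
  note s = psd_sym[OF T(2)]
  have "spec T (S \<inter> U) = spec T S o\<^sub>L spec T U" if "S \<in> sets borel" "U \<in> sets borel" for S U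
    by (rule blinfun_eqI) (simp add: spec_Int[OF s that])
  hence "spectral_measure (spec T)"
    unfolding spectral_measure_def using T(1) s
    by (auto simp: is_proj_iff clin_spec spec(1) spec_UNIV intro!: spec_sums)
  thus ?thesis
    unfolding spectral_measure_of_def
    by (simp add: scalar_measure_spec[OF s] spec_integral[OF s] cinner_sym_op[OF T])
qed

lemma sets_scalar_measure: "sets (scalar_measure E x) = sets borel"
  and space_scalar_measure: "space (scalar_measure E x) = UNIV"
  using sets.sigma_sets_eq[of "borel :: real measure"] by (simp_all add: scalar_measure_def space_measure_of_conv)

context
  fixes E :: "real set \<Rightarrow> 'a::chilbert_space oper" and T :: "'a oper"
  assumes E: "spectral_measure_of E T" and T: "sym_op T"
begin

lemma E_proj: "S \<in> sets borel \<Longrightarrow> rproj (E S)"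
  and E_UNIV: "E UNIV = id_blinfun"
  and E_Int: "S \<in> sets borel \<Longrightarrow> U \<in> sets borel \<Longrightarrow> E S \<cdot> (E U \<cdot> x) = E (S \<inter> U) \<cdot> x"
  and E_sums: "range F \<subseteq> sets borel \<Longrightarrow> disjoint_family F \<Longrightarrow> (\<lambda>n::nat. E (F n) \<cdot> x) sums (E (\<Union>n. F n) \<cdot> x)"
  using E by (auto simp: spectral_measure_of_def spectral_measure_def is_proj_iff)

lemma E_empty: "E {} = 0"
proof (rule blinfun_eqI)
  fix x
  have "(\<lambda>n::nat. E {} \<cdot> x) sums (E (\<Union>n::nat. {}) \<cdot> x)"
    by (rule E_sums) (auto simp: disjoint_family_on_def)
  hence "summable (\<lambda>n::nat. E {} \<cdot> x)" by (rule sums_summable)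
  thus "E {} \<cdot> x = 0 \<cdot> x" by (simp add: summable_const_iff)
qed

lemma emeasure_scalar_measure: "S \<in> sets borel \<Longrightarrow> emeasure (scalar_measure E x) S = ennreal (inner (E S \<cdot> x) x)"
proof -
  assume S: "S \<in> sets borel"
  let ?m = "\<lambda>S. ennreal (Re (cinner (E S \<cdot> x) x))"
  have m: "?m S = ennreal (inner (E S \<cdot> x) x)" for S by (simp add: inner_eq_Re_cinner)
  have "emeasure (scalar_measure E x) S = ?m S"
  proof (rule emeasure_measure_of[OF scalar_measure_def])
    show "positive (sets (scalar_measure E x)) ?m"
      by (simp add: positive_def E_empty cinner_eq)
    show "countably_additive (sets (scalar_measure E x)) ?m"
      unfolding countably_additive_def m
    proof (intro allI impI)
      fix F :: "nat \<Rightarrow> real set"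
      assume "range F \<subseteq> sets (scalar_measure E x)" "disjoint_family F" "\<Union> (range F) \<in> sets (scalar_measure E x)"
      hence F: "range F \<subseteq> sets borel" "disjoint_family F" by (auto simp: sets_scalar_measure)
      have "(\<lambda>n. inner (E (F n) \<cdot> x) x) sums inner (E (\<Union>n. F n) \<cdot> x) x"
        by (rule bounded_linear.sums[OF bounded_linear_inner_left E_sums[OF F]])
      moreover have "0 \<le> inner (E (F n) \<cdot> x) x" for n
        using F(1) by (intro psd_ge0 rproj_psd E_proj) auto
      ultimately show "(\<Sum>n. ennreal (inner (E (F n) \<cdot> x) x)) = ennreal (inner (E (\<Union> (range F)) \<cdot> x) x)"
        by (intro suminf_ennreal_eq)
    qed
  qed (use S in \<open>auto simp: sets_scalar_measure\<close>)
  thus ?thesis unfolding m .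
qed

lemma finite_scalar_measure: "finite_measure (scalar_measure E x)"
  by (rule finite_measureI) (simp add: space_scalar_measure emeasure_scalar_measure)

lemma E_form: "integrable (scalar_measure E x) (\<lambda>t. t)" "inner (T \<cdot> x) x = (LINT t|scalar_measure E x. t)"
proof -
  have "integrable (scalar_measure E x) (\<lambda>t. t) \<and> cinner (T \<cdot> x) x = of_real (LINT t|scalar_measure E x. t)"
    using E by (simp add: spectral_measure_of_def)
  thus "integrable (scalar_measure E x) (\<lambda>t. t)" "inner (T \<cdot> x) x = (LINT t|scalar_measure E x. t)"
    by (simp_all add: inner_eq_Re_cinner)
qed

lemma E_const: "(LINT t|scalar_measure E x. a) = a * (norm x)\<^sup>2"
proof -
  interpret finite_measure "scalar_measure E x" by (rule finite_scalar_measure)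
  have "measure (scalar_measure E x) UNIV = (norm x)\<^sup>2"
    by (simp add: measure_def emeasure_scalar_measure E_UNIV power2_norm_eq_inner)
  thus ?thesis by (simp add: space_scalar_measure)
qed

lemma E_localized:
  assumes S: "S \<in> sets borel" and y: "inner (E (- S) \<cdot> y) y = 0"
  shows "AE t in scalar_measure E y. t \<in> S"
proof (rule AE_I[where N = "- S"])
  show "emeasure (scalar_measure E y) (- S) = 0" using S y by (simp add: emeasure_scalar_measure)
qed (use S in \<open>auto simp: sets_scalar_measure\<close>)

lemma E_form_mono:
  assumes "AE t in scalar_measure E y. a \<le> t"
  shows "a * (norm y)\<^sup>2 \<le> inner (T \<cdot> y) y"
proof -
  interpret finite_measure "scalar_measure E y" by (rule finite_scalar_measure)
  have "(LINT t|scalar_measure E y. a) \<le> (LINT t|scalar_measure E y. t)"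
    by (intro integral_mono_AE E_form(1) integrable_const assms)
  thus ?thesis by (simp only: E_form(2) E_const)
qed

lemma E_form_antimono:
  assumes "AE t in scalar_measure E y. t \<le> a"
  shows "inner (T \<cdot> y) y \<le> a * (norm y)\<^sup>2"
proof -
  interpret finite_measure "scalar_measure E y" by (rule finite_scalar_measure)
  have "(LINT t|scalar_measure E y. t) \<le> (LINT t|scalar_measure E y. a)"
    by (intro integral_mono_AE E_form(1) integrable_const assms)
  thus ?thesis by (simp only: E_form(2) E_const)
qed

text \<open>The integral of \<open>t - a\<close> vanishes while the integrand is almost everywhere
  positive, so the measure is 0; its total mass is the squared norm of \<open>y\<close>.\<close>

lemma E_form_strict:
  assumes ae: "AE t in scalar_measure E y. a < t" and eq: "inner (T \<cdot> y) y = a * (norm y)\<^sup>2"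
  shows "y = 0"
proof -
  interpret finite_measure "scalar_measure E y" by (rule finite_scalar_measure)
  have int: "integrable (scalar_measure E y) (\<lambda>t. t - a)"
    by (intro Bochner_Integration.integrable_diff E_form(1) integrable_const)
  have "(LINT t|scalar_measure E y. t - a) = (LINT t|scalar_measure E y. t) - (LINT t|scalar_measure E y. a)"
    by (intro Bochner_Integration.integral_diff E_form(1) integrable_const)
  also have "\<dots> = 0" using eq by (simp only: E_form(2) E_const)
  finally have z: "(LINT t|scalar_measure E y. t - a) = 0" .
  have "AE t in scalar_measure E y. 0 \<le> t - a" using ae by eventually_elim simp
  hence "AE t in scalar_measure E y. t - a = 0" using integral_nonneg_eq_0_iff_AE[OF int] z by blast
  with ae have "AE t in scalar_measure E y. False" by eventually_elim simp
  hence "emeasure (scalar_measure E y) UNIV = 0"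
    by (subst (asm) AE_iff_measurable[where N = UNIV]) (simp_all add: sets_scalar_measure space_scalar_measure)
  thus ?thesis by (simp add: emeasure_scalar_measure E_UNIV)
qed

text \<open>The scalar measure of \<open>E S x\<close> is that of \<open>x\<close> restricted to
  \<open>S\<close>, and likewise for the complement, so the integral that represents the form
  splits.\<close>

lemma E_form_split:
  assumes S: "S \<in> sets borel"
  shows "inner (T \<cdot> x) x = inner (T \<cdot> (E S \<cdot> x)) (E S \<cdot> x) + inner (T \<cdot> (x - E S \<cdot> x)) (x - E S \<cdot> x)"
proof -
  let ?m = "scalar_measure E x" and ?i = "\<lambda>S t. indicat_real S t *\<^sub>R t"
  interpret finite_measure ?m by (rule finite_scalar_measure)
  have P: "rproj (E S)" by (rule E_proj[OF S])
  have id: "(\<lambda>t. t) \<in> borel_measurable ?m" by (rule measurable_ident_sets) (simp add: sets_scalar_measure)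
  have form: "inner (T \<cdot> y) y = (LINT t|?m. ?i U t)" if U: "U \<in> sets borel"
    and y: "\<And>V. V \<in> sets borel \<Longrightarrow> inner (E V \<cdot> y) y = inner (E (U \<inter> V) \<cdot> x) x" for U y
  proof -
    have "scalar_measure E y = density ?m (indicator U)"
    proof (rule measure_eqI)
      fix V assume "V \<in> sets (scalar_measure E y)"
      hence V: "V \<in> sets borel" by (simp add: sets_scalar_measure)
      show "emeasure (scalar_measure E y) V = emeasure (density ?m (indicator U)) V"
        using U V by (simp add: emeasure_restricted sets_scalar_measure emeasure_scalar_measure y)
    qed (simp add: sets_scalar_measure)
    moreover have "(indicator U :: real \<Rightarrow> ennreal) = (\<lambda>t. ennreal (indicat_real U t))" by (auto simp: indicator_def)
    ultimately have "(LINT t|scalar_measure E y. t) = (LINT t|?m. ?i U t)"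
      using integral_density[OF id, of "indicat_real U"] U
      by (simp add: borel_measurable_indicator sets_scalar_measure)
    thus ?thesis by (simp add: E_form(2))
  qed
  have int: "integrable ?m (?i U)" if "U \<in> sets borel" for U
    by (intro integrable_mult_indicator E_form(1)) (simp add: sets_scalar_measure that)
  have sym: "inner (E S \<cdot> u) v = inner u (E S \<cdot> v)" for u v by (rule sym_opD[OF rproj_sym[OF P]])
  have 1: "inner (E V \<cdot> (E S \<cdot> x)) (E S \<cdot> x) = inner (E (S \<inter> V) \<cdot> x) x" if "V \<in> sets borel" for V
    using S that by (simp add: E_Int Int_left_absorb flip: sym) (simp add: Int_commute)
  have 2: "inner (E V \<cdot> (x - E S \<cdot> x)) (x - E S \<cdot> x) = inner (E (- S \<inter> V) \<cdot> x) x" if V: "V \<in> sets borel" for V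
  proof -
    have "inner (E V \<cdot> x) (E S \<cdot> x) = inner (E (S \<inter> V) \<cdot> x) x"
      using S V by (simp add: E_Int flip: sym)
    moreover have "inner (E V \<cdot> (E S \<cdot> x)) x = inner (E (S \<inter> V) \<cdot> x) x"
      using S V by (simp add: E_Int Int_commute)
    moreover have "inner (E V \<cdot> x) x = inner (E (S \<inter> V) \<cdot> x) x + inner (E (- S \<inter> V) \<cdot> x) x"
    proof -
      have "emeasure ?m (S \<inter> V) + emeasure ?m (- S \<inter> V) = emeasure ?m ((S \<inter> V) \<union> (- S \<inter> V))"
        by (rule plus_emeasure) (use S V in \<open>auto simp: sets_scalar_measure\<close>)
      moreover have "(S \<inter> V) \<union> (- S \<inter> V) = V" by auto
      ultimately have e: "ennreal (inner (E V \<cdot> x) x) = ennreal (inner (E (S \<inter> V) \<cdot> x) x) + ennreal (inner (E (- S \<inter> V) \<cdot> x) x)"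
        using S V by (simp add: emeasure_scalar_measure)
      have nn: "0 \<le> inner (E U \<cdot> x) x" if "U \<in> sets borel" for U by (intro psd_ge0 rproj_psd E_proj that)
      have "S \<inter> V \<in> sets borel" "- S \<inter> V \<in> sets borel" using S V by auto
      note n = nn[OF V] nn[OF this(1)] nn[OF this(2)]
      show ?thesis
        using e unfolding ennreal_plus[OF n(2,3), symmetric] by (simp only: ennreal_inj[OF n(1) add_nonneg_nonneg[OF n(2,3)]])
    qed
    ultimately show ?thesis using 1[OF V] by (simp add: op_simps)
  qed
  have cS: "- S \<in> sets borel" using S by auto
  have "inner (T \<cdot> x) x = (LINT t|?m. t)" by (rule E_form(2))
  also have "\<dots> = (LINT t|?m. ?i S t + ?i (- S) t)"
    by (rule Bochner_Integration.integral_cong) (auto simp: indicator_def)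
  also have "\<dots> = (LINT t|?m. ?i S t) + (LINT t|?m. ?i (- S) t)"
    by (rule Bochner_Integration.integral_add[OF int[OF S] int[OF cS]])
  also have "(LINT t|?m. ?i S t) = inner (T \<cdot> (E S \<cdot> x)) (E S \<cdot> x)" by (rule form[OF S, symmetric]) (rule 1)
  also have "(LINT t|?m. ?i (- S) t) = inner (T \<cdot> (x - E S \<cdot> x)) (x - E S \<cdot> x)"
    by (rule form[OF cS, symmetric]) (rule 2)
  finally show ?thesis .
qed

text \<open>The splitting of the form, applied to a sum of a vector of the range of
  \<open>E S\<close> and one of its complement, makes the off-diagonal terms vanish; so
  \<open>T\<close> leaves the range invariant.\<close>

lemma E_ocomm:
  assumes S: "S \<in> sets borel"
  shows "ocomm (E S) T"
proof -
  have P: "rproj (E S)" by (rule E_proj[OF S])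
  have o: "inner (T \<cdot> (E S \<cdot> u)) (v - E S \<cdot> v) = 0" for u v
  proof -
    let ?p = "E S \<cdot> u" and ?q = "v - E S \<cdot> v"
    have "E S \<cdot> (?p + ?q) = ?p" "?p + ?q - E S \<cdot> (?p + ?q) = ?q" using P by (simp_all add: op_simps)
    hence "inner (T \<cdot> (?p + ?q)) (?p + ?q) = inner (T \<cdot> ?p) ?p + inner (T \<cdot> ?q) ?q"
      using E_form_split[OF S, of "?p + ?q"] by (simp only:)
    moreover have "inner (T \<cdot> (p + q)) (p + q) = inner (T \<cdot> p) p + inner (T \<cdot> p) q + (inner (T \<cdot> q) p + inner (T \<cdot> q) q)" for p q
      by (simp only: blinfun.add_right inner_add_left inner_add_right)
    ultimately have "inner (T \<cdot> ?p) ?q + inner (T \<cdot> ?q) ?p = 0" by (simp only:)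
    thus ?thesis using sym_op_swap[OF T, of ?q ?p] by linarith
  qed
  have inv: "E S \<cdot> (T \<cdot> (E S \<cdot> u)) = T \<cdot> (E S \<cdot> u)" for u
  proof (rule inner_eq_all_imp_eq)
    fix z
    show "inner (E S \<cdot> (T \<cdot> (E S \<cdot> u))) z = inner (T \<cdot> (E S \<cdot> u)) z"
      using o[of u z] by (simp add: sym_opD[OF rproj_sym[OF P]] inner_diff_right)
  qed
  have "radj T = T" using T by (simp add: sym_op_radj)
  thus ?thesis
    unfolding ocomm_def using rproj_commute_if_invariant[OF P inv] inv by simp
qed

text \<open>\<open>E {a<..}\<close> lies below \<open>spec_gt T a\<close> by the maximality in
  \<open>spec_gt_absorb\<close>. A vector of \<open>spec_gt T a\<close> orthogonal to it has form at
  most \<open>a\<close>, and strictness makes it 0.\<close>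

lemma E_greaterThan: "E {a<..} = spec_gt T a"
proof (rule blinfun_eqI)
  fix x
  let ?P = "E {a<..}" and ?G = "spec_gt T a"
  have P: "rproj ?P" by (rule E_proj) simp
  have PT: "ocomm ?P T" by (rule E_ocomm) simp
  have ae: "AE t in scalar_measure E (?P \<cdot> y). a < t" for y
  proof -
    have "{..a} \<inter> {a<..} = {}" by auto
    hence "E (- {a<..}) \<cdot> (?P \<cdot> y) = 0" using E_Int[of "{..a}" "{a<..}" y] by (simp add: E_empty)
    thus ?thesis using E_localized[of "{a<..}" "?P \<cdot> y"] by simp
  qed
  have GP: "?G \<cdot> (?P \<cdot> y) = ?P \<cdot> y" for y
  proof (rule spec_gt_absorb[OF T P PT])
    show "a * (norm (?P \<cdot> z))\<^sup>2 \<le> inner (T \<cdot> (?P \<cdot> z)) (?P \<cdot> z)" for z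
      by (rule E_form_mono) (use ae[of z] in \<open>auto elim: eventually_mono\<close>)
    show "?P \<cdot> z = 0" if "inner (T \<cdot> (?P \<cdot> z)) (?P \<cdot> z) = a * (norm (?P \<cdot> z))\<^sup>2" for z
      by (rule E_form_strict[OF ae that])
  qed
  have c: "?P \<cdot> (?G \<cdot> y) = ?G \<cdot> (?P \<cdot> y)" for y by (rule ocommD[OF spec_gt(2)[OF T PT]])
  define y where "y = ?G \<cdot> (x - ?P \<cdot> x)"
  have y1: "?P \<cdot> y = 0" "?G \<cdot> y = y" unfolding y_def c using P spec_gt(1)[OF T] by (simp_all add: op_simps)
  have "AE t in scalar_measure E y. t \<in> - {a<..}"
    by (rule E_localized) (simp_all add: y1)
  hence "inner (T \<cdot> y) y \<le> a * (norm y)\<^sup>2"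
    by (intro E_form_antimono) (auto elim: eventually_mono)
  moreover have "a * (norm y)\<^sup>2 \<le> inner (T \<cdot> y) y" using spec_gt(3)[OF T, of a y] by (simp add: y1)
  ultimately have "y = 0" using spec_gt(5)[OF T, of a y] by (simp add: y1)
  thus "?P \<cdot> x = ?G \<cdot> x" by (simp add: y_def blinfun.diff_right GP)
qed

text \<open>The scalar measures agree on open half-lines and hence on all Borel sets, and forms
  determine projections. This gives the description in \<open>spec_proj\<close> its unique
  value.\<close>

lemma spectral_measure_unique:
  assumes S: "S \<in> sets borel"
  shows "E S = spec T S"
proof (rule spec_eqI[OF T S, symmetric])
  show "sym_op (E S)" by (rule rproj_sym[OF E_proj[OF S]])
  fix x
  have "scalar_measure E x = spec_meas T x"
  proof (rule measure_eqI_lessThan)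
    interpret finite_measure "spec_meas T x" by (rule finite_spec_meas[OF T])
    show "emeasure (scalar_measure E x) {a<..} < \<infinity>" for a by (simp add: emeasure_scalar_measure)
    show "emeasure (scalar_measure E x) {a<..} = emeasure (spec_meas T x) {a<..}" for a
      by (simp add: emeasure_scalar_measure emeasure_eq_measure spec(2)[OF T] E_greaterThan spec_greaterThan[OF T])
  qed (simp_all add: sets_scalar_measure sets_spec_meas[OF T])
  hence "emeasure (spec_meas T x) S = ennreal (inner (E S \<cdot> x) x)" by (metis emeasure_scalar_measure[OF S])
  moreover have "0 \<le> inner (E S \<cdot> x) x" by (intro psd_ge0 rproj_psd E_proj S)
  ultimately show "measure (spec_meas T x) S = inner (E S \<cdot> x) x" by (simp add: measure_def)
qed

end

lemma spec_proj_eq_spec: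
  assumes T: "positive_op T" and S: "S \<in> sets borel"
  shows "spec_proj S T = spec T S"
  unfolding spec_proj_def
proof (rule the_equality)
  have T': "T \<in> clin_ops" "psd T" using T by (auto simp: positive_op_iff)
  show "\<exists>E. spectral_measure_of E T \<and> spec T S = E S" using spectral_measure_of_spec[OF T'] by blast
  show "P = spec T S" if "\<exists>E. spectral_measure_of E T \<and> P = E S" for P
    using that spectral_measure_unique[OF _ psd_sym[OF T'(2)] S] by blast
qed

section \<open>Von Neumann algebras as real operator algebras\<close>

lemma ocomm_iff: "ocomm S T \<longleftrightarrow> S o\<^sub>L T = T o\<^sub>L S"
  unfolding ocomm_def by (metis blinfun_apply_blinfun_compose blinfun_eqI)

lemma imult_clin: "imult \<in> clin_ops"
  by (simp add: clin_ops_iff)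

lemma imult_commutant: "S \<subseteq> clin_ops \<Longrightarrow> imult \<in> commutant S"
  unfolding commutant_def using imult_clin by (auto simp: clin_ops_iff ocomm_iff)

lemma rcomm_eq_commutant: "imult \<in> S \<Longrightarrow> rcomm S = commutant S"
  unfolding rcomm_def commutant_def by (auto simp: clin_ops_iff ocomm_iff)

text \<open>As \<open>\<i>1\<close> lies in \<open>M\<close> and in its commutant, real linear operators that commute with either of them
  are complex linear, and the real commutants agree with the complex ones.\<close>

lemma real_vna_of_vna:
  assumes "von_neumann_algebra M"
  shows "real_vna M"
proof
  have M: "M \<subseteq> clin_ops" "\<And>T. T \<in> M \<Longrightarrow> adj T \<in> M" "commutant (commutant M) = M"
    using assms by (auto simp: von_neumann_algebra_def)
  have "commutant M \<subseteq> clin_ops" by (auto simp: commutant_def)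
  hence "imult \<in> commutant (commutant M)" by (rule imult_commutant)
  hence "rcomm M = commutant M" using M(3) by (intro rcomm_eq_commutant) simp
  thus "rcomm (rcomm M) = M" using imult_commutant[OF M(1)] M(3) by (simp add: rcomm_eq_commutant)
  show "radj T \<in> M" if "T \<in> M" for T using M(2)[OF that] adj_eq_radj[of T] M(1) that by auto
qed

locale infinite_complex_factor =
  fixes M :: "'h::chilbert_space oper set"
  assumes infinite_factor: "infinite_factor M" and sigma: "sigma_finite_vna M"
begin

lemma vna: "von_neumann_algebra M"
  using infinite_factor by (simp add: infinite_factor_def vn_factor_def)

lemma clin: "T \<in> M \<Longrightarrow> T \<in> clin_ops"
  using vna by (auto simp: von_neumann_algebra_def)

lemma adj_radj: "T \<in> M \<Longrightarrow> adj T = radj T"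
  by (rule adj_eq_radj[OF clin])

sublocale real_vna M
  by (rule real_vna_of_vna[OF vna])

lemma projs_iff: "P \<in> projs M \<longleftrightarrow> mproj P"
  using clin by (auto simp: projs_def is_proj_iff mproj_def)

lemma pos_elems_iff: "T \<in> pos_elems M \<longleftrightarrow> T \<in> M \<and> psd T"
  using clin by (auto simp: pos_elems_def positive_op_iff)

lemma op_le_iff: "S \<in> M \<Longrightarrow> T \<in> M \<Longrightarrow> S \<preceq> T \<longleftrightarrow> psd (T - S)"
  using clin[of "T - S"] by (auto simp: op_le_def positive_op_iff)

lemma op_le_mproj: "mproj P \<Longrightarrow> mproj Q \<Longrightarrow> P \<preceq> Q \<longleftrightarrow> (\<forall>x. Q \<cdot> (P \<cdot> x) = P \<cdot> x)"
  by (rule op_le_proj_iff) (auto simp: is_proj_iff mproj_def clin)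

text \<open>The first projection in \<open>equiv_in\<close> is the final projection of the witness,
  whereas the first in \<open>emb\<close> is the initial one; so \<open>V\<close> is the adjoint of
  the witness.\<close>

lemma equiv_in_embD:
  assumes PQ: "equiv_in M P Q" and P: "mproj P"
  obtains V where "emb V P Q" "V o\<^sub>L radj V = Q"
proof -
  obtain X where X: "X \<in> M" "P = X o\<^sub>L radj X" "Q = radj X o\<^sub>L X"
    using PQ by (auto simp: equiv_in_def adj_radj)
  have "radj X \<cdot> (P \<cdot> x) = radj X \<cdot> x" for x
    by (rule partial_isometry(1)) (use P X(2) in auto)
  hence "emb (radj X) P Q" using X by (simp add: emb_def)
  from that[OF this] show thesis by (simp add: X(3))
qed

lemma subequiv_in_subeq:
  assumes "subequiv_in M P Q" "mproj P" "mproj Q"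
  shows "subeq P Q"
proof -
  obtain Q' where Q': "mproj Q'" "Q' \<preceq> Q" "equiv_in M P Q'"
    using assms(1) by (auto simp: subequiv_in_def projs_iff)
  obtain V where V: "emb V P Q'" by (rule equiv_in_embD[OF Q'(3) assms(2)])
  have "subeq Q' Q" using Q'(2) op_le_mproj[OF Q'(1) assms(3)] by (intro subeq_sub Q'(1)) simp
  thus ?thesis using V subeq_trans unfolding subeq_def by blast
qed

lemma infinite_projE:
  assumes "infinite_proj M P"
  obtains V where "mproj P" "emb V P P" "V o\<^sub>L radj V \<noteq> P"
proof -
  obtain Q where P: "mproj P" and Q: "mproj Q" "Q \<preceq> P" "equiv_in M P Q" "Q \<noteq> P"
    using assms by (auto simp: infinite_proj_def finite_proj_def projs_iff)
  obtain V where V: "emb V P Q" "V o\<^sub>L radj V = Q" by (rule equiv_in_embD[OF Q(3) P])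
  have QP: "P \<cdot> (Q \<cdot> x) = Q \<cdot> x" for x using Q(2) op_le_mproj[OF Q(1) P] by simp
  have "P \<cdot> (V \<cdot> x) = V \<cdot> x" for x using QP[of "V \<cdot> x"] by (simp add: embD(3)[OF V(1)])
  hence "emb V P P" using V(1) by (simp add: emb_def)
  thus thesis using that P V(2) Q(4) by simp
qed

sublocale real_factor M
proof
  show "Z = 0 \<or> Z = id_blinfun" if Z: "rproj Z" "Z \<in> M" "Z \<in> rcomm M" for Z
  proof -
    have "Z \<in> commutant M"
      using Z(3) clin[OF Z(2)] by (auto simp: rcomm_def commutant_def ocomm_iff)
    hence "Z \<in> M \<inter> commutant M" using Z(2) by simp
    moreover have "M \<inter> commutant M = {T. \<exists>c. \<forall>x. T \<cdot> x = c *\<^sub>C x}"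
      using infinite_factor by (simp add: infinite_factor_def vn_factor_def)
    ultimately obtain c where c: "\<And>x. Z \<cdot> x = c *\<^sub>C x" by blast
    show ?thesis
    proof (cases "c = 0")
      case True
      have "0 *\<^sub>C x = 0" for x :: 'h using scaleR_eq_scaleC[of 0 x] by simp
      hence "Z = 0" using c True by (intro blinfun_eqI) simp
      thus ?thesis ..
    next
      case False
      have "c *\<^sub>C x = x" for x :: 'h
      proof -
        have "c *\<^sub>C c *\<^sub>C x = c *\<^sub>C x" using rproj_idem[OF Z(1), of x] by (simp add: c)
        hence "inverse c *\<^sub>C c *\<^sub>C c *\<^sub>C x = inverse c *\<^sub>C c *\<^sub>C x" by simp
        moreover have "1 *\<^sub>C y = y" for y :: 'h using scaleR_eq_scaleC[of 1 y] by simp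
        ultimately show ?thesis using False by (simp add: scaleC_scaleC flip: mult.assoc)
      qed
      hence "Z = id_blinfun" using c by (intro blinfun_eqI) simp
      thus ?thesis ..
    qed
  qed
  show "countable F" if F: "F \<subseteq> {P \<in> M. rproj P \<and> P \<noteq> 0}" "pairwise (\<lambda>P Q. \<forall>x. P \<cdot> (Q \<cdot> x) = 0) F" for F
  proof -
    have "F \<subseteq> projs M - {0}" using F(1) by (auto simp: projs_iff mproj_def)
    moreover have "pairwise (\<lambda>P Q. P o\<^sub>L Q = 0) F"
      using F(2) by (rule pairwise_mono) (auto intro!: blinfun_eqI)
    ultimately show ?thesis using sigma by (simp add: sigma_finite_vna_def)
  qed
  have "infinite_proj M id_blinfun" using infinite_factor by (simp add: infinite_factor_def)
  then obtain V where "emb V id_blinfun id_blinfun" "V o\<^sub>L radj V \<noteq> id_blinfun" by (rule infinite_projE)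
  thus "\<exists>S\<in>M. (\<forall>x. radj S \<cdot> (S \<cdot> x) = x) \<and> S o\<^sub>L radj S \<noteq> id_blinfun"
    by (intro bexI[of _ V]) (auto simp: emb_def)
qed

lemma infinite_proj_iff_big: "infinite_proj M P \<longleftrightarrow> big P"
proof
  assume "infinite_proj M P"
  then obtain V where "mproj P" "emb V P P" "V o\<^sub>L radj V \<noteq> P" by (rule infinite_projE)
  thus "big P" by (rule infinite_imp_big)
next
  assume b: "big P"
  hence P: "mproj P" by (simp add: big_def)
  obtain V where V: "emb V P P" "V o\<^sub>L radj V \<noteq> P" by (rule big_imp_infinite[OF b])
  let ?Q = "V o\<^sub>L radj V"
  have Q: "mproj ?Q" "?Q \<preceq> P"
    using emb_final[OF V(1) P] op_le_mproj[OF emb_final(1)[OF V(1) P] P] by auto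
  have "P = radj V o\<^sub>L V" by (rule blinfun_eqI) (simp add: embD(2)[OF V(1)])
  hence "equiv_in M P ?Q"
    unfolding equiv_in_def using embD(1)[OF V(1)] radj_closed[of V]
    by (intro bexI[of _ "radj V"]) (auto simp: adj_radj)
  thus "infinite_proj M P"
    using P Q V(2) by (auto simp: infinite_proj_def finite_proj_def projs_iff)
qed

lemma finite_proj_iff: "finite_proj M P \<longleftrightarrow> mproj P \<and> \<not> big P"
  using infinite_proj_iff_big[of P] by (auto simp: infinite_proj_def projs_iff finite_proj_def)

text \<open>The centre is trivial, so a single nonzero finite projection already witnesses
  semifiniteness.\<close>

lemma semifinite_or_type_III: "semifinite_vna M \<or> type_III_vna M"
proof (rule disjCI)
  assume "\<not> type_III_vna M"
  then obtain P where P: "finite_proj M P" "P \<noteq> 0" by (auto simp: type_III_vna_def)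
  show "semifinite_vna M"
    unfolding semifinite_vna_def
  proof (intro ballI impI exI[of _ P] conjI P)
    fix Z assume Z: "Z \<in> projs M \<inter> commutant M" "Z \<noteq> 0"
    have "Z \<in> rcomm M" using Z(1) by (auto simp: rcomm_def commutant_def ocomm_iff)
    hence "Z = id_blinfun" using center[of Z] Z by (auto simp: projs_iff)
    thus "P \<preceq> Z" using op_le_mproj[of P id_blinfun] P(1) by (simp add: finite_proj_iff)
  qed
qed

text \<open>For normality, the range of an increasing sequence is directed and its strong limit is
  its least upper bound among the positive elements of \<open>M\<close>.\<close>

lemma trace_factor_of_factor_trace:
  assumes "factor_trace M \<tau>"
  shows "trace_factor M \<tau>"
proof
  have t: "trace_on M \<tau>" "faithful_on M \<tau>" "normal_on M \<tau>" "semifinite_on M \<tau>"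
    using assms by (auto simp: factor_trace_def)
  show "\<tau> (S + T) = \<tau> S + \<tau> T" if "S \<in> M" "psd S" "T \<in> M" "psd T" for S T
    using t(1) that by (simp add: trace_on_def pos_elems_iff)
  show "\<tau> (c *\<^sub>R T) = ennreal c * \<tau> T" if "T \<in> M" "psd T" "0 \<le> c" for T c
    using t(1) that by (simp add: trace_on_def pos_elems_iff)
  show "\<tau> (radj X o\<^sub>L X) = \<tau> (X o\<^sub>L radj X)" if "X \<in> M" for X
    using t(1) that by (auto simp: trace_on_def adj_radj)
  show "T = 0" if "T \<in> M" "psd T" "\<tau> T = 0" for T
    using t(2) that by (simp add: faithful_on_def pos_elems_iff)
  show "\<exists>S\<in>M. psd S \<and> S \<noteq> 0 \<and> psd (T - S) \<and> \<tau> S < \<infinity>" if T: "T \<in> M" "psd T" "T \<noteq> 0" for T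
  proof -
    have "T \<in> pos_elems M" using T by (simp add: pos_elems_iff)
    then obtain S where "S \<in> pos_elems M" "S \<noteq> 0" "S \<preceq> T" "\<tau> S < \<infinity>"
      using t(4) T(3) unfolding semifinite_on_def by blast
    thus ?thesis unfolding pos_elems_iff using op_le_iff[of S T] T(1) by auto
  qed
  show "\<tau> S = (SUP n. \<tau> (F n))"
    if F: "\<And>n. F n \<in> M" "\<And>n. psd (F n)" "\<And>n. psd (F (Suc n) - F n)" "\<And>x. (\<lambda>n::nat. F n \<cdot> x) \<longlonglongrightarrow> S \<cdot> x" for F S
  proof -
    have S: "S \<in> M" by (rule limit_closed[OF F(1,4)])
    have mono: "inner (F m \<cdot> x) x \<le> inner (F n \<cdot> x) x" if "m \<le> n" for m n x
      using that by (rule lift_Suc_mono_le[rotated]) (use psd_ge0[OF F(3)] in \<open>simp add: op_simps\<close>)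
    have lim: "(\<lambda>n. inner (F n \<cdot> x) x) \<longlonglongrightarrow> inner (S \<cdot> x) x" for x by (intro tendsto_intros F(4))
    have le: "inner (F n \<cdot> x) x \<le> inner (S \<cdot> x) x" for n x
      by (rule LIMSEQ_le_const[OF lim]) (use mono in blast)
    have ss: "sym_op S" by (rule sym_op_limit[OF psd_sym[OF F(2)] F(4)])
    have "psd S" unfolding psd_def using ss psd_ge0[OF F(2)] le order_trans by blast
    have FS: "F n \<preceq> S" for n
      using op_le_iff[OF F(1) S] ss psd_sym[OF F(2)] le by (simp add: psd_diff_iff)
    have FF: "F m \<preceq> F n" if "m \<le> n" for m n
      using op_le_iff[OF F(1) F(1)] psd_sym[OF F(2)] mono[OF that] by (simp add: psd_diff_iff)
    have "\<tau> S = (SUP T\<in>range F. \<tau> T)"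
    proof (rule t(3)[unfolded normal_on_def, rule_format], intro conjI ballI impI)
      show "range F \<subseteq> pos_elems M" using F(1,2) by (auto simp: pos_elems_iff)
      show "S \<in> pos_elems M" using S \<open>psd S\<close> by (simp add: pos_elems_iff)
      show "\<exists>W\<in>range F. U \<preceq> W \<and> V \<preceq> W" if "U \<in> range F" "V \<in> range F" for U V
      proof -
        obtain m n where "U = F m" "V = F n" using \<open>U \<in> range F\<close> \<open>V \<in> range F\<close> by blast
        thus ?thesis using FF[of m "max m n"] FF[of n "max m n"] by auto
      qed
      show "U \<preceq> S" if "U \<in> range F" for U using FS that by auto
      show "S \<preceq> U" if U: "U \<in> pos_elems M" "\<forall>T\<in>range F. T \<preceq> U" for U
      proof -
        have UM: "U \<in> M" "psd U" using U(1) by (auto simp: pos_elems_iff)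
        have "inner (S \<cdot> x) x \<le> inner (U \<cdot> x) x" for x
        proof (rule LIMSEQ_le_const2[OF lim])
          have "inner (F n \<cdot> x) x \<le> inner (U \<cdot> x) x" for n
            using U(2) op_le_iff[OF F(1) UM(1), of n] by (simp add: psd_diff_iff)
          thus "\<exists>N. \<forall>n\<ge>N. inner (F n \<cdot> x) x \<le> inner (U \<cdot> x) x" by blast
        qed
        thus ?thesis using op_le_iff[OF S UM(1)] ss psd_sym[OF UM(2)] by (simp add: psd_diff_iff)
      qed
    qed simp
    thus ?thesis by (simp add: image_image)
  qed
qed

end

text \<open>For uniqueness, \<open>R (R - X) = 0\<close> makes \<open>R\<close> commute with
  \<open>X\<close> and hence with its positive support; then \<open>R\<close> lives on the support,
  and on the support \<open>R - X\<close> vanishes.\<close>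

lemma pos_part_eq:
  assumes X: "X \<in> clin_ops" "sym_op X"
  shows "pos_part X = X o\<^sub>L pos_supp X"
  unfolding pos_part_def
proof (rule the_equality)
  note ps = pos_supp[OF X(2)]
  let ?E = "pos_supp X"
  note Es = sym_opD[OF rproj_sym[OF ps(1)]] and Ei = rproj_idem[OF ps(1)]
  have XE: "X \<cdot> (?E \<cdot> x) = ?E \<cdot> (X \<cdot> x)" for x by (rule ocommD[OF ps(3)])
  have Ec: "?E \<in> clin_ops"
    unfolding clin_ops_iff
    by (rule ps(2)) (use X(1) in \<open>simp_all add: clin_ops_iff radj_imult ocomm_def op_simps\<close>)
  show "positive_op (X o\<^sub>L ?E) \<and> positive_op ((X o\<^sub>L ?E) - X) \<and> (X o\<^sub>L ?E) o\<^sub>L ((X o\<^sub>L ?E) - X) = 0"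
  proof (intro conjI)
    have s: "sym_op (X o\<^sub>L ?E)" by (rule sym_op_compose[OF X(2) rproj_sym[OF ps(1)] ps(3)])
    have 1: "inner (X \<cdot> (?E \<cdot> x)) x = inner (X \<cdot> (?E \<cdot> x)) (?E \<cdot> x)" for x
      by (simp only: XE Es Ei)
    show "positive_op (X o\<^sub>L ?E)"
      unfolding positive_op_iff psd_def using s X(1) Ec ps(4) by (simp add: 1)
    have 2: "inner (((X o\<^sub>L ?E) - X) \<cdot> x) x = - inner (X \<cdot> (x - ?E \<cdot> x)) (x - ?E \<cdot> x)" for x
      by (simp add: op_simps XE Es Ei)
    show "positive_op ((X o\<^sub>L ?E) - X)"
      unfolding positive_op_iff psd_def 2 using s X Ec ps(5) by simp
    show "(X o\<^sub>L ?E) o\<^sub>L ((X o\<^sub>L ?E) - X) = 0"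
      by (rule blinfun_eqI) (simp add: op_simps XE Ei)
  qed
  fix R assume "positive_op R \<and> positive_op (R - X) \<and> R o\<^sub>L (R - X) = 0"
  hence R: "psd R" "psd (R - X)" and RN: "R o\<^sub>L (R - X) = 0" by (auto simp: positive_op_iff)
  have RX: "R \<cdot> (R \<cdot> x) = R \<cdot> (X \<cdot> x)" for x
    using arg_cong[OF RN, of "\<lambda>T. T \<cdot> x"] by (simp add: op_simps)
  have XR: "X \<cdot> (R \<cdot> x) = R \<cdot> (R \<cdot> x)" for x
    by (rule inner_eq_all_imp_eq)
      (simp add: sym_opD[OF X(2)] sym_opD[OF psd_sym[OF R(1)]] flip: RX)
  have co: "ocomm R X" by (simp add: ocomm_def RX XR)
  have ER: "?E \<cdot> (R \<cdot> x) = R \<cdot> (?E \<cdot> x)" for x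
    using ps(2)[OF co] co psd_sym[OF R(1)] by (simp add: sym_op_radj ocomm_def)
  have 1: "R \<cdot> x = ?E \<cdot> (R \<cdot> x)" for x
  proof -
    define z where "z = R \<cdot> x - ?E \<cdot> (R \<cdot> x)"
    have "X \<cdot> z = R \<cdot> z" by (simp add: z_def op_simps XE XR ER)
    hence "inner (R \<cdot> z) z \<le> 0" using ps(5)[of "R \<cdot> x"] by (simp add: z_def)
    hence "R \<cdot> z = 0" using psd_ge0[OF R(1), of z] by (intro psd_kernel[OF R(1)]) simp
    moreover have "inner z z = inner (R \<cdot> z) x"
    proof -
      have "?E \<cdot> z = 0" by (simp add: z_def blinfun.diff_right Ei)
      hence "inner z (?E \<cdot> (R \<cdot> x)) = 0" by (simp flip: Es)
      hence "inner z z = inner z (R \<cdot> x)" by (subst (2) z_def) (simp only: inner_diff_right diff_zero)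
      thus ?thesis by (simp only: sym_opD[OF psd_sym[OF R(1)]])
    qed
    ultimately show ?thesis by (simp add: z_def)
  qed
  have 2: "?E \<cdot> (R \<cdot> x - X \<cdot> x) = 0" for x
  proof -
    define z where "z = ?E \<cdot> (R \<cdot> x - X \<cdot> x)"
    have "R \<cdot> z = 0" by (simp add: z_def op_simps RX flip: ER)
    moreover have "0 \<le> inner (X \<cdot> z) z" using ps(4) by (simp add: z_def)
    ultimately have "inner ((R - X) \<cdot> z) z = 0" using psd_ge0[OF R(2), of z] by (simp add: op_simps)
    hence "(R - X) \<cdot> z = 0" by (rule psd_kernel[OF R(2)])
    moreover have "inner z z = inner z ((R - X) \<cdot> x)" by (simp add: z_def Es Ei op_simps)
    ultimately have "inner z z = 0" by (simp add: sym_opD[OF psd_sym[OF R(2)], symmetric])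
    thus ?thesis by (simp add: z_def)
  qed
  show "R = X o\<^sub>L ?E"
    by (rule blinfun_eqI) (use 1 2 in \<open>simp add: op_simps XE\<close>)
qed

lemma null_proj_eq:
  assumes T: "T \<in> clin_ops"
  shows "null_proj T = proj_on {x. T \<cdot> x = 0}"
  unfolding null_proj_def
proof (rule the_equality)
  let ?K = "{x. T \<cdot> x = 0}"
  note K = proj_on[OF kernel_subspace[of T]]
  have "proj_on ?K \<in> clin_ops"
    unfolding clin_ops_iff
    by (rule proj_on_kernel_ocomm) (use T in \<open>simp_all add: clin_ops_iff radj_imult ocomm_def op_simps\<close>)
  thus "is_proj (proj_on ?K) \<and> range (proj_on ?K) = ?K" using K by (simp add: is_proj_iff)
  fix P :: "'a oper" assume "is_proj P \<and> range P = ?K"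
  hence P: "rproj P" "range P = ?K" by (auto simp: is_proj_iff)
  have KP: "proj_on ?K \<cdot> (P \<cdot> x) = P \<cdot> x" for x
  proof -
    have "P \<cdot> x \<in> ?K" using P(2) by blast
    thus ?thesis using proj_on_eq_iff[OF kernel_subspace[of T]] by simp
  qed
  have PK: "P \<cdot> (proj_on ?K \<cdot> x) = proj_on ?K \<cdot> x" for x
  proof -
    have "proj_on ?K \<cdot> x \<in> range P" using K(2) P(2) by blast
    thus ?thesis using P(1) by auto
  qed
  show "P = proj_on ?K"
  proof (rule blinfun_eqI)
    show "P \<cdot> x = proj_on ?K \<cdot> x" for x using rproj_le_sym[OF P(1) K(1) KP, of x] PK[of x] by simp
  qed
qed

section \<open>Reducing a uniform gap, type III and the essential norm to the strict case\<close>

context real_factor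
begin

text \<open>The strict case with \<open>l\<close> in the role of \<open>\<alpha>\<close> and
  \<open>\<gamma>\<close> between \<open>\<alpha>\<close> and \<open>l\<close>: since the norms of
  the \<open>B n\<close> are at most \<open>\<alpha>\<close>, they have no spectrum from
  \<open>l\<close> on, and (\<beta>,\<gamma>] has the same spectral projection as
  (\<beta>,\<infinity>).\<close>

lemma strict_bound_case:
  fixes B :: "nat \<Rightarrow> 'a \<Rightarrow>\<^sub>L 'a"
  assumes A: "A \<in> M" "psd A"
    and F1: "\<And>P Q. mproj P \<Longrightarrow> mproj Q \<Longrightarrow> (\<And>x. P \<cdot> (Q \<cdot> x) = 0) \<Longrightarrow> big (P + Q) \<Longrightarrow> big P \<or> big Q"
    and F2: "\<And>J P. (\<And>n. mproj (J n)) \<Longrightarrow> (\<And>n x. J (Suc n) \<cdot> (J n \<cdot> x) = J n \<cdot> x) \<Longrightarrow>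
      (\<And>x. (\<lambda>n::nat. J n \<cdot> x) \<longlonglongrightarrow> P \<cdot> x) \<Longrightarrow> big P \<Longrightarrow> \<exists>n. subeq e (J n)"
    and e: "mproj e" "e \<noteq> 0"
    and inf: "\<And>l'. l' < l \<Longrightarrow> big (spec A {l'<..})" and l: "\<alpha> < l"
    and B: "\<And>n. B n \<in> M" "\<And>n. psd (B n)" "\<And>n. norm (B n) \<le> \<alpha>"
    and \<beta>: "0 < \<beta>" and I: "infinite {n. subeq e (spec (B n) {\<beta><..})}"
  obtains X where "\<And>n. X n \<in> M" "\<And>n. radj (X n) o\<^sub>L X n = B n" "\<And>n. \<exists>Q. big Q \<and> (\<forall>x. X n \<cdot> (radj (X n) \<cdot> (Q \<cdot> x)) = 0)"
    "\<And>x. (\<lambda>n. X n \<cdot> (radj (X n) \<cdot> x)) sums (A \<cdot> x)"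
proof -
  define \<gamma> where "\<gamma> = (\<alpha> + l) / 2"
  have \<gamma>: "\<alpha> < \<gamma>" "\<gamma> < l" using l by (simp_all add: \<gamma>_def)
  note Bs = psd_sym[OF B(2)]
  have high: "spec (B n) {c<..} = 0" if "\<alpha> \<le> c" for n c
    unfolding spec_greaterThan[OF Bs]
    by (rule blinfun_eqI) (use B(3)[of n] that in \<open>simp add: spec_gt_high[OF Bs]\<close>)
  obtain n where n: "subeq e (spec (B n) {\<beta><..})" using not_finite_existsD[OF I] by blast
  \<comment> \<open>Otherwise the spectral projections above \<open>\<beta>\<close> are 0 and cannot
    contain a copy of the nonzero \<open>e\<close>.\<close>
  have "\<beta> < \<alpha>"
  proof (rule ccontr)
    assume "\<not> \<beta> < \<alpha>"
    then obtain V where V: "emb V e 0" using n high by (auto simp: subeq_def)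
    have "e = 0" using embD(2,3)[OF V] by (intro blinfun_eqI) (metis blinfun.zero_left blinfun.zero_right)
    thus False using e(2) by simp
  qed
  hence "\<beta> < \<gamma>" using \<gamma>(1) by simp
  have "spec (B n) {\<beta><..\<gamma>} = spec (B n) {\<beta><..}" for n
  proof -
    have "{\<beta><..} = {\<beta><..\<gamma>} \<union> {\<gamma><..}" using \<open>\<beta> < \<gamma>\<close> by auto
    moreover have "spec (B n) ({\<beta><..\<gamma>} \<union> {\<gamma><..}) = spec (B n) {\<beta><..\<gamma>} + spec (B n) {\<gamma><..}"
      by (rule spec_Un[OF Bs]) auto
    ultimately show ?thesis using high[of \<gamma> n] \<gamma>(1) by simp
  qed
  hence I': "infinite {n. subeq e (spec (B n) {\<beta><..\<gamma>})}" using I by simp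
  have B0: "spec (B n) {l..} = 0" for n
  proof (rule blinfun_eqI)
    fix x
    have "spec (B n) {\<gamma><..} \<cdot> (spec (B n) {l..} \<cdot> x) = spec (B n) {l..} \<cdot> x"
      by (rule spec_mono[OF Bs]) (use \<gamma> in auto)
    thus "spec (B n) {l..} \<cdot> x = 0 \<cdot> x" using high[of \<gamma> n] \<gamma>(1) by simp
  qed
  show ?thesis
    by (rule strict_case[OF A F1 F2 e inf B(1,2) B0 \<beta> \<open>\<beta> < \<gamma>\<close> \<gamma>(2) I']) (assumption | rule that)+
qed

lemma big_spec_below_norm:
  assumes A: "A \<in> M" "psd A" and all: "\<And>P. mproj P \<Longrightarrow> P \<noteq> 0 \<Longrightarrow> big P"
    and l: "l < norm A" and A0: "A \<noteq> 0"
  shows "big (spec A {l<..})"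
proof (rule all)
  note As = psd_sym[OF A(2)]
  show "mproj (spec A {l<..})" by (rule mproj_spec[OF A(1) As]) simp
  show "spec A {l<..} \<noteq> 0"
  proof
    assume 0: "spec A {l<..} = 0"
    have "inner (A \<cdot> x) x \<le> max l 0 * (norm x)\<^sup>2" for x
    proof -
      have "inner (A \<cdot> x) x \<le> l * (norm x)\<^sup>2"
        using spec_gt(4)[OF As, of x l] 0 by (simp add: spec_greaterThan[OF As])
      also have "\<dots> \<le> max l 0 * (norm x)\<^sup>2" by (intro mult_right_mono) auto
      finally show ?thesis .
    qed
    hence "norm A \<le> max l 0" by (intro norm_le_if_form_le[OF A(2)]) auto
    moreover have "0 < norm A" using A0 by simp
    ultimately show False using l by linarith
  qed
qed

text \<open>The type III source of \<open>F1\<close> and \<open>F2\<close>: when all nonzero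
  projections are infinite, both come down to the fact that infinite projections are exactly the
  nonzero ones and contain a copy of every projection.\<close>

lemma purely_infinite_big:
  assumes all: "\<And>P. mproj P \<Longrightarrow> P \<noteq> 0 \<Longrightarrow> big P" and e: "mproj e"
  shows "mproj P \<Longrightarrow> mproj Q \<Longrightarrow> big (P + Q) \<Longrightarrow> big P \<or> big Q"
    and "(\<And>n. mproj (J n)) \<Longrightarrow> (\<And>x. (\<lambda>n::nat. J n \<cdot> x) \<longlonglongrightarrow> P \<cdot> x) \<Longrightarrow> big P \<Longrightarrow> \<exists>n. subeq e (J n)"
proof -
  show "big P \<or> big Q" if "mproj P" "mproj Q" "big (P + Q)" for P Q
    using all[OF that(1)] all[OF that(2)] that(3) not_big_zero by (cases "P = 0"; cases "Q = 0") auto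
  show "\<exists>n. subeq e (J n)" if J: "\<And>n. mproj (J n)" "\<And>x. (\<lambda>n::nat. J n \<cdot> x) \<longlonglongrightarrow> P \<cdot> x" and P: "big P"
  proof (rule ccontr)
    assume "\<nexists>n. subeq e (J n)"
    hence "J n = 0" for n using all[OF J(1)] big_subeq[OF _ e] by blast
    hence "P \<cdot> x = 0" for x using J(2)[of x] LIMSEQ_unique by (simp add: LIMSEQ_const_iff)
    hence "P = 0" by (intro blinfun_eqI) simp
    thus False using P not_big_zero by simp
  qed
qed

end

context infinite_complex_factor
begin

text \<open>The null projection of \<open>C j\<close> dominates the reserved piece \<open>Q\<close>
  and is therefore infinite.\<close>

lemma decomposition_transfer:
  assumes X: "\<And>n. X n \<in> M" "\<And>n. radj (X n) o\<^sub>L X n = B n" "\<And>n. \<exists>Q. big Q \<and> (\<forall>x. X n \<cdot> (radj (X n) \<cdot> (Q \<cdot> x)) = 0)"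
    "\<And>x. (\<lambda>n. X n \<cdot> (radj (X n) \<cdot> x)) sums (A \<cdot> x)"
  shows "\<exists>C. (\<forall>j. C j \<in> pos_elems M \<and> equiv_in M (C j) (B j) \<and> infinite_proj M (null_proj (C j))) \<and>
    (\<forall>x. (\<lambda>j. C j \<cdot> x) sums A \<cdot> x)"
proof (intro exI[of _ "\<lambda>n. X n o\<^sub>L radj (X n)"] conjI allI)
  fix n
  let ?C = "X n o\<^sub>L radj (X n)" and ?K = "{x. (X n o\<^sub>L radj (X n)) \<cdot> x = 0}"
  have CM: "?C \<in> M" using X(1)[of n] by simp
  show "?C \<in> pos_elems M" using CM by (simp add: pos_elems_iff psd_radj_compose)
  show "equiv_in M ?C (B n)" unfolding equiv_in_def
    by (rule bexI[OF _ X(1)[of n]]) (simp add: adj_radj[OF X(1)] X(2))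
  have K: "mproj (proj_on ?K)"
    unfolding mproj_def
  proof (rule conjI[OF memI])
    show "ocomm Z (proj_on ?K)" if "Z \<in> rcomm M" for Z
      by (rule proj_on_kernel_ocomm[OF mem_ocomm[OF CM that] mem_ocomm[OF CM rcomm_radj[OF that]]])
  qed (rule proj_on(1)[OF kernel_subspace])
  obtain Q where Q: "big Q" "\<And>x. ?C \<cdot> (Q \<cdot> x) = 0" using X(3)[of n] by auto
  have "proj_on ?K \<cdot> (Q \<cdot> x) = Q \<cdot> x" for x
    using Q(2)[of x] proj_on_eq_iff[OF kernel_subspace[of ?C]] by simp
  from big_mono[OF Q(1) K this]
  show "infinite_proj M (null_proj ?C)" by (simp add: infinite_proj_iff_big null_proj_eq[OF clin[OF CM]])
qed (use X(4) in simp)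

lemma type_III_big: "type_III_vna M \<Longrightarrow> mproj P \<Longrightarrow> P \<noteq> 0 \<Longrightarrow> big P"
  using finite_proj_iff by (auto simp: type_III_vna_def)

text \<open>If the spectral projection above \<open>l\<close> is not infinite, the part of
  \<open>A\<close> above \<open>l\<close> lies in the ideal, so the distance of \<open>A\<close> to
  the ideal is at most the norm of the part below.\<close>

lemma ess_norm_le:
  assumes A: "A \<in> M" "psd A" and l: "0 \<le> l" and fin: "\<not> big (spec A {l<..})"
  shows "ess_norm M A \<le> l"
proof -
  note As = psd_sym[OF A(2)]
  let ?E = "spec A {l<..}"
  have Em: "mproj ?E" by (rule mproj_spec[OF A(1) As]) simp
  have Ei: "?E \<cdot> (?E \<cdot> x) = ?E \<cdot> x" for x using Em by auto
  have "A o\<^sub>L ?E \<in> finite_proj_ideal M"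
    using A(1) Em fin by (auto simp: finite_proj_ideal_def two_sided_ideal_def finite_proj_iff)
  hence "ess_norm M A \<le> dist A (A o\<^sub>L ?E)" unfolding ess_norm_def by (rule infdist_le)
  also have "\<dots> \<le> l"
    unfolding dist_norm
  proof (rule norm_le_if_form_le[OF _ l])
    have AE: "A \<cdot> (?E \<cdot> x) = ?E \<cdot> (A \<cdot> x)" for x by (rule spec_ocomm[OF As]) simp
    have f: "inner ((A - (A o\<^sub>L ?E)) \<cdot> x) x = inner (A \<cdot> (x - ?E \<cdot> x)) (x - ?E \<cdot> x)" for x
      using sym_opD[OF rproj_sym[OF mprojD(2)[OF Em]]] by (simp add: op_simps AE Ei)
    have "sym_op (A o\<^sub>L ?E)"
      by (rule sym_op_compose[OF As rproj_sym[OF mprojD(2)[OF Em]]]) (simp add: ocomm_def AE)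
    thus "psd (A - (A o\<^sub>L ?E))" unfolding psd_def f using As psd_ge0[OF A(2)] by simp
    show "inner ((A - (A o\<^sub>L ?E)) \<cdot> x) x \<le> l * (norm x)\<^sup>2" for x
    proof -
      have "inner ((A - (A o\<^sub>L ?E)) \<cdot> x) x \<le> l * (norm (x - ?E \<cdot> x))\<^sup>2"
        unfolding f using spec_gt(4)[OF As, of x l] by (simp add: spec_greaterThan[OF As])
      also have "\<dots> \<le> l * (norm x)\<^sup>2"
        using rproj_norm_le[OF rproj_compl[OF mprojD(2)[OF Em]], of x] l
        by (intro mult_left_mono power_mono) (simp_all add: op_simps)
      finally show ?thesis .
    qed
  qed
  finally show ?thesis .
qed

lemma big_spec_below_ess_norm:
  assumes A: "A \<in> M" "psd A" and l: "l < \<alpha>" and \<alpha>: "0 < \<alpha>" "\<alpha> \<le> ess_norm M A"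
  shows "big (spec A {l<..})"
proof (rule big_mono)
  note As = psd_sym[OF A(2)]
  \<comment> \<open>\<open>ess_norm_le\<close> asks for a nonnegative level and \<open>l\<close> may
    be negative; as \<open>\<alpha>\<close> is positive, the raised level is still below the
    essential norm.\<close>
  show "big (spec A {max l 0<..})"
    using ess_norm_le[OF A, of "max l 0"] l \<alpha> by (rule_tac ccontr) auto
  show "mproj (spec A {l<..})" by (rule mproj_spec[OF A(1) As]) simp
  show "spec A {l<..} \<cdot> (spec A {max l 0<..} \<cdot> x) = spec A {max l 0<..} \<cdot> x" for x
    by (rule spec_mono[OF As]) auto
qed

end

theorem theorem3p4:
  fixes M :: "'h::chilbert_space oper set"
    and \<tau> :: "'h oper \<Rightarrow> ennreal"
    and A :: "'h oper"
    and B :: "nat \<Rightarrow> 'h oper"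
    and \<alpha> :: real
  assumes "infinite_factor M" and "sigma_finite_vna M"
    and "semifinite_vna M \<Longrightarrow> factor_trace M \<tau>"
    and "A \<in> pos_elems M"
    and "\<And>j. B j \<in> pos_elems M"
    and "bdd_above (range (\<lambda>j. norm (B j)))"
    and "\<alpha> = (SUP j. norm (B j))"
    and "((semifinite_vna M \<longrightarrow> \<tau> (pos_part (A - \<alpha> *\<^sub>R id_blinfun)) = \<infinity>) \<and>
          (type_III_vna M \<longrightarrow> norm A > \<alpha>) \<and>
          (\<exists>\<beta>>0. \<exists>P\<in>projs M. P \<noteq> 0 \<and>
             infinite {j. subequiv_in M P (spec_proj {\<beta><..} (B j))}))
         \<or>
         ((semifinite_vna M \<longrightarrow> ess_norm M A \<ge> \<alpha>) \<and>
          (type_III_vna M \<longrightarrow> norm A \<ge> \<alpha>) \<and>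
          (\<forall>j. spec_proj {\<alpha>} (B j) = 0) \<and>
          (\<exists>\<beta> \<gamma>. 0 < \<beta> \<and> \<beta> < \<gamma> \<and> \<gamma> < \<alpha> \<and>
             (\<exists>P\<in>projs M. P \<noteq> 0 \<and>
                infinite {j. subequiv_in M P (spec_proj {\<beta><..\<gamma>} (B j))})))"
  shows "\<exists>C. (\<forall>j. C j \<in> pos_elems M \<and> equiv_in M (C j) (B j) \<and>
                   infinite_proj M (null_proj (C j))) \<and>
             (\<forall>x. (\<lambda>j. blinfun_apply (C j) x) sums blinfun_apply A x)"
proof -
  interpret infinite_complex_factor M using assms(1,2) by unfold_locales
  have A: "A \<in> M" "psd A" using assms(4) by (simp_all add: pos_elems_iff)
  have B: "\<And>n. B n \<in> M" "\<And>n. psd (B n)" using assms(5) by (simp_all add: pos_elems_iff)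
  note As = psd_sym[OF A(2)] and Bs = psd_sym[OF B(2)]
  have Bn: "norm (B n) \<le> \<alpha>" for n unfolding assms(7) by (rule cSUP_upper[OF UNIV_I assms(6)])
  have Bf: "inner (B n \<cdot> x) x \<le> \<alpha> * (norm x)\<^sup>2" for n x
  proof (rule order_trans[OF inner_le_norm])
    show "norm (B n) * (norm x)\<^sup>2 \<le> \<alpha> * (norm x)\<^sup>2" using Bn[of n] by (intro mult_right_mono) auto
  qed
  have high: "spec (B n) {c<..} = 0" if "\<alpha> \<le> c" for n c
    unfolding spec_greaterThan[OF Bs]
    by (rule blinfun_eqI) (use Bn[of n] that in \<open>simp add: spec_gt_high[OF Bs]\<close>)
  have sp: "spec_proj S (B n) = spec (B n) S" if "S \<in> sets borel" for S n
    using assms(5)[of n] that by (intro spec_proj_eq_spec) (simp add: pos_elems_def)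
  have sub: "infinite {n. subeq e (spec (B n) S)}"
    if S: "S \<in> sets borel" and P: "mproj P" and I: "infinite {n. subequiv_in M P (spec_proj S (B n))}"
      and e: "subeq e P" for S P e
  proof (rule infinite_super[OF _ I], safe)
    fix n assume "subequiv_in M P (spec_proj S (B n))"
    hence "subeq P (spec (B n) S)"
      unfolding sp[OF S] by (rule subequiv_in_subeq[OF _ P mproj_spec[OF B(1) Bs S]])
    thus "subeq e (spec (B n) S)" by (rule subeq_trans[OF e])
  qed
  have self: "subeq P P" if "mproj P" for P by (rule subeq_sub) (use that in auto)
  from assms(8) show ?thesis
  proof (elim disjE conjE exE bexE)
    fix \<beta> P
    assume tr: "semifinite_vna M \<longrightarrow> \<tau> (pos_part (A - \<alpha> *\<^sub>R id_blinfun)) = \<infinity>"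
      and III: "type_III_vna M \<longrightarrow> \<alpha> < norm A" and \<beta>: "0 < \<beta>"
      and P: "P \<in> projs M" "P \<noteq> 0" and I: "infinite {j. subequiv_in M P (spec_proj {\<beta><..} (B j))}"
    have Pm: "mproj P" using P(1) by (simp add: projs_iff)
    \<comment> \<open>Otherwise the spectral projections above \<open>\<beta>\<close> all vanish,
      and the nonzero \<open>P\<close> embeds in none of them.\<close>
    have \<alpha>: "0 < \<alpha>"
    proof (rule ccontr)
      assume "\<not> 0 < \<alpha>"
      hence "spec (B n) {\<beta><..} = 0" for n using \<beta> by (intro high) simp
      moreover obtain n where "subeq P (spec (B n) {\<beta><..})"
        using not_finite_existsD[OF sub[OF _ Pm I self[OF Pm]]] by auto
      ultimately obtain V where V: "emb V P 0" by (auto simp: subeq_def)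
      have "P \<cdot> x = 0 \<cdot> x" for x using embD(2,3)[OF V, of x] by (simp flip: embD(2)[OF V])
      thus False using P(2) by (auto intro: blinfun_eqI)
    qed
    show ?thesis
    proof (cases "semifinite_vna M")
      case True
      interpret trace_factor M \<tau> by (rule trace_factor_of_factor_trace[OF assms(3)[OF True]])
      \<comment> \<open>\<open>P\<close> may have infinite trace, whereas
        \<open>tr_big_limit\<close> and the slices ask for a projection of finite trace; a
        subprojection embeds wherever \<open>P\<close> does.\<close>
      obtain e where e: "mproj e" "e \<noteq> 0" "\<And>x. P \<cdot> (e \<cdot> x) = e \<cdot> x" "\<tau> e < \<infinity>"
        by (rule finite_subprojection[OF Pm P(2)]) (rule that)
      have I': "infinite {n. subeq e (spec (B n) {\<beta><..})}"
        by (rule sub[OF _ Pm I subeq_sub[OF e(1,3)]]) simp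
      show ?thesis
      \<comment> \<open>Infinite spectrum above some \<open>l > \<alpha>\<close> provides a uniform
        gap. Without such a level the infinite trace of the positive part has to provide the savings
        slice by slice.\<close>
      proof (cases "\<exists>l>\<alpha>. big (spec A {l<..})")
        case True
        then obtain l where l: "\<alpha> < l" "big (spec A {l<..})" by blast
        have inf: "big (spec A {l'<..})" if "l' < l" for l'
          by (rule big_mono[OF l(2) mproj_spec[OF A(1) As]]) (use that in \<open>auto intro!: spec_mono[OF As]\<close>)
        show ?thesis
          by (rule strict_bound_case[OF A tr_big_add tr_big_limit[OF e(1,4)] e(1,2) inf l(1) B Bn \<beta> I'])
            (assumption | rule decomposition_transfer)+
      next
        case False
        have fin: "\<tau> (spec A {s<..}) < \<infinity>" if "\<alpha> < s" for s
          using False that big_iff[OF mproj_spec[OF A(1) As, of "{s<..}"]] by (auto simp: less_top)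
        have "A - \<alpha> *\<^sub>R id_blinfun \<in> M" using A(1) by auto
        hence "pos_part (A - \<alpha> *\<^sub>R id_blinfun) = (A - \<alpha> *\<^sub>R id_blinfun) o\<^sub>L spec A {\<alpha><..}"
          using As by (subst pos_part_eq) (auto simp: clin spec_greaterThan[OF As] spec_gt_def)
        hence K: "\<tau> ((A - \<alpha> *\<^sub>R id_blinfun) o\<^sub>L spec A {\<alpha><..}) = \<infinity>" using tr \<open>semifinite_vna M\<close> by simp
        show ?thesis
          by (rule slack_case[OF A fin K e(1,2,4) B Bf \<alpha> \<beta> I'])
            (assumption | rule decomposition_transfer)+
      qed
    next
      case False
      hence t: "type_III_vna M" using semifinite_or_type_III by simp
      note all = type_III_big[OF t]
      have l: "\<alpha> < norm A" using III t by simp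
      hence "A \<noteq> 0" using \<alpha> by auto
      note inf = big_spec_below_norm[OF A all _ this]
      have I': "infinite {n. subeq P (spec (B n) {\<beta><..})}" by (rule sub[OF _ Pm I self[OF Pm]]) simp
      show ?thesis
        by (rule strict_bound_case[OF A _ _ Pm P(2) inf l B Bn \<beta> I'])
          (assumption | rule purely_infinite_big[OF all Pm] decomposition_transfer)+
    qed
  next
    fix \<beta> \<gamma> P
    assume ess: "semifinite_vna M \<longrightarrow> \<alpha> \<le> ess_norm M A"
      and III: "type_III_vna M \<longrightarrow> \<alpha> \<le> norm A" and at: "\<forall>j. spec_proj {\<alpha>} (B j) = 0"
      and \<beta>: "0 < \<beta>" "\<beta> < \<gamma>" "\<gamma> < \<alpha>"
      and P: "P \<in> projs M" "P \<noteq> 0" and I: "infinite {j. subequiv_in M P (spec_proj {\<beta><..\<gamma>} (B j))}"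
    have Pm: "mproj P" using P(1) by (simp add: projs_iff)
    have \<alpha>: "0 < \<alpha>" using \<beta> by simp
    \<comment> \<open>The norm bound leaves only the point \<open>\<alpha>\<close> of this
      half-line, and there the spectral projection vanishes by assumption.\<close>
    have B0: "spec (B n) {\<alpha>..} = 0" for n
    proof -
      have "{\<alpha>..} = {\<alpha>} \<union> {\<alpha><..}" by auto
      moreover have "spec (B n) ({\<alpha>} \<union> {\<alpha><..}) = spec (B n) {\<alpha>} + spec (B n) {\<alpha><..}"
        by (rule spec_Un[OF Bs]) auto
      ultimately show ?thesis using at high[of \<alpha> n] by (simp add: sp)
    qed
    show ?thesis
    proof (cases "semifinite_vna M")
      case True
      interpret trace_factor M \<tau> by (rule trace_factor_of_factor_trace[OF assms(3)[OF True]])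
      obtain e where e: "mproj e" "e \<noteq> 0" "\<And>x. P \<cdot> (e \<cdot> x) = e \<cdot> x" "\<tau> e < \<infinity>"
        by (rule finite_subprojection[OF Pm P(2)]) (rule that)
      have I': "infinite {n. subeq e (spec (B n) {\<beta><..\<gamma>})}"
        by (rule sub[OF _ Pm I subeq_sub[OF e(1,3)]]) simp
      have inf: "big (spec A {l<..})" if "l < \<alpha>" for l
        by (rule big_spec_below_ess_norm[OF A that \<alpha>]) (use ess True in simp)
      show ?thesis
        by (rule strict_case[OF A tr_big_add tr_big_limit[OF e(1,4)] e(1,2) inf B B0 \<beta> I'])
          (assumption | rule decomposition_transfer)+
    next
      case False
      hence t: "type_III_vna M" using semifinite_or_type_III by simp
      note all = type_III_big[OF t]
      have l: "\<alpha> \<le> norm A" using III t by simp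
      hence A0: "A \<noteq> 0" using \<alpha> by auto
      have inf: "big (spec A {l'<..})" if "l' < \<alpha>" for l'
        by (rule big_spec_below_norm[OF A all _ A0]) (use that l in auto)
      have I': "infinite {n. subeq P (spec (B n) {\<beta><..\<gamma>})}" by (rule sub[OF _ Pm I self[OF Pm]]) simp
      show ?thesis
        by (rule strict_case[OF A _ _ Pm P(2) inf B B0 \<beta> I'])
          (assumption | rule purely_infinite_big[OF all Pm] decomposition_transfer)+
    qed
  qed
qed

end
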